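(* Assume that the initial curve $\gamma_0:S^1\to\mathbb R^n$ has a one-to-one convex projection onto the $xy$-plane and that its curve shortening flow $\gamma(\cdot,t)$ develops a Type II singularity as $t\to T$. Then for any sequence $\tau_j\to+\infty$, there exist a subsequence and a line $L$ in $\mathbb R^n$ such that the $j$-th rescaled CSF $\Gamma_j$ locally smoothly converges (along the subsequence) to the stationary line $L$ of multiplicity two. Moreover, the line $L$ is not perpendicular to the $xy$-plane.
   Context: $S^1=\mathbb R/2\pi\mathbb Z$. A curve shortening flow (CSF) in $\mathbb R^n$ is a smooth map $\gamma:S^1\times[0,T)\to\mathbb R^n$ with each $\gamma(\cdot,t)$ an immersion and $\gamma_t=\gamma_{ss}$, $\partial_s=|\gamma_u|^{-1}\partial_u$; $T$ is the maximal existence time. $P_{xy}$ is the orthogonal projection of $\mathbb R^n=\mathbb R^2\times\mathbb R^{n-2}$ onto the first two coordinates $x,y$. A smooth closed immersed curve $\gamma$ has a one-to-one convex projection (onto the $xy$-plane) if $P_{xy}|_\gamma$ is injective and $P_{xy}(\gamma)$ is a convex curve. The CSF develops a Type I singularity as $t\to T$ if $\limsup_{t\to T}\sup_{u}k^2(u,t)(T-t)<+\infty$ ($k$ the curvature), and a Type II singularity otherwise. It is a known earlier result that a CSF starting from a curve with a one-to-one convex projection keeps this property and shrinks to a point as $t\to T$; this point is assumed to be the origin. The rescaled CSF is $\Gamma(u,\tau):=\gamma(u,t)/\sqrt{2T-2t}$, $\tau:=-\tfrac12\log(T-t)$, with arc-length parameter $\sigma$, $\partial_\sigma=|\Gamma_u|^{-1}\partial_u$.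 For a sequence $\tau_j\to+\infty$, the $j$-th rescaled CSF is $\Gamma_j(\sigma,\tau):=\Gamma(\sigma,\tau_j+\tau)$. $\Gamma_j$ locally smoothly converges to a rescaled flow $\Gamma_\infty$ if for any real $a<b$ and $R>0$ there are a finite union of closed intervals $I=\cup I_\alpha$, an integer $J$ and smooth time-dependent reparameterizations $\phi_j$ such that for $j\ge J$, $\Gamma_j(\phi_j(u,\tau),\tau)$, $u\in I$, reparameterizes all the arcs $\Gamma_j(\cdot,\tau)\cap\overline{B_R(0)}$ for every $\tau\in[a,b]$, and $\Gamma_j(\phi_j(u,\tau),\tau)\to\Gamma_\infty(u,\tau)$ as smooth functions on $I\times[a,b]$ as $j\to\infty$. For a unit vector $\vec v$, the rescaled flow $\Gamma_\infty:(\mathbb R\sqcup\mathbb R)\times\mathbb R\to\mathbb R^n$, $(\lambda,\tau)\mapsto\lambda\vec v$, is called a stationary line of multiplicity two. *)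

theory Defs
  imports "HOL-Analysis.Analysis"
begin

section \<open>Smooth functions of two real variables\<close>

text \<open>
  Derivatives are taken within the given sets, hence one-sided at endpoints. The sets are always
  nondegenerate intervals or finite unions of such, so these derivatives are unique.
\<close>

definition deriv_fst :: "real set \<Rightarrow> (real \<Rightarrow> real \<Rightarrow> 'a::real_normed_vector) \<Rightarrow> real \<Rightarrow> real \<Rightarrow> 'a"
  where "deriv_fst A f = (\<lambda>u t. vector_derivative (\<lambda>v. f v t) (at u within A))"

definition deriv_snd :: "real set \<Rightarrow> (real \<Rightarrow> real \<Rightarrow> 'a::real_normed_vector) \<Rightarrow> real \<Rightarrow> real \<Rightarrow> 'a"
  where "deriv_snd B f = (\<lambda>u t. vector_derivative (\<lambda>s. f u s) (at t within B))"

definition mixed_deriv ::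
    "real set \<Rightarrow> real set \<Rightarrow> nat \<Rightarrow> nat \<Rightarrow> (real \<Rightarrow> real \<Rightarrow> 'a::real_normed_vector) \<Rightarrow> real \<Rightarrow> real \<Rightarrow> 'a"
  where "mixed_deriv A B i m f = (deriv_fst A ^^ i) ((deriv_snd B ^^ m) f)"

definition smooth_on :: "real set \<Rightarrow> real set \<Rightarrow> (real \<Rightarrow> real \<Rightarrow> 'a::real_normed_vector) \<Rightarrow> bool"
  where "smooth_on A B f \<longleftrightarrow>
    (\<forall>i m.
      continuous_on (A \<times> B) (\<lambda>(u, t). mixed_deriv A B i m f u t) \<and>
      (\<forall>u\<in>A. \<forall>t\<in>B.
        (\<lambda>v. mixed_deriv A B i m f v t) differentiable (at u within A) \<and>
        (\<lambda>s. mixed_deriv A B i m f u s) differentiable (at t within B)))"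


section \<open>Curve shortening flow\<close>

text \<open>
  A map on the circle \<open>\<real> / 2\<pi>\<int>\<close> is a \<open>2\<pi>\<close>-periodic map on the reals.
  \<open>arc_deriv c f\<close> is the derivative of \<open>f\<close> with respect to the arc length of the curve \<open>c\<close>.
\<close>

definition arc_deriv :: "(real \<Rightarrow> 'a::real_normed_vector) \<Rightarrow> (real \<Rightarrow> 'a) \<Rightarrow> real \<Rightarrow> 'a"
  where "arc_deriv c f =
    (\<lambda>u. inverse (norm (vector_derivative c (at u))) *\<^sub>R vector_derivative f (at u))"

definition curvature_vector :: "(real \<Rightarrow> 'a::real_normed_vector) \<Rightarrow> real \<Rightarrow> 'a"
  where "curvature_vector c = arc_deriv c (arc_deriv c c)"

definition curvature :: "(real \<Rightarrow> 'a::real_normed_vector) \<Rightarrow> real \<Rightarrow> real"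
  where "curvature c u = norm (curvature_vector c u)"

definition CSF :: "real \<Rightarrow> (real \<Rightarrow> real \<Rightarrow> 'a::real_normed_vector) \<Rightarrow> bool"
  where "CSF T \<gamma> \<longleftrightarrow>
    0 < T \<and>
    (\<forall>u. \<forall>t\<in>{0..<T}. \<gamma> (u + 2 * pi) t = \<gamma> u t) \<and>
    smooth_on UNIV {0..<T} \<gamma> \<and>
    (\<forall>u. \<forall>t\<in>{0..<T}. vector_derivative (\<lambda>v. \<gamma> v t) (at u) \<noteq> 0) \<and>
    (\<forall>u. \<forall>t\<in>{0..<T}.
      ((\<lambda>s. \<gamma> u s) has_vector_derivative curvature_vector (\<lambda>v. \<gamma> v t) u) (at t within {0..<T}))"

definition maximal_CSF :: "real \<Rightarrow> (real \<Rightarrow> real \<Rightarrow> 'a::real_normed_vector) \<Rightarrow> bool"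
  where "maximal_CSF T \<gamma> \<longleftrightarrow>
    CSF T \<gamma> \<and>
    \<not> (\<exists>T' \<gamma>'. T < T' \<and> CSF T' \<gamma>' \<and> (\<forall>u. \<forall>t\<in>{0..<T}. \<gamma>' u t = \<gamma> u t))"

definition shrinks_to :: "real \<Rightarrow> (real \<Rightarrow> real \<Rightarrow> 'a::real_normed_vector) \<Rightarrow> 'a \<Rightarrow> bool"
  where "shrinks_to T \<gamma> p \<longleftrightarrow> uniform_limit UNIV (\<lambda>t u. \<gamma> u t) (\<lambda>u. p) (at_left T)"

definition type_I_singularity :: "real \<Rightarrow> (real \<Rightarrow> real \<Rightarrow> 'a::real_normed_vector) \<Rightarrow> bool"
  where "type_I_singularity T \<gamma> \<longleftrightarrow>
    Limsup (at_left T) (\<lambda>t. SUP u. ereal ((curvature (\<lambda>v. \<gamma> v t) u)\<^sup>2 * (T - t))) < \<infinity>"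

definition type_II_singularity :: "real \<Rightarrow> (real \<Rightarrow> real \<Rightarrow> 'a::real_normed_vector) \<Rightarrow> bool"
  where "type_II_singularity T \<gamma> \<longleftrightarrow> \<not> type_I_singularity T \<gamma>"


section \<open>One-to-one convex projections\<close>

text \<open>
  The two distinguished coordinates of the ambient space are given by two indices \<open>x\<close> and \<open>y\<close>,
  assumed to be distinct where these notions are used.
\<close>

definition xy_proj :: "'n \<Rightarrow> 'n \<Rightarrow> real ^ 'n::finite \<Rightarrow> real ^ 2"
  where "xy_proj x y p = vector [p $ x, p $ y]"

definition xy_plane :: "'n \<Rightarrow> 'n \<Rightarrow> (real ^ 'n::finite) set"
  where "xy_plane x y = span {axis x 1, axis y 1}"

definition convex_curve :: "(real ^ 2) set \<Rightarrow> bool"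
  where "convex_curve C \<longleftrightarrow> (\<exists>K. compact K \<and> convex K \<and> interior K \<noteq> {} \<and> C = frontier K)"

text \<open>
  Injectivity is injectivity of the projected parametrization on the circle, so that multiply
  covered curves are excluded.
\<close>

definition one_to_one_convex_projection :: "'n \<Rightarrow> 'n \<Rightarrow> (real \<Rightarrow> real ^ 'n::finite) \<Rightarrow> bool"
  where "one_to_one_convex_projection x y c \<longleftrightarrow>
    inj_on (\<lambda>u. xy_proj x y (c u)) {0..<2 * pi} \<and>
    convex_curve (range (\<lambda>u. xy_proj x y (c u)))"

definition perpendicular :: "'a::real_inner set \<Rightarrow> 'a set \<Rightarrow> bool"
  where "perpendicular L P \<longleftrightarrow> (\<forall>p\<in>L. \<forall>q\<in>P. orthogonal p q)"


section \<open>Rescaled flows and their convergence\<close>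

text \<open>The equation \<open>\<tau> = - log (T - t) / 2\<close> is solved for \<open>t\<close>.\<close>

definition rescaled_CSF ::
    "real \<Rightarrow> (real \<Rightarrow> real \<Rightarrow> 'a::real_normed_vector) \<Rightarrow> real \<Rightarrow> real \<Rightarrow> 'a"
  where "rescaled_CSF T \<gamma> u \<tau> =
    (let t = T - exp (- 2 * \<tau>) in inverse (sqrt (2 * T - 2 * t)) *\<^sub>R \<gamma> u t)"

text \<open>
  The spatial parameter of the \<open>j\<close>-th flow is left as it is rather than normalized to arc length:
  convergence is up to time-dependent reparametrizations.
\<close>

definition rescaled_CSF_seq ::
    "real \<Rightarrow> (real \<Rightarrow> real \<Rightarrow> 'a::real_normed_vector) \<Rightarrow> (nat \<Rightarrow> real) \<Rightarrow> nat \<Rightarrow> real \<Rightarrow> real \<Rightarrow> 'a"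
  where "rescaled_CSF_seq T \<gamma> \<tau> j u s = rescaled_CSF T \<gamma> u (\<tau> j + s)"

definition finite_union_closed_intervals :: "real set \<Rightarrow> bool"
  where "finite_union_closed_intervals S \<longleftrightarrow>
    (\<exists>C. finite C \<and> (\<forall>(c, d)\<in>C. c < d) \<and> S = (\<Union>(c, d)\<in>C. {c..d}))"

text \<open>
  The limit flow lives on a disjoint union of copies of the real line, indexed by the finite
  type \<open>'k\<close>; \<open>I k\<close> is the part of the parameter domain lying in the copy \<open>k\<close>.
  The maps \<open>\<phi> j k\<close> are real-valued lifts of maps into the circle, and the circle itself is
  identified with the complex unit circle through \<open>cis\<close>. The bijection says that
  \<open>\<phi> j\<close> parametrizes exactly the arcs in the closed ball. Orientation may be reversed.
  The parameter domain must contain all parameters of the limit flow inside the open ball: otherwise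
  some copies (or all of them, with \<open>I\<close> empty) could be omitted and the multiplicity of the limit
  would be meaningless.
\<close>

definition locally_smoothly_converges ::
    "(nat \<Rightarrow> real \<Rightarrow> real \<Rightarrow> 'a::real_normed_vector) \<Rightarrow> ('k::finite \<Rightarrow> real \<Rightarrow> real \<Rightarrow> 'a) \<Rightarrow> bool"
  where "locally_smoothly_converges \<Gamma> \<Gamma>inf \<longleftrightarrow>
    (\<forall>a b R. a < b \<longrightarrow> 0 < R \<longrightarrow>
      (\<exists>(I :: 'k \<Rightarrow> real set) (J :: nat) (\<phi> :: nat \<Rightarrow> 'k \<Rightarrow> real \<Rightarrow> real \<Rightarrow> real).
        (\<forall>k. finite_union_closed_intervals (I k)) \<and>
        (\<forall>k u. \<forall>s\<in>{a..b}. \<Gamma>inf k u s \<in> ball 0 R \<longrightarrow> u \<in> I k) \<and>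
        (\<forall>j\<ge>J.
          (\<forall>k. smooth_on (I k) {a..b} (\<phi> j k)) \<and>
          (\<forall>k. \<forall>u\<in>I k. \<forall>s\<in>{a..b}. deriv_fst (I k) (\<phi> j k) u s \<noteq> 0) \<and>
          (\<forall>s\<in>{a..b}.
            bij_betw (\<lambda>(k, u). cis (\<phi> j k u s)) (SIGMA k:UNIV. I k)
              (cis ` {v. \<Gamma> j v s \<in> cball 0 R}))) \<and>
        (\<forall>k i m.
          uniform_limit (I k \<times> {a..b})
            (\<lambda>j (u, s). mixed_deriv (I k) {a..b} i m (\<lambda>u s. \<Gamma> j (\<phi> j k u s) s) u s)
            (\<lambda>(u, s). mixed_deriv (I k) {a..b} i m (\<Gamma>inf k) u s)
            sequentially)))"

text \<open>The two copies of the real line are indexed by the two Booleans.\<close>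

definition stationary_double_line :: "'a::real_normed_vector \<Rightarrow> bool \<Rightarrow> real \<Rightarrow> real \<Rightarrow> 'a"
  where "stationary_double_line v = (\<lambda>k u s. u *\<^sub>R v)"

end

theory Submission
  imports Defs
begin

text \<open>
  The hypotheses are contradictory: the singularity is always of type I.

  The oriented area of the projected triangle on three parameters solves a heat equation on the simplex of
  cyclically ordered triples and vanishes on its boundary, so the projection stays convex. A Hopf-type barrier
  bounds it below at a positive time by a multiple of \<open>sin ((v - u) / 2) sin ((w - v) / 2) sin ((w - u) / 2)\<close>.
  All other coordinate area forms are bounded above by such a multiple, so they are dominated by the projected form
  at that time, and by the maximum principle ever after. Hence the tangents make a uniformly positive angle with
  the orthogonal complement of the \<open>xy\<close>-plane.

  The projection is then a convex plane curve moving by a uniformly parabolic equation. Grim reapers and paperclips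
  as barriers show that the product of its diameter and its width is comparable to \<open>T - t\<close>. A long thin region would
  retain its width while its diameter decays, so the diameter is at most a multiple of \<open>sqrt (T - t)\<close>, and the
  region contains a disc with a radius of the same order. With this disc, Tso's argument bounds the curvature by a
  multiple of \<open>1 / sqrt (T - t)\<close>.
\<close>

section \<open>Maximum principles\<close>

text \<open>The projected curve does not move by curve shortening: arc length refers to the space
  curve, so only \<open>\<delta>\<^sup>2 \<le> a * |c1|\<^sup>2 \<le> 1\<close> is available, and
  the work lies in finding \<delta>. The three-point form \<open>\<beta> (g u) (g v) + \<beta> (g v)
  (g w) + \<beta> (g w) (g u)\<close> solves, for every alternating \<beta>, the same linear
  equation without zeroth order term. Combinations of forms therefore obey the maximum principle,
  and an inequality between two forms that holds at one time lasts. Every form vanishes to third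
  order when its three points collide, so a comparison needs a lower bound of exactly this order.
  Initial convexity does not give it, because flat arcs and tangents orthogonal to the plane are
  allowed; it holds only at positive times. Later the two speed bounds are used separately: the grim
  reaper needs the lower one, the paperclip and the sine arch the upper one. The first order
  coefficient b is never estimated, since it drops out at critical points.\<close>

lemma local_min_second_derivative:
  fixes f f' :: "real \<Rightarrow> real"
  assumes der: "\<forall>\<^sub>F v in nhds u. (f has_real_derivative f' v) (at v)"
    and der2: "(f' has_real_derivative f'') (at u)"
    and min: "\<forall>\<^sub>F v in nhds u. f u \<le> f v"
  shows "f' u = 0" and "0 \<le> f''"
proof -
  from der min have "\<forall>\<^sub>F v in nhds u. (f has_real_derivative f' v) (at v) \<and> f u \<le> f v"
    by (rule eventually_conj)
  then obtain d where d: "d > 0"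
    and D: "\<And>v. dist v u < d \<Longrightarrow> (f has_real_derivative f' v) (at v) \<and> f u \<le> f v"
    by (auto simp: eventually_nhds_metric)
  show z: "f' u = 0"
    by (rule DERIV_local_min[of f "f' u" u d]) (use d D in \<open>auto simp: dist_real_def abs_minus_commute\<close>)
  show "0 \<le> f''"
  proof (rule ccontr)
    assume "\<not> 0 \<le> f''"
    then obtain e where e: "e > 0" and E: "\<And>h. h > 0 \<Longrightarrow> h < e \<Longrightarrow> f' (u + h) < 0"
      using DERIV_neg_dec_right[OF der2] z by force
    define h where "h = min d e / 2"
    have h: "h > 0" "h < d" "h < e" using d e by (auto simp: h_def)
    obtain x where x: "u < x" "x < u + h" "f (u + h) - f u = (u + h - u) * f' x"
      using MVT2[of u "u + h" f f'] D h by (auto simp: dist_real_def)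
    have "f' x < 0" using E[of "x - u"] x h by auto
    with x h have "f (u + h) < f u" using mult_pos_neg[of h "f' x"] by auto
    moreover have "f u \<le> f (u + h)" using D[of "u + h"] h by (auto simp: dist_real_def)
    ultimately show False by simp
  qed
qed

lemma left_min_derivative:
  fixes g :: "real \<Rightarrow> real"
  assumes der: "(g has_real_derivative g') (at t within {a..<b})" and t: "a < t" "t < b"
    and min: "\<forall>\<^sub>F s in at_left t. g t \<le> g s"
  shows "g' \<le> 0"
proof -
  have "((\<lambda>s. (g s - g t) / (s - t)) \<longlongrightarrow> g') (at t within {a..<b})"
    using der by (simp add: has_field_derivative_iff)
  moreover have "at_left t \<le> at t within {a..<b}"
  proof -
    have "at_left t = at t within {a..<t}"
      using t by (intro at_within_nhd[where S="{a<..}"]) auto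
    also have "\<dots> \<le> at t within {a..<b}" by (rule at_le) (use t in auto)
    finally show ?thesis .
  qed
  ultimately have lim: "((\<lambda>s. (g s - g t) / (s - t)) \<longlongrightarrow> g') (at_left t)"
    using tendsto_mono by blast
  have "\<forall>\<^sub>F s in at_left t. s < t" by (simp add: eventually_at_filter)
  with min have "\<forall>\<^sub>F s in at_left t. (g s - g t) / (s - t) \<le> 0"
    by eventually_elim (simp add: divide_nonneg_neg)
  then show ?thesis
    by (rule tendsto_upperbound[OF lim]) simp
qed

lemma parabolic_min:
  fixes f :: "real \<Rightarrow> real \<Rightarrow> real"
  assumes min: "\<And>v s. (v, s) \<in> R \<Longrightarrow> f u t \<le> f v s"
    and nbhd: "\<forall>\<^sub>F v in nhds u. (v, t) \<in> R" "\<forall>\<^sub>F s in at_left t. (u, s) \<in> R"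
    and der: "\<forall>\<^sub>F v in nhds u. ((\<lambda>v. f v t) has_real_derivative fu v) (at v)"
    and der2: "(fu has_real_derivative fuu) (at u)"
    and dert: "((\<lambda>s. f u s) has_real_derivative ft) (at t within {a..<b})" "a < t" "t < b"
  shows "fu u = 0" and "0 \<le> fuu" and "ft \<le> 0"
proof -
  have "\<forall>\<^sub>F v in nhds u. f u t \<le> f v t"
    using nbhd(1) by eventually_elim (rule min)
  from local_min_second_derivative[OF der der2 this] show "fu u = 0" "0 \<le> fuu" .
  have "\<forall>\<^sub>F s in at_left t. f u t \<le> f u s"
    using nbhd(2) by eventually_elim (rule min)
  with dert show "ft \<le> 0" by (intro left_min_derivative)
qed

lemma periodic_2pi_shift:
  fixes P :: "real \<Rightarrow> 'a"
  assumes "\<And>u. P (u + 2 * pi) = P u"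
  shows "P (u + 2 * pi * of_int k) = P u"
proof -
  have nat: "P (u + 2 * pi * real n) = P u" for u n
  proof (induction n)
    case (Suc n)
    have "P (u + 2 * pi * real (Suc n)) = P ((u + 2 * pi * real n) + 2 * pi)"
      by (simp add: algebra_simps)
    also have "\<dots> = P (u + 2 * pi * real n)" by (rule assms)
    finally show ?case using Suc.IH by (rule trans)
  qed simp
  show ?thesis
  proof (cases "k \<ge> 0")
    case True
    then have "of_int k = real (nat k)" by simp
    then show ?thesis using nat[of u "nat k"] by metis
  next
    case False
    then have e: "of_int k = - real (nat (- k))" by simp
    have "u = u + 2 * pi * of_int k + 2 * pi * real (nat (- k))" unfolding e by (simp only: mult_minus_right)
    then show ?thesis using nat[of "u + 2 * pi * of_int k" "nat (- k)"] by metis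
  qed
qed

lemma shift_into_period:
  obtains k :: int where "u + 2 * pi * of_int k \<in> {0..<2 * pi}"
proof
  define m where "m = \<lfloor>u / (2 * pi)\<rfloor>"
  have "of_int m \<le> u / (2 * pi)" "u / (2 * pi) < of_int m + 1" by (auto simp: m_def)
  then have "2 * pi * of_int m \<le> u" "u < 2 * pi * of_int m + 2 * pi"
    by (auto simp: field_simps)
  then show "u + 2 * pi * of_int (- m) \<in> {0..<2 * pi}" by auto
qed

lemma periodic_region_min:
  fixes f :: "real \<Rightarrow> real \<Rightarrow> real"
  assumes R: "closed R" "R \<subseteq> UNIV \<times> {t1..t2}" "R \<noteq> {}"
    and cont: "continuous_on R (\<lambda>(u, t). f u t)"
    and per: "\<And>u t. (u + 2 * pi, t) \<in> R \<longleftrightarrow> (u, t) \<in> R"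
      "\<And>u t. (u, t) \<in> R \<Longrightarrow> f (u + 2 * pi) t = f u t"
  obtains u t where "(u, t) \<in> R" and "\<And>v s. (v, s) \<in> R \<Longrightarrow> f u t \<le> f v s"
proof -
  have shift: "((u + 2 * pi * of_int k, t) \<in> R) = ((u, t) \<in> R)" for u t k
    by (rule periodic_2pi_shift[of "\<lambda>u. (u, t) \<in> R"]) (rule per(1))
  have fshift: "f (u + 2 * pi * of_int k) t = f u t" if "(u, t) \<in> R" for u t k
  proof -
    \<comment> \<open>The function is periodic only on R; its option-valued extension is periodic
      everywhere, so the shift by integer multiples of the period applies.\<close>
    have "(if (u + 2 * pi * of_int k, t) \<in> R then Some (f (u + 2 * pi * of_int k) t) else None)
      = (if (u, t) \<in> R then Some (f u t) else None)"
      by (rule periodic_2pi_shift[of "\<lambda>u. if (u, t) \<in> R then Some (f u t) else None"])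
        (simp add: per)
    with that shift[of u k t] show ?thesis by (simp split: if_splits)
  qed
  define K where "K = R \<inter> {0..2 * pi} \<times> {t1..t2}"
  have cK: "compact K" unfolding K_def using R by (intro closed_Int_compact compact_Times) auto
  have inK: "\<exists>v. (v, t) \<in> K \<and> f v t = f u t" if "(u, t) \<in> R" for u t
  proof -
    obtain k where k: "u + 2 * pi * of_int k \<in> {0..<2 * pi}" by (rule shift_into_period)
    with that shift[of u k t] fshift[OF that, of k] R(2) show ?thesis
      by (intro exI[of _ "u + 2 * pi * of_int k"]) (auto simp: K_def)
  qed
  from R(3) inK have "K \<noteq> {}" by fast
  with cK obtain x where x: "x \<in> K" "\<And>y. y \<in> K \<Longrightarrow> (\<lambda>(u, t). f u t) x \<le> (\<lambda>(u, t). f u t) y"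
    using continuous_attains_inf[OF cK _ continuous_on_subset[OF cont]] unfolding K_def by blast
  obtain u t where ut: "x = (u, t)" by (cases x)
  show thesis
  proof (rule that[of u t])
    show "(u, t) \<in> R" using x ut by (simp add: K_def)
    show "f u t \<le> f v s" if vs: "(v, s) \<in> R" for v s
    proof -
      obtain v' where v': "(v', s) \<in> K" "f v' s = f v s" using inK[OF vs] by blast
      show ?thesis using x(2)[OF v'(1)] v'(2) by (simp add: ut)
    qed
  qed
qed

text \<open>Only a negative minimum has to be excluded. There a first order term vanishes and a
  second order term with positive coefficient has a sign. R may have a moving lateral boundary:
  nonnegativity on it enters through \<open>step\<close>, by showing that a negative point is not on
  the boundary.\<close>

lemma parabolic_principle:
  fixes f :: "real \<Rightarrow> real \<Rightarrow> real"
  assumes R: "closed R" "R \<subseteq> UNIV \<times> {t1..t2}" and T: "t0 \<le> t1" "t2 < T"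
    and cont: "continuous_on R (\<lambda>(u, t). f u t)"
    and per: "\<And>u t. (u + 2 * pi, t) \<in> R \<longleftrightarrow> (u, t) \<in> R"
      "\<And>u t. (u, t) \<in> R \<Longrightarrow> f (u + 2 * pi) t = f u t"
    and step: "\<And>u t. (u, t) \<in> R \<Longrightarrow> f u t < 0 \<Longrightarrow>
      t1 < t \<and> (\<forall>\<^sub>F v in nhds u. (v, t) \<in> R) \<and> (\<forall>\<^sub>F s in at_left t. (u, s) \<in> R) \<and>
      (\<exists>fu fuu ft. (\<forall>\<^sub>F v in nhds u. ((\<lambda>v. f v t) has_real_derivative fu v) (at v)) \<and>
        (fu has_real_derivative fuu) (at u) \<and>
        ((\<lambda>s. f u s) has_real_derivative ft) (at t within {t0..<T}) \<and>
        (fu u = 0 \<longrightarrow> 0 \<le> fuu \<longrightarrow> 0 < ft))"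
    and ut: "(u, t) \<in> R"
  shows "0 \<le> f u t"
proof (rule ccontr)
  assume neg: "\<not> 0 \<le> f u t"
  obtain v s where vs: "(v, s) \<in> R" and min: "\<And>v' s'. (v', s') \<in> R \<Longrightarrow> f v s \<le> f v' s'"
    using periodic_region_min[OF R _ cont per] ut by blast
  from min[OF ut] neg have "f v s < 0" by simp
  from step[OF vs this] obtain fu fuu ft where s: "t1 < s"
    and n: "\<forall>\<^sub>F w in nhds v. (w, s) \<in> R" "\<forall>\<^sub>F r in at_left s. (v, r) \<in> R"
    and d: "\<forall>\<^sub>F w in nhds v. ((\<lambda>v. f v s) has_real_derivative fu w) (at w)"
      "(fu has_real_derivative fuu) (at v)"
      "((\<lambda>r. f v r) has_real_derivative ft) (at s within {t0..<T})"
    and pos: "fu v = 0 \<longrightarrow> 0 \<le> fuu \<longrightarrow> 0 < ft" by blast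
  have "t0 < s" "s < T" using s T vs R(2) by auto
  from parabolic_min[OF min n d this] pos show False by auto
qed

lemma eventually_at_left_interval: "a < t \<Longrightarrow> t \<le> b \<Longrightarrow> \<forall>\<^sub>F s in at_left t. s \<in> {a..b}"
  for t :: real
  by (rule eventually_at_leftI[of a]) auto

lemma has_real_derivative_linear:
  assumes "bounded_linear L" "(g has_vector_derivative g') (at x within S)"
  shows "((\<lambda>x. L (g x)) has_real_derivative L g') (at x within S)"
  using bounded_linear.has_vector_derivative[OF assms]
  by (simp add: has_real_derivative_iff_has_vector_derivative)

section \<open>Convex plane curves moving by a parabolic equation\<close>

definition wedge :: "complex \<Rightarrow> complex \<Rightarrow> real"
  where "wedge p q = Im (cnj p * q)"

lemma wedge_alt: "wedge p q = Re p * Im q - Im p * Re q"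
  by (simp add: wedge_def)

lemma bounded_linear_Re_mult: "bounded_linear (\<lambda>z. Re (k * z))"
  by (intro bounded_linear_intros bounded_linear_compose[OF bounded_linear_Re])

lemma bounded_linear_Im_mult: "bounded_linear (\<lambda>z. Im (k * z))"
  by (intro bounded_linear_intros bounded_linear_compose[OF bounded_linear_Im])

text \<open>The projection of a space curve shortening flow: \<open>a\<close> and \<open>b\<close> express \<open>\<partial>\<^sub>s\<^sup>2\<close> with the arc length of the space
  curve, and \<open>\<delta>\<close> bounds the ratio of the projected speed to the full speed from below.\<close>

locale plane_flow =
  fixes c c1 c2 :: "real \<Rightarrow> real \<Rightarrow> complex" and a b :: "real \<Rightarrow> real \<Rightarrow> real"
    and t0 T \<delta> :: real
  assumes t0: "t0 < T"
    and periodic: "t \<in> {t0..<T} \<Longrightarrow> c (u + 2 * pi) t = c u t"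
    and cont: "continuous_on (UNIV \<times> {t0..<T}) (\<lambda>(u, t). c u t)"
    and deriv1: "t \<in> {t0..<T} \<Longrightarrow> ((\<lambda>v. c v t) has_vector_derivative c1 u t) (at u)"
    and deriv2: "t \<in> {t0..<T} \<Longrightarrow> ((\<lambda>v. c1 v t) has_vector_derivative c2 u t) (at u)"
    and heat: "t \<in> {t0..<T} \<Longrightarrow>
      ((\<lambda>s. c u s) has_vector_derivative a u t *\<^sub>R c2 u t + b u t *\<^sub>R c1 u t) (at t within {t0..<T})"
    and speed_lower: "t \<in> {t0..<T} \<Longrightarrow> \<delta>\<^sup>2 \<le> a u t * (cmod (c1 u t))\<^sup>2"
    and speed_upper: "t \<in> {t0..<T} \<Longrightarrow> a u t * (cmod (c1 u t))\<^sup>2 \<le> 1"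
    and a_pos: "t \<in> {t0..<T} \<Longrightarrow> 0 < a u t"
    and \<delta>_pos: "0 < \<delta>"
    and tangent_left: "t \<in> {t0..<T} \<Longrightarrow> u < v \<Longrightarrow> v < u + 2 * pi \<Longrightarrow> 0 < wedge (c1 u t) (c v t - c u t)"
    and triangle_left: "t \<in> {t0..<T} \<Longrightarrow> u < v \<Longrightarrow> v < w \<Longrightarrow> w < u + 2 * pi \<Longrightarrow>
      0 < wedge (c v t - c u t) (c w t - c u t)"
    and shrinks: "uniform_limit UNIV (\<lambda>t u. c u t) (\<lambda>_. 0) (at_left T)"
begin

lemma periodic_int: "t \<in> {t0..<T} \<Longrightarrow> c (u + 2 * pi * of_int k) t = c u t"
  by (rule periodic_2pi_shift) (rule periodic)

lemma param_in_period:
  assumes "t \<in> {t0..<T}"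
  obtains v where "v \<in> {u..<u + 2 * pi}" "c v t = c w t"
proof -
  obtain k :: int where "(w - u) + 2 * pi * of_int k \<in> {0..<2 * pi}" by (rule shift_into_period)
  then show thesis
    by (intro that[of "w + 2 * pi * of_int k"]) (use periodic_int[OF assms] in auto)
qed

lemma cont_space: "t \<in> {t0..<T} \<Longrightarrow> continuous_on S (\<lambda>v. c v t)"
  using deriv1 by (meson continuous_at_imp_continuous_on has_vector_derivative_continuous)

lemma coord_derivs:
  assumes "t \<in> {t0..<T}"
  shows "((\<lambda>v. Re (k * c v t)) has_real_derivative Re (k * c1 u t)) (at u)"
    "((\<lambda>v. Re (k * c1 v t)) has_real_derivative Re (k * c2 u t)) (at u)"
    "((\<lambda>s. Re (k * c u s)) has_real_derivative a u t * Re (k * c2 u t) + b u t * Re (k * c1 u t))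
      (at t within {t0..<T})"
    "((\<lambda>v. Im (k * c v t)) has_real_derivative Im (k * c1 u t)) (at u)"
    "((\<lambda>v. Im (k * c1 v t)) has_real_derivative Im (k * c2 u t)) (at u)"
    "((\<lambda>s. Im (k * c u s)) has_real_derivative a u t * Im (k * c2 u t) + b u t * Im (k * c1 u t))
      (at t within {t0..<T})"
proof -
  note R = has_real_derivative_linear[OF bounded_linear_Re_mult]
  note I = has_real_derivative_linear[OF bounded_linear_Im_mult]
  show "((\<lambda>v. Re (k * c v t)) has_real_derivative Re (k * c1 u t)) (at u)"
    "((\<lambda>v. Re (k * c1 v t)) has_real_derivative Re (k * c2 u t)) (at u)"
    "((\<lambda>v. Im (k * c v t)) has_real_derivative Im (k * c1 u t)) (at u)"
    "((\<lambda>v. Im (k * c1 v t)) has_real_derivative Im (k * c2 u t)) (at u)"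
    using R[OF deriv1] R[OF deriv2] I[OF deriv1] I[OF deriv2] assms by blast+
  show "((\<lambda>s. Re (k * c u s)) has_real_derivative a u t * Re (k * c2 u t) + b u t * Re (k * c1 u t))
      (at t within {t0..<T})"
    using R[OF heat[OF assms], of k u] by (simp add: distrib_left mult_ac)
  show "((\<lambda>s. Im (k * c u s)) has_real_derivative a u t * Im (k * c2 u t) + b u t * Im (k * c1 u t))
      (at t within {t0..<T})"
    using I[OF heat[OF assms], of k u] by (simp add: distrib_left mult_ac)
qed

lemma cont_curve: "S \<subseteq> UNIV \<times> {t0..<T} \<Longrightarrow> continuous_on S (\<lambda>x. c (fst x) (snd x))"
  using continuous_on_subset[OF cont] by (simp add: case_prod_unfold)

lemma half_plane_preserved:
  assumes t: "t0 \<le> t1" "t1 \<le> t" "t < T"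
    and init: "\<And>u. Re (k * c u t1) \<le> m"
  shows "Re (k * c u t) \<le> m"
proof (rule field_le_epsilon)
  fix e :: real assume e: "e > 0"
  \<comment> \<open>The added term \<open>\<epsilon> * (s - t1)\<close> produces the strict time
    derivative that \<open>parabolic_principle\<close> asks for; the summand 1 in the denominator
    covers t = t1. The later barrier arguments use the same device.\<close>
  define \<epsilon> where "\<epsilon> = e / (t - t1 + 1)"
  have \<epsilon>: "\<epsilon> > 0" "\<epsilon> * (t - t1) \<le> e" using e t by (auto simp: \<epsilon>_def field_simps)
  let ?R = "UNIV \<times> {t1..t}"
  let ?f = "\<lambda>u s. m - Re (k * c u s) + \<epsilon> * (s - t1)"
  have "0 \<le> ?f u t"
  proof (rule parabolic_principle[of ?R t1 t t0 T ?f u t])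
    show "continuous_on ?R (\<lambda>(u, s). ?f u s)"
      unfolding case_prod_unfold by (intro continuous_intros cont_curve) (use t in auto)
  next
    fix v s assume vs: "(v, s) \<in> ?R" and neg: "?f v s < 0"
    have s: "s \<in> {t0..<T}" using vs t by auto
    have "s \<noteq> t1" using init[of v] neg by auto
    then have s1: "t1 < s" using vs by auto
    have d: "((\<lambda>v. ?f v s) has_real_derivative - Re (k * c1 w s)) (at w)" for w
      by (rule derivative_eq_intros coord_derivs s refl)+ simp
    have d2: "((\<lambda>v. - Re (k * c1 v s)) has_real_derivative - Re (k * c2 v s)) (at v)"
      by (rule derivative_eq_intros coord_derivs s refl)+
    have dt: "((\<lambda>s. ?f v s) has_real_derivative
        - (a v s * Re (k * c2 v s) + b v s * Re (k * c1 v s)) + \<epsilon>) (at s within {t0..<T})"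
      by (rule derivative_eq_intros coord_derivs s refl)+ simp
    show "t1 < s \<and> (\<forall>\<^sub>F v in nhds v. (v, s) \<in> ?R) \<and> (\<forall>\<^sub>F s in at_left s. (v, s) \<in> ?R) \<and>
      (\<exists>fu fuu ft. (\<forall>\<^sub>F v in nhds v. ((\<lambda>v. ?f v s) has_real_derivative fu v) (at v)) \<and>
        (fu has_real_derivative fuu) (at v) \<and>
        ((\<lambda>s. ?f v s) has_real_derivative ft) (at s within {t0..<T}) \<and>
        (fu v = 0 \<longrightarrow> 0 \<le> fuu \<longrightarrow> 0 < ft))"
    proof (intro conjI exI)
      show "\<forall>\<^sub>F w in nhds v. ((\<lambda>v. ?f v s) has_real_derivative - Re (k * c1 w s)) (at w)"
        using d by simp
      show "- Re (k * c1 v s) = 0 \<longrightarrow> 0 \<le> - Re (k * c2 v s) \<longrightarrow>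
        0 < - (a v s * Re (k * c2 v s) + b v s * Re (k * c1 v s)) + \<epsilon>"
        using \<epsilon> mult_nonneg_nonneg[of "a v s" "- Re (k * c2 v s)"] a_pos[OF s, of v]
        by (auto simp del: times_complex.sel)
    qed (use s1 vs d2 dt eventually_at_left_interval[of t1 s t] in auto)
  qed (use t periodic in \<open>auto simp: closed_Times\<close>)
  then show "Re (k * c u t) \<le> m + e" using \<epsilon> by simp
qed

section \<open>The convex hull of the curve\<close>

definition region :: "real \<Rightarrow> complex set"
  where "region t = convex hull (range (\<lambda>u. c u t))"

lemma curve_in_region: "c u t \<in> region t"
  by (simp add: region_def hull_inc)

lemma convex_region: "convex (region t)"
  by (simp add: region_def)

lemma range_eq: 
  assumes "t \<in> {t0..<T}"
  shows "range (\<lambda>u. c u t) = (\<lambda>u. c u t) ` {0..2 * pi}"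
proof
  show "range (\<lambda>u. c u t) \<subseteq> (\<lambda>u. c u t) ` {0..2 * pi}"
  proof
    fix z assume "z \<in> range (\<lambda>u. c u t)"
    then obtain w where "z = c w t" by auto
    then obtain v where "v \<in> {0..<0 + 2 * pi}" "c v t = z" using param_in_period[OF assms, of 0 w] by metis
    then show "z \<in> (\<lambda>u. c u t) ` {0..2 * pi}" by (intro image_eqI[of _ _ v]) auto
  qed
qed auto

lemma compact_curve: "t \<in> {t0..<T} \<Longrightarrow> compact (range (\<lambda>u. c u t))"
  unfolding range_eq by (intro compact_continuous_image cont_space) auto

lemma compact_region: "t \<in> {t0..<T} \<Longrightarrow> compact (region t)"
  unfolding region_def by (intro compact_convex_hull compact_curve)

lemma region_half_plane:
  assumes "\<And>u. Re (k * c u t) \<le> m" "p \<in> region t"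
  shows "Re (k * p) \<le> m"
proof -
  have "region t \<subseteq> {z. Re (k * z) \<le> m}" unfolding region_def
  proof (rule hull_minimal)
    have "{z. Re (k * z) \<le> m} = {z. inner (cnj k) z \<le> m}" by (auto simp: inner_complex_def)
    then show "convex {z. Re (k * z) \<le> m}" by (simp add: convex_halfspace_le)
  qed (use assms in auto)
  then show ?thesis using assms by auto
qed

lemma not_in_region:
  assumes "t \<in> {t0..<T}" "p \<notin> region t"
  obtains k m where "cmod k = 1" "Re (k * p) > m" "\<And>u. Re (k * c u t) \<le> m"
proof -
  obtain z m where z: "inner z p < m" "\<forall>x\<in>region t. inner z x > m"
    using separating_hyperplane_closed_point[OF convex_region compact_imp_closed[OF compact_region[OF assms(1)]] assms(2)]
    by blast
  have "z \<noteq> 0" using z curve_in_region[of 0 t] by force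
  define k where "k = - cnj z / cmod z"
  have kz: "Re (k * q) = - inner z q / cmod z" for q
    by (simp add: k_def inner_complex_def diff_divide_distrib add_divide_distrib)
  show thesis
  proof (rule that[of k "- m / cmod z"])
    show "cmod k = 1" using \<open>z \<noteq> 0\<close> by (simp add: k_def norm_divide)
    show "Re (k * p) > - m / cmod z" using z(1) \<open>z \<noteq> 0\<close> unfolding kz by (simp add: divide_strict_right_mono)
    show "Re (k * c u t) \<le> - m / cmod z" for u
      using z(2)[rule_format, OF curve_in_region[of u t]] \<open>z \<noteq> 0\<close> unfolding kz by (simp add: divide_right_mono)
  qed
qed

text \<open>A compact convex set is the intersection of the half-planes containing it, and each of
  these is preserved.\<close>

lemma region_decreasing:
  assumes t: "t0 \<le> t1" "t1 \<le> t" "t < T"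
  shows "region t \<subseteq> region t1"
proof
  fix p assume p: "p \<in> region t"
  show "p \<in> region t1"
  proof (rule ccontr)
    assume "p \<notin> region t1"
    then obtain k m where km: "Re (k * p) > m" "\<And>u. Re (k * c u t1) \<le> m"
      using not_in_region[of t1 p] t by (metis atLeastLessThan_iff order.strict_trans1)
    from half_plane_preserved[OF t km(2)] region_half_plane[OF _ p] km(1) show False by (metis not_le)
  qed
qed

text \<open>The open half-plane left of the tangent together with the contact point is convex, so it
  contains the hull as soon as it contains the curve. Consequently every curve point is an extreme
  point of the region.\<close>

lemma tangent_left_weak:
  assumes t: "t \<in> {t0..<T}" and p: "p \<in> region t" "p \<noteq> c u t"
  shows "0 < wedge (c1 u t) (p - c u t)"
proof -
  let ?S = "{z. 0 < wedge (c1 u t) (z - c u t)} \<union> {c u t}"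
  have "region t \<subseteq> ?S" unfolding region_def
  proof (rule hull_minimal)
    show "range (\<lambda>u. c u t) \<subseteq> ?S"
    proof
      fix z assume "z \<in> range (\<lambda>u. c u t)"
      then obtain w where w: "z = c w t" by auto
      obtain v where v: "v \<in> {u..<u + 2 * pi}" "c v t = z" using param_in_period[OF t, of u w] w by metis
      show "z \<in> ?S" using tangent_left[OF t, of u v] v by (cases "v = u") auto
    qed
    show "convex ?S"
    proof (rule convexI)
      fix x y and \<alpha> \<beta> :: real
      assume xy: "x \<in> ?S" "y \<in> ?S" and ab: "0 \<le> \<alpha>" "0 \<le> \<beta>" "\<alpha> + \<beta> = 1"
      let ?L = "\<lambda>z. wedge (c1 u t) (z - c u t)"
      have lin: "?L (\<alpha> *\<^sub>R x + \<beta> *\<^sub>R y) = \<alpha> * ?L x + \<beta> * ?L y"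
      proof -
        have "\<alpha> *\<^sub>R x + \<beta> *\<^sub>R y - c u t = \<alpha> *\<^sub>R (x - c u t) + \<beta> *\<^sub>R (y - c u t)"
        proof -
          have "c u t = \<alpha> *\<^sub>R c u t + \<beta> *\<^sub>R c u t" using ab(3) by (simp flip: scaleR_add_left)
          then show ?thesis by (simp add: algebra_simps)
        qed
        moreover have "wedge q (\<alpha> *\<^sub>R v + \<beta> *\<^sub>R w) = \<alpha> * wedge q v + \<beta> * wedge q w" for q v w
          by (simp add: wedge_alt algebra_simps)
        ultimately show ?thesis by simp
      qed
      have nn: "?L x \<ge> 0" "?L y \<ge> 0" using xy by (auto simp: wedge_alt)
      show "\<alpha> *\<^sub>R x + \<beta> *\<^sub>R y \<in> ?S"
      proof (cases "?L (\<alpha> *\<^sub>R x + \<beta> *\<^sub>R y) > 0")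
        case False
        then have "\<alpha> * ?L x + \<beta> * ?L y \<le> 0" by (simp add: lin)
        then have "\<alpha> * ?L x = 0" "\<beta> * ?L y = 0"
          using mult_nonneg_nonneg[OF ab(1) nn(1)] mult_nonneg_nonneg[OF ab(2) nn(2)] by linarith+
        then have "\<alpha> = 0 \<or> x = c u t" "\<beta> = 0 \<or> y = c u t" using xy by auto
        then have "\<alpha> *\<^sub>R x + \<beta> *\<^sub>R y = c u t" using ab(3) by (auto simp flip: scaleR_add_left)
        then show ?thesis by simp
      qed auto
    qed
  qed
  with p show ?thesis by auto
qed

lemma curve_not_between:
  assumes t: "t \<in> {t0..<T}" and p: "p - h \<in> region t" "p + h \<in> region t" "h \<noteq> 0"
  shows "c u t \<noteq> p"
proof
  assume e: "c u t = p"
  have "0 < wedge (c1 u t) (p - h - c u t)" "0 < wedge (c1 u t) (p + h - c u t)"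
    using tangent_left_weak[OF t p(1), of u] tangent_left_weak[OF t p(2), of u] p(3) e by auto
  then show False by (simp add: e wedge_alt)
qed

lemma uniformly_close:
  assumes s: "s \<in> {t0..<T}" and e: "0 < e"
  obtains d where "0 < d" "\<And>t u. t \<in> {t0..<T} \<Longrightarrow> \<bar>t - s\<bar> < d \<Longrightarrow> cmod (c u t - c u s) < e"
proof -
  define r where "r = (s + T) / 2"
  have r: "s < r" "r < T" using s by (auto simp: r_def)
  let ?K = "{0..2 * pi} \<times> {t0..r}"
  have "uniformly_continuous_on ?K (\<lambda>(u, t). c u t)"
    by (intro compact_uniformly_continuous continuous_on_subset[OF cont] compact_Times)
      (use r in auto)
  then obtain d where d: "d > 0" and
    D: "\<And>x y. x \<in> ?K \<Longrightarrow> y \<in> ?K \<Longrightarrow> dist y x < d \<Longrightarrow> dist ((\<lambda>(u, t). c u t) y) ((\<lambda>(u, t). c u t) x) < e"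
    by (rule uniformly_continuous_onE[OF _ e]) (simp add: dist_commute)
  show thesis
  proof (rule that[of "min d (r - s)"])
    show "0 < min d (r - s)" using d r by simp
    fix t u assume t: "t \<in> {t0..<T}" "\<bar>t - s\<bar> < min d (r - s)"
    obtain k :: int where k: "u + 2 * pi * of_int k \<in> {0..<2 * pi}" by (rule shift_into_period)
    have "dist (c (u + 2 * pi * of_int k) t) (c (u + 2 * pi * of_int k) s) < e"
      using D[of "(u + 2 * pi * of_int k, s)" "(u + 2 * pi * of_int k, t)"] k t s
      by (auto simp: dist_Pair_Pair dist_real_def)
    then show "cmod (c u t - c u s) < e" using periodic_int t s by (simp add: dist_norm)
  qed
qed

text \<open>The support line touches the curve somewhere and is the tangent there. A second contact
  point p would lie on this tangent, against the strict inequality in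
  \<open>tangent_left_weak\<close>.\<close>

lemma support_contact:
  assumes t: "t \<in> {t0..<T}" and p: "p \<in> region t" and sup: "\<And>u. Re (k * c u t) \<le> Re (k * p)" and k: "k \<noteq> 0"
  shows "\<exists>u. c u t = p"
proof -
  let ?S = "{z. Re (k * z) < Re (k * p)}"
  have "\<not> range (\<lambda>u. c u t) \<subseteq> ?S"
  proof
    assume "range (\<lambda>u. c u t) \<subseteq> ?S"
    moreover have "?S = {z. inner (cnj k) z < Re (k * p)}" by (auto simp: inner_complex_def)
    then have "convex ?S" by (simp add: convex_halfspace_lt)
    ultimately have "region t \<subseteq> ?S" unfolding region_def by (rule hull_minimal)
    with p show False by auto
  qed
  then obtain u where "\<not> Re (k * c u t) < Re (k * p)" by blast
  with sup[of u] have u: "Re (k * c u t) = Re (k * p)" by simp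
  have d0: "Re (k * c1 u t) = 0"
    by (rule DERIV_local_max[OF coord_derivs(1)[OF t], of 1]) (use sup u in auto)
  show ?thesis
  proof (rule ccontr)
    assume "\<not> ?thesis"
    then have ne: "p \<noteq> c u t" by auto
    have pos: "0 < wedge (c1 u t) (p - c u t)" by (rule tangent_left_weak[OF t p ne])
    have z: "Re (k * (p - c u t)) = 0" using u by (simp add: right_diff_distrib)
    \<comment> \<open>The tangent and the chord to p are both orthogonal to \<open>cnj k\<close>,
      hence parallel. Multiplying by the squared components of k avoids dividing by one that may
      vanish.\<close>
    have "(Re k)\<^sup>2 * wedge (c1 u t) (p - c u t) = 0" "(Im k)\<^sup>2 * wedge (c1 u t) (p - c u t) = 0"
    proof -
      have 1: "Re k * Re (c1 u t) = Im k * Im (c1 u t)" "Re k * Re (p - c u t) = Im k * Im (p - c u t)"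
        using d0 z by simp_all
      have "(Re k)\<^sup>2 * wedge (c1 u t) (p - c u t)
        = Re k * ((Re k * Re (c1 u t)) * Im (p - c u t) - Im (c1 u t) * (Re k * Re (p - c u t)))"
        by (simp add: wedge_alt power2_eq_square algebra_simps)
      also have "\<dots> = 0" unfolding 1 by (simp add: algebra_simps)
      finally show "(Re k)\<^sup>2 * wedge (c1 u t) (p - c u t) = 0" .
      have "(Im k)\<^sup>2 * wedge (c1 u t) (p - c u t)
        = Im k * (Re (c1 u t) * (Im k * Im (p - c u t)) - (Im k * Im (c1 u t)) * Re (p - c u t))"
        by (simp add: wedge_alt power2_eq_square algebra_simps)
      also have "\<dots> = 0" unfolding 1[symmetric] by (simp add: algebra_simps)
      finally show "(Im k)\<^sup>2 * wedge (c1 u t) (p - c u t) = 0" .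
    qed
    with pos have "Re k = 0" "Im k = 0" by auto
    with k show False by (simp add: complex_eq_iff)
  qed
qed

end

section \<open>Orientation of a parametrized convex curve\<close>

lemma mem_interior_shrink:
  fixes o' :: complex
  assumes "convex K" "o' \<in> interior K" "x \<in> K" "0 \<le> l" "l < 1"
  shows "o' + l *\<^sub>R (x - o') \<in> interior K"
proof -
  have "x - (1 - l) *\<^sub>R (x - o') \<in> interior K"
    by (rule mem_interior_convex_shrink) (use assms in auto)
  moreover have "x - (1 - l) *\<^sub>R (x - o') = o' + l *\<^sub>R (x - o')" by (simp add: algebra_simps)
  ultimately show ?thesis by simp
qed

text \<open>\<open>W u v\<close> is the oriented area seen from an interior point \<open>o'\<close>. As \<open>v\<close> runs once around the circle
  from \<open>u\<close>, \<open>W u v\<close> changes sign exactly once, at the antipode of \<open>u\<close>.\<close>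

locale convex_loop =
  fixes c :: "real \<Rightarrow> complex" and K :: "complex set" and o' :: complex
  assumes cont: "continuous_on UNIV c"
    and periodic: "c (u + 2 * pi) = c u"
    and inj: "inj_on c {0..<2 * pi}"
    and K: "compact K" "convex K" "o' \<in> interior K"
    and range: "range c = frontier K"
begin

definition W :: "real \<Rightarrow> real \<Rightarrow> real"
  where "W u v = wedge (c u - o') (c v - o')"

lemma on_frontier: "c u \<in> K" "c u \<notin> interior K"
proof -
  have "c u \<in> frontier K" using range by auto
  moreover have "closure K = K" using K(1) by (simp add: compact_imp_closed)
  ultimately show "c u \<in> K" "c u \<notin> interior K" by (auto simp: frontier_def)
qed

lemma W_antisym: "W v u = - W u v"
  by (simp add: W_def wedge_alt)

lemma W_periodic: "W (u + 2 * pi) v = W u v" "W u (v + 2 * pi) = W u v"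
  by (simp_all add: W_def periodic)

lemma inj': "c u = c v \<Longrightarrow> u \<le> v \<Longrightarrow> v < u + 2 * pi \<Longrightarrow> u = v"
proof -
  assume e: "c u = c v" and uv: "u \<le> v" "v < u + 2 * pi"
  obtain k where k: "u + 2 * pi * of_int k \<in> {0..<2 * pi}" by (rule shift_into_period)
  define x y where "x = u + 2 * pi * real_of_int k" and "y = v + 2 * pi * real_of_int k"
  have xy: "c x = c u" "c y = c v" unfolding x_def y_def by (rule periodic_2pi_shift[of c, OF periodic])+
  have "x = y"
  proof (cases "y < 2 * pi")
    case True
    then show ?thesis using inj_onD[OF inj, of x y] xy e k uv by (auto simp: x_def y_def)
  next
    case False
    have "c (y - 2 * pi) = c y" using periodic[of "y - 2 * pi"] by simp
    then have "x = y - 2 * pi" using inj_onD[OF inj, of x "y - 2 * pi"] xy e k uv False by (auto simp: x_def y_def)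
    then show ?thesis using uv by (simp add: x_def y_def)
  qed
  then show "u = v" by (simp add: x_def y_def)
qed

text \<open>Of two frontier points on one ray from an interior point, the nearer one would be a
  shrunk copy of the farther one and therefore interior.\<close>

lemma same_ray:
  assumes "c v - o' = l *\<^sub>R (c u - o')" "0 < l"
  shows "c v = c u"
proof -
  have "\<not> l < 1" using mem_interior_shrink[OF K(2,3) on_frontier(1)[of u], of l] on_frontier(2)[of v] assms
    by (metis add_diff_cancel_left' add.commute diff_add_cancel less_imp_le)
  moreover have "\<not> 1 < l"
  proof
    assume l: "1 < l"
    have "c u - o' = inverse l *\<^sub>R (c v - o')" using assms by simp
    then have "c u = o' + inverse l *\<^sub>R (c v - o')" by (metis add.commute diff_add_cancel)
    then show False
      using mem_interior_shrink[OF K(2,3) on_frontier(1)[of v], of "inverse l"] on_frontier(2)[of u] l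
      by (simp add: inverse_less_1_iff)
  qed
  ultimately have "l = 1" by linarith
  with assms show ?thesis by simp
qed

lemma hit:
  assumes "z \<noteq> 0"
  obtains v l where "u \<le> v" "v < u + 2 * pi" "0 < l" "c v - o' = l *\<^sub>R z"
proof -
  obtain l where l: "0 < l" "o' + l *\<^sub>R z \<in> frontier K"
    using ray_to_frontier[OF compact_imp_bounded[OF K(1)] K(3) assms] by metis
  then obtain w where w: "c w = o' + l *\<^sub>R z" using range by (metis imageE)
  obtain k :: int where k: "(w - u) + 2 * pi * of_int k \<in> {0..<2 * pi}" by (rule shift_into_period)
  have "c (w + 2 * pi * of_int k) = c w" by (rule periodic_2pi_shift[of c, OF periodic])
  then show thesis using that[of "w + 2 * pi * of_int k" l] k l w by auto
qed

lemma radius_nz: "c u - o' \<noteq> 0"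
  using on_frontier(2)[of u] K(3) by auto

lemma cont_W: "continuous_on S (\<lambda>v. W u v)" "continuous_on S (\<lambda>v. W v u)"
  unfolding W_def wedge_def by (intro continuous_intros continuous_on_subset[OF cont]; simp)+

definition turns :: "real \<Rightarrow> real \<Rightarrow> bool"
  where "turns \<rho> u \<longleftrightarrow> (\<exists>s. u < s \<and> s < u + 2 * pi \<and> W u s = 0 \<and>
    (\<forall>v. u < v \<longrightarrow> v < s \<longrightarrow> 0 < \<rho> * W u v) \<and> (\<forall>v. s < v \<longrightarrow> v < u + 2 * pi \<longrightarrow> \<rho> * W u v < 0))"

lemma parallel:
  assumes "wedge p q = 0" "p \<noteq> 0"
  obtains l where "q = l *\<^sub>R p"
proof
  have "(Re p)\<^sup>2 + (Im p)\<^sup>2 \<noteq> 0" using assms(2) by (simp add: complex_eq_iff sum_power2_eq_zero_iff)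
  moreover have e: "Re p * Im q = Im p * Re q" using assms(1) by (simp add: wedge_alt)
  have "Re q * ((Re p)\<^sup>2 + (Im p)\<^sup>2) = (Re p * Re q + Im p * Im q) * Re p"
    "Im q * ((Re p)\<^sup>2 + (Im p)\<^sup>2) = (Re p * Re q + Im p * Im q) * Im p"
    using e by algebra+
  ultimately show "q = ((Re p * Re q + Im p * Im q) / ((Re p)\<^sup>2 + (Im p)\<^sup>2)) *\<^sub>R p"
    by (simp add: complex_eq_iff field_simps)
qed

lemma const_sign:
  assumes "\<And>v. a < v \<Longrightarrow> v < b \<Longrightarrow> W u v \<noteq> 0" "a < x" "x < b" "a < y" "y < b" "0 < W u x"
  shows "0 < W u y"
proof (rule ccontr)
  assume "\<not> 0 < W u y"
  moreover have "connected {a<..<b}" by simp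
  ultimately obtain v where "v \<in> {a<..<b}" "W u v = 0"
    using connected_continuous_image[OF cont_W(1)] assms
      connectedD_interval[of "W u ` {a<..<b}" "W u y" "W u x" 0] by force
  with assms(1) show False by auto
qed

lemma const_sign_neg:
  assumes "\<And>v. a < v \<Longrightarrow> v < b \<Longrightarrow> W u v \<noteq> 0" "a < x" "x < b" "a < y" "y < b" "W u x < 0"
  shows "W u y < 0"
proof (rule ccontr)
  assume "\<not> W u y < 0"
  then have "0 < W u y" using assms(1)[of y] assms(4,5) by linarith
  then have "0 < W u x" using const_sign[of a b u y x] assms by blast
  with assms(6) show False by simp
qed

text \<open>A zero of \<open>W u\<close> places c v on the line through o' and c u, which meets the
  frontier only at c u and at its antipode. The rays at right angles to c u are hit too, so both
  signs occur, one on each side of the antipode.\<close>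

lemma turns_cases: "turns 1 u \<or> turns (-1) u"
proof -
  obtain s l where s: "u \<le> s" "s < u + 2 * pi" "0 < l" "c s - o' = l *\<^sub>R (- (c u - o'))"
    using hit[of "- (c u - o')" u] radius_nz[of u] by auto
  have "u \<noteq> s"
  proof
    assume "u = s"
    then have "(1 + l) *\<^sub>R (c u - o') = 0" using s(4) by (simp add: algebra_simps)
    then show False using s(3) radius_nz[of u] by simp
  qed
  then have us: "u < s" using s by simp
  have Ws: "W u s = 0" unfolding W_def s(4) by (simp add: wedge_alt algebra_simps)
  have nz: "W u v \<noteq> 0" if v: "u < v" "v < u + 2 * pi" "v \<noteq> s" for v
  proof
    assume "W u v = 0"
    then obtain k where k: "c v - o' = k *\<^sub>R (c u - o')"
      using parallel[of "c u - o'" "c v - o'"] radius_nz[of u] by (auto simp: W_def)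
    have "k \<noteq> 0" using k radius_nz[of v] by auto
    show False
    proof (cases "0 < k")
      case True
      from same_ray[OF k this] inj'[of u v] v show False by auto
    next
      case False
      have "c v - o' = (- k / l) *\<^sub>R (c s - o')" unfolding s(4) k using s(3) by (simp add: algebra_simps)
      moreover have "0 < - k / l" using False \<open>k \<noteq> 0\<close> s(3) by (simp add: divide_less_0_iff)
      ultimately have "c v = c s" by (rule same_ray)
      then show False using inj'[of v s] inj'[of s v] v us s(2) by (cases "v \<le> s") auto
    qed
  qed
  obtain v1 l1 where v1: "u \<le> v1" "v1 < u + 2 * pi" "0 < l1" "c v1 - o' = l1 *\<^sub>R (\<i> * (c u - o'))"
    using hit[of "\<i> * (c u - o')" u] radius_nz[of u] by auto
  obtain v2 l2 where v2: "u \<le> v2" "v2 < u + 2 * pi" "0 < l2" "c v2 - o' = l2 *\<^sub>R (- \<i> * (c u - o'))"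
    using hit[of "- \<i> * (c u - o')" u] radius_nz[of u] by auto
  have sq: "0 < (Re (c u - o'))\<^sup>2 + (Im (c u - o'))\<^sup>2"
    using radius_nz[of u] by (simp add: complex_eq_iff sum_power2_gt_zero_iff)
  have "W u v1 = l1 * ((Re (c u - o'))\<^sup>2 + (Im (c u - o'))\<^sup>2)"
    "W u v2 = - (l2 * ((Re (c u - o'))\<^sup>2 + (Im (c u - o'))\<^sup>2))"
    unfolding W_def v1(4) v2(4) by (simp_all add: wedge_alt power2_eq_square algebra_simps)
  then have W12: "0 < W u v1" "W u v2 < 0" using sq v1(3) v2(3) by simp_all
  have Wu: "W u u = 0" by (simp add: W_def wedge_alt)
  then have o12: "u < v1" "u < v2" "v1 \<noteq> s" "v2 \<noteq> s" using W12 v1 v2 Ws by (auto simp: less_le)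
  have nz1: "W u v \<noteq> 0" if "u < v" "v < s" for v using nz[of v] that s(2) by auto
  have nz2: "W u v \<noteq> 0" if "s < v" "v < u + 2 * pi" for v using nz[of v] that us by auto
  have p1: "0 < W u y" if "0 < W u x" "u < x" "x < s" "u < y" "y < s" for x y
    using const_sign[of u s u x y] nz1 that by blast
  have n1: "W u y < 0" if "W u x < 0" "u < x" "x < s" "u < y" "y < s" for x y
    using const_sign_neg[of u s u x y] nz1 that by blast
  have p2: "0 < W u y" if "0 < W u x" "s < x" "x < u + 2 * pi" "s < y" "y < u + 2 * pi" for x y
    using const_sign[of s "u + 2 * pi" u x y] nz2 that by blast
  have n2: "W u y < 0" if "W u x < 0" "s < x" "x < u + 2 * pi" "s < y" "y < u + 2 * pi" for x y
    using const_sign_neg[of s "u + 2 * pi" u x y] nz2 that by blast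
  show ?thesis
  proof (cases "v1 < s")
    case True
    have "\<not> v2 < s" using p1[of v1 v2] True o12 W12 by auto
    then have "s < v2" using o12 by auto
    have "turns 1 u" unfolding turns_def
      by (rule exI[of _ s]) (use us s(2) Ws p1[of v1] n2[of v2] True \<open>s < v2\<close> o12 W12 v2 in auto)
    then show ?thesis ..
  next
    case False
    then have "s < v1" using o12 by auto
    have "\<not> s < v2" using p2[of v1 v2] \<open>s < v1\<close> o12 W12 v1 v2 by auto
    then have "v2 < s" using o12 by auto
    have "turns (-1) u" unfolding turns_def
      by (rule exI[of _ s]) (use us s(2) Ws n1[of v2] p2[of v1] \<open>v2 < s\<close> \<open>s < v1\<close> o12 W12 v1 in auto)
    then show ?thesis ..
  qed
qed

text \<open>Two sample values of W, one on either side of the antipode, decide the orientation, and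
  their signs persist for nearby u.\<close>

lemma turns_open:
  assumes \<rho>: "\<rho> = 1 \<or> \<rho> = -1" and t: "turns \<rho> u"
  shows "\<forall>\<^sub>F x in nhds u. turns \<rho> x \<and> \<not> turns (- \<rho>) x"
proof -
  obtain s where s: "u < s" "s < u + 2 * pi" "W u s = 0"
    "\<forall>v. u < v \<longrightarrow> v < s \<longrightarrow> 0 < \<rho> * W u v" "\<forall>v. s < v \<longrightarrow> v < u + 2 * pi \<longrightarrow> \<rho> * W u v < 0"
    using t by (auto simp: turns_def)
  define v0 v1 where "v0 = (u + s) / 2" and "v1 = (s + (u + 2 * pi)) / 2"
  have v: "u < v0" "v0 < s" "s < v1" "v1 < u + 2 * pi" using s by (auto simp: v0_def v1_def)
  have lim: "((\<lambda>x. \<rho> * W x v) \<longlongrightarrow> \<rho> * W u v) (nhds u)" for v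
  proof -
    have "isCont (\<lambda>x. W x v) u" using cont_W(2)[of UNIV v] continuous_on_eq_continuous_at[of UNIV "\<lambda>x. W x v"] by blast
    then have "((\<lambda>x. W x v) \<longlongrightarrow> W u v) (nhds u)"
      unfolding isCont_def by (rule iffD1[OF tendsto_at_iff_tendsto_nhds[of "\<lambda>x. W x v" u]])
    then show ?thesis by (intro tendsto_intros)
  qed
  have "\<forall>\<^sub>F x in nhds u. 0 < \<rho> * W x v0" using s v by (intro order_tendstoD(1)[OF lim]) auto
  moreover have "\<forall>\<^sub>F x in nhds u. \<rho> * W x v1 < 0" using s v by (intro order_tendstoD(2)[OF lim]) auto
  moreover have "\<forall>\<^sub>F x in nhds u. x \<in> {v1 - 2 * pi<..<v0}" using v by (intro eventually_nhds_in_open) auto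
  ultimately show ?thesis
  proof eventually_elim
    case (elim x)
    have "\<not> turns (- \<rho>) x"
    proof
      assume "turns (- \<rho>) x"
      then obtain r where r: "\<forall>v. x < v \<longrightarrow> v < r \<longrightarrow> 0 < - \<rho> * W x v" "\<forall>v. r < v \<longrightarrow> v < x + 2 * pi \<longrightarrow> - \<rho> * W x v < 0"
        "W x r = 0" by (auto simp: turns_def)
      have "\<not> v0 < r" using r(1)[rule_format, of v0] elim by auto
      then have "r < v1" using v by auto
      then show False using r(2)[rule_format, of v1] elim by auto
    qed
    then show ?case using turns_cases[of x] \<rho> by auto
  qed
qed

lemma turns_everywhere: "(\<forall>u. turns 1 u) \<or> (\<forall>u. turns (-1) u)"
proof (rule ccontr)
  assume "\<not> ?thesis"
  then obtain u v where uv: "\<not> turns 1 u" "\<not> turns (-1) v" by auto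
  let ?A = "{u. turns 1 u}" and ?B = "{u. turns (-1) u}"
  have "open ?A" "open ?B"
    unfolding open_subopen[of ?A] open_subopen[of ?B]
    using turns_open[of 1] turns_open[of "-1"] by (fastforce simp: eventually_nhds)+
  moreover have "?A \<inter> ?B = {}"
    using turns_open[of 1] eventually_nhds_x_imp_x by fastforce
  moreover have "UNIV \<subseteq> ?A \<union> ?B" using turns_cases by auto
  ultimately have "?A = {} \<or> ?B = {}"
    using connectedD[OF connected_UNIV, of ?A ?B] by auto
  moreover have "turns (-1) u" "turns 1 v" using turns_cases uv by auto
  ultimately show False by auto
qed

lemma triangle_W: "wedge (c v - c u) (c w - c u) = W u v + W v w + W w u"
  by (simp add: W_def wedge_alt algebra_simps)

text \<open>Here c v lies in the angle at o' between c u and c w, with positive coordinates \<alpha>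
  and \<beta>. If the area were negative, \<alpha> + \<beta> would be less than 1, and c v would be
  a point of a chord moved towards o', hence interior.\<close>

lemma triangle_obtuse:
  assumes \<rho>: "\<rho> = 1 \<or> \<rho> = -1" and W: "0 < \<rho> * W u v" "0 < \<rho> * W v w" "0 < \<rho> * W u w"
  shows "0 \<le> \<rho> * (W u v + W v w + W w u)"
proof (rule ccontr)
  define \<alpha> \<beta> where "\<alpha> = W v w / W u w" and "\<beta> = W u v / W u w"
  have Wuw: "W u w \<noteq> 0" using W by auto
  have ab: "0 < \<alpha>" "0 < \<beta>"
    using W \<rho> by (auto simp: \<alpha>_def \<beta>_def zero_less_divide_iff)
  assume "\<not> ?thesis"
  then have "\<rho> * (W u v + W v w) < \<rho> * W u w" using W_antisym[of w u] by (simp add: algebra_simps)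
  then have sum: "\<alpha> + \<beta> < 1"
    using W \<rho> unfolding \<alpha>_def \<beta>_def add_divide_distrib[symmetric]
    by (auto simp: divide_less_eq add.commute)
  have "W u w *\<^sub>R (c v - o') = W v w *\<^sub>R (c u - o') + W u v *\<^sub>R (c w - o')"
    by (simp add: W_def wedge_alt complex_eq_iff algebra_simps)
  then have cv: "c v - o' = \<alpha> *\<^sub>R (c u - o') + \<beta> *\<^sub>R (c w - o')"
    using Wuw unfolding \<alpha>_def \<beta>_def divide_inverse_commute scaleR_scaleR[symmetric] scaleR_add_right[symmetric]
    by (metis scaleR_left_imp_eq scaleR_scaleR right_inverse scaleR_one)
  define q where "q = (\<alpha> / (\<alpha> + \<beta>)) *\<^sub>R c u + (\<beta> / (\<alpha> + \<beta>)) *\<^sub>R c w"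
  have "q \<in> K" unfolding q_def
    by (rule convexD[OF K(2) on_frontier(1) on_frontier(1)])
      (use ab in \<open>auto simp: add_divide_distrib[symmetric]\<close>)
  then have "o' + (\<alpha> + \<beta>) *\<^sub>R (q - o') \<in> interior K"
    by (intro mem_interior_shrink K) (use ab sum in auto)
  moreover have "(\<alpha> + \<beta>) *\<^sub>R (q - o') = c v - o'"
  proof -
    have "(\<alpha> + \<beta>) *\<^sub>R q = \<alpha> *\<^sub>R c u + \<beta> *\<^sub>R c w" using ab by (simp add: q_def scaleR_add_right)
    then show ?thesis unfolding cv by (simp add: algebra_simps)
  qed
  ultimately show False using on_frontier(2)[of v] by simp
qed

text \<open>If all three values of W are nonnegative, so is their sum. Otherwise one of them is
  negative, and a cyclic rotation brings it to the position treated by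
  \<open>triangle_obtuse\<close>.\<close>

lemma ordered_triangle:
  assumes \<rho>: "\<rho> = 1 \<or> \<rho> = -1" and t: "\<And>u. turns \<rho> u" and o: "u < v" "v < w" "w < u + 2 * pi"
  shows "0 \<le> \<rho> * (W u v + W v w + W w u)"
proof -
  have neg: "0 \<le> \<rho> * (W u v + W v w + W w u)"
    if o: "u < v" "v < w" "w < u + 2 * pi" and n: "\<rho> * W w u < 0" for u v w
  proof -
    have uw: "0 < \<rho> * W u w" using n W_antisym[of w u] by simp
    obtain s where s: "\<forall>v. u < v \<longrightarrow> v < s \<longrightarrow> 0 < \<rho> * W u v" "\<forall>v. s < v \<longrightarrow> v < u + 2 * pi \<longrightarrow> \<rho> * W u v < 0" "W u s = 0"
      using t[of u] by (auto simp: turns_def)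
    have "\<not> s < w" "s \<noteq> w" using s(2)[rule_format, of w] s(3) uw o by auto
    then have uv: "0 < \<rho> * W u v" using s(1) o by auto
    obtain r where r: "\<forall>v. w < v \<longrightarrow> v < r \<longrightarrow> 0 < \<rho> * W w v" "\<forall>v. r < v \<longrightarrow> v < w + 2 * pi \<longrightarrow> \<rho> * W w v < 0"
      using t[of w] by (auto simp: turns_def)
    have "\<not> u + 2 * pi < r" using r(1)[rule_format, of "u + 2 * pi"] o n by (auto simp: W_periodic)
    then have "\<rho> * W w (v + 2 * pi) < 0" using r(2) o by auto
    then have vw: "0 < \<rho> * W v w" using W_antisym[of w v] by (simp add: W_periodic)
    show ?thesis by (rule triangle_obtuse[OF \<rho> uv vw uw])
  qed
  consider "\<rho> * W w u < 0" | "\<rho> * W u v < 0" | "\<rho> * W v w < 0"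
    | "0 \<le> \<rho> * W w u" "0 \<le> \<rho> * W u v" "0 \<le> \<rho> * W v w" by linarith
  then show ?thesis
  proof cases
    case 2
    then show ?thesis using neg[of v w "u + 2 * pi"] o by (simp add: W_periodic add_ac)
  next
    case 3
    then show ?thesis using neg[of w "u + 2 * pi" "v + 2 * pi"] o by (simp add: W_periodic add_ac)
  qed (use neg[OF o] in \<open>simp_all add: distrib_left\<close>)
qed

lemma oriented:
  obtains \<rho> where "\<rho> = 1 \<or> \<rho> = -1"
    "\<And>u v w. u \<le> v \<Longrightarrow> v \<le> w \<Longrightarrow> w \<le> u + 2 * pi \<Longrightarrow> 0 \<le> \<rho> * wedge (c v - c u) (c w - c u)"
    "\<exists>u v w. u < v \<and> v < w \<and> w < u + 2 * pi \<and> 0 < \<rho> * wedge (c v - c u) (c w - c u)"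
proof -
  obtain \<rho> :: real where \<rho>: "\<rho> = 1 \<or> \<rho> = -1" and t: "\<And>u. turns \<rho> u" using turns_everywhere by blast
  show thesis
  proof (rule that[OF \<rho>])
    fix u v w :: real assume o: "u \<le> v" "v \<le> w" "w \<le> u + 2 * pi"
    show "0 \<le> \<rho> * wedge (c v - c u) (c w - c u)"
    proof (cases "u = v \<or> v = w \<or> w = u + 2 * pi")
      case True
      then show ?thesis by (auto simp: wedge_alt periodic)
    next
      case False
      then show ?thesis unfolding triangle_W by (intro ordered_triangle[OF \<rho> t]) (use o in auto)
    qed
  next
    \<comment> \<open>A strict triple is 0, s / 2, s with s the antipode of 0: \<open>W 0 s\<close>
      vanishes and the other two terms are positive.\<close>
    obtain s where s: "0 < s" "s < 2 * pi" "W 0 s = 0" "\<forall>v. 0 < v \<longrightarrow> v < s \<longrightarrow> 0 < \<rho> * W 0 v"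
      using t[of 0] by (auto simp: turns_def)
    obtain r where r: "s < r" "r < s + 2 * pi" "\<forall>v. s < v \<longrightarrow> v < r \<longrightarrow> 0 < \<rho> * W s v"
      "\<forall>v. r < v \<longrightarrow> v < s + 2 * pi \<longrightarrow> \<rho> * W s v < 0" using t[of s] by (auto simp: turns_def)
    have Ws: "W s (2 * pi) = 0" using W_periodic(2)[of s 0] W_antisym[of s 0] s(3) by simp
    then have "r = 2 * pi" using r(3)[rule_format, of "2 * pi"] r(4)[rule_format, of "2 * pi"] s
      by (cases "r < 2 * pi"; cases "2 * pi < r") auto
    then have "\<rho> * W s (s / 2 + 2 * pi) < 0" using r(4) s by auto
    then have "0 < \<rho> * W (s / 2) s" using W_antisym[of s "s / 2"] by (simp add: W_periodic)
    moreover have "0 < \<rho> * W 0 (s / 2)" using s by auto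
    moreover have "W s 0 = 0" using W_antisym[of s 0] s(3) by simp
    ultimately have "0 < \<rho> * wedge (c (s / 2) - c 0) (c s - c 0)" unfolding triangle_W by (simp add: distrib_left)
    then show "\<exists>u v w. u < v \<and> v < w \<and> w < u + 2 * pi \<and> 0 < \<rho> * wedge (c v - c u) (c w - c u)"
      using s by (intro exI[of _ 0] exI[of _ "s / 2"] exI[of _ s]) auto
  qed
qed

end

section \<open>Comparison with explicit solutions\<close>

declare times_complex.sel [simp del]

lemma parabolic_stepI:
  fixes f :: "real \<Rightarrow> real \<Rightarrow> real"
  assumes "t1 < t" "\<forall>\<^sub>F v in nhds u. (v, t) \<in> R" "\<forall>\<^sub>F s in at_left t. (u, s) \<in> R"
    "\<forall>\<^sub>F v in nhds u. ((\<lambda>v. f v t) has_real_derivative fu v) (at v)"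
    "(fu has_real_derivative fuu) (at u)"
    "((\<lambda>s. f u s) has_real_derivative ft) (at t within {t0..<T})"
    "fu u = 0 \<Longrightarrow> 0 \<le> fuu \<Longrightarrow> 0 < ft"
  shows "t1 < t \<and> (\<forall>\<^sub>F v in nhds u. (v, t) \<in> R) \<and> (\<forall>\<^sub>F s in at_left t. (u, s) \<in> R) \<and>
      (\<exists>fu fuu ft. (\<forall>\<^sub>F v in nhds u. ((\<lambda>v. f v t) has_real_derivative fu v) (at v)) \<and>
        (fu has_real_derivative fuu) (at u) \<and>
        ((\<lambda>s. f u s) has_real_derivative ft) (at t within {t0..<T}) \<and>
        (fu u = 0 \<longrightarrow> 0 \<le> fuu \<longrightarrow> 0 < ft))"
  using assms by blast

lemma ln_cos_derivative:
  assumes "(Y has_real_derivative Y') (at u within S)" "0 < cos (l * Y u)"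
  shows "((\<lambda>u. ln (cos (l * Y u))) has_real_derivative - (l * tan (l * Y u) * Y')) (at u within S)"
  using assms by (auto intro!: derivative_eq_intros simp: tan_def field_simps)

lemma tan_derivative:
  assumes "(Y has_real_derivative Y') (at u within S)" "0 < cos (l * Y u)"
  shows "((\<lambda>u. tan (l * Y u)) has_real_derivative l * (1 + (tan (l * Y u))\<^sup>2) * Y') (at u within S)"
proof -
  have "((\<lambda>u. tan (l * Y u)) has_real_derivative inverse ((cos (l * Y u))\<^sup>2) * (l * Y')) (at u within S)"
    using assms by (auto intro!: derivative_eq_intros)
  moreover have "inverse ((cos (l * Y u))\<^sup>2) = 1 + (tan (l * Y u))\<^sup>2"
    using assms(2) by (simp add: tan_sec power_inverse)
  ultimately show ?thesis by (simp add: mult_ac)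
qed

lemma ln_cosh_derivative:
  assumes "(X has_real_derivative X') (at u within S)"
  shows "((\<lambda>u. ln (cosh (l * X u))) has_real_derivative l * tanh (l * X u) * X') (at u within S)"
  using assms by (auto intro!: derivative_eq_intros simp: tanh_def field_simps)

lemma tanh_derivative:
  assumes "(X has_real_derivative X') (at u within S)"
  shows "((\<lambda>u. tanh (l * X u)) has_real_derivative l * (1 - (tanh (l * X u))\<^sup>2) * X') (at u within S)"
  using assms by (auto intro!: derivative_eq_intros)

lemma unit_frame_norm:
  assumes "cmod e = 1"
  shows "(Re (cnj e * z))\<^sup>2 + (Im (cnj e * z))\<^sup>2 = (cmod z)\<^sup>2"
  using assms by (metis cmod_power2 complex_mod_cnj mult_1 norm_mult)

lemma cos_one_ge_half: "1 / 2 \<le> cos (1 :: real)"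
proof -
  have "cos (pi / 3) \<le> cos (1 :: real)"
    using pi_gt3 pi_less_4 by (intro cos_monotone_0_pi_le) auto
  then show ?thesis by (simp add: cos_60)
qed

context plane_flow
begin

lemma frame_derivs:
  assumes "t \<in> {t0..<T}"
  shows "((\<lambda>v. Re (k * (c v t - p))) has_real_derivative Re (k * c1 u t)) (at u)"
    "((\<lambda>s. Re (k * (c u s - p))) has_real_derivative a u t * Re (k * c2 u t) + b u t * Re (k * c1 u t))
      (at t within {t0..<T})"
    "((\<lambda>v. Im (k * (c v t - p))) has_real_derivative Im (k * c1 u t)) (at u)"
    "((\<lambda>s. Im (k * (c u s - p))) has_real_derivative a u t * Im (k * c2 u t) + b u t * Im (k * c1 u t))
      (at t within {t0..<T})"
  unfolding right_diff_distrib minus_complex.sel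
  using DERIV_diff[OF coord_derivs(1)[OF assms] DERIV_const] DERIV_diff[OF coord_derivs(3)[OF assms] DERIV_const]
    DERIV_diff[OF coord_derivs(4)[OF assms] DERIV_const] DERIV_diff[OF coord_derivs(6)[OF assms] DERIV_const]
  by simp_all

text \<open>If a half-plane separated p from the region at time t, the region at time s would reach
  at most r beyond that half-plane, while the ball contains a point lying farther out.\<close>

lemma region_interior_persists:
  assumes s: "s \<in> {t0..<T}" and r: "0 < r" and ball: "cball p r \<subseteq> region s"
  obtains d where "0 < d" "\<And>t. t \<in> {t0..<T} \<Longrightarrow> \<bar>t - s\<bar> < d \<Longrightarrow> p \<in> region t"
proof -
  obtain d where d: "0 < d" and close: "\<And>t u. t \<in> {t0..<T} \<Longrightarrow> \<bar>t - s\<bar> < d \<Longrightarrow> cmod (c u t - c u s) < r"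
    by (rule uniformly_close[OF s r], rule that)
  show thesis
  proof (rule that[OF d])
    fix t assume t: "t \<in> {t0..<T}" "\<bar>t - s\<bar> < d"
    show "p \<in> region t"
    proof (rule ccontr)
      assume "p \<notin> region t"
      then obtain k m where k: "cmod k = 1" and km: "Re (k * p) > m" "\<And>u. Re (k * c u t) \<le> m"
        using not_in_region[OF t(1)] by metis
      have "Re (k * c u s) \<le> m + r" for u
      proof -
        have "Re (k * (c u s - c u t)) \<le> cmod (k * (c u s - c u t))" by (rule complex_Re_le_cmod)
        also have "\<dots> \<le> r" using close[OF t, of u] k by (simp add: norm_mult norm_minus_commute)
        finally show ?thesis using km(2)[of u] by (simp add: right_diff_distrib del: times_complex.sel)
      qed
      moreover have "p + r * cnj k \<in> region s"
      proof -
        have "norm (complex_of_real r * cnj k) = r"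
          by (simp only: norm_mult norm_of_real complex_mod_cnj k) (use r in simp)
        moreover have "dist p (p + r * cnj k) = norm (complex_of_real r * cnj k)"
          by (metis add_diff_cancel_left' dist_commute dist_norm)
        ultimately show ?thesis using subsetD[OF ball, of "p + r * cnj k"] by (simp only: mem_cball order_refl simp_thms)
      qed
      ultimately have "Re (k * (p + r * cnj k)) \<le> m + r" by (rule region_half_plane)
      moreover have "k * (p + r * cnj k) = k * p + r"
      proof -
        have "k * cnj k = 1" by (simp only: k flip: complex_norm_square) simp
        moreover have "k * (p + r * cnj k) = k * p + r * (k * cnj k)" by (simp only: distrib_left mult.left_commute)
        ultimately show ?thesis by (simp only: mult_1_right)
      qed
      ultimately show False using km(1) by simp
    qed
  qed
qed

text \<open>A boundary point of the region has a support line, and by \<open>support_contact\<close>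
  it then lies on the curve.\<close>

lemma region_interior:
  assumes s: "s \<in> {t0..<T}" and p: "p \<in> region s" and off: "\<And>u. c u s \<noteq> p"
  obtains r where "0 < r" "cball p r \<subseteq> region s"
proof -
  have "p \<in> interior (region s)"
  proof (rule ccontr)
    assume "p \<notin> interior (region s)"
    then have "p \<notin> rel_interior (region s) \<or> interior (region s) = {}"
      using rel_interior_nonempty_interior by blast
    obtain z where z: "z \<noteq> 0" "\<And>x. x \<in> region s \<Longrightarrow> inner z x \<le> inner z p"
    proof -
      have "convex (interior (region s))" by (rule convex_interior[OF convex_region])
      show thesis
      proof (cases "interior (region s) = {}")
        case True
        then obtain z b where z: "z \<noteq> 0" "region s \<subseteq> {x. inner z x = b}"
          using empty_interior_subset_hyperplane[OF convex_region] by metis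
        have "inner z x \<le> inner z p" if "x \<in> region s" for x
        proof -
          have "inner z x = b" "inner z p = b" using z(2) p that by blast+
          then show ?thesis by simp
        qed
        with z(1) show thesis by (rule that)
      next
        case False
        obtain z b where z: "z \<noteq> 0" "\<forall>x\<in>interior (region s). inner z x \<le> b" "\<forall>x\<in>{p}. inner z x \<ge> b"
          using separating_hyperplane_sets[OF convex_interior[OF convex_region] convex_singleton False]
            \<open>p \<notin> interior (region s)\<close> by (metis Int_insert_right_if0 Int_empty_right insert_not_empty)
        have "region s \<subseteq> closure (interior (region s))"
          using convex_closure_interior[OF convex_region False] closure_subset by metis
        also have "\<dots> \<subseteq> {x. inner z x \<le> b}"
          by (rule closure_minimal) (use z in \<open>auto simp: closed_halfspace_le\<close>)
        finally show thesis using z by (intro that[of z]) force+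
      qed
    qed
    have "\<exists>u. c u s = p"
    proof (rule support_contact[OF s p, of "cnj z"])
      show "Re (cnj z * c u s) \<le> Re (cnj z * p)" for u
        using z(2)[OF curve_in_region[of u s]] by (simp add: inner_complex_def times_complex.sel)
    qed (use z in auto)
    with off show False by auto
  qed
  then show thesis using that by (meson mem_interior_cball)
qed

text \<open>A point can leave the region only when the curve passes over it. At the last time s at
  which p is still inside, p belongs to the region by closedness; being off the curve it is
  interior, so it would stay a little longer.\<close>

lemma region_exit:
  assumes t: "t0 \<le> t1" "t1 \<le> t2" "t2 < T" and p: "p \<in> region t1"
    and off: "\<And>u t. t \<in> {t1..t2} \<Longrightarrow> c u t \<noteq> p"
  shows "p \<in> region t2"
proof -
  let ?S = "{t \<in> {t1..t2}. p \<in> region t}"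
  define s where "s = Sup ?S"
  have ne: "?S \<noteq> {}" "bdd_above ?S" using t p by auto
  have "t1 \<le> s" unfolding s_def by (rule cSup_upper) (use ne t p in auto)
  moreover have "s \<le> t2" unfolding s_def by (rule cSup_least[OF ne(1)]) auto
  ultimately have s: "s \<in> {t1..t2}" "s \<in> {t0..<T}" using t by auto
  have ps: "p \<in> region s"
  proof (rule ccontr)
    assume "p \<notin> region s"
    then obtain k m where k: "cmod k = 1" and km: "Re (k * p) > m" "\<And>u. Re (k * c u s) \<le> m"
      using not_in_region[OF s(2)] by metis
    obtain d where d: "0 < d" and
      close: "\<And>t u. t \<in> {t0..<T} \<Longrightarrow> \<bar>t - s\<bar> < d \<Longrightarrow> cmod (c u t - c u s) < Re (k * p) - m"
    proof (rule uniformly_close[OF s(2), of "Re (k * p) - m"])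
      show "0 < Re (k * p) - m" using km(1) by simp
    qed (rule that)
    obtain r where r: "r \<in> ?S" "s - d < r"
      using less_cSup_iff[OF ne, of "s - d"] d unfolding s_def by auto
    have "r \<le> s" unfolding s_def by (rule cSup_upper) (use r ne in auto)
    then have rr: "r \<in> {t0..<T}" "\<bar>r - s\<bar> < d" using r s t by auto
    have "range (\<lambda>u. c u r) \<subseteq> {z. inner (cnj k) z < Re (k * p)}"
    proof
      fix z assume "z \<in> range (\<lambda>u. c u r)"
      then obtain u where u: "z = c u r" by auto
      have "Re (k * (c u r - c u s)) \<le> cmod (k * (c u r - c u s))" by (rule complex_Re_le_cmod)
      also have "\<dots> < Re (k * p) - m" using close[OF rr, of u] k by (simp add: norm_mult)
      finally show "z \<in> {z. inner (cnj k) z < Re (k * p)}"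
        using km(2)[of u] unfolding u by (simp add: right_diff_distrib inner_complex_def times_complex.sel)
    qed
    then have "region r \<subseteq> {z. inner (cnj k) z < Re (k * p)}"
      unfolding region_def by (rule hull_minimal) (rule convex_halfspace_lt)
    with r show False by (auto simp: inner_complex_def times_complex.sel)
  qed
  show ?thesis
  proof (cases "s = t2")
    case False
    obtain r where r: "0 < r" "cball p r \<subseteq> region s"
      by (rule region_interior[OF s(2) ps off[OF s(1)]], rule that)
    obtain d where d: "0 < d" "\<And>t. t \<in> {t0..<T} \<Longrightarrow> \<bar>t - s\<bar> < d \<Longrightarrow> p \<in> region t"
      by (rule region_interior_persists[OF s(2) r], rule that)
    define t' where "t' = min t2 (s + d / 2)"
    have "t' > s" "t' \<in> {t1..t2}" "\<bar>t' - s\<bar> < d" using False s d t by (auto simp: t'_def)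
    moreover from this have "p \<in> region t'" using d t by auto
    ultimately have "t' \<in> ?S" by simp
    then have "t' \<le> s" unfolding s_def using ne by (intro cSup_upper)
    with \<open>t' > s\<close> show ?thesis by simp
  qed (use ps in simp)
qed

text \<open>Comparison with the grim reaper \<open>l X = ln (cos (l Y)) + const\<close>.\<close>

lemma strip_tip_retracts:
  assumes t: "t0 \<le> t1" "t1 \<le> t" "t < T" and e: "cmod e = 1" and l: "0 < l"
    and strip: "\<And>u. \<bar>l * Im (cnj e * (c u t1 - p))\<bar> \<le> 1"
    and tip: "\<And>u. Re (cnj e * (c u t1 - p)) \<le> x1"
  shows "l * Re (cnj e * (c u t - p)) \<le> l * x1 + 1 - \<delta>\<^sup>2 * l\<^sup>2 * (t - t1)"
proof (rule field_le_epsilon)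
  fix e0 :: real assume e0: "e0 > 0"
  define \<epsilon> where "\<epsilon> = e0 / (t - t1 + 1)"
  have \<epsilon>: "\<epsilon> > 0" "\<epsilon> * (t - t1) \<le> e0" using e0 t by (auto simp: \<epsilon>_def field_simps)
  define X where "X = (\<lambda>u t. Re (cnj e * (c u t - p)))"
  define Y where "Y = (\<lambda>u t. Im (cnj e * (c u t - p)))"
  \<comment> \<open>The strip is an intersection of two half-planes and hence preserved; this keeps
    \<open>l * Y\<close> in a range where cos is at least 1/2.\<close>
  have strip': "\<bar>l * Y v s\<bar> \<le> 1" if s: "s \<in> {t1..t}" for v s
  proof -
    have "Re ((- \<i> * cnj e * l) * c v s) \<le> 1 + l * Im (cnj e * p)"
    proof (rule half_plane_preserved[of t1])
      show "Re ((- \<i> * cnj e * l) * c u t1) \<le> 1 + l * Im (cnj e * p)" for u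
        using strip[of u] by (simp add: times_complex.sel algebra_simps)
    qed (use s t in auto)
    moreover have "Re ((\<i> * cnj e * l) * c v s) \<le> 1 - l * Im (cnj e * p)"
    proof (rule half_plane_preserved[of t1])
      show "Re ((\<i> * cnj e * l) * c u t1) \<le> 1 - l * Im (cnj e * p)" for u
        using strip[of u] by (simp add: times_complex.sel algebra_simps)
    qed (use s t in auto)
    ultimately show ?thesis by (simp add: Y_def times_complex.sel algebra_simps)
  qed
  have cosp: "1 / 2 \<le> cos (l * Y v s)" if s: "s \<in> {t1..t}" for v s
  proof -
    have "cos 1 \<le> cos \<bar>l * Y v s\<bar>" using strip'[OF s, of v] pi_gt3 by (intro cos_monotone_0_pi_le) auto
    then show ?thesis using cos_one_ge_half by (simp add: abs_if split: if_splits)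
  qed
  let ?R = "UNIV \<times> {t1..t}"
  let ?f = "\<lambda>u s. l * x1 + 1 - (\<delta>\<^sup>2 * l\<^sup>2 - \<epsilon>) * (s - t1) - l * X u s + ln (cos (l * Y u s))"
  have "0 \<le> ?f u t"
  proof (rule parabolic_principle[of ?R t1 t t0 T ?f u t])
    have cX: "continuous_on ?R (\<lambda>x. X (fst x) (snd x))" and cY: "continuous_on ?R (\<lambda>x. Y (fst x) (snd x))"
      unfolding X_def Y_def by (intro continuous_intros cont_curve; use t in force)+
    have "cos (l * Y (fst x) (snd x)) \<noteq> 0" if "x \<in> ?R" for x
      using cosp[of "snd x" "fst x"] that by auto
    then show "continuous_on ?R (\<lambda>(u, s). ?f u s)"
      unfolding case_prod_unfold by (intro continuous_intros cX cY) blast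
  next
    fix v s assume vs: "(v, s) \<in> ?R" and neg: "?f v s < 0"
    have s: "s \<in> {t0..<T}" "s \<in> {t1..t}" using vs t by auto
    \<comment> \<open>The summand 1 in the bound pays for
      \<open>ln (cos (l * Y)) \<ge> - ln 2\<close> at the initial time.\<close>
    have "s \<noteq> t1"
    proof
      assume "s = t1"
      with neg have "l * (x1 - X v t1) + 1 + ln (cos (l * Y v t1)) < 0" by (simp add: algebra_simps)
      moreover have "l * (x1 - X v t1) \<ge> 0" using tip[of v] l by (simp add: X_def)
      moreover have "ln (1 / 2) \<le> ln (cos (l * Y v t1))" using cosp[of t1 v] t by simp
      moreover have "ln (1 / 2 :: real) = - ln 2" by (simp add: ln_div)
      moreover have "ln (2 :: real) < 1" using ln_2_less_1 .
      ultimately show False by linarith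
    qed
    then have s1: "t1 < s" using vs by auto
    define X1 Y1 X2 Y2 where "X1 = (\<lambda>w. Re (cnj e * c1 w s))" and "Y1 = (\<lambda>w. Im (cnj e * c1 w s))"
      and "X2 = Re (cnj e * c2 v s)" and "Y2 = Im (cnj e * c2 v s)"
    have cp: "0 < cos (l * Y w s)" for w using cosp[OF s(2), of w] by simp
    note D = frame_derivs[OF s(1), of "cnj e" _ _, folded X_def Y_def]
    have dX: "((\<lambda>v. X v s) has_real_derivative X1 w) (at w)"
      and dY: "((\<lambda>v. Y v s) has_real_derivative Y1 w) (at w)" for w
      unfolding X_def Y_def X1_def Y1_def by (rule frame_derivs[OF s(1)])+
    have dX1: "(X1 has_real_derivative X2) (at v)" and dY1: "(Y1 has_real_derivative Y2) (at v)"
      unfolding X1_def Y1_def X2_def Y2_def by (rule coord_derivs[OF s(1)])+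
    have tX: "((\<lambda>s. X v s) has_real_derivative a v s * X2 + b v s * X1 v) (at s within {t0..<T})"
      and tY: "((\<lambda>s. Y v s) has_real_derivative a v s * Y2 + b v s * Y1 v) (at s within {t0..<T})"
      unfolding X_def Y_def X1_def Y1_def X2_def Y2_def by (rule frame_derivs[OF s(1)])+
    define fu where "fu = (\<lambda>w. - (l * X1 w) - l * tan (l * Y w s) * Y1 w)"
    define q where "q = tan (l * Y v s)"
    define fuu where "fuu = - (l * X2) - (l * (l * (1 + q\<^sup>2) * Y1 v) * Y1 v + l * q * Y2)"
    define ft where "ft = - (\<delta>\<^sup>2 * l\<^sup>2 - \<epsilon>) - l * (a v s * X2 + b v s * X1 v)
      - l * q * (a v s * Y2 + b v s * Y1 v)"
    have d: "((\<lambda>v. ?f v s) has_real_derivative fu w) (at w)" for w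
      unfolding fu_def by (rule derivative_eq_intros dX ln_cos_derivative[OF dY cp] refl)+ simp
    have d2: "(fu has_real_derivative fuu) (at v)"
      unfolding fu_def fuu_def q_def
      by (rule derivative_eq_intros dX1 dY1 tan_derivative[OF dY cp] refl)+ simp
    have dt: "((\<lambda>s. ?f v s) has_real_derivative ft) (at s within {t0..<T})"
      unfolding ft_def q_def by (rule derivative_eq_intros tX ln_cos_derivative[OF tY cp] refl)+ simp
    have pos: "0 < ft" if z: "fu v = 0" and nn: "0 \<le> fuu"
    proof -
      from z have "l * (X1 v + q * Y1 v) = 0" by (simp add: fu_def q_def algebra_simps)
      with l have x1: "X1 v = - q * Y1 v" by simp
      have "(X1 v)\<^sup>2 + (Y1 v)\<^sup>2 = (cmod (c1 v s))\<^sup>2"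
        unfolding X1_def Y1_def by (rule unit_frame_norm[OF e])
      \<comment> \<open>At a critical point the factor that the second derivative of ln cos produces
        is exactly the squared projected speed, so the lower speed bound applies.\<close>
      then have sp: "(1 + q\<^sup>2) * (Y1 v)\<^sup>2 = (cmod (c1 v s))\<^sup>2"
        by (simp add: x1 power2_eq_square algebra_simps)
      have "ft = \<epsilon> - \<delta>\<^sup>2 * l\<^sup>2 + a v s * fuu + b v s * fu v + l\<^sup>2 * (a v s * ((1 + q\<^sup>2) * (Y1 v)\<^sup>2))"
        unfolding ft_def fuu_def fu_def q_def[symmetric] by (simp add: power2_eq_square algebra_simps)
      also have "\<dots> = \<epsilon> + a v s * fuu + l\<^sup>2 * (a v s * (cmod (c1 v s))\<^sup>2 - \<delta>\<^sup>2)"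
        unfolding sp z by (simp add: algebra_simps)
      finally show "0 < ft"
        using \<epsilon>(1) mult_nonneg_nonneg[OF less_imp_le[OF a_pos[OF s(1), of v]] nn] speed_lower[OF s(1), of v]
        by (smt (verit) zero_le_power2 mult_nonneg_nonneg)
    qed
    show "t1 < s \<and> (\<forall>\<^sub>F v in nhds v. (v, s) \<in> ?R) \<and> (\<forall>\<^sub>F s in at_left s. (v, s) \<in> ?R) \<and>
      (\<exists>fu fuu ft. (\<forall>\<^sub>F v in nhds v. ((\<lambda>v. ?f v s) has_real_derivative fu v) (at v)) \<and>
        (fu has_real_derivative fuu) (at v) \<and>
        ((\<lambda>s. ?f v s) has_real_derivative ft) (at s within {t0..<T}) \<and>
        (fu v = 0 \<longrightarrow> 0 \<le> fuu \<longrightarrow> 0 < ft))"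
      by (rule parabolic_stepI[where f = ?f, OF s1 _ _ always_eventually[rule_format, OF d] d2 dt pos])
        (use vs eventually_at_left_interval[OF s1, of t] in auto)
  qed (use t periodic in \<open>auto simp: closed_Times X_def Y_def\<close>)
  moreover have "ln (cos (l * Y u t)) \<le> 0" using cosp[of t u] t by simp
  ultimately have "l * X u t \<le> l * x1 + 1 - (\<delta>\<^sup>2 * l\<^sup>2 - \<epsilon>) * (t - t1)" by simp
  then show "l * Re (cnj e * (c u t - p)) \<le> l * x1 + 1 - \<delta>\<^sup>2 * l\<^sup>2 * (t - t1) + e0"
    using \<epsilon>(2) by (simp add: X_def algebra_simps)
qed

end

lemma DERIV_tendsto_nhds: "(f has_real_derivative f') (at x) \<Longrightarrow> (f \<longlongrightarrow> f x) (nhds x)"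
  using DERIV_isCont[of f f' x] unfolding isCont_def tendsto_at_iff_tendsto_nhds .

context plane_flow
begin

text \<open>Comparison with the ancient paperclip \<open>cos (l Y) = C cosh (l X)\<close>.\<close>

lemma oval_avoided:
  assumes t: "t0 \<le> t1" "t1 \<le> t" "t < T" and e: "cmod e = 1" and l: "0 < l" and \<beta>: "0 < \<beta>" "\<beta> < pi / 2"
    and init: "\<And>u. \<bar>l * Im (cnj e * (c u t1 - p))\<bar> \<le> \<beta> \<Longrightarrow>
      ln (cos (l * Im (cnj e * (c u t1 - p)))) \<le> ln (cos \<beta>) + ln (cosh (l * Re (cnj e * (c u t1 - p))))"
    and u: "\<bar>l * Im (cnj e * (c u t - p))\<bar> \<le> \<beta>"
  shows "ln (cos (l * Im (cnj e * (c u t - p))))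
    \<le> ln (cos \<beta>) + ln (cosh (l * Re (cnj e * (c u t - p)))) + l\<^sup>2 * (t - t1)"
proof (rule field_le_epsilon)
  fix e0 :: real assume e0: "e0 > 0"
  define \<epsilon> where "\<epsilon> = e0 / (t - t1 + 1)"
  have \<epsilon>: "\<epsilon> > 0" "\<epsilon> * (t - t1) \<le> e0" using e0 t by (auto simp: \<epsilon>_def field_simps)
  define X where "X = (\<lambda>u t. Re (cnj e * (c u t - p)))"
  define Y where "Y = (\<lambda>u t. Im (cnj e * (c u t - p)))"
  \<comment> \<open>The comparison is confined to the strip where the logarithm of cos is defined.
    On the edge of the strip ?f is nonnegative, because there
    \<open>cos (l * Y) = cos \<beta>\<close> and cosh is at least 1.\<close>
  let ?R = "{x \<in> UNIV \<times> {t1..t}. \<bar>l * Y (fst x) (snd x)\<bar> \<le> \<beta>}"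
  let ?f = "\<lambda>u s. ln (cos \<beta>) + ln (cosh (l * X u s)) - ln (cos (l * Y u s)) + (l\<^sup>2 + \<epsilon>) * (s - t1)"
  have cosp: "0 < cos (l * Y v s)" if "\<bar>l * Y v s\<bar> \<le> \<beta>" for v s
    using that \<beta> by (intro cos_gt_zero_pi) auto
  have cX: "continuous_on (UNIV \<times> {t1..t}) (\<lambda>x. X (fst x) (snd x))"
    and cY: "continuous_on (UNIV \<times> {t1..t}) (\<lambda>x. Y (fst x) (snd x))"
    unfolding X_def Y_def by (intro continuous_intros cont_curve; use t in force)+
  have "0 \<le> ?f u t"
  proof (rule parabolic_principle[of ?R t1 t t0 T ?f u t])
    have eq: "?R = (UNIV \<times> {t1..t}) \<inter> (\<lambda>x. \<bar>l * Y (fst x) (snd x)\<bar>) -` {..\<beta>}" by auto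
    show "closed ?R" unfolding eq
      by (intro continuous_closed_preimage continuous_intros cY closed_Times closed_UNIV
          closed_atLeastAtMost closed_atMost)
    have "cos (l * Y (fst x) (snd x)) \<noteq> 0" if "x \<in> ?R" for x
      using cosp[of "fst x" "snd x"] that by auto
    then show "continuous_on ?R (\<lambda>(u, s). ?f u s)"
      unfolding case_prod_unfold
      by (intro continuous_intros continuous_on_subset[OF cX] continuous_on_subset[OF cY])
        (auto simp: cosh_real_nonzero)
  next
    fix v s assume vs: "(v, s) \<in> ?R" and neg: "?f v s < 0"
    have s: "s \<in> {t0..<T}" "s \<in> {t1..t}" using vs t by auto
    have ch: "0 \<le> ln (cosh (l * X v s))" by (rule ln_ge_zero) (rule cosh_real_ge_1)
    have "s \<noteq> t1" using init[of v] vs neg by (auto simp: X_def Y_def)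
    then have s1: "t1 < s" using vs by auto
    have lt: "\<bar>l * Y v s\<bar> < \<beta>"
    proof (rule ccontr)
      assume "\<not> \<bar>l * Y v s\<bar> < \<beta>"
      then have "\<bar>l * Y v s\<bar> = \<beta>" using vs by simp
      then have "cos (l * Y v s) = cos \<beta>" by (metis cos_abs_real)
      with neg have "ln (cosh (l * X v s)) + (l\<^sup>2 + \<epsilon>) * (s - t1) < 0" by simp
      with ch have "(l\<^sup>2 + \<epsilon>) * (s - t1) < 0" by linarith
      moreover have "0 \<le> (l\<^sup>2 + \<epsilon>) * (s - t1)" using s1 \<epsilon> by simp
      ultimately show False by simp
    qed
    define X1 Y1 X2 Y2 where "X1 = (\<lambda>w. Re (cnj e * c1 w s))" and "Y1 = (\<lambda>w. Im (cnj e * c1 w s))"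
      and "X2 = Re (cnj e * c2 v s)" and "Y2 = Im (cnj e * c2 v s)"
    have dX: "((\<lambda>v. X v s) has_real_derivative X1 w) (at w)"
      and dY: "((\<lambda>v. Y v s) has_real_derivative Y1 w) (at w)" for w
      unfolding X_def Y_def X1_def Y1_def by (rule frame_derivs[OF s(1)])+
    have dX1: "(X1 has_real_derivative X2) (at v)" and dY1: "(Y1 has_real_derivative Y2) (at v)"
      unfolding X1_def Y1_def X2_def Y2_def by (rule coord_derivs[OF s(1)])+
    have tX: "((\<lambda>s. X v s) has_real_derivative a v s * X2 + b v s * X1 v) (at s within {t0..<T})"
      and tY: "((\<lambda>s. Y v s) has_real_derivative a v s * Y2 + b v s * Y1 v) (at s within {t0..<T})"
      unfolding X_def Y_def X1_def Y1_def X2_def Y2_def by (rule frame_derivs[OF s(1)])+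
    have near: "\<forall>\<^sub>F w in nhds v. \<bar>l * Y w s\<bar> < \<beta>"
    proof (rule order_tendstoD[OF _ lt])
      have "((\<lambda>w. Y w s) \<longlongrightarrow> Y v s) (nhds v)"
        by (rule DERIV_tendsto_nhds[OF dY])
      then show "((\<lambda>w. \<bar>l * Y w s\<bar>) \<longlongrightarrow> \<bar>l * Y v s\<bar>) (nhds v)" by (intro tendsto_intros)
    qed
    have left: "\<forall>\<^sub>F r in at_left s. \<bar>l * Y v r\<bar> < \<beta>"
    proof (rule order_tendstoD[OF _ lt])
      have "((\<lambda>r. Y v r) \<longlongrightarrow> Y v s) (at s within {t1..s})"
        using DERIV_continuous[OF DERIV_subset[OF tY, of "{t1..s}"]] s t
        by (simp add: continuous_within subset_iff)
      moreover have "at_left s = at s within {t1..s}"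
        using at_within_Icc_at_left[OF s1] by simp
      ultimately show "((\<lambda>r. \<bar>l * Y v r\<bar>) \<longlongrightarrow> \<bar>l * Y v s\<bar>) (at_left s)"
        by (intro tendsto_intros) simp
    qed
    define fu where "fu = (\<lambda>w. l * tanh (l * X w s) * X1 w + l * tan (l * Y w s) * Y1 w)"
    define q r where "q = tan (l * Y v s)" and "r = tanh (l * X v s)"
    define fuu where "fuu = l * (l * (1 - r\<^sup>2) * X1 v) * X1 v + l * r * X2
      + (l * (l * (1 + q\<^sup>2) * Y1 v) * Y1 v + l * q * Y2)"
    define ft where "ft = l * r * (a v s * X2 + b v s * X1 v)
      + l * q * (a v s * Y2 + b v s * Y1 v) + (l\<^sup>2 + \<epsilon>)"
    have cp: "0 < cos (l * Y v s)" using cosp vs by auto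
    have d: "\<forall>\<^sub>F w in nhds v. ((\<lambda>v. ?f v s) has_real_derivative fu w) (at w)"
      using near
    proof eventually_elim
      case (elim w)
      then have cw: "0 < cos (l * Y w s)" by (intro cosp) simp
      show ?case unfolding fu_def
        by (rule derivative_eq_intros ln_cosh_derivative[OF dX] ln_cos_derivative[OF dY cw] refl)+ simp
    qed
    have d2: "(fu has_real_derivative fuu) (at v)"
      unfolding fu_def fuu_def q_def r_def
      by (rule derivative_eq_intros dX1 dY1 tanh_derivative[OF dX] tan_derivative[OF dY cp] refl)+ simp
    have dt: "((\<lambda>s. ?f v s) has_real_derivative ft) (at s within {t0..<T})"
      unfolding ft_def q_def r_def
      by (rule derivative_eq_intros ln_cosh_derivative[OF tX] ln_cos_derivative[OF tY cp] refl)+ simp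
    have pos: "0 < ft" if z: "fu v = 0" and nn: "0 \<le> fuu"
    proof -
      from z have "l * (r * X1 v + q * Y1 v) = 0" by (simp add: fu_def q_def r_def algebra_simps)
      with l have "r * X1 v = - (q * Y1 v)" by simp
      then have sq: "r\<^sup>2 * (X1 v)\<^sup>2 = q\<^sup>2 * (Y1 v)\<^sup>2" by (metis power2_minus power_mult_distrib)
      have "(X1 v)\<^sup>2 + (Y1 v)\<^sup>2 = (cmod (c1 v s))\<^sup>2"
        unfolding X1_def Y1_def by (rule unit_frame_norm[OF e])
      \<comment> \<open>At a critical point the two weights recombine to the squared projected
        speed. Its upper bound says that the flow closes in no faster than the paperclip
        shrinks.\<close>
      with sq have sp: "(1 - r\<^sup>2) * (X1 v)\<^sup>2 + (1 + q\<^sup>2) * (Y1 v)\<^sup>2 = (cmod (c1 v s))\<^sup>2"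
        by (simp add: algebra_simps)
      have "ft = \<epsilon> + a v s * fuu + b v s * fu v
        + l\<^sup>2 * (1 - a v s * ((1 - r\<^sup>2) * (X1 v)\<^sup>2 + (1 + q\<^sup>2) * (Y1 v)\<^sup>2))"
        unfolding ft_def fuu_def fu_def q_def[symmetric] r_def[symmetric]
        by (simp add: power2_eq_square algebra_simps)
      also have "\<dots> = \<epsilon> + a v s * fuu + l\<^sup>2 * (1 - a v s * (cmod (c1 v s))\<^sup>2)"
        unfolding sp z by simp
      finally show "0 < ft"
        using \<epsilon>(1) mult_nonneg_nonneg[OF less_imp_le[OF a_pos[OF s(1), of v]] nn] speed_upper[OF s(1), of v]
        by (smt (verit) zero_le_power2 mult_nonneg_nonneg)
    qed
    show "t1 < s \<and> (\<forall>\<^sub>F v in nhds v. (v, s) \<in> ?R) \<and> (\<forall>\<^sub>F s in at_left s. (v, s) \<in> ?R) \<and>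
      (\<exists>fu fuu ft. (\<forall>\<^sub>F v in nhds v. ((\<lambda>v. ?f v s) has_real_derivative fu v) (at v)) \<and>
        (fu has_real_derivative fuu) (at v) \<and>
        ((\<lambda>s. ?f v s) has_real_derivative ft) (at s within {t0..<T}) \<and>
        (fu v = 0 \<longrightarrow> 0 \<le> fuu \<longrightarrow> 0 < ft))"
    proof (rule parabolic_stepI[where f = ?f, OF s1 _ _ d d2 dt pos])
      show "\<forall>\<^sub>F v in nhds v. (v, s) \<in> ?R" using near by eventually_elim (use s in auto)
      show "\<forall>\<^sub>F s in at_left s. (v, s) \<in> ?R"
        using left eventually_at_left_interval[OF s1 order.refl] by eventually_elim (use s in auto)
    qed
  qed (use t periodic u in \<open>auto simp: X_def Y_def\<close>)
  then show "ln (cos (l * Im (cnj e * (c u t - p))))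
    \<le> ln (cos \<beta>) + ln (cosh (l * Re (cnj e * (c u t - p)))) + l\<^sup>2 * (t - t1) + e0"
    using \<epsilon>(2) by (simp add: X_def Y_def algebra_simps)
qed

text \<open>Below the curve lies a graph over a chord of the final region that solves the heat equation; since the
  chord is inside all earlier regions, the curve cannot cross the graph at its ends.\<close>

lemma lens_preserved:
  assumes t: "t0 \<le> t1" "t1 \<le> t" "t < T" and e: "cmod e = 1" and d: "0 < d" and \<eta>: "0 \<le> \<eta>"
    and chord: "p \<in> region t" "p + d * e \<in> region t"
    and init: "\<And>u. 0 < Re (cnj e * (c u t1 - p)) \<Longrightarrow> Re (cnj e * (c u t1 - p)) < d \<Longrightarrow>
      0 < \<rho> * Im (cnj e * (c u t1 - p)) \<Longrightarrow>
      \<eta> * sin (pi / d * Re (cnj e * (c u t1 - p))) \<le> \<rho> * Im (cnj e * (c u t1 - p))"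
    and u: "0 \<le> Re (cnj e * (c u t - p))" "Re (cnj e * (c u t - p)) \<le> d" "0 \<le> \<rho> * Im (cnj e * (c u t - p))"
    and \<rho>: "\<rho> \<noteq> 0"
  shows "\<eta> * exp (- (pi / d)\<^sup>2 * (t - t1)) * sin (pi / d * Re (cnj e * (c u t - p)))
    \<le> \<rho> * Im (cnj e * (c u t - p))"
proof (rule field_le_epsilon)
  fix e0 :: real assume e0: "e0 > 0"
  define \<epsilon> where "\<epsilon> = e0 / (t - t1 + 1)"
  have \<epsilon>: "\<epsilon> > 0" "\<epsilon> * (t - t1) \<le> e0" using e0 t by (auto simp: \<epsilon>_def field_simps)
  define X where "X = (\<lambda>u t. Re (cnj e * (c u t - p)))"
  define Y where "Y = (\<lambda>u t. Im (cnj e * (c u t - p)))"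
  define \<omega> where "\<omega> = pi / d"
  have \<omega>: "\<omega> * d = pi" "\<omega> > 0" using d by (auto simp: \<omega>_def)
  let ?R = "{x \<in> UNIV \<times> {t1..t}. 0 \<le> X (fst x) (snd x) \<and> X (fst x) (snd x) \<le> d \<and> 0 \<le> \<rho> * Y (fst x) (snd x)}"
  let ?f = "\<lambda>u s. \<rho> * Y u s - \<eta> * exp (- \<omega>\<^sup>2 * (s - t1)) * sin (\<omega> * X u s) + \<epsilon> * (s - t1)"
  have cX: "continuous_on (UNIV \<times> {t1..t}) (\<lambda>x. X (fst x) (snd x))"
    and cY: "continuous_on (UNIV \<times> {t1..t}) (\<lambda>x. Y (fst x) (snd x))"
    unfolding X_def Y_def by (intro continuous_intros cont_curve; use t in force)+
  \<comment> \<open>The chord belongs to all earlier regions, and an inner point of it lies between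
    two others, so up to time t the curve cannot be there
    (\<open>curve_not_between\<close>).\<close>
  have open_segment: "c v s \<noteq> p + x * e" if s: "s \<in> {t1..t}" and x: "0 < x" "x < d" for v s x
  proof -
    define h where "h = min x (d - x)"
    have h: "h > 0" "h \<le> x" "h \<le> d - x" using x by (auto simp: h_def)
    have seg: "p + y * e \<in> region s" if "0 \<le> y" "y \<le> d" for y
    proof -
      have "(1 - y / d) *\<^sub>R p + (y / d) *\<^sub>R (p + d * e) \<in> region t"
        using that d by (intro convexD[OF convex_region chord]) auto
      moreover have "(1 - y / d) *\<^sub>R p + (y / d) *\<^sub>R (p + d * e) = p + y * e"
        using d by (simp add: scaleR_conv_of_real algebra_simps)
      ultimately show ?thesis using region_decreasing[of s t] s t by auto
    qed
    show ?thesis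
    proof (rule curve_not_between[of s _ "h * e"])
      have eq: "p + x * e - h * e = p + complex_of_real (x - h) * e"
        "p + x * e + h * e = p + complex_of_real (x + h) * e" by (simp_all add: algebra_simps)
      show "p + x * e - h * e \<in> region s" "p + x * e + h * e \<in> region s"
        unfolding eq using h x by (auto intro!: seg simp del: of_real_add of_real_diff)
      show "h * e \<noteq> 0" using h e by auto
    qed (use s t in auto)
  qed
  have "0 \<le> ?f u t"
  proof (rule parabolic_principle[of ?R t1 t t0 T ?f u t])
    have eq: "?R = (UNIV \<times> {t1..t}) \<inter> (\<lambda>x. (X (fst x) (snd x), \<rho> * Y (fst x) (snd x))) -` ({0..d} \<times> {0..})"
      by auto
    show "closed ?R" unfolding eq
      by (intro continuous_closed_preimage continuous_intros cX cY closed_Times closed_UNIV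
          closed_atLeastAtMost closed_atLeast)
    show "continuous_on ?R (\<lambda>(u, s). ?f u s)"
      unfolding case_prod_unfold
      by (intro continuous_intros continuous_on_subset[OF cX] continuous_on_subset[OF cY]) auto
  next
    fix v s assume vs: "(v, s) \<in> ?R" and neg: "?f v s < 0"
    have s: "s \<in> {t0..<T}" "s \<in> {t1..t}" using vs t by auto
    have inner: "0 < X v s" "X v s < d"
    proof -
      have "sin (\<omega> * X v s) \<noteq> 0"
      proof
        assume "sin (\<omega> * X v s) = 0"
        with neg have "\<rho> * Y v s + \<epsilon> * (s - t1) < 0" by simp
        moreover have "0 \<le> \<epsilon> * (s - t1)" using \<epsilon> s by simp
        ultimately show False using vs by simp
      qed
      then have "X v s \<noteq> 0" "X v s \<noteq> d" using \<omega> by auto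
      then show "0 < X v s" "X v s < d" using vs by auto
    qed
    have Ypos: "0 < \<rho> * Y v s"
    proof (rule ccontr)
      assume "\<not> 0 < \<rho> * Y v s"
      then have "\<rho> * Y v s = 0" using vs by auto
      then have Y0: "Y v s = 0" using \<rho> by simp
      have "cnj e * (c v s - p) = X v s" using Y0 by (simp add: complex_eq_iff X_def Y_def)
      then have "e * (cnj e * (c v s - p)) = e * X v s" by simp
      moreover have "e * cnj e = 1" using complex_norm_square[of e] e by simp
      ultimately have "c v s = p + X v s * e" by (simp add: mult.assoc[symmetric] algebra_simps)
      then show False using open_segment[OF s(2) inner] by blast
    qed
    have "s \<noteq> t1"
    proof
      assume "s = t1"
      with init[of v] inner Ypos neg show False by (simp add: X_def Y_def \<omega>_def)
    qed
    then have s1: "t1 < s" using vs by auto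
    define X1 Y1 X2 Y2 where "X1 = (\<lambda>w. Re (cnj e * c1 w s))" and "Y1 = (\<lambda>w. Im (cnj e * c1 w s))"
      and "X2 = Re (cnj e * c2 v s)" and "Y2 = Im (cnj e * c2 v s)"
    have dX: "((\<lambda>v. X v s) has_real_derivative X1 w) (at w)"
      and dY: "((\<lambda>v. Y v s) has_real_derivative Y1 w) (at w)" for w
      unfolding X_def Y_def X1_def Y1_def by (rule frame_derivs[OF s(1)])+
    have dX1: "(X1 has_real_derivative X2) (at v)" and dY1: "(Y1 has_real_derivative Y2) (at v)"
      unfolding X1_def Y1_def X2_def Y2_def by (rule coord_derivs[OF s(1)])+
    have tX: "((\<lambda>s. X v s) has_real_derivative a v s * X2 + b v s * X1 v) (at s within {t0..<T})"
      and tY: "((\<lambda>s. Y v s) has_real_derivative a v s * Y2 + b v s * Y1 v) (at s within {t0..<T})"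
      unfolding X_def Y_def X1_def Y1_def X2_def Y2_def by (rule frame_derivs[OF s(1)])+
    have near: "\<forall>\<^sub>F w in nhds v. 0 < X w s \<and> X w s < d \<and> 0 < \<rho> * Y w s"
    proof -
      have "((\<lambda>w. X w s) \<longlongrightarrow> X v s) (nhds v)" "((\<lambda>w. \<rho> * Y w s) \<longlongrightarrow> \<rho> * Y v s) (nhds v)"
        by (intro tendsto_intros DERIV_tendsto_nhds[OF dX] DERIV_tendsto_nhds[OF dY])+
      then show ?thesis using inner Ypos by (intro eventually_conj order_tendstoD)
    qed
    have left: "\<forall>\<^sub>F r in at_left s. 0 < X v r \<and> X v r < d \<and> 0 < \<rho> * Y v r"
    proof -
      have "((\<lambda>r. X v r) \<longlongrightarrow> X v s) (at s within {t1..s})" "((\<lambda>r. Y v r) \<longlongrightarrow> Y v s) (at s within {t1..s})"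
        using DERIV_continuous[OF DERIV_subset[OF tX, of "{t1..s}"]]
          DERIV_continuous[OF DERIV_subset[OF tY, of "{t1..s}"]] s t
        by (auto simp: continuous_within subset_iff)
      moreover have "at_left s = at s within {t1..s}"
        using at_within_Icc_at_left[OF s1] by simp
      ultimately have "((\<lambda>r. X v r) \<longlongrightarrow> X v s) (at_left s)" "((\<lambda>r. \<rho> * Y v r) \<longlongrightarrow> \<rho> * Y v s) (at_left s)"
        by (auto intro!: tendsto_intros)
      then show ?thesis using inner Ypos by (intro eventually_conj order_tendstoD)
    qed
    define g where "g = \<eta> * exp (- \<omega>\<^sup>2 * (s - t1))"
    define S C where "S = sin (\<omega> * X v s)" and "C = cos (\<omega> * X v s)"
    define fu where "fu = (\<lambda>w. \<rho> * Y1 w - g * (cos (\<omega> * X w s) * (\<omega> * X1 w)))"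
    define fuu where "fuu = \<rho> * Y2 - g * (C * (\<omega> * X2) - S * (\<omega> * X1 v) * (\<omega> * X1 v))"
    define ft where "ft = \<rho> * (a v s * Y2 + b v s * Y1 v)
      - (g * (C * (\<omega> * (a v s * X2 + b v s * X1 v))) - \<omega>\<^sup>2 * g * S) + \<epsilon>"
    have dfu: "((\<lambda>v. ?f v s) has_real_derivative fu w) (at w)" for w
      unfolding fu_def g_def by (rule derivative_eq_intros dX dY refl)+ simp
    have d2: "(fu has_real_derivative fuu) (at v)"
      unfolding fu_def fuu_def S_def C_def
      by (rule derivative_eq_intros dX dX1 dY1 refl)+ (simp add: algebra_simps)
    have dt: "((\<lambda>s. ?f v s) has_real_derivative ft) (at s within {t0..<T})"
      unfolding ft_def S_def C_def g_def
      by (rule derivative_eq_intros tX tY refl)+ (simp add: algebra_simps)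
    have pos: "0 < ft" if z: "fu v = 0" and nn: "0 \<le> fuu"
    proof -
      have gS: "0 \<le> g * S"
        using inner \<omega> \<eta> unfolding g_def S_def
        by (intro mult_nonneg_nonneg sin_ge_zero) (auto simp flip: \<omega>(1))
      have "(X1 v)\<^sup>2 + (Y1 v)\<^sup>2 = (cmod (c1 v s))\<^sup>2"
        unfolding X1_def Y1_def by (rule unit_frame_norm[OF e])
      then have "(X1 v)\<^sup>2 \<le> (cmod (c1 v s))\<^sup>2" by (smt (verit) zero_le_power2)
      then have "a v s * (X1 v)\<^sup>2 \<le> a v s * (cmod (c1 v s))\<^sup>2"
        using a_pos[OF s(1), of v] by (intro mult_left_mono) auto
      \<comment> \<open>The arch decays at the rate of unit diffusion, whereas the flow acts on
        graphs with diffusion coefficient \<open>a * X1\<^sup>2 \<le> 1\<close>; hence the arch is a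
        subsolution.\<close>
      then have "0 \<le> 1 - a v s * (X1 v)\<^sup>2" using speed_upper[OF s(1), of v] by simp
      then have "0 \<le> \<omega>\<^sup>2 * (g * S) * (1 - a v s * (X1 v)\<^sup>2)" by (rule mult_nonneg_nonneg[OF mult_nonneg_nonneg[OF zero_le_power2 gS]])
      moreover have "0 \<le> a v s * fuu" using a_pos[OF s(1), of v] nn by simp
      moreover have "ft = \<epsilon> + a v s * fuu + b v s * fu v + \<omega>\<^sup>2 * (g * S) * (1 - a v s * (X1 v)\<^sup>2)"
        unfolding ft_def fuu_def fu_def C_def[symmetric] by (simp add: power2_eq_square algebra_simps)
      ultimately show "0 < ft" using \<epsilon>(1) z by simp
    qed
    show "t1 < s \<and> (\<forall>\<^sub>F v in nhds v. (v, s) \<in> ?R) \<and> (\<forall>\<^sub>F s in at_left s. (v, s) \<in> ?R) \<and>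
      (\<exists>fu fuu ft. (\<forall>\<^sub>F v in nhds v. ((\<lambda>v. ?f v s) has_real_derivative fu v) (at v)) \<and>
        (fu has_real_derivative fuu) (at v) \<and>
        ((\<lambda>s. ?f v s) has_real_derivative ft) (at s within {t0..<T}) \<and>
        (fu v = 0 \<longrightarrow> 0 \<le> fuu \<longrightarrow> 0 < ft))"
    proof (rule parabolic_stepI[where f = ?f, OF s1 _ _ always_eventually[rule_format, OF dfu] d2 dt pos])
      show "\<forall>\<^sub>F v in nhds v. (v, s) \<in> ?R" using near by eventually_elim (use s in auto)
      show "\<forall>\<^sub>F s in at_left s. (v, s) \<in> ?R"
        using left eventually_at_left_interval[OF s1 order.refl] by eventually_elim (use s in auto)
    qed
  qed (use t periodic u in \<open>auto simp: X_def Y_def\<close>)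
  then show "\<eta> * exp (- (pi / d)\<^sup>2 * (t - t1)) * sin (pi / d * Re (cnj e * (c u t - p)))
    \<le> \<rho> * Im (cnj e * (c u t - p)) + e0"
    using \<epsilon>(2) by (simp add: X_def Y_def \<omega>_def)
qed

end

section \<open>Diameter and width\<close>

lemma cnj_frame:
  assumes "cmod e = 1"
  shows "cnj e * (z * e) = z" "e * (cnj e * z) = z"
proof -
  have "e * cnj e = 1" using complex_norm_square[of e] assms by simp
  then show "cnj e * (z * e) = z" "e * (cnj e * z) = z"
    by (metis mult.assoc mult.commute mult_1_right)+
qed

lemma sin_pi_le_min:
  assumes "0 \<le> x" "x \<le> 1"
  shows "sin (pi * x) \<le> pi * x" "sin (pi * x) \<le> pi * (1 - x)"
proof -
  show "sin (pi * x) \<le> pi * x" using assms by (intro sin_x_le_x) auto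
  have "sin (pi * x) = sin (pi * (1 - x))" by (simp add: right_diff_distrib)
  also have "\<dots> \<le> pi * (1 - x)" using assms by (intro sin_x_le_x) auto
  finally show "sin (pi * x) \<le> pi * (1 - x)" .
qed

context plane_flow
begin

text \<open>The segment from p in the unit direction e realizes the diameter l. The number w is the
  greatest distance from its line, attained on one side, so the extent across the diameter is
  between w and 2 * w.\<close>

definition diam_frame :: "real \<Rightarrow> complex \<Rightarrow> complex \<Rightarrow> real \<Rightarrow> real \<Rightarrow> bool"
  where "diam_frame t p e l w \<longleftrightarrow> cmod e = 1 \<and> 0 < l \<and> 0 < w \<and>
    (\<exists>u1 u2. u1 < u2 \<and> u2 < u1 + 2 * pi \<and> c u1 t = p \<and> c u2 t = p + l * e) \<and>
    (\<forall>u v. cmod (c u t - c v t) \<le> l) \<and>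
    (\<forall>u. \<bar>Im (cnj e * (c u t - p))\<bar> \<le> w) \<and> (\<exists>q. \<bar>Im (cnj e * (c q t - p))\<bar> = w)"

lemma wedge_frame:
  assumes "cmod e = 1"
  shows "wedge (of_real l * e) z = l * Im (cnj e * z)" "wedge z (of_real l * e) = - l * Im (cnj e * z)"
  by (simp_all add: wedge_alt times_complex.sel algebra_simps)

lemma diam_frame_exists:
  assumes t: "t \<in> {t0..<T}"
  obtains p e l w where "diam_frame t p e l w"
proof -
  let ?K = "range (\<lambda>u. c u t)"
  obtain P Q where PQ: "P \<in> ?K" "Q \<in> ?K" "\<And>x y. x \<in> ?K \<Longrightarrow> y \<in> ?K \<Longrightarrow> dist x y \<le> dist P Q"
    using compact_sup_maxdistance[OF compact_curve[OF t]] by (metis UNIV_not_empty image_is_empty)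
  obtain u1 where u1: "P = c u1 t" using PQ by auto
  obtain u2 where u2: "u2 \<in> {u1..<u1 + 2 * pi}" "c u2 t = Q"
    using PQ(2) param_in_period[OF t, of u1] by (metis imageE)
  have "c (u1 + pi) t \<noteq> c u1 t"
    using tangent_left[OF t, of u1 "u1 + pi"] by (auto simp: wedge_alt)
  then have "0 < dist (c (u1 + pi) t) (c u1 t)" by simp
  also have "\<dots> \<le> dist P Q" by (intro PQ(3)) auto
  finally have pos: "0 < dist P Q" .
  define l where "l = dist P Q"
  define e where "e = (Q - P) / l"
  have l: "0 < l" using pos by (simp add: l_def)
  have "l * cmod e = cmod (Q - P)" unfolding e_def using l by (simp add: norm_divide)
  then have e: "cmod e = 1" using l by (simp add: l_def dist_norm norm_minus_commute)
  have Q: "Q = P + l * e" using l by (simp add: e_def)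
  have "u1 \<noteq> u2" using pos u1 u2 by auto
  then have lt: "u1 < u2" "u2 < u1 + 2 * pi" using u2 by auto
  have "continuous_on {0..2 * pi} (\<lambda>u. \<bar>Im (cnj e * (c u t - P))\<bar>)"
    by (intro continuous_intros cont_space t)
  then obtain q where q: "\<forall>v\<in>{0..2 * pi}. \<bar>Im (cnj e * (c v t - P))\<bar> \<le> \<bar>Im (cnj e * (c q t - P))\<bar>"
    using continuous_attains_sup[of "{0..2 * pi}" "\<lambda>u. \<bar>Im (cnj e * (c u t - P))\<bar>"] by auto
  have q': "\<bar>Im (cnj e * (c v t - P))\<bar> \<le> \<bar>Im (cnj e * (c q t - P))\<bar>" for v
  proof -
    obtain v' where "v' \<in> {0..<0 + 2 * pi}" "c v' t = c v t" using param_in_period[OF t, of 0 v] .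
    then show ?thesis using q by (metis add_0 atLeastAtMost_iff atLeastLessThan_iff less_imp_le)
  qed
  have "0 < wedge (c ((u1 + u2) / 2) t - c u1 t) (c u2 t - c u1 t)"
    using lt by (intro triangle_left[OF t]) auto
  also have "c u2 t - c u1 t = of_real l * e" using u1 u2 Q by simp
  finally have "Im (cnj e * (c ((u1 + u2) / 2) t - P)) \<noteq> 0"
    using wedge_frame(2)[OF e, of "c ((u1 + u2) / 2) t - c u1 t" l] u1 by auto
  with q'[of "(u1 + u2) / 2"] have w: "0 < \<bar>Im (cnj e * (c q t - P))\<bar>" by simp
  show thesis
  proof (rule that[of P e l "\<bar>Im (cnj e * (c q t - P))\<bar>"])
    show "diam_frame t P e l \<bar>Im (cnj e * (c q t - P))\<bar>"
      unfolding diam_frame_def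
    proof (intro conjI)
      show "\<exists>u1 u2. u1 < u2 \<and> u2 < u1 + 2 * pi \<and> c u1 t = P \<and> c u2 t = P + l * e"
        using lt u1 u2 Q by auto
      show "\<forall>u v. cmod (c u t - c v t) \<le> l"
        using PQ(3) by (auto simp: l_def dist_norm)
    qed (use e l w q' in auto)
  qed
qed

text \<open>No curve point is farther than l from either end of the diameter, which confines its
  abscissa. All bounds are half-planes and so pass to the hull.\<close>

lemma diam_frame_box:
  assumes f: "diam_frame t p e l w" and z: "z \<in> region t"
  shows "0 \<le> Re (cnj e * (z - p))" "Re (cnj e * (z - p)) \<le> l" "\<bar>Im (cnj e * (z - p))\<bar> \<le> w"
proof -
  note f = f[unfolded diam_frame_def]
  have e: "cmod e = 1" using f by auto
  obtain u1 u2 where u: "c u1 t = p" "c u2 t = p + l * e" using f by auto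
  have nrm: "cmod (cnj e * y) = cmod y" for y using e by (simp add: norm_mult)
  have x: "0 \<le> Re (cnj e * (c v t - p)) \<and> Re (cnj e * (c v t - p)) \<le> l" for v
  proof -
    have "cmod (c v t - p) \<le> l" "cmod (p + l * e - c v t) \<le> l" using f u by metis+
    then have "Re (cnj e * (c v t - p)) \<le> l" "Re (cnj e * (p + l * e - c v t)) \<le> l"
      using complex_Re_le_cmod nrm order_trans by metis+
    moreover have "cnj e * (p + l * e - c v t) = l - cnj e * (c v t - p)"
      using cnj_frame(1)[OF e, of l] by (simp add: algebra_simps)
    ultimately show ?thesis by simp
  qed
  have x': "Re (cnj e * c v t) \<le> l + Re (cnj e * p)" "Re (- cnj e * c v t) \<le> - Re (cnj e * p)" for v
    using x[of v] by (simp_all add: right_diff_distrib)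
  have "Re (cnj e * z) \<le> l + Re (cnj e * p)" by (rule region_half_plane[OF x'(1) z])
  moreover have "Re (- cnj e * z) \<le> - Re (cnj e * p)" by (rule region_half_plane[OF x'(2) z])
  ultimately show "0 \<le> Re (cnj e * (z - p))" "Re (cnj e * (z - p)) \<le> l"
    by (simp_all add: right_diff_distrib)
  have y: "\<bar>Im (cnj e * c v t) - Im (cnj e * p)\<bar> \<le> w" for v
    using f by (simp add: right_diff_distrib)
  have i: "Re ((\<i> * cnj e) * y) = - Im (cnj e * y)" "Re ((- \<i> * cnj e) * y) = Im (cnj e * y)" for y
    by (simp_all add: times_complex.sel)
  have "Re ((- \<i> * cnj e) * z) \<le> w + Im (cnj e * p)"
  proof (rule region_half_plane[OF _ z])
    show "Re ((- \<i> * cnj e) * c v t) \<le> w + Im (cnj e * p)" for v unfolding i using y[of v] by linarith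
  qed
  moreover have "Re ((\<i> * cnj e) * z) \<le> w - Im (cnj e * p)"
  proof (rule region_half_plane[OF _ z])
    show "Re ((\<i> * cnj e) * c v t) \<le> w - Im (cnj e * p)" for v unfolding i using y[of v] by linarith
  qed
  ultimately show "\<bar>Im (cnj e * (z - p))\<bar> \<le> w"
    unfolding i by (simp add: right_diff_distrib)
qed

lemma diam_frame_w_le:
  assumes "diam_frame t p e l w"
  shows "w \<le> l"
proof -
  obtain q u where "\<bar>Im (cnj e * (c q t - p))\<bar> = w" "c u t = p" "cmod (c q t - c u t) \<le> l" "cmod e = 1"
    using assms by (auto simp: diam_frame_def)
  then show ?thesis using abs_Im_le_cmod[of "cnj e * (c q t - p)"] by (simp add: norm_mult)
qed

section \<open>Remaining lifetime against the product of diameter and width\<close>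

lemma diam_frame_retract:
  assumes f: "diam_frame t1 p e l w" and t: "t0 \<le> t1" "t1 \<le> t" "t < T"
  shows "Re (cnj e * (c u t - p)) \<le> l + w - \<delta>\<^sup>2 / w * (t - t1)"
    "\<delta>\<^sup>2 / w * (t - t1) - w \<le> Re (cnj e * (c u t - p))"
proof -
  have e: "cmod e = 1" and w: "0 < w" using f by (auto simp: diam_frame_def)
  note box = diam_frame_box[OF f curve_in_region]
  have scale: "R \<le> x + w - \<delta>\<^sup>2 / w * (t - t1)"
    if "1 / w * R \<le> 1 / w * x + 1 - \<delta>\<^sup>2 * (1 / w)\<^sup>2 * (t - t1)" for R x
  proof -
    have "w * (1 / w * R) \<le> w * (1 / w * x + 1 - \<delta>\<^sup>2 * (1 / w)\<^sup>2 * (t - t1))"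
      using w by (intro mult_left_mono[OF that]) auto
    also have "w * (1 / w * x + 1 - \<delta>\<^sup>2 * (1 / w)\<^sup>2 * (t - t1)) = x + w - \<delta>\<^sup>2 / w * (t - t1)"
      using w by (simp add: field_simps power2_eq_square)
    finally show ?thesis using w by simp
  qed
  have strip: "\<bar>1 / w * Im (cnj e * (c u t1 - p))\<bar> \<le> 1" for u
    using box(3)[of u] w by (simp add: abs_mult)
  show "Re (cnj e * (c u t - p)) \<le> l + w - \<delta>\<^sup>2 / w * (t - t1)"
    by (rule scale, rule strip_tip_retracts[OF t e]) (use box strip w in auto)
  have "Re (cnj (- e) * (c u t - p)) \<le> 0 + w - \<delta>\<^sup>2 / w * (t - t1)"
    by (rule scale, rule strip_tip_retracts[OF t]) (use box strip w e in auto)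
  then show "\<delta>\<^sup>2 / w * (t - t1) - w \<le> Re (cnj e * (c u t - p))" by simp
qed

text \<open>Each tip retracts at speed at least \<open>\<delta>\<^sup>2 / w\<close> after an offset
  w, and the two tips cannot pass each other. The factor 3 comes from
  \<open>l + 2 * w \<le> 3 * l\<close>.\<close>

lemma lifetime_upper:
  assumes f: "diam_frame t1 p e l w" and t: "t1 \<in> {t0..<T}"
  shows "2 * \<delta>\<^sup>2 * (T - t1) \<le> 3 * (l * w)"
proof (rule dense_le_bounded[of 0])
  show "0 < 2 * \<delta>\<^sup>2 * (T - t1)" using \<delta>_pos t by simp
  fix x assume x: "0 < x" "x < 2 * \<delta>\<^sup>2 * (T - t1)"
  define s where "s = t1 + x / (2 * \<delta>\<^sup>2)"
  have s: "t1 \<le> s" "s < T" using x \<delta>_pos by (auto simp: s_def field_simps)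
  have w: "0 < w" using f by (auto simp: diam_frame_def)
  have "\<delta>\<^sup>2 / w * (s - t1) - w \<le> l + w - \<delta>\<^sup>2 / w * (s - t1)"
    using diam_frame_retract[OF f _ s] t by (meson atLeastLessThan_iff order_trans)
  then have "2 * (\<delta>\<^sup>2 / w * (s - t1)) \<le> l + 2 * w" by simp
  also have "2 * (\<delta>\<^sup>2 / w * (s - t1)) = x / w" using \<delta>_pos by (simp add: s_def)
  finally have "x \<le> w * (l + 2 * w)" using w by (simp add: field_simps)
  also have "\<dots> \<le> w * (3 * l)" using diam_frame_w_le[OF f] w by (intro mult_left_mono) auto
  finally show "x \<le> 3 * (l * w)" by (simp add: mult_ac)
qed

text \<open>At height \<open>k * yq\<close> the triangle over the chord with apex (xq, yq) has the
  section from \<open>xq * k\<close> to \<open>l - (l - xq) * k\<close>.\<close>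

lemma triangle_in_region:
  assumes r: "p \<in> region t" "p + of_real l * e \<in> region t" "p + Complex xq yq * e \<in> region t"
    and l: "0 < l" and k: "0 \<le> k" "xq * k \<le> x" "x \<le> l - (l - xq) * k" "k \<le> 1"
  shows "p + Complex x (k * yq) * e \<in> region t"
proof -
  define m where "m = (x - xq * k) / l"
  have m: "0 \<le> m" "m * l = x - xq * k" using k l by (auto simp: m_def)
  have "m * l \<le> (1 - k) * l" unfolding m using k by (simp add: algebra_simps)
  then have m1: "0 \<le> 1 - k - m" using l by simp
  have "(1 - k - m) *\<^sub>R p + m *\<^sub>R (p + of_real l * e) + k *\<^sub>R (p + Complex xq yq * e)
    \<in> convex hull {p, p + of_real l * e, p + Complex xq yq * e}"
    unfolding convex_hull_3 using m m1 k by (intro CollectI exI[of _ "1 - k - m"] exI[of _ m] exI[of _ k]) auto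
  moreover have "convex hull {p, p + of_real l * e, p + Complex xq yq * e} \<subseteq> region t"
    by (rule hull_minimal) (use r convex_region in auto)
  moreover have "(1 - k - m) *\<^sub>R p + m *\<^sub>R (p + of_real l * e) + k *\<^sub>R (p + Complex xq yq * e)
    = p + (of_real (m * l) + k *\<^sub>R Complex xq yq) * e"
    by (simp add: scaleR_conv_of_real algebra_simps)
  moreover have "of_real (m * l) + k *\<^sub>R Complex xq yq = Complex x (k * yq)"
    unfolding m by (simp add: complex_eq_iff times_complex.sel algebra_simps)
  ultimately show ?thesis by auto
qed

lemma diam_frame_rectangle:
  assumes f: "diam_frame t p e l w"
  obtains m where "\<And>x y. \<bar>x\<bar> \<le> l / 4 \<Longrightarrow> \<bar>y\<bar> \<le> w / 4 \<Longrightarrow> m + Complex x y * e \<in> region t"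
proof -
  have e: "cmod e = 1" and lw: "0 < l" "0 < w" using f by (auto simp: diam_frame_def)
  obtain q where q: "\<bar>Im (cnj e * (c q t - p))\<bar> = w" using f by (auto simp: diam_frame_def)
  obtain u1 u2 where u: "c u1 t = p" "c u2 t = p + l * e" using f by (auto simp: diam_frame_def)
  define xq yq where "xq = Re (cnj e * (c q t - p))" and "yq = Im (cnj e * (c q t - p))"
  have cq: "c q t = p + Complex xq yq * e"
    using cnj_frame(2)[OF e, of "c q t - p"] by (simp add: xq_def yq_def complex_eq_iff mult.commute)
  have xq: "0 \<le> xq" "xq \<le> l" using diam_frame_box[OF f curve_in_region, of q] by (auto simp: xq_def)
  have yq: "\<bar>yq\<bar> = w" using q by (simp add: yq_def)
  have r: "p \<in> region t" "p + of_real l * e \<in> region t" "p + Complex xq yq * e \<in> region t"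
    using curve_in_region u cq by metis+
  \<comment> \<open>For heights k between 0 and 1/2 all sections of the triangle contain the
    interval from xq / 2 to xq / 2 + l / 2. The rectangle is centred over its midpoint at a quarter
    of the height.\<close>
  show thesis
  proof (rule that[of "p + Complex (xq / 2 + l / 4) (yq / 4) * e"])
    fix x y :: real assume xy: "\<bar>x\<bar> \<le> l / 4" "\<bar>y\<bar> \<le> w / 4"
    define k where "k = 1 / 4 + y / yq"
    have "yq \<noteq> 0" using yq lw by auto
    have "\<bar>y / yq\<bar> \<le> 1 / 4" using xy yq lw by (simp add: abs_divide field_simps)
    then have k: "0 \<le> k" "k \<le> 1 / 2" unfolding k_def by linarith+
    have "p + Complex (xq / 2 + l / 4 + x) (k * yq) * e \<in> region t"
    proof (rule triangle_in_region[OF r lw(1) k(1)])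
      have "xq * k \<le> xq * (1 / 2)" using k xq by (intro mult_left_mono) auto
      then show "xq * k \<le> xq / 2 + l / 4 + x" using xy by (simp add: abs_le_iff)
      have "(l - xq) * k \<le> (l - xq) * (1 / 2)" using k xq by (intro mult_left_mono) auto
      then show "xq / 2 + l / 4 + x \<le> l - (l - xq) * k" using xy by (simp add: abs_le_iff)
    qed (use k in simp)
    moreover have "Complex (xq / 2 + l / 4 + x) (k * yq) = Complex (xq / 2 + l / 4) (yq / 4) + Complex x y"
      using \<open>yq \<noteq> 0\<close> by (simp add: complex_eq_iff k_def algebra_simps)
    ultimately show "p + Complex (xq / 2 + l / 4) (yq / 4) * e + Complex x y * e \<in> region t"
      by (simp add: algebra_simps)
  qed
qed

lemma curve_outside_rectangle:
  assumes t: "t \<in> {t0..<T}" and e: "cmod e = 1" and "0 < A" "0 < B"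
    and rect: "\<And>x y. \<bar>x\<bar> \<le> A \<Longrightarrow> \<bar>y\<bar> \<le> B \<Longrightarrow> m + Complex x y * e \<in> region t"
    and y: "\<bar>Im (cnj e * (c u t - m))\<bar> < B"
  shows "A \<le> \<bar>Re (cnj e * (c u t - m))\<bar>"
proof (rule ccontr)
  define x y where "x = Re (cnj e * (c u t - m))" and "y = Im (cnj e * (c u t - m))"
  assume "\<not> ?thesis"
  then have xA: "\<bar>x\<bar> < A" by (simp add: x_def)
  define h where "h = A - \<bar>x\<bar>"
  have h: "0 < h" "\<bar>x - h\<bar> \<le> A" "\<bar>x + h\<bar> \<le> A" using xA unfolding h_def by arith+
  have yB: "\<bar>y\<bar> \<le> B" using y by (simp add: y_def)
  have eq: "m + Complex x y * e - of_real h * e = m + Complex (x - h) y * e"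
    "m + Complex x y * e + of_real h * e = m + Complex (x + h) y * e"
    by (simp_all add: complex_eq_iff times_complex.sel algebra_simps)
  have "c u t \<noteq> m + Complex x y * e"
  proof (rule curve_not_between[OF t, of _ "of_real h * e"])
    show "m + Complex x y * e - of_real h * e \<in> region t" "m + Complex x y * e + of_real h * e \<in> region t"
      unfolding eq by (intro rect h yB)+
    show "of_real h * e \<noteq> 0" using h e by auto
  qed
  moreover have "c u t = m + Complex x y * e"
    using cnj_frame(2)[OF e, of "c u t - m"] by (simp add: x_def y_def mult.commute complex_eq_iff)
  ultimately show False by contradiction
qed

text \<open>Otherwise a paperclip inscribed in the rectangle of \<open>diam_frame_rectangle\<close>
  is still of definite size at time T. Its centre m is never crossed, stays in regions shrinking to
  the origin, and therefore is the origin. But then the curve converges to m, where F vanishes,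
  although F is at most -1/2 on the curve.\<close>

lemma lifetime_lower:
  assumes f: "diam_frame t1 p e l w" and t: "t1 \<in> {t0..<T}"
  shows "l * w \<le> 32 * pi * (T - t1)"
proof (rule ccontr)
  assume "\<not> ?thesis"
  then have short: "32 * pi * (T - t1) < l * w" by simp
  have e: "cmod e = 1" and lw: "0 < l" "0 < w" using f by (auto simp: diam_frame_def)
  obtain m where rect: "\<And>x y. \<bar>x\<bar> \<le> l / 4 \<Longrightarrow> \<bar>y\<bar> \<le> w / 4 \<Longrightarrow> m + Complex x y * e \<in> region t1"
    using diam_frame_rectangle[OF f] by metis
  \<comment> \<open>With this scale \<open>L * (w / 4) = pi\<close>, so the strip of half-width
    \<beta> < pi / 2 lies well within the height of the rectangle.\<close>
  define L where "L = 4 * pi / w"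
  have L: "0 < L" using lw by (simp add: L_def)
  define a0 where "a0 = L * (l / 4)"
  have a0: "pi \<le> a0" using diam_frame_w_le[OF f] lw by (simp add: a0_def L_def field_simps)
  \<comment> \<open>The choice \<open>cos \<beta> * cosh a0 = 1\<close> places the tips of the
    initial paperclip on the short sides of the rectangle.\<close>
  define \<beta> where "\<beta> = arccos (1 / cosh a0)"
  have ch: "1 < cosh a0" using less_le_trans[OF pi_gt_zero a0] cosh_real_strict_mono[of 0 a0] by simp
  then have inv: "0 < 1 / cosh a0" "1 / cosh a0 < 1" by auto
  then have cosb: "cos \<beta> = 1 / cosh a0" unfolding \<beta>_def by (intro cos_arccos) linarith+
  have \<beta>: "0 < \<beta>" "\<beta> < pi / 2"
  proof -
    have "arccos 1 < \<beta>" unfolding \<beta>_def by (rule arccos_less_arccos) (use inv in linarith)+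
    then show "0 < \<beta>" by simp
    have "\<beta> < arccos 0" unfolding \<beta>_def by (rule arccos_less_arccos) (use inv in linarith)+
    then show "\<beta> < pi / 2" by simp
  qed
  have lnb: "ln (cos \<beta>) = - ln (cosh a0)" using ch by (simp add: cosb ln_div)
  have time: "L\<^sup>2 * (s - t1) \<le> a0 / 2" if "s \<le> T" for s
  proof -
    have "T - t1 < l * w / (32 * pi)" using short by (simp add: pos_less_divide_eq mult.commute)
    then have "L\<^sup>2 * (s - t1) \<le> L\<^sup>2 * (l * w / (32 * pi))"
      using that by (intro mult_left_mono) auto
    also have "\<dots> = a0 / 2" using lw by (simp add: L_def a0_def power2_eq_square)
    finally show ?thesis .
  qed
  \<comment> \<open>Since \<open>ln (cos \<beta>) \<le> ln 2 - a0\<close>, the loss a0 / 2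
    accumulated until T leaves at most \<open>1 - a0 / 2\<close>, and a0 exceeds 3. Having
    \<open>pi \<le> a0\<close> relies on w \<le> l.\<close>
  have gain: "ln (cos \<beta>) + a0 / 2 \<le> - (1 / 2)"
  proof -
    have "exp a0 / 2 \<le> cosh a0" by (simp add: cosh_def)
    then have "ln (exp a0 / 2) \<le> ln (cosh a0)" using ch by simp
    then have "a0 - ln 2 \<le> ln (cosh a0)" by (simp add: ln_div)
    moreover have "ln 2 < (1 :: real)" by (rule ln_2_less_1)
    ultimately show ?thesis unfolding lnb using a0 pi_gt3 by simp
  qed
  define F where "F = (\<lambda>z. ln (cos (L * Im (cnj e * (z - m)))) - ln (cosh (L * Re (cnj e * (z - m)))))"
  have avoid: "F (c u s) \<le> - (1 / 2)"
    if s: "s \<in> {t1..<T}" and u: "\<bar>L * Im (cnj e * (c u s - m))\<bar> \<le> \<beta>" for u s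
  proof -
    have "ln (cos (L * Im (cnj e * (c u s - m))))
      \<le> ln (cos \<beta>) + ln (cosh (L * Re (cnj e * (c u s - m)))) + L\<^sup>2 * (s - t1)"
    proof (rule oval_avoided[OF _ _ _ e L \<beta> _ u])
      fix u assume u: "\<bar>L * Im (cnj e * (c u t1 - m))\<bar> \<le> \<beta>"
      then have "L * \<bar>Im (cnj e * (c u t1 - m))\<bar> \<le> \<beta>" using L by (simp add: abs_mult)
      moreover have "L * (w / 4) = pi" using lw by (simp add: L_def)
      ultimately have "L * \<bar>Im (cnj e * (c u t1 - m))\<bar> < L * (w / 4)" using \<beta> pi_gt_zero by linarith
      then have "\<bar>Im (cnj e * (c u t1 - m))\<bar> < w / 4" using L by simp
      then have "l / 4 \<le> \<bar>Re (cnj e * (c u t1 - m))\<bar>"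
        by (intro curve_outside_rectangle[OF t e, where B = "w / 4"] rect) (use lw in auto)
      then have "a0 \<le> \<bar>L * Re (cnj e * (c u t1 - m))\<bar>"
        unfolding a0_def using L by (simp add: abs_mult)
      then have "cosh a0 \<le> cosh (L * Re (cnj e * (c u t1 - m)))"
        using cosh_real_nonneg_le_iff[of a0 "\<bar>L * Re (cnj e * (c u t1 - m))\<bar>"] a0 pi_gt_zero by simp
      then have "0 \<le> ln (cos \<beta>) + ln (cosh (L * Re (cnj e * (c u t1 - m))))"
        unfolding lnb using ch by simp
      moreover have "0 < cos (L * Im (cnj e * (c u t1 - m)))"
        using u \<beta> by (intro cos_gt_zero_pi) auto
      then have "ln (cos (L * Im (cnj e * (c u t1 - m)))) \<le> 0" by simp
      ultimately show "ln (cos (L * Im (cnj e * (c u t1 - m))))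
        \<le> ln (cos \<beta>) + ln (cosh (L * Re (cnj e * (c u t1 - m))))" by simp
    qed (use s t in auto)
    then show ?thesis using time[of s] gain s unfolding F_def by simp
  qed
  have F_m: "F m = 0" by (simp add: F_def)
  have m_in: "m \<in> region s" if s: "s \<in> {t1..<T}" for s
  proof (rule region_exit[of t1 s])
    have "m + Complex 0 0 * e \<in> region t1" by (rule rect) (use lw in auto)
    moreover have "m + Complex 0 0 * e = m" by (simp add: complex_eq_iff times_complex.sel)
    ultimately show "m \<in> region t1" by simp
    fix u r assume "r \<in> {t1..s}"
    then show "c u r \<noteq> m" using avoid[of r u] F_m \<beta> s by auto
  qed (use s t in auto)
  have ev: "\<forall>\<^sub>F s in at_left T. s \<in> {t1..<T}"
    using t by (intro eventually_at_leftI[of t1]) auto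
  have "cmod m \<le> \<epsilon>" if \<epsilon>: "0 < \<epsilon>" for \<epsilon>
  proof -
    have "\<forall>\<^sub>F s in at_left T. \<forall>u\<in>UNIV. dist (c u s) 0 < \<epsilon>" using shrinks \<epsilon> by (rule uniform_limitD)
    from eventually_happens[OF eventually_conj[OF ev this]]
    obtain s where s: "s \<in> {t1..<T}" "\<And>u. cmod (c u s) < \<epsilon>" by auto
    have "region s \<subseteq> cball 0 \<epsilon>" unfolding region_def by (rule hull_minimal) (use less_imp_le[OF s(2)] in auto)
    with m_in[OF s(1)] show ?thesis by auto
  qed
  then have m0: "m = 0" by (metis dense_ge norm_le_zero_iff)
  have lim: "((\<lambda>s. c 0 s) \<longlongrightarrow> 0) (at_left T)"
    using tendsto_uniform_limitI[OF shrinks, of 0] by simp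
  have "((\<lambda>s. F (c 0 s)) \<longlongrightarrow> F 0) (at_left T)"
    unfolding F_def m0 by (intro tendsto_intros lim) auto
  moreover have "F 0 > - (1 / 2)" using F_m m0 by simp
  ultimately have 1: "\<forall>\<^sub>F s in at_left T. F (c 0 s) > - (1 / 2)" by (rule order_tendstoD(1))
  have "((\<lambda>s. \<bar>L * Im (cnj e * (c 0 s - m))\<bar>) \<longlongrightarrow> \<bar>L * Im (cnj e * (0 - m))\<bar>) (at_left T)"
    by (intro tendsto_intros lim)
  moreover have "\<bar>L * Im (cnj e * (0 - m))\<bar> < \<beta>" using m0 \<beta> by simp
  ultimately have 2: "\<forall>\<^sub>F s in at_left T. \<bar>L * Im (cnj e * (c 0 s - m))\<bar> < \<beta>" by (rule order_tendstoD(2))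
  from eventually_happens[OF eventually_conj[OF ev eventually_conj[OF 1 2]]]
  obtain s where "s \<in> {t1..<T}" "F (c 0 s) > - (1 / 2)" "\<bar>L * Im (cnj e * (c 0 s - m))\<bar> < \<beta>" by auto
  with avoid[of s 0] show False by auto
qed

text \<open>The arc from u1 to u2 runs on one side of the chord and the rest of the loop on the
  other. Each of them passes over the midpoint, by the intermediate value theorem.\<close>

lemma diam_frame_mid_height:
  assumes f: "diam_frame t p e l w" and t: "t \<in> {t0..<T}" and \<rho>: "\<bar>\<rho>\<bar> = 1"
  obtains v where "Re (cnj e * (c v t - p)) = l / 2" "0 < \<rho> * Im (cnj e * (c v t - p))"
proof -
  have e: "cmod e = 1" and l: "0 < l" using f by (auto simp: diam_frame_def)
  obtain u1 u2 where u: "u1 < u2" "u2 < u1 + 2 * pi" "c u1 t = p" "c u2 t = p + l * e"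
    using f by (auto simp: diam_frame_def)
  define X where "X = (\<lambda>v. Re (cnj e * (c v t - p)))"
  have Xc: "continuous_on S X" for S unfolding X_def by (intro continuous_intros cont_space t)
  have X: "X u1 = 0" "X u2 = l" "X (u1 + 2 * pi) = 0"
    using u periodic[OF t, of u1] by (simp_all add: X_def cnj_frame(1)[OF e])
  consider "\<rho> = 1" | "\<rho> = -1" using \<rho> by (auto simp: abs_if split: if_splits)
  then show thesis
  proof cases
    case 1
    obtain v where v: "u2 \<le> v" "v \<le> u1 + 2 * pi" "X v = l / 2"
      using IVT2'[of X "u1 + 2 * pi" "l / 2" u2] X Xc l u by auto
    then have "u2 < v" "v < u1 + 2 * pi" using X l by (auto simp: less_le)
    then have "0 < wedge (c u2 t - c u1 t) (c v t - c u1 t)" using u by (intro triangle_left[OF t]) auto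
    then show thesis using that[of v] v(3) 1 u l wedge_frame(1)[OF e, of l "c v t - p"]
      by (simp add: X_def zero_less_mult_iff)
  next
    case 2
    obtain v where v: "u1 \<le> v" "v \<le> u2" "X v = l / 2"
      using IVT'[of X u1 "l / 2" u2] X Xc l u by auto
    then have "u1 < v" "v < u2" using X l by (auto simp: less_le)
    then have "0 < wedge (c v t - c u1 t) (c u2 t - c u1 t)" using u by (intro triangle_left[OF t]) auto
    then show thesis using that[of v] v(3) 2 u l wedge_frame(2)[OF e, of "c v t - p" l]
      by (simp add: X_def zero_less_mult_iff mult_less_0_iff)
  qed
qed

text \<open>The triangle spanned by the later chord and the earlier point lies in the earlier
  region, and a sine arch fits under it. By \<open>lens_preserved\<close> the curve at time t still
  passes above what is left of the arch, which is tested over the middle of the chord.\<close>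

lemma width_from_earlier_point:
  assumes f: "diam_frame t p e l w" and t: "t0 \<le> t1" "t1 \<le> t" "t < T"
    and Q: "p + Complex xq yq * e \<in> region t1" and xq: "0 \<le> xq" "xq \<le> l"
  shows "\<bar>yq\<bar> / pi * exp (- (pi / l)\<^sup>2 * (t - t1)) \<le> w"
proof (cases "yq = 0")
  case True
  then show ?thesis using f by (simp add: diam_frame_def)
next
  case False
  have tt: "t \<in> {t0..<T}" "t1 \<in> {t0..<T}" using t by auto
  have e: "cmod e = 1" and lw: "0 < l" "0 < w" using f by (auto simp: diam_frame_def)
  define \<rho> where "\<rho> = sgn yq"
  have \<rho>: "\<bar>\<rho>\<bar> = 1" "\<rho> * yq = \<bar>yq\<bar>" "\<rho> \<noteq> 0" "\<rho> * \<rho> = 1"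
    using False by (auto simp: \<rho>_def abs_sgn sgn_mult_abs mult.commute sgn_if)
  obtain u1 u2 where u: "c u1 t = p" "c u2 t = p + l * e" using f by (auto simp: diam_frame_def)
  have chord: "p \<in> region t" "p + of_real l * e \<in> region t" using curve_in_region u by metis+
  have dec: "region t \<subseteq> region t1" by (rule region_decreasing[OF t])
  obtain v where v: "Re (cnj e * (c v t - p)) = l / 2" "0 < \<rho> * Im (cnj e * (c v t - p))"
    using diam_frame_mid_height[OF f tt(1) \<rho>(1)] by metis
  have "\<bar>yq\<bar> / pi * exp (- (pi / l)\<^sup>2 * (t - t1)) * sin (pi / l * Re (cnj e * (c v t - p)))
    \<le> \<rho> * Im (cnj e * (c v t - p))"
  proof (rule lens_preserved[OF t e lw(1) _ chord])
    fix u
    define x y where "x = Re (cnj e * (c u t1 - p))" and "y = \<rho> * Im (cnj e * (c u t1 - p))"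
    assume "0 < Re (cnj e * (c u t1 - p))" "Re (cnj e * (c u t1 - p)) < l" "0 < \<rho> * Im (cnj e * (c u t1 - p))"
    then have xy: "0 < x" "x < l" "0 < y" by (auto simp: x_def y_def)
    \<comment> \<open>The height is divided by pi because
      \<open>sin (pi * x) \<le> pi * min x (1 - x)\<close>: the arch stays below the triangle
      wherever over the chord its apex lies.\<close>
    define g where "g = \<bar>yq\<bar> / pi * sin (pi / l * x)"
    have cu: "c u t1 = p + Complex x (\<rho> * y) * e"
      using cnj_frame(2)[OF e, of "c u t1 - p"] \<rho>(4)
      by (simp add: x_def y_def complex_eq_iff mult.commute flip: mult.assoc)
    show "\<bar>yq\<bar> / pi * sin (pi / l * Re (cnj e * (c u t1 - p))) \<le> \<rho> * Im (cnj e * (c u t1 - p))"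
    proof (rule ccontr)
      assume "\<not> ?thesis"
      then have yg: "y < g" by (simp add: x_def y_def g_def)
      define h where "h = min y (g - y)"
      have h: "0 < h" "h \<le> y" "y + h \<le> g" using xy yg by (auto simp: h_def)
      have below: "p + Complex x (\<rho> * z) * e \<in> region t1" if z: "0 \<le> z" "z \<le> g" for z
      proof -
        define k where "k = z / \<bar>yq\<bar>"
        have "k \<le> sin (pi * (x / l)) / pi"
          using z(2) False by (simp add: k_def g_def field_simps)
        moreover have "sin (pi * (x / l)) \<le> pi * (x / l)" "sin (pi * (x / l)) \<le> pi * (1 - x / l)"
          using sin_pi_le_min[of "x / l"] xy by auto
        ultimately have k: "k \<le> x / l" "k \<le> 1 - x / l"
          using pi_gt_zero by (smt (verit) pos_divide_le_eq mult.commute)+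
        have k0: "0 \<le> k" using z by (simp add: k_def)
        have "p + Complex x (k * yq) * e \<in> region t1"
        proof (rule triangle_in_region[OF _ _ Q lw(1) k0])
          have "xq * k \<le> l * (x / l)" using k k0 xq lw by (intro mult_mono) auto
          then show "xq * k \<le> x" using lw by simp
          have "(l - xq) * k \<le> l * (1 - x / l)" using k k0 xq lw by (intro mult_mono) auto
          then show "x \<le> l - (l - xq) * k" using lw by (simp add: algebra_simps)
          show "k \<le> 1" using k xy lw by (smt (verit) divide_nonneg_pos)
        qed (use chord dec in auto)
        moreover have "k * yq = \<rho> * z"
        proof -
          have "yq = \<rho> * \<bar>yq\<bar>" by (simp add: \<rho>_def sgn_mult_abs)
          then have "k * yq = k * (\<rho> * \<bar>yq\<bar>)" by simp
          also have "\<dots> = \<rho> * z" using False by (simp add: k_def)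
          finally show ?thesis .
        qed
        ultimately show ?thesis by simp
      qed
      have eq: "p + Complex x (\<rho> * y) * e - Complex 0 (\<rho> * h) * e = p + Complex x (\<rho> * (y - h)) * e"
        "p + Complex x (\<rho> * y) * e + Complex 0 (\<rho> * h) * e = p + Complex x (\<rho> * (y + h)) * e"
        by (simp_all add: complex_eq_iff times_complex.sel algebra_simps)
      have "c u t1 \<noteq> p + Complex x (\<rho> * y) * e"
      proof (rule curve_not_between[OF tt(2), of _ "Complex 0 (\<rho> * h) * e"])
        show "Complex 0 (\<rho> * h) * e \<noteq> 0" using h e \<rho>(3) by (auto simp only: mult_eq_0_iff) (auto simp: complex_eq_iff)
      qed (unfold eq, use h xy in \<open>auto intro!: below\<close>)
      with cu show False by contradiction
    qed
  qed (use v \<rho> lw in auto)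
  also have "pi / l * Re (cnj e * (c v t - p)) = pi / 2" unfolding v(1) using lw by simp
  also have "\<rho> * Im (cnj e * (c v t - p)) \<le> w"
    using diam_frame_box(3)[OF f curve_in_region, of v] \<rho>(1)
      abs_ge_self[of "\<rho> * Im (cnj e * (c v t - p))"] by (simp only: abs_mult mult_1)
  finally show ?thesis by (simp only: sin_pi_half mult_1_right)
qed

text \<open>The fraction of the earlier diameter by which each tip retracts, after deduction of the
  offset w1, while the remaining lifetime is halved. It combines \<open>\<delta>\<^sup>2\<close>
  with the constant of \<open>lifetime_lower\<close>.\<close>

definition retract_const :: real
  where "retract_const = \<delta>\<^sup>2 / (128 * pi)"

text \<open>The threshold for \<open>l\<^sup>2 / (T - t1)\<close> above which the earlier region is
  so thin that w1 is negligible beside the retraction and beside l.\<close>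

definition thin_const :: real
  where "thin_const = 9 * (32 * pi) / retract_const"

text \<open>Collects \<open>lifetime_lower\<close> (32 * pi), the surviving fraction of the width
  (12 * pi and \<open>retract_const\<close>) and \<open>lifetime_upper\<close> (3 and
  \<open>2 * \<delta>\<^sup>2\<close>).\<close>

definition decay_const :: real
  where "decay_const = 32 * pi * (12 * pi) * 3 / (retract_const * 2 * \<delta>\<^sup>2)"

lemma retract_const: "0 < retract_const" "retract_const \<le> 1 / 4"
proof -
  show "0 < retract_const" using \<delta>_pos by (simp add: retract_const_def)
  have "\<delta>\<^sup>2 \<le> 1" using speed_lower[of t0 0] speed_upper[of t0 0] t0 by auto
  then have "retract_const \<le> 1 / (128 * pi)" unfolding retract_const_def
    by (intro divide_right_mono) auto
  also have "\<dots> \<le> 1 / 4" using pi_gt3 by (simp add: field_simps)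
  finally show "retract_const \<le> 1 / 4" .
qed

text \<open>The later chord lies in the box with sides l1 and 2 * w1 of the earlier frame, and w1
  \<le> l1.\<close>

lemma diam_frame_l_le:
  assumes f1: "diam_frame t1 p1 e1 l1 w1" and f: "diam_frame t p e l w" and t: "t0 \<le> t1" "t1 \<le> t" "t < T"
  shows "l \<le> 3 * l1"
proof -
  have e: "cmod e = 1" "cmod e1 = 1" "0 < l" using f f1 by (auto simp: diam_frame_def)
  obtain u1 u2 where u: "c u1 t = p" "c u2 t = p + l * e" using f by (auto simp: diam_frame_def)
  have "p \<in> region t1" "p + l * e \<in> region t1"
    using curve_in_region[of u1 t] curve_in_region[of u2 t] u region_decreasing[OF t] by auto
  note box = diam_frame_box[OF f1 this(1)] diam_frame_box[OF f1 this(2)]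
  define z where "z = cnj e1 * (p + l * e - p1) - cnj e1 * (p - p1)"
  have "z = cnj e1 * (l * e)" by (simp add: z_def algebra_simps)
  then have "cmod z = l" using e by (simp add: norm_mult)
  moreover have "cmod z \<le> \<bar>Re z\<bar> + \<bar>Im z\<bar>" by (rule cmod_le)
  moreover have "\<bar>Re z\<bar> \<le> l1" "\<bar>Im z\<bar> \<le> 2 * w1" using box unfolding z_def by simp_all
  ultimately show ?thesis using diam_frame_w_le[OF f1] by linarith
qed

text \<open>By \<open>lifetime_upper\<close> and \<open>lifetime_lower\<close>, \<open>l w\<close> is comparable to \<open>T - t\<close> and \<open>l1 w1\<close> to \<open>T - t1\<close>.
  The tips at time \<open>t1\<close> retract by a fixed fraction of \<open>l1\<close>, so next to the middle of the later chord the
  region had at time \<open>t1\<close> a thickness comparable to \<open>w1\<close>, and a fixed fraction of it is left at time \<open>t\<close>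
  if \<open>l\<close> is large (\<open>width_from_earlier_point\<close>).\<close>

lemma diameter_decay:
  assumes f1: "diam_frame t1 p1 e1 l1 w1" and f: "diam_frame t p e l w"
    and t: "t0 \<le> t1" "t1 < t" "t < T" and half: "2 * (T - t) \<le> T - t1"
    and large: "thin_const * (T - t1) \<le> l\<^sup>2"
  shows "l * (T - t1) \<le> decay_const * l1 * (T - t)"
proof -
  define k where "k = retract_const"
  have k: "0 < k" "k \<le> 1 / 4" "\<delta>\<^sup>2 = 128 * pi * k" using retract_const by (auto simp: k_def retract_const_def)
  have t1: "t1 \<in> {t0..<T}" and tt: "t0 \<le> t1" "t1 \<le> t" "t < T" and tT: "t \<in> {t0..<T}" using t by auto
  have e: "cmod e = 1" and lw: "0 < l" "0 < w" using f by (auto simp: diam_frame_def)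
  have e1: "cmod e1 = 1" and lw1: "0 < l1" "0 < w1" using f1 by (auto simp: diam_frame_def)
  have l3: "l \<le> 3 * l1" by (rule diam_frame_l_le[OF f1 f tt])
  have M1: "l1 * w1 \<le> 32 * pi * (T - t1)" by (rule lifetime_lower[OF f1 t1])
  \<comment> \<open>The purpose of \<open>thin_const\<close>; it yields w1 \<le> k * l1, 4 * w1
    \<le> l and a decay exponent of at most 1.\<close>
  have "32 * pi * (T - t1) \<le> k * l\<^sup>2 / 9"
    using large k pi_gt_zero by (simp add: thin_const_def k_def[symmetric] field_simps)
  with M1 have M2: "l1 * w1 \<le> k * l\<^sup>2 / 9" by simp
  have w1k: "w1 \<le> k * l1"
  proof -
    have "l\<^sup>2 \<le> (3 * l1)\<^sup>2" using l3 lw by (intro power_mono) auto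
    then have "k * l\<^sup>2 \<le> k * (9 * l1\<^sup>2)" using k by (intro mult_left_mono) (auto simp: power_mult_distrib)
    then have "l1 * w1 \<le> l1 * (k * l1)" using M2 by (simp add: power2_eq_square algebra_simps)
    then show ?thesis using lw1 by simp
  qed
  have w1l: "4 * w1 \<le> l"
  proof -
    have "k * l\<^sup>2 \<le> k * (3 * l1 * l)"
      unfolding power2_eq_square using l3 lw k by (intro mult_left_mono mult_right_mono) auto
    with M2 have "l1 * w1 \<le> k * (3 * l1 * l) / 9" by linarith
    then have "l1 * (3 * w1) \<le> l1 * (k * l)" by (simp add: algebra_simps)
    then have "3 * w1 \<le> k * l" using lw1 by simp
    also have "\<dots> \<le> 1 / 4 * l" using k lw by (intro mult_right_mono) auto
    finally show ?thesis using lw by simp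
  qed
  \<comment> \<open>The elapsed time is at least half of T - t1, which \<open>lifetime_lower\<close>
    bounds from below by a multiple of \<open>l1 * w1\<close>. Subtracting the offset w1 \<le> k *
    l1 leaves k * l1 at each end.\<close>
  have retract: "2 * k * l1 \<le> \<delta>\<^sup>2 / w1 * (t - t1)"
  proof -
    have "32 * pi * (T - t1) \<le> 32 * pi * (2 * (t - t1))" using half by (intro mult_left_mono) auto
    with M1 have "l1 * w1 \<le> 32 * pi * (2 * (t - t1))" by (rule order_trans)
    then have "l1 * w1 \<le> 64 * pi * (t - t1)" by (simp only: mult.assoc[symmetric])
    then have "k * (l1 * w1) \<le> k * (64 * pi * (t - t1))" using k by (intro mult_left_mono) auto
    then show ?thesis unfolding k(3) using lw1 by (simp add: field_simps)
  qed
  obtain u1 u2 where u: "c u1 t = p" "c u2 t = p + l * e" using f by (auto simp: diam_frame_def)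
  have xr: "k * l1 \<le> Re (cnj e1 * (c v t - p1))" "Re (cnj e1 * (c v t - p1)) \<le> l1 - k * l1" for v
    using diam_frame_retract[OF f1 tt, of v] retract w1k by linarith+
  define m where "m = p + of_real (l / 2) * e"
  define xm ym where "xm = Re (cnj e1 * (m - p1))" and "ym = Im (cnj e1 * (m - p1))"
  have inr1: "p \<in> region t1" "p + l * e \<in> region t1"
    using curve_in_region[of u1 t] curve_in_region[of u2 t] u region_decreasing[OF tt] by auto
  have mavg: "cnj e1 * (m - p1) = (cnj e1 * (p - p1) + cnj e1 * (p + l * e - p1)) / 2"
    by (simp add: m_def algebra_simps)
  have xm: "k * l1 \<le> xm" "xm \<le> l1 - k * l1"
    using xr[of u1] xr[of u2] unfolding u xm_def mavg by simp_all
  have ym: "\<bar>ym\<bar> \<le> w1"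
    using diam_frame_box(3)[OF f1 inr1(1)] diam_frame_box(3)[OF f1 inr1(2)] unfolding ym_def mavg by simp
  \<comment> \<open>Over the abscissa xm the earlier region contains points at the heights 0 and k *
    yq. These differ by k * w1, so one of them is at vertical distance at least k * w1 / 2 from m.
    The triangle reaches the height k * yq there because xm keeps the distance k * l1 from both
    ends.\<close>
  obtain z where z: "p1 + Complex xm (ym + z) * e1 \<in> region t1" "k * w1 / 2 \<le> \<bar>z\<bar>" "\<bar>z\<bar> \<le> 2 * w1"
  proof -
    obtain q where q: "\<bar>Im (cnj e1 * (c q t1 - p1))\<bar> = w1" using f1 by (auto simp: diam_frame_def)
    obtain v1 v2 where v: "c v1 t1 = p1" "c v2 t1 = p1 + l1 * e1" using f1 by (auto simp: diam_frame_def)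
    define xq yq where "xq = Re (cnj e1 * (c q t1 - p1))" and "yq = Im (cnj e1 * (c q t1 - p1))"
    have cq: "c q t1 = p1 + Complex xq yq * e1"
      using cnj_frame(2)[OF e1, of "c q t1 - p1"] by (simp add: xq_def yq_def complex_eq_iff mult.commute)
    have xq: "0 \<le> xq" "xq \<le> l1" using diam_frame_box[OF f1 curve_in_region, of q] by (auto simp: xq_def)
    have r: "p1 \<in> region t1" "p1 + of_real l1 * e1 \<in> region t1" "p1 + Complex xq yq * e1 \<in> region t1"
      using curve_in_region v cq by metis+
    have "xq * k \<le> k * l1" "(l1 - xq) * k \<le> k * l1"
      unfolding mult.commute[of k] using xq k by (intro mult_right_mono; simp)+
    then have "p1 + Complex xm (k * yq) * e1 \<in> region t1"
      using xm k by (intro triangle_in_region[OF r lw1(1)]) linarith+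
    then have 1: "p1 + Complex xm (ym + (k * yq - ym)) * e1 \<in> region t1" by simp
    have "p1 + Complex xm (0 * yq) * e1 \<in> region t1"
      using xm k lw1 mult_pos_pos[OF k(1) lw1(1)] by (intro triangle_in_region[OF r lw1(1)]) auto
    then have 2: "p1 + Complex xm (ym + (- ym)) * e1 \<in> region t1" by simp
    have kq: "\<bar>k * yq\<bar> = k * w1" using q k by (simp add: yq_def abs_mult)
    have kw: "k * w1 \<le> w1" using k lw1 by (simp add: mult_left_le_one_le)
    show thesis
    proof (cases "k * w1 / 2 \<le> \<bar>ym\<bar>")
      case True
      show thesis by (rule that[OF 2]) (use True ym lw1 in auto)
    next
      case False
      show thesis by (rule that[OF 1]) (use False ym kq kw in linarith)+
    qed
  qed
  define f' where "f' = cnj e1 * e"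
  have ff: "cmod f' = 1" using e e1 by (simp add: f'_def norm_mult)
  \<comment> \<open>The later chord of length l rises by at most 2 * w1 \<le> l / 2 in the earlier
    frame, so up to reversal the two frames differ by at most 30 degrees, and a vertical
    displacement keeps half of its size.\<close>
  have sf: "\<bar>Im f'\<bar> \<le> 1 / 2"
  proof -
    have "cnj e1 * (p + l * e - p1) - cnj e1 * (p - p1) = l * f'" by (simp add: f'_def algebra_simps)
    then have "l * Im f' = Im (cnj e1 * (p + l * e - p1)) - Im (cnj e1 * (p - p1))"
      by (metis Im_complex_of_real Re_complex_of_real minus_complex.simps(2) add.right_neutral mult_zero_left times_complex.simps(2))
    then have "\<bar>l * Im f'\<bar> \<le> 2 * w1"
      using diam_frame_box(3)[OF f1 inr1(1)] diam_frame_box(3)[OF f1 inr1(2)] by linarith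
    then have "l * \<bar>Im f'\<bar> \<le> 2 * w1" using lw by (simp add: abs_mult)
    with w1l have "l * \<bar>Im f'\<bar> \<le> l * (1 / 2)" by linarith
    then show ?thesis using lw by simp
  qed
  have cf: "1 / 2 \<le> \<bar>Re f'\<bar>"
  proof -
    have "(Re f')\<^sup>2 + (Im f')\<^sup>2 = 1" using ff by (simp add: cmod_power2[symmetric])
    moreover have "(Im f')\<^sup>2 \<le> (1 / 2)\<^sup>2" using sf by (metis abs_ge_zero power2_abs power_mono)
    ultimately have "(1 / 2)\<^sup>2 \<le> \<bar>Re f'\<bar>\<^sup>2" by (simp add: power2_eq_square)
    then show ?thesis by (rule power2_le_imp_le) simp
  qed
  have Q: "p1 + Complex xm (ym + z) * e1 = p + Complex (l / 2 + z * Im f') (z * Re f') * e"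
  proof -
    have m1: "m = p1 + Complex xm ym * e1"
      using cnj_frame(2)[OF e1, of "m - p1"] by (simp add: xm_def ym_def complex_eq_iff mult.commute)
    have e1f: "e1 = cnj f' * e" using cnj_frame(2)[OF e, of e1] by (simp add: f'_def mult_ac)
    have "Complex 0 z * cnj f' = Complex (z * Im f') (z * Re f')"
      by (simp add: complex_eq_iff times_complex.sel)
    then have "Complex 0 z * e1 = Complex (z * Im f') (z * Re f') * e"
      by (subst e1f) (simp only: mult.assoc[symmetric])
    moreover have "p1 + Complex xm (ym + z) * e1 = m + Complex 0 z * e1"
      unfolding m1 by (simp add: complex_eq_iff times_complex.sel algebra_simps)
    ultimately have "p1 + Complex xm (ym + z) * e1 = m + Complex (z * Im f') (z * Re f') * e" by simp
    also have "\<dots> = p + Complex (l / 2 + z * Im f') (z * Re f') * e"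
      unfolding m_def by (simp add: complex_eq_iff times_complex.sel algebra_simps)
    finally show ?thesis .
  qed
  have "\<bar>z * Im f'\<bar> \<le> (2 * w1) * (1 / 2)" unfolding abs_mult using z sf lw1 by (intro mult_mono) auto
  then have xx: "0 \<le> l / 2 + z * Im f'" "l / 2 + z * Im f' \<le> l" using w1l lw1 by linarith+
  have W: "\<bar>z * Re f'\<bar> / pi * exp (- (pi / l)\<^sup>2 * (t - t1)) \<le> w"
    by (rule width_from_earlier_point[OF f tt _ xx]) (use z(1) Q in simp)
  have yy: "k * w1 / 4 \<le> \<bar>z * Re f'\<bar>"
  proof -
    have "(k * w1 / 2) * (1 / 2) \<le> \<bar>z\<bar> * \<bar>Re f'\<bar>" using z cf k lw1 by (intro mult_mono) auto
    then show ?thesis by (simp add: abs_mult)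
  qed
  \<comment> \<open>Diffusion over the length l acts on the time scale \<open>l\<^sup>2\<close>,
    which exceeds the elapsed time because l is large.\<close>
  have ex: "1 / 3 \<le> exp (- (pi / l)\<^sup>2 * (t - t1))"
  proof -
    have "(pi / l)\<^sup>2 * (t - t1) \<le> 1"
    proof -
      have "pi\<^sup>2 * (t - t1) \<le> (4 * pi) * (t - t1)"
        using t pi_less_4 pi_gt_zero unfolding power2_eq_square by (intro mult_right_mono) auto
      also have "\<dots> \<le> 32 * pi * (T - t1)" using t pi_gt_zero by (intro mult_mono) auto
      also have "\<dots> \<le> k * l\<^sup>2 / 9" by fact
      also have "\<dots> \<le> l\<^sup>2"
      proof -
        have "k * l\<^sup>2 \<le> 1 * l\<^sup>2" using k by (intro mult_right_mono) auto
        moreover have "0 \<le> l\<^sup>2" by simp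
        ultimately show ?thesis by linarith
      qed
      finally show ?thesis using lw by (simp add: power_divide field_simps)
    qed
    then have "exp (- 1) \<le> exp (- (pi / l)\<^sup>2 * (t - t1))" by simp
    moreover have "1 / 3 \<le> exp (- 1 :: real)" using exp_le by (simp add: exp_minus field_simps)
    ultimately show ?thesis by linarith
  qed
  have "k * w1 / 4 / pi * (1 / 3) \<le> \<bar>z * Re f'\<bar> / pi * exp (- (pi / l)\<^sup>2 * (t - t1))"
    using yy ex k lw1 by (intro mult_mono divide_right_mono) auto
  with W have ww: "k * w1 / (12 * pi) \<le> w" by (simp add: field_simps)
  have M: "l * w \<le> 32 * pi * (T - t)" by (rule lifetime_lower[OF f tT])
  have up: "2 * \<delta>\<^sup>2 * (T - t1) \<le> 3 * (l1 * w1)" by (rule lifetime_upper[OF f1 t1])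
  \<comment> \<open>T - t1 is controlled by \<open>l1 * w1\<close>, w1 by w, and
    \<open>l * w\<close> by T - t; thus both widths disappear.\<close>
  have "l * (T - t1) * (2 * \<delta>\<^sup>2 * k) \<le> l * k * (3 * (l1 * w1))"
    using mult_left_mono[OF up, of "l * k"] lw k by (simp add: mult_ac)
  also have "\<dots> = 3 * l1 * (12 * pi) * (l * (k * w1 / (12 * pi)))" by (simp add: field_simps)
  also have "\<dots> \<le> 3 * l1 * (12 * pi) * (l * w)" using ww lw lw1 by (intro mult_left_mono) auto
  also have "\<dots> \<le> 3 * l1 * (12 * pi) * (32 * pi * (T - t))" using M lw1 by (intro mult_left_mono) auto
  also have "\<dots> = decay_const * l1 * (T - t) * (2 * \<delta>\<^sup>2 * k)"
    unfolding decay_const_def k_def[symmetric] using k(1) \<delta>_pos by (simp add: field_simps)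
  finally show ?thesis by (rule mult_right_le_imp_le) (use k(1) \<delta>_pos in simp)
qed

text \<open>Induction over time scales: stepping back multiplies the remaining lifetime by N. If l
  is large, \<open>diameter_decay\<close> gives \<open>l \<le> decay_const / N * l1\<close>, and
  \<open>N \<ge> decay_const\<^sup>2\<close> makes this factor at most 1 / sqrt N, just what the
  scaling \<open>l\<^sup>2 \<le> K * (T - t)\<close> requires with the same K.\<close>

lemma diameter_bound:
  obtains K where "0 < K" "\<And>t p e l w. t \<in> {t0..<T} \<Longrightarrow> diam_frame t p e l w \<Longrightarrow> l\<^sup>2 \<le> K * (T - t)"
proof -
  define N where "N = max 2 (decay_const\<^sup>2)"
  have N: "2 \<le> N" "decay_const\<^sup>2 \<le> N" "0 < N" by (auto simp: N_def)
  obtain p0 e0 l0 w0 where f0: "diam_frame t0 p0 e0 l0 w0"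
    using diam_frame_exists[of t0] t0 by (metis atLeastLessThan_iff order.refl)
  have l0: "0 < l0" using f0 by (auto simp: diam_frame_def)
  have thin: "0 < thin_const" using retract_const by (simp add: thin_const_def)
  \<comment> \<open>The first entry serves diameters below the threshold of
    \<open>diameter_decay\<close>, the second the first time scale after t0, where stepping back
    would leave the interval.\<close>
  define K where "K = max (thin_const * N) (9 * l0\<^sup>2 * N / (T - t0))"
  have K: "0 < K" "thin_const * N \<le> K" "9 * l0\<^sup>2 * N / (T - t0) \<le> K"
    using thin N by (auto simp: K_def less_max_iff_disj)
  have main: "l\<^sup>2 \<le> K * (T - t)"
    if "t \<in> {t0..<T}" "(T - t0) / N ^ n \<le> T - t" "diam_frame t p e l w" for n t p e l w
    using that
  proof (induction n arbitrary: t p e l w)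
    case 0
    then have "t = t0" by auto
    have l: "0 < l" "l \<le> 3 * l0" using 0 diam_frame_l_le[OF f0 0(3)] by (auto simp: diam_frame_def)
    have "l\<^sup>2 \<le> (3 * l0)\<^sup>2" using l by (intro power_mono) auto
    also have "\<dots> = 9 * l0\<^sup>2 * 1" by (simp add: power_mult_distrib)
    also have "\<dots> \<le> 9 * l0\<^sup>2 * N" using N by (intro mult_left_mono) auto
    also have "\<dots> \<le> K * (T - t)" using K(3) t0 \<open>t = t0\<close> by (simp add: pos_divide_le_eq)
    finally show ?case .
  next
    case (Suc n)
    have tT: "t < T" "t0 \<le> t" using Suc.prems by auto
    have l: "0 < l" "l \<le> 3 * l0"
      using Suc.prems diam_frame_l_le[OF f0 Suc.prems(3)] by (auto simp: diam_frame_def)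
    show ?case
    proof (cases "(T - t0) / N \<le> T - t")
      case True
      have "l\<^sup>2 \<le> (3 * l0)\<^sup>2" using l by (intro power_mono) auto
      also have "\<dots> = (9 * l0\<^sup>2 * N / (T - t0)) * ((T - t0) / N)"
        using N t0 by (simp add: power_mult_distrib)
      also have "\<dots> \<le> K * (T - t)" using K True t0 N by (intro mult_mono) auto
      finally show ?thesis .
    next
      case False
      define t1 where "t1 = T - N * (T - t)"
      have NT: "T - t1 = N * (T - t)" by (simp add: t1_def)
      have "N * (T - t) < T - t0" using False N by (simp add: field_simps)
      then have t1: "t0 \<le> t1" by (simp add: t1_def)
      have "2 * (T - t) \<le> N * (T - t)" using N tT by (intro mult_right_mono) auto
      then have half: "2 * (T - t) \<le> T - t1" by (simp add: NT)
      have "T - t < 2 * (T - t)" using tT by simp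
      also note half
      finally have lt: "t1 < t" by simp
      have t1': "t1 \<in> {t0..<T}" using t1 lt tT by auto
      obtain p1 e1 l1 w1 where f1: "diam_frame t1 p1 e1 l1 w1" using diam_frame_exists[OF t1'] by metis
      have "(T - t0) / N ^ n \<le> T - t1"
        using Suc.prems(2) N unfolding NT by (simp add: field_simps)
      from Suc.IH[OF t1' this f1] have IH: "l1\<^sup>2 \<le> K * (N * (T - t))" by (simp add: NT)
      show ?thesis
      proof (cases "thin_const * (T - t1) \<le> l\<^sup>2")
        case True
        have "l * (T - t1) \<le> decay_const * l1 * (T - t)"
          by (rule diameter_decay[OF f1 Suc.prems(3) t1 lt tT(1) half True])
        then have "(l * N) * (T - t) \<le> decay_const * l1 * (T - t)" by (simp add: NT mult_ac)
        then have "l * N \<le> decay_const * l1" using tT by (simp add: mult_le_cancel_right)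
        then have "(l * N)\<^sup>2 \<le> (decay_const * l1)\<^sup>2" using l N by (intro power_mono) auto
        also have "\<dots> = decay_const\<^sup>2 * l1\<^sup>2" by (simp add: power_mult_distrib)
        also have "\<dots> \<le> N * (K * (N * (T - t)))" using N IH by (intro mult_mono) auto
        finally have "N\<^sup>2 * l\<^sup>2 \<le> N\<^sup>2 * (K * (T - t))" by (simp add: power2_eq_square mult_ac)
        then show ?thesis using N by simp
      next
        case False
        then have "l\<^sup>2 \<le> (thin_const * N) * (T - t)" by (simp add: NT mult_ac)
        also have "\<dots> \<le> K * (T - t)" using K tT by (intro mult_right_mono) auto
        finally show ?thesis .
      qed
    qed
  qed
  show thesis
  proof (rule that[OF K(1)])
    fix t p e l w assume t: "t \<in> {t0..<T}" and f: "diam_frame t p e l w"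
    have "0 < (T - t) / (T - t0)" using t by simp
    then obtain n where "(1 / N) ^ n < (T - t) / (T - t0)"
      using real_arch_pow_inv[of "(T - t) / (T - t0)" "1 / N"] N by auto
    then have "(T - t0) / N ^ n \<le> T - t" using t N by (simp add: power_divide field_simps)
    then show "l\<^sup>2 \<le> K * (T - t)" by (rule main[OF t _ f])
  qed
qed

lemma size_bounds:
  obtains K \<kappa> where "0 < K" "0 < \<kappa>"
    "\<And>t u v. t \<in> {t0..<T} \<Longrightarrow> cmod (c u t - c v t) \<le> K * sqrt (T - t)"
    "\<And>t. t \<in> {t0..<T} \<Longrightarrow> \<exists>m. cball m (\<kappa> * sqrt (T - t)) \<subseteq> region t"
proof -
  obtain K where K: "0 < K" "\<And>t p e l w. t \<in> {t0..<T} \<Longrightarrow> diam_frame t p e l w \<Longrightarrow> l\<^sup>2 \<le> K * (T - t)"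
    using diameter_bound by metis
  \<comment> \<open>By \<open>lifetime_upper\<close> and the diameter bound, w is at least
    \<open>\<delta>\<^sup>2 / (3 * sqrt K)\<close> times sqrt (T - t); a disc of radius w / 4 fits
    into the rectangle.\<close>
  define \<kappa> where "\<kappa> = \<delta>\<^sup>2 / (6 * sqrt K) / 2"
  show thesis
  proof (rule that[of "sqrt K" \<kappa>])
    show "0 < sqrt K" "0 < \<kappa>" using K(1) \<delta>_pos by (auto simp: \<kappa>_def)
    fix t assume t: "t \<in> {t0..<T}"
    obtain p e l w where f: "diam_frame t p e l w" using diam_frame_exists[OF t] by metis
    have lw: "0 < l" "0 < w" "w \<le> l" "cmod e = 1" using f diam_frame_w_le[OF f] by (auto simp: diam_frame_def)
    have l: "l \<le> sqrt K * sqrt (T - t)"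
      using K(2)[OF t f] lw by (simp add: real_le_rsqrt flip: real_sqrt_mult)
    show "cmod (c u t - c v t) \<le> sqrt K * sqrt (T - t)" for u v
      using f l unfolding diam_frame_def by (meson order_trans)
    show "\<exists>m. cball m (\<kappa> * sqrt (T - t)) \<subseteq> region t"
    proof -
      obtain m where rect: "\<And>x y. \<bar>x\<bar> \<le> l / 4 \<Longrightarrow> \<bar>y\<bar> \<le> w / 4 \<Longrightarrow> m + Complex x y * e \<in> region t"
        using diam_frame_rectangle[OF f] by metis
      define r where "r = sqrt (T - t)"
      have r: "0 < r" "r * r = T - t" using t by (auto simp: r_def)
      have "2 * \<delta>\<^sup>2 * (r * r) \<le> 3 * (l * w)" using lifetime_upper[OF f t] r by simp
      also have "\<dots> \<le> 3 * ((sqrt K * r) * w)" using l lw by (simp add: r_def)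
      finally have "(2 * \<delta>\<^sup>2 * r) * r \<le> (3 * sqrt K * w) * r" by (simp add: mult_ac)
      then have "2 * \<delta>\<^sup>2 * r \<le> 3 * sqrt K * w" using r by (simp add: mult_le_cancel_right)
      moreover have "\<delta>\<^sup>2 * r \<le> 2 * \<delta>\<^sup>2 * r" using r by simp
      ultimately have "\<delta>\<^sup>2 * r \<le> 3 * sqrt K * w" by (rule order_trans[rotated])
      then have w: "\<kappa> * r \<le> w / 4" using K(1) by (simp add: \<kappa>_def field_simps)
      have "cball m (\<kappa> * r) \<subseteq> region t"
      proof
        fix z assume "z \<in> cball m (\<kappa> * r)"
        then have "cmod (z - m) \<le> w / 4" using w by (simp add: dist_norm norm_minus_commute)
        then have n: "cmod (cnj e * (z - m)) \<le> w / 4" using lw by (simp add: norm_mult)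
        have "m + Complex (Re (cnj e * (z - m))) (Im (cnj e * (z - m))) * e \<in> region t"
          using n abs_Re_le_cmod[of "cnj e * (z - m)"] abs_Im_le_cmod[of "cnj e * (z - m)"] lw
          by (intro rect) linarith+
        then show "z \<in> region t"
          using cnj_frame(2)[OF lw(4), of "z - m"] by (simp add: mult.commute)
      qed
      then show ?thesis unfolding r_def by blast
    qed
  qed
qed

end

section \<open>Regularity of curve shortening flow\<close>

text \<open>In \<open>mixed_deriv\<close> the time derivatives are taken first, whereas the
  evolution of tangents needs the time derivative of a space derivative. Writing f as a time
  integral and differentiating under the integral exchanges the two.\<close>

lemma partial_derivatives_commute:
  fixes f ft fu ftu :: "real \<Rightarrow> real \<Rightarrow> 'a::euclidean_space"
  assumes dt: "\<And>u t. t \<in> {0..<T} \<Longrightarrow> ((\<lambda>s. f u s) has_vector_derivative ft u t) (at t within {0..<T})"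
    and du: "\<And>u t. t \<in> {0..<T} \<Longrightarrow> ((\<lambda>v. f v t) has_vector_derivative fu u t) (at u)"
    and dtu: "\<And>u t. t \<in> {0..<T} \<Longrightarrow> ((\<lambda>v. ft v t) has_vector_derivative ftu u t) (at u)"
    and ct: "continuous_on (UNIV \<times> {0..<T}) (\<lambda>(u, t). ft u t)"
    and ctu: "continuous_on (UNIV \<times> {0..<T}) (\<lambda>(u, t). ftu u t)"
    and t: "t \<in> {0..<T}"
  shows "((\<lambda>s. fu u s) has_vector_derivative ftu u t) (at t within {0..<T})"
proof -
  have cont1: "continuous_on {0..s} (\<lambda>r. ftu v r)" "continuous_on {0..s} (\<lambda>r. ft v r)"
    if "s \<in> {0..<T}" for v s
  proof -
    have p: "continuous_on {0..s} (\<lambda>r. (v, r))" "(\<lambda>r. (v, r)) ` {0..s} \<subseteq> UNIV \<times> {0..<T}"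
      using that by (auto intro!: continuous_intros)
    show "continuous_on {0..s} (\<lambda>r. ftu v r)" "continuous_on {0..s} (\<lambda>r. ft v r)"
      using continuous_on_compose2[OF ctu p] continuous_on_compose2[OF ct p] by simp_all
  qed
  have eq: "fu v s = fu v 0 + integral {0..s} (\<lambda>r. ftu v r)" if s: "s \<in> {0..<T}" for v s
  proof -
    have ftc: "f w s = f w 0 + integral {0..s} (\<lambda>r. ft w r)" for w
    proof -
      have "((\<lambda>r. ft w r) has_integral f w s - f w 0) {0..s}"
      proof (rule fundamental_theorem_of_calculus)
        show "((\<lambda>s. f w s) has_vector_derivative ft w x) (at x within {0..s})" if "x \<in> {0..s}" for x
          by (rule has_vector_derivative_within_subset[OF dt]) (use that s in auto)
      qed (use s in auto)
      then show ?thesis by (simp add: integral_unique)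
    qed
    have "((\<lambda>w. integral (cbox 0 s) (ft w)) has_vector_derivative integral (cbox 0 s) (ftu v)) (at v within UNIV)"
    proof (rule leibniz_rule_vector_derivative)
      show "((\<lambda>w. ft w r) has_vector_derivative ftu w r) (at w within UNIV)" if "r \<in> cbox 0 s" for w r
        using dtu[of r w] that s by auto
      show "ft w integrable_on cbox 0 s" for w
        using cont1[OF s] by (auto intro: integrable_continuous_interval)
      show "continuous_on (UNIV \<times> cbox 0 s) (\<lambda>(w, r). ftu w r)"
        by (rule continuous_on_subset[OF ctu]) (use s in auto)
    qed auto
    then have "((\<lambda>w. f w 0 + integral {0..s} (\<lambda>r. ft w r)) has_vector_derivative
        fu v 0 + integral {0..s} (\<lambda>r. ftu v r)) (at v)"
      using du[of 0 v] s by (intro has_vector_derivative_add) auto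
    then have "((\<lambda>w. f w s) has_vector_derivative fu v 0 + integral {0..s} (\<lambda>r. ftu v r)) (at v)"
      using ftc by simp
    from vector_derivative_unique_at[OF du[OF s] this] show ?thesis .
  qed
  define s where "s = (t + T) / 2"
  have s: "t < s" "s \<in> {0..<T}" using t by (auto simp: s_def)
  have "((\<lambda>x. integral {0..x} (\<lambda>r. ftu u r)) has_vector_derivative ftu u t) (at t within {0..s})"
    by (rule integral_has_vector_derivative[OF cont1(1)[OF s(2)]]) (use s t in auto)
  then have "((\<lambda>x. fu u 0 + integral {0..x} (\<lambda>r. ftu u r)) has_vector_derivative ftu u t) (at t within {0..s})"
    using has_vector_derivative_add[OF has_vector_derivative_const] by fastforce
  then have "((\<lambda>x. fu u x) has_vector_derivative ftu u t) (at t within {0..s})"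
  proof (rule has_vector_derivative_transform[rotated 2, of _ "ftu u t" t "{0..s}", unfolded add_0])
    show "fu u x = fu u 0 + integral {0..x} (\<lambda>r. ftu u r)" if "x \<in> {0..s}" for x
      by (rule eq) (use that s in auto)
  qed (use s t in auto)
  moreover have "at t within {0..s} = at t within {0..<T}"
    by (rule at_within_nhd[where S = "{..<s}"]) (use s in auto)
  ultimately show ?thesis by simp
qed

lemma periodic_derivative:
  assumes "\<And>u. f (u + p) = f u" "\<And>u. (f has_vector_derivative f' u) (at u)"
  shows "f' (u + p) = f' u"
proof -
  have "((\<lambda>v. f (v + p)) has_vector_derivative f' (u + p)) (at u)"
    using vector_diff_chain_at[of "\<lambda>v. v + p" 1 u f "f' (u + p)"] assms(2)[of "u + p"]
    by (simp add: o_def has_vector_derivative_add_const has_vector_derivative_id)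
  then show ?thesis using assms by (simp add: vector_derivative_unique_at)
qed

text \<open>V is at once the velocity and the curvature vector; \<open>V_eq\<close> is the second
  arc length derivative expressed in the parameter u. By exchange of derivatives V1 and V2 are also
  the time derivatives of g1 and g2.\<close>

locale space_flow =
  fixes g g1 g2 V V1 V2 :: "real \<Rightarrow> real \<Rightarrow> 'a::euclidean_space" and T :: real
  assumes T_pos: "0 < T"
    and per: "t \<in> {0..<T} \<Longrightarrow> g (u + 2 * pi) t = g u t"
    and cont_g: "continuous_on (UNIV \<times> {0..<T}) (\<lambda>(u, t). g u t)"
    and cont_g1: "continuous_on (UNIV \<times> {0..<T}) (\<lambda>(u, t). g1 u t)"
    and cont_g2: "continuous_on (UNIV \<times> {0..<T}) (\<lambda>(u, t). g2 u t)"
    and cont_V: "continuous_on (UNIV \<times> {0..<T}) (\<lambda>(u, t). V u t)"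
    and cont_V1: "continuous_on (UNIV \<times> {0..<T}) (\<lambda>(u, t). V1 u t)"
    and g_u: "t \<in> {0..<T} \<Longrightarrow> ((\<lambda>v. g v t) has_vector_derivative g1 u t) (at u)"
    and g1_u: "t \<in> {0..<T} \<Longrightarrow> ((\<lambda>v. g1 v t) has_vector_derivative g2 u t) (at u)"
    and V_u: "t \<in> {0..<T} \<Longrightarrow> ((\<lambda>v. V v t) has_vector_derivative V1 u t) (at u)"
    and V1_u: "t \<in> {0..<T} \<Longrightarrow> ((\<lambda>v. V1 v t) has_vector_derivative V2 u t) (at u)"
    and g_t: "t \<in> {0..<T} \<Longrightarrow> ((\<lambda>s. g u s) has_vector_derivative V u t) (at t within {0..<T})"
    and g1_t: "t \<in> {0..<T} \<Longrightarrow> ((\<lambda>s. g1 u s) has_vector_derivative V1 u t) (at t within {0..<T})"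
    and g2_t: "t \<in> {0..<T} \<Longrightarrow> ((\<lambda>s. g2 u s) has_vector_derivative V2 u t) (at t within {0..<T})"
    and g1_nz: "t \<in> {0..<T} \<Longrightarrow> g1 u t \<noteq> 0"
    and V_eq: "t \<in> {0..<T} \<Longrightarrow> V u t = inverse ((norm (g1 u t))\<^sup>2) *\<^sub>R g2 u t
      - (inner (g1 u t) (g2 u t) / (norm (g1 u t)) ^ 4) *\<^sub>R g1 u t"

lemma curvature_vector_eq:
  fixes c :: "real \<Rightarrow> 'a::euclidean_space"
  assumes c: "\<And>u. (c has_vector_derivative c1 u) (at u)" "\<And>u. (c1 has_vector_derivative c2 u) (at u)"
    and nz: "\<And>u. c1 u \<noteq> 0"
  shows "curvature_vector c u = inverse ((norm (c1 u))\<^sup>2) *\<^sub>R c2 u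
      - (inner (c1 u) (c2 u) / (norm (c1 u)) ^ 4) *\<^sub>R c1 u"
proof -
  have v: "vector_derivative c (at u) = c1 u" for u using c(1) by (rule vector_derivative_at)
  have arc: "arc_deriv c c = (\<lambda>u. inverse (norm (c1 u)) *\<^sub>R c1 u)" by (simp add: arc_deriv_def v)
  have n': "((\<lambda>u. norm (c1 u)) has_real_derivative inner (c2 u) (sgn (c1 u))) (at u)"
    using has_derivative_compose[OF c(2)[of u, unfolded has_vector_derivative_def] has_derivative_norm[OF nz]]
    by (simp add: has_field_derivative_def mult_commute_abs)
  have i: "((\<lambda>u. inverse (norm (c1 u))) has_real_derivative - (inner (c2 u) (sgn (c1 u)) / (norm (c1 u))\<^sup>2)) (at u)"
    by (rule derivative_eq_intros n' refl)+ (use nz in \<open>auto simp: power2_eq_square field_simps\<close>)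
  have "((\<lambda>u. inverse (norm (c1 u)) *\<^sub>R c1 u) has_vector_derivative
      inverse (norm (c1 u)) *\<^sub>R c2 u + (- (inner (c2 u) (sgn (c1 u)) / (norm (c1 u))\<^sup>2)) *\<^sub>R c1 u) (at u)"
    by (rule has_vector_derivative_scaleR[OF i c(2)])
  then have vd: "vector_derivative (arc_deriv c c) (at u) =
      inverse (norm (c1 u)) *\<^sub>R c2 u + (- (inner (c2 u) (sgn (c1 u)) / (norm (c1 u))\<^sup>2)) *\<^sub>R c1 u"
    unfolding arc by (rule vector_derivative_at)
  have "inverse (norm (c1 u)) * (- (inner (c2 u) (sgn (c1 u)) / (norm (c1 u))\<^sup>2))
      = - (inner (c1 u) (c2 u) / (norm (c1 u)) ^ 4)"
    using nz[of u] by (simp add: sgn_div_norm inner_commute field_simps power2_eq_square power4_eq_xxxx)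
  moreover have "inverse (norm (c1 u)) * inverse (norm (c1 u)) = inverse ((norm (c1 u))\<^sup>2)"
    by (simp add: power2_eq_square)
  ultimately show ?thesis
    unfolding curvature_vector_def arc_deriv_def[of c "arc_deriv c c"] v vd scaleR_add_right scaleR_scaleR
    by simp
qed

lemma CSF_space_flow:
  fixes \<gamma> :: "real \<Rightarrow> real \<Rightarrow> 'a::euclidean_space"
  assumes "CSF T \<gamma>"
  obtains g1 g2 V V1 V2 where "space_flow \<gamma> g1 g2 V V1 V2 T"
    "\<And>u t. t \<in> {0..<T} \<Longrightarrow> curvature (\<lambda>v. \<gamma> v t) u = norm (V u t)"
proof -
  let ?B = "{0..<T}"
  define G where "G = (\<lambda>i m. mixed_deriv UNIV ?B i m \<gamma>)"
  note csf = assms[unfolded CSF_def]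
  have T: "0 < T" using csf by auto
  have sm: "smooth_on UNIV ?B \<gamma>" using csf by auto
  have cont: "continuous_on (UNIV \<times> ?B) (\<lambda>(u, t). G i m u t)" for i m
    using sm by (auto simp: smooth_on_def G_def)
  have du: "((\<lambda>v. G i m v t) has_vector_derivative G (Suc i) m u t) (at u)" if "t \<in> ?B" for i m u t
  proof -
    have "(\<lambda>v. G i m v t) differentiable (at u)" using sm that by (auto simp: smooth_on_def G_def)
    moreover have "G (Suc i) m u t = vector_derivative (\<lambda>v. G i m v t) (at u)"
      by (simp add: G_def mixed_deriv_def deriv_fst_def)
    ultimately show ?thesis by (simp add: vector_derivative_works)
  qed
  have dt0: "((\<lambda>s. G 0 m u s) has_vector_derivative G 0 (Suc m) u t) (at t within ?B)" if "t \<in> ?B" for m u t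
  proof -
    have "(\<lambda>s. G 0 m u s) differentiable (at t within ?B)" using sm that by (auto simp: smooth_on_def G_def)
    moreover have "G 0 (Suc m) u t = vector_derivative (\<lambda>s. G 0 m u s) (at t within ?B)"
      by (simp add: G_def mixed_deriv_def deriv_snd_def)
    ultimately show ?thesis by (simp add: vector_derivative_works)
  qed
  have dt: "((\<lambda>s. G i m u s) has_vector_derivative G i (Suc m) u t) (at t within ?B)" if "t \<in> ?B" for i m u t
    using that
  proof (induction i arbitrary: u t)
    case (Suc i)
    show ?case
      by (rule partial_derivatives_commute[OF Suc.IH du du cont cont Suc.prems])
  qed (rule dt0)
  have G0: "G 0 0 = \<gamma>" by (simp add: G_def mixed_deriv_def)
  have nz: "G 1 0 u t \<noteq> 0" if "t \<in> ?B" for u t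
    using csf that vector_derivative_at[OF du[OF that, of 0 0 u]] by (auto simp: G0)
  have cv: "curvature_vector (\<lambda>v. \<gamma> v t) u = G 0 1 u t" if t: "t \<in> ?B" for u t
  proof -
    have "((\<lambda>s. \<gamma> u s) has_vector_derivative curvature_vector (\<lambda>v. \<gamma> v t) u) (at t within ?B)"
      using csf t by auto
    moreover have "((\<lambda>s. \<gamma> u s) has_vector_derivative G 0 1 u t) (at t within ?B)"
      using dt[OF t, of 0 0 u] by (simp add: G0)
    moreover have "at t within ?B \<noteq> bot"
    proof -
      have "{t<..<T} \<subseteq> ?B" "t < T" using t by auto
      moreover from this have "at t within {t<..<T} \<noteq> bot" by (simp add: at_within_eq_bot_iff closure_greaterThanLessThan)
      ultimately show ?thesis by (metis at_le bot.extremum_uniqueI)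
    qed
    ultimately show ?thesis by (rule vector_derivative_unique_within[rotated])
  qed
  show thesis
  proof (rule that)
    show "space_flow \<gamma> (G 1 0) (G 2 0) (G 0 1) (G 1 1) (G 2 1) T"
    proof
      fix u t assume t: "t \<in> ?B"
      have "curvature_vector (\<lambda>v. G 0 0 v t) u = inverse ((norm (G 1 0 u t))\<^sup>2) *\<^sub>R G 2 0 u t
        - (inner (G 1 0 u t) (G 2 0 u t) / (norm (G 1 0 u t)) ^ 4) *\<^sub>R G 1 0 u t"
        by (rule curvature_vector_eq) (use du[OF t] nz[OF t] in \<open>simp_all add: numeral_2_eq_2\<close>)
      then show "G 0 1 u t = inverse ((norm (G 1 0 u t))\<^sup>2) *\<^sub>R G 2 0 u t
        - (inner (G 1 0 u t) (G 2 0 u t) / (norm (G 1 0 u t)) ^ 4) *\<^sub>R G 1 0 u t"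
        using cv[OF t] by (simp add: G0)
    next
      fix u t assume t: "t \<in> ?B"
      show "\<gamma> (u + 2 * pi) t = \<gamma> u t" using csf t by blast
      show "G 1 0 u t \<noteq> 0" by (rule nz[OF t])
      show "((\<lambda>v. \<gamma> v t) has_vector_derivative G 1 0 u t) (at u)" using du[OF t, of 0 0] by (simp only: G0 One_nat_def)
      show "((\<lambda>v. G 1 0 v t) has_vector_derivative G 2 0 u t) (at u)"
        "((\<lambda>v. G 1 1 v t) has_vector_derivative G 2 1 u t) (at u)"
        using du[OF t, of 1] by (simp_all only: numeral_2_eq_2 One_nat_def)
      show "((\<lambda>v. G 0 1 v t) has_vector_derivative G 1 1 u t) (at u)" using du[OF t, of 0] by (simp only: One_nat_def)
      show "((\<lambda>s. \<gamma> u s) has_vector_derivative G 0 1 u t) (at t within ?B)"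
        using dt[OF t, of 0 0] by (simp only: G0 One_nat_def)
      show "((\<lambda>s. G 1 0 u s) has_vector_derivative G 1 1 u t) (at t within ?B)"
        "((\<lambda>s. G 2 0 u s) has_vector_derivative G 2 1 u t) (at t within ?B)"
        using dt[OF t, of _ 0] by (simp_all only: One_nat_def)
    qed (use T cont[of 0 0] in \<open>simp_all only: cont G0\<close>)
    show "curvature (\<lambda>v. \<gamma> v t) u = norm (G 0 1 u t)" if "t \<in> ?B" for u t
      using cv[OF that] by (simp add: curvature_def)
  qed
qed

section \<open>A curvature estimate\<close>

lemma bessel_two:
  fixes x y z :: "'a::real_inner"
  assumes "inner x y = 0" "x \<noteq> 0" "y \<noteq> 0"
  shows "(inner z x)\<^sup>2 / (norm x)\<^sup>2 + (inner z y)\<^sup>2 / (norm y)\<^sup>2 \<le> (norm z)\<^sup>2"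
proof -
  define \<alpha> \<beta> where "\<alpha> = inner z x / (norm x)\<^sup>2" and "\<beta> = inner z y / (norm y)\<^sup>2"
  have a: "\<alpha> * (norm x)\<^sup>2 = inner z x" "\<beta> * (norm y)\<^sup>2 = inner z y" using assms by (auto simp: \<alpha>_def \<beta>_def)
  have "0 \<le> inner (z - \<alpha> *\<^sub>R x - \<beta> *\<^sub>R y) (z - \<alpha> *\<^sub>R x - \<beta> *\<^sub>R y)" by simp
  also have "\<dots> = (norm z)\<^sup>2 - 2 * \<alpha> * inner z x - 2 * \<beta> * inner z y
      + \<alpha> * (\<alpha> * (norm x)\<^sup>2) + \<beta> * (\<beta> * (norm y)\<^sup>2)"
    using assms(1) by (simp add: power2_norm_eq_inner inner_diff inner_commute algebra_simps)
  also have "\<dots> = (norm z)\<^sup>2 - \<alpha> * inner z x - \<beta> * inner z y" unfolding a by simp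
  finally show ?thesis by (simp add: \<alpha>_def \<beta>_def power2_eq_square)
qed

lemma wedge_inner: "wedge p q = inner (\<i> * p) q"
  by (simp add: wedge_alt inner_complex_def times_complex.sel)

lemma bilinear_wedge: "bounded_bilinear wedge"
  unfolding wedge_inner by (rule bounded_bilinear.comp1[OF bounded_bilinear_inner bounded_linear_mult_right])

lemma wedge_le: "\<bar>wedge p q\<bar> \<le> cmod p * cmod q"
  unfolding wedge_def using abs_Im_le_cmod[of "cnj p * q"] by (simp add: norm_mult)

lemma has_real_derivative_inner:
  assumes "(f has_vector_derivative f') (at x within S)" "(h has_vector_derivative h') (at x within S)"
  shows "((\<lambda>x. inner (f x) (h x)) has_real_derivative inner (f x) h' + inner f' (h x)) (at x within S)"
  using bounded_bilinear.has_vector_derivative[OF bounded_bilinear_inner assms]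
  by (simp add: has_real_derivative_iff_has_vector_derivative)

lemma has_real_derivative_wedge:
  assumes "(f has_vector_derivative f') (at x within S)" "(h has_vector_derivative h') (at x within S)"
  shows "((\<lambda>x. wedge (f x) (h x)) has_real_derivative wedge (f x) h' + wedge f' (h x)) (at x within S)"
  using bounded_bilinear.has_vector_derivative[OF bilinear_wedge assms]
  by (simp add: has_real_derivative_iff_has_vector_derivative)

lemma has_real_derivative_norm:
  assumes "(f has_vector_derivative f') (at x within S)" "f x \<noteq> 0"
  shows "((\<lambda>x. norm (f x)) has_real_derivative inner (f x) f' / norm (f x)) (at x within S)"
proof -
  have "((\<lambda>x. norm (f x)) has_derivative (\<lambda>h. inner (h *\<^sub>R f') (sgn (f x)))) (at x within S)"
    by (rule has_derivative_compose[OF assms(1)[unfolded has_vector_derivative_def] has_derivative_norm[OF assms(2)]])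
  moreover have "(\<lambda>h. inner (h *\<^sub>R f') (sgn (f x))) = (*) (inner (f x) f' / norm (f x))"
    by (auto simp: fun_eq_iff sgn_div_norm inner_commute divide_inverse)
  ultimately show ?thesis by (simp add: has_field_derivative_def)
qed

section \<open>Evolution of speed and curvature\<close>

context space_flow
begin

lemma orthogonal: "t \<in> {0..<T} \<Longrightarrow> inner (g1 u t) (V u t) = 0"
  using g1_nz[of t u]
  by (simp add: V_eq inner_diff_right power2_norm_eq_inner[symmetric] power2_eq_square power4_eq_xxxx field_simps)

lemma inner_g2_V:
  assumes t: "t \<in> {0..<T}"
  shows "inner (g2 u t) (V u t) = (norm (g1 u t))\<^sup>2 * (norm (V u t))\<^sup>2"
proof -
  have "(norm (V u t))\<^sup>2 = inner (V u t) (V u t)" by (simp add: power2_norm_eq_inner)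
  also have "\<dots> = inner (V u t) (inverse ((norm (g1 u t))\<^sup>2) *\<^sub>R g2 u t
      - (inner (g1 u t) (g2 u t) / (norm (g1 u t)) ^ 4) *\<^sub>R g1 u t)"
    by (subst (2) V_eq[OF t]) simp
  also have "\<dots> = inverse ((norm (g1 u t))\<^sup>2) * inner (g2 u t) (V u t)"
    using orthogonal[OF t, of u] by (simp add: inner_diff_right inner_commute)
  finally show ?thesis using g1_nz[OF t, of u] by (simp add: field_simps)
qed

text \<open>Obtained by differentiating the orthogonality of g1 and V along the curve; it gives the
  rate at which the arc length element shrinks.\<close>

lemma inner_g1_V1:
  assumes t: "t \<in> {0..<T}"
  shows "inner (g1 u t) (V1 u t) = - ((norm (g1 u t))\<^sup>2 * (norm (V u t))\<^sup>2)"
proof -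
  have "((\<lambda>v. inner (g1 v t) (V v t)) has_real_derivative inner (g1 u t) (V1 u t) + inner (g2 u t) (V u t)) (at u)"
    by (rule has_real_derivative_inner[OF g1_u[OF t] V_u[OF t]])
  moreover have "((\<lambda>v. inner (g1 v t) (V v t)) has_real_derivative 0) (at u)"
    using orthogonal[OF t] by simp
  ultimately have "inner (g1 u t) (V1 u t) + inner (g2 u t) (V u t) = 0" by (rule DERIV_unique)
  then show ?thesis using inner_g2_V[OF t, of u] by simp
qed

lemma speed_t:
  assumes t: "t \<in> {0..<T}"
  shows "((\<lambda>s. norm (g1 u s)) has_real_derivative - (norm (g1 u t) * (norm (V u t))\<^sup>2)) (at t within {0..<T})"
  using has_real_derivative_norm[OF g1_t[OF t] g1_nz[OF t], of u] g1_nz[OF t, of u]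
  by (simp add: inner_g1_V1[OF t] power2_eq_square)

text \<open>The terms with V2 and V1 form the second arc length derivative of |V|^2 without its
  gradient part 2 |V1|^2 / |g1|^2. This part reappears with a favourable sign in
  \<open>curvature_estimate\<close>.\<close>

lemma curvature_sq_t:
  assumes t: "t \<in> {0..<T}"
  shows "((\<lambda>s. inner (V u s) (V u s)) has_real_derivative
      4 * (inner (V u t) (V u t))\<^sup>2 + 2 * inner (V u t) (V2 u t) / (norm (g1 u t))\<^sup>2
      - 2 * inner (g1 u t) (g2 u t) / (norm (g1 u t)) ^ 4 * inner (V u t) (V1 u t)) (at t within {0..<T})"
proof -
  let ?D = "\<lambda>f f'. (f has_real_derivative f') (at t within {0..<T})"
  define n where "n = norm (g1 u t)"
  define k where "k = inner (V u t) (V u t)"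
  have n: "n \<noteq> 0" using g1_nz[OF t] by (simp add: n_def)
  have sp: "?D (\<lambda>s. norm (g1 u s)) (- (n * k))"
    using speed_t[OF t, of u] by (simp add: n_def k_def power2_norm_eq_inner)
  have a: "?D (\<lambda>s. inverse ((norm (g1 u s))\<^sup>2)) (2 * k / n\<^sup>2)"
    by (rule derivative_eq_intros sp refl)+ (use n in \<open>auto simp: n_def power2_eq_square field_simps\<close>)
  \<comment> \<open>Existence of b' suffices: it multiplies g1, which is orthogonal to V.\<close>
  obtain b' where b: "?D (\<lambda>s. inner (g1 u s) (g2 u s) / (norm (g1 u s)) ^ 4) b'"
  proof -
    have "?D (\<lambda>s. (norm (g1 u s)) ^ 4) (4 * (n ^ 3 * - (n * k)))"
      by (rule derivative_eq_intros sp refl)+ (simp add: n_def)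
    from DERIV_quotient[OF has_real_derivative_inner[OF g1_t[OF t] g2_t[OF t]] this] show thesis
      using n by (intro that) (simp add: n_def)
  qed
  define V' where "V' = (inverse (n\<^sup>2) *\<^sub>R V2 u t + (2 * k / n\<^sup>2) *\<^sub>R g2 u t)
      - ((inner (g1 u t) (g2 u t) / n ^ 4) *\<^sub>R V1 u t + b' *\<^sub>R g1 u t)"
  have "((\<lambda>s. inverse ((norm (g1 u s))\<^sup>2) *\<^sub>R g2 u s
      - (inner (g1 u s) (g2 u s) / (norm (g1 u s)) ^ 4) *\<^sub>R g1 u s) has_vector_derivative V') (at t within {0..<T})"
    unfolding V'_def n_def
    by (rule has_vector_derivative_diff has_vector_derivative_scaleR a[unfolded n_def] b g2_t[OF t] g1_t[OF t])+
  then have V_t: "((\<lambda>s. V u s) has_vector_derivative V') (at t within {0..<T})"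
    by (rule has_vector_derivative_transform[rotated 2]) (use t V_eq in auto)
  have "inner V' (V u t) = 2 * k\<^sup>2 + inner (V u t) (V2 u t) / n\<^sup>2
      - inner (g1 u t) (g2 u t) / n ^ 4 * inner (V u t) (V1 u t)"
  proof -
    have "inner (g2 u t) (V u t) = n\<^sup>2 * k" using inner_g2_V[OF t, of u] by (simp add: n_def k_def power2_norm_eq_inner)
    moreover have "n * (n * (inverse n * inverse n)) = 1"
    proof -
      have "n * (n * (inverse n * inverse n)) = (n * inverse n) * (n * inverse n)" by (simp only: mult_ac)
      then show ?thesis unfolding right_inverse[OF n] by (simp only: mult_1_left)
    qed
    ultimately show ?thesis
      using orthogonal[OF t, of u]
      by (simp add: V'_def inner_diff_left inner_add_left inner_diff_right inner_add_right inner_commute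
          power2_eq_square divide_inverse algebra_simps)
  qed
  then have "inner (V u t) V' + inner V' (V u t) = 4 * k\<^sup>2 + 2 * inner (V u t) (V2 u t) / n\<^sup>2
      - 2 * inner (g1 u t) (g2 u t) / n ^ 4 * inner (V u t) (V1 u t)"
    by (simp add: inner_commute[of "V u t" V'])
  with has_real_derivative_inner[OF V_t V_t] show ?thesis
    unfolding n_def[symmetric] k_def[symmetric] by (rule DERIV_cong)
qed

lemma periodic_g1: "t \<in> {0..<T} \<Longrightarrow> g1 (u + 2 * pi) t = g1 u t"
  by (rule periodic_derivative[OF per g_u])

lemma periodic_g2: "t \<in> {0..<T} \<Longrightarrow> g2 (u + 2 * pi) t = g2 u t"
  by (rule periodic_derivative[OF periodic_g1 g1_u])

lemma periodic_V: "t \<in> {0..<T} \<Longrightarrow> V (u + 2 * pi) t = V u t"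
  by (simp add: V_eq periodic_g1 periodic_g2)

text \<open>Tso's trick: the maximum principle is applied to \<open>(t - t1) |V|\<^sup>2 / (G - h)\<^sup>2\<close> with the support function
  \<open>G = wedge (P g1) (m - P g) / |g1|\<close>.\<close>

lemma curvature_estimate:
  fixes P :: "'a \<Rightarrow> complex"
  assumes P: "bounded_linear P" "\<And>x. cmod (P x) \<le> norm x"
    and t: "0 \<le> t1" "t1 < t2" "t2 < T" and h: "0 < h"
    and low: "\<And>u s. s \<in> {t1..t2} \<Longrightarrow> 2 * h * norm (g1 u s) \<le> wedge (P (g1 u s)) (m - P (g u s))"
    and up: "\<And>u. cmod (m - P (g u t2)) \<le> D"
  shows "(norm (V u t2))\<^sup>2 * (t2 - t1) \<le> (1 / h\<^sup>2 + 16 * (t2 - t1) / h ^ 4) * D\<^sup>2"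
proof -
  \<comment> \<open>By the hypothesis \<open>low\<close> the support function is at least 2 * h, so
    w is at least h.\<close>
  define w where "w = (\<lambda>u s. wedge (P (g1 u s)) (m - P (g u s)) / norm (g1 u s) - h)"
  define k where "k = (\<lambda>u s. inner (V u s) (V u s))"
  let ?R = "UNIV \<times> {t1..t2}"
  have sT: "s \<in> {0..<T}" if "s \<in> {t1..t2}" for s using that t by auto
  have wh: "h \<le> w u s" if s: "s \<in> {t1..t2}" for u s
    using low[OF s, of u] g1_nz[OF sT[OF s], of u] by (simp add: w_def field_simps)
  have cR: "continuous_on ?R (\<lambda>x. f (fst x) (snd x))"
    if "continuous_on (UNIV \<times> {0..<T}) (\<lambda>(u, t). f u t)" for f :: "real \<Rightarrow> real \<Rightarrow> 'a"
  proof -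
    have "?R \<subseteq> UNIV \<times> {0..<T}" using t by auto
    from continuous_on_subset[OF that this] show ?thesis by (simp add: case_prod_unfold)
  qed
  note cP = bounded_linear.continuous_on[OF P(1)]
  have cw: "continuous_on ?R (\<lambda>x. w (fst x) (snd x))"
    unfolding w_def
    by (intro continuous_intros bounded_bilinear.continuous_on[OF bilinear_wedge] cP cR[OF cont_g] cR[OF cont_g1])
      (use g1_nz sT in auto)
  have ck: "continuous_on ?R (\<lambda>x. k (fst x) (snd x))"
    unfolding k_def by (intro continuous_intros cR[OF cont_V])
  define q where "q = (\<lambda>u s. (s - t1) * k u s / (w u s)\<^sup>2)"
  have w_nz: "w u s \<noteq> 0" if "s \<in> {t1..t2}" for u s using wh[OF that, of u] h by auto
  have "continuous_on ?R (\<lambda>x. - q (fst x) (snd x))"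
    unfolding q_def by (intro continuous_intros cw ck) (use w_nz in auto)
  then obtain u0 s0 where s0: "(u0, s0) \<in> ?R" and max: "\<And>v s. (v, s) \<in> ?R \<Longrightarrow> - q u0 s0 \<le> - q v s"
    by (rule periodic_region_min[of ?R t1 t2 "\<lambda>u s. - q u s", unfolded case_prod_unfold, rotated 3])
      (use t per periodic_g1 periodic_V sT in \<open>auto simp: closed_Times q_def w_def k_def\<close>)
  define K where "K = q u0 s0"
  have s0': "s0 \<in> {t1..t2}" using s0 by auto
  note s0T = sT[OF s0']
  have "K \<le> 1 / h\<^sup>2 + 16 * (t2 - t1) / h ^ 4"
  proof (rule ccontr)
    assume "\<not> ?thesis"
    \<comment> \<open>The two summands serve different ends: \<open>1 / h\<^sup>2 \<le> K\<close>
      absorbs the term K1 that comes from differentiating s - t1, and the other one is contradicted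
      in the end.\<close>
    then have K: "1 / h\<^sup>2 + 16 * (t2 - t1) / h ^ 4 < K" by simp
    have K0: "0 < 1 / h\<^sup>2" "0 \<le> 16 * (t2 - t1) / h ^ 4" using h t by auto
    then have Kpos: "0 < K" "1 / h\<^sup>2 \<le> K" "16 * (t2 - t1) / h ^ 4 < K" using K by linarith+
    define \<theta> where "\<theta> = s0 - t1"
    have "\<theta> \<noteq> 0" using Kpos(1) by (auto simp: K_def q_def \<theta>_def)
    then have \<theta>: "0 < \<theta>" "\<theta> \<le> t2 - t1" using s0 by (auto simp: \<theta>_def)
    \<comment> \<open>With K the maximum of q, this function is nonnegative and vanishes at the
      maximum point; differentiating it avoids derivatives of the quotient.\<close>
    define f where "f = (\<lambda>u s. K * (w u s)\<^sup>2 - (s - t1) * k u s)"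
    have f0: "f u0 s0 = 0" using w_nz[OF s0', of u0] by (simp add: f_def K_def q_def)
    have min: "f u0 s0 \<le> f v s" if vs: "(v, s) \<in> ?R" for v s
    proof -
      have "q v s \<le> K" using max[OF vs] by (simp add: K_def)
      then have "(s - t1) * k v s \<le> K * (w v s)\<^sup>2"
        using w_nz[of s v] vs by (simp add: q_def pos_divide_le_eq)
      then show ?thesis unfolding f0 by (simp add: f_def)
    qed
    define N where "N = (\<lambda>v. norm (g1 v s0))"
    have N: "N v \<noteq> 0" for v using g1_nz[OF s0T, of v] by (simp add: N_def)
    have N_u: "(N has_real_derivative inner (g1 v s0) (g2 v s0) / N v) (at v)" for v
      unfolding N_def by (rule has_real_derivative_norm[OF g1_u[OF s0T] g1_nz[OF s0T]])
    note Pu = bounded_linear.has_vector_derivative[OF P(1)]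
    note d0 = has_vector_derivative_diff[OF has_vector_derivative_const[of m] Pu[OF g_u[OF s0T]], unfolded diff_0]
    define w1 where "w1 = (\<lambda>v. N v * wedge (P (V v s0)) (m - P (g v s0)))"
    have w_u: "((\<lambda>v. w v s0) has_real_derivative w1 v) (at v)" for v
    proof -
      have J: "((\<lambda>v. wedge (P (g1 v s0)) (m - P (g v s0))) has_real_derivative
          wedge (P (g2 v s0)) (m - P (g v s0))) (at v)"
        using has_real_derivative_wedge[OF Pu[OF g1_u[OF s0T]] d0, of v] by (simp add: wedge_alt)
      have PV: "P (V v s0) = inverse ((N v)\<^sup>2) *\<^sub>R P (g2 v s0)
          - (inner (g1 v s0) (g2 v s0) / (N v) ^ 4) *\<^sub>R P (g1 v s0)"
        unfolding V_eq[OF s0T] N_def using P(1) by (simp add: bounded_linear.linear linear_diff linear_scale)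
      have lin: "wedge (x *\<^sub>R p - y *\<^sub>R p') z = x * wedge p z - y * wedge p' z" for x y p p' z
        by (simp add: wedge_alt algebra_simps)
      have "w1 v = (wedge (P (g2 v s0)) (m - P (g v s0)) * N v
          - wedge (P (g1 v s0)) (m - P (g v s0)) * (inner (g1 v s0) (g2 v s0) / N v)) / (N v * N v)"
        unfolding w1_def PV lin using N[of v] by (simp add: field_simps power2_eq_square power4_eq_xxxx)
      then show ?thesis
        using DERIV_diff[OF DERIV_quotient[OF J N_u N] DERIV_const[of h]]
        unfolding w_def N_def[symmetric] by (simp add: N_def mult.commute)
    qed
    define q1 where "q1 = wedge (P (V u0 s0)) (m - P (g u0 s0))"
    define q2 where "q2 = wedge (P (V1 u0 s0)) (m - P (g u0 s0)) + wedge (P (g1 u0 s0)) (P (V u0 s0))"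
    define n where "n = N u0"
    define r where "r = inner (g1 u0 s0) (g2 u0 s0)"
    have n: "0 < n" using N[of u0] by (simp add: n_def N_def)
    have w1_u: "(w1 has_real_derivative r / n * q1 + n * q2) (at u0)"
    proof -
      have "((\<lambda>v. wedge (P (V v s0)) (m - P (g v s0))) has_real_derivative q2) (at u0)"
        using has_real_derivative_wedge[OF Pu[OF V_u[OF s0T]] d0, of u0]
        by (simp add: q2_def wedge_alt algebra_simps)
      from DERIV_mult[OF N_u this] show ?thesis unfolding w1_def q1_def n_def r_def by (simp add: mult.commute)
    qed
    define fu where "fu = (\<lambda>v. 2 * K * w v s0 * w1 v - \<theta> * (2 * inner (V v s0) (V1 v s0)))"
    define W K1 where "W = w u0 s0" and "K1 = k u0 s0"
    define fuu where "fuu = 2 * K * ((w1 u0)\<^sup>2 + W * (r / n * q1 + n * q2))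
      - \<theta> * (2 * (inner (V1 u0 s0) (V1 u0 s0) + inner (V u0 s0) (V2 u0 s0)))"
    define kt where "kt = 4 * K1\<^sup>2 + 2 * inner (V u0 s0) (V2 u0 s0) / n\<^sup>2 - 2 * r / n ^ 4 * inner (V u0 s0) (V1 u0 s0)"
    define wt where "wt = K1 * (W + h) + (q2 - 2 * wedge (P (g1 u0 s0)) (P (V u0 s0))) / n"
    define ft where "ft = 2 * K * W * wt - K1 - \<theta> * kt"
    have f_u: "((\<lambda>v. f v s0) has_real_derivative fu v) (at v)" for v
      unfolding f_def fu_def k_def \<theta>_def
      by (rule derivative_eq_intros w_u has_real_derivative_inner[OF V_u[OF s0T] V_u[OF s0T]] refl)+
        (simp add: inner_commute algebra_simps)
    have f_uu: "(fu has_real_derivative fuu) (at u0)"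
      unfolding fu_def fuu_def W_def
      by (rule derivative_eq_intros w_u w1_u has_real_derivative_inner[OF V_u[OF s0T] V1_u[OF s0T]] refl)+
        (simp add: power2_eq_square algebra_simps)
    have w_t: "((\<lambda>s. w u0 s) has_real_derivative wt) (at s0 within {0..<T})"
    proof -
      note d1 = has_vector_derivative_diff[OF has_vector_derivative_const[of m] Pu[OF g_t[OF s0T]], unfolded diff_0]
      have J: "((\<lambda>s. wedge (P (g1 u0 s)) (m - P (g u0 s))) has_real_derivative
          q2 - 2 * wedge (P (g1 u0 s0)) (P (V u0 s0))) (at s0 within {0..<T})"
        using has_real_derivative_wedge[OF Pu[OF g1_t[OF s0T]] d1, of u0]
        by (simp add: q2_def wedge_alt algebra_simps)
      have sp: "((\<lambda>s. norm (g1 u0 s)) has_real_derivative - (n * K1)) (at s0 within {0..<T})"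
        using speed_t[OF s0T, of u0] by (simp add: n_def N_def K1_def k_def power2_norm_eq_inner)
      have "wedge (P (g1 u0 s0)) (m - P (g u0 s0)) = n * (W + h)" using n by (simp add: W_def w_def n_def N_def)
      then have "((q2 - 2 * wedge (P (g1 u0 s0)) (P (V u0 s0))) * n
          - wedge (P (g1 u0 s0)) (m - P (g u0 s0)) * - (n * K1)) / (n * n) = wt"
        using n by (simp add: wt_def field_simps)
      then show ?thesis
        using DERIV_diff[OF DERIV_quotient[OF J sp] DERIV_const[of h]] n
        unfolding w_def by (simp add: n_def N_def mult.commute)
    qed
    have f_t: "((\<lambda>s. f u0 s) has_real_derivative ft) (at s0 within {0..<T})"
    proof -
      have kd: "((\<lambda>s. k u0 s) has_real_derivative kt) (at s0 within {0..<T})"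
        using curvature_sq_t[OF s0T, of u0] by (simp add: k_def kt_def K1_def n_def N_def r_def)
      show ?thesis unfolding f_def ft_def W_def K1_def \<theta>_def
        by (rule derivative_eq_intros w_t kd refl)+ (simp add: algebra_simps)
    qed
    have "0 < s0" using \<theta> t by (simp add: \<theta>_def)
    note pm = parabolic_min[where f = f and R = ?R, OF min _ _ always_eventually[rule_format, OF f_u] f_uu f_t this]
    have ev: "\<forall>\<^sub>F s in at_left s0. (u0, s) \<in> ?R"
      using eventually_at_left_interval[of t1 s0 t2] \<theta> s0 by (simp add: \<theta>_def)
    have fu0: "fu u0 = 0" and fuu0: "0 \<le> fuu" and ft0: "ft \<le> 0"
      using pm ev s0 t by auto
    have eqK: "\<theta> * K1 = K * W\<^sup>2" using f0 by (simp add: f_def \<theta>_def K1_def W_def)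
    have W: "h \<le> W" using wh[OF s0'] by (simp add: W_def)
    have "0 < K * W\<^sup>2" using Kpos W h by simp
    then have K1: "0 < K1" using eqK \<theta> by (metis zero_less_mult_pos)
    then have Vnz: "V u0 s0 \<noteq> 0" by (auto simp: K1_def k_def)
    have rel: "\<theta> * inner (V u0 s0) (V1 u0 s0) = K * W * w1 u0" using fu0 by (simp add: fu_def W_def)
    define Y where "Y = inner (V1 u0 s0) (V1 u0 s0)"
    \<comment> \<open>V1 has a tangential component forced by \<open>inner_g1_V1\<close> and,
      orthogonal to it, one along V. By the critical point relation the second cancels
      \<open>K * w1\<^sup>2\<close>; the first absorbs half of the reaction term
      \<open>4 * \<theta> * K1\<^sup>2\<close>.\<close>
    have bessel: "n\<^sup>2 * K1\<^sup>2 + (inner (V u0 s0) (V1 u0 s0))\<^sup>2 / K1 \<le> Y"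
      using bessel_two[OF orthogonal[OF s0T, of u0] g1_nz[OF s0T] Vnz, of "V1 u0 s0"] inner_g1_V1[OF s0T, of u0] n
      by (simp add: Y_def K1_def k_def n_def N_def inner_commute power2_norm_eq_inner[symmetric] power_mult_distrib
          power2_eq_square field_simps)
    have "\<theta> * ((inner (V u0 s0) (V1 u0 s0))\<^sup>2 / K1) = K * (w1 u0)\<^sup>2"
    proof -
      have "\<theta> * K1 * (\<theta> * ((inner (V u0 s0) (V1 u0 s0))\<^sup>2 / K1)) = (\<theta> * inner (V u0 s0) (V1 u0 s0))\<^sup>2"
        using K1 by (simp add: power2_eq_square)
      also have "\<dots> = \<theta> * K1 * (K * (w1 u0)\<^sup>2)" unfolding rel eqK by (simp add: power2_eq_square)
      finally show ?thesis using \<theta> K1 by simp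
    qed
    then have Y: "\<theta> * (n\<^sup>2 * K1\<^sup>2) + K * (w1 u0)\<^sup>2 \<le> \<theta> * Y"
      using mult_left_mono[OF bessel, of \<theta>] \<theta> by (simp add: distrib_left)
    have "ft = fuu / n\<^sup>2 - r / n ^ 4 * fu u0 + 2 * (\<theta> * Y - K * (w1 u0)\<^sup>2) / n\<^sup>2
        + 2 * K * W * K1 * (W + h) - 4 * K * W * (wedge (P (g1 u0 s0)) (P (V u0 s0)) / n) - K1 - 4 * \<theta> * K1\<^sup>2"
    proof -
      have "w1 u0 = n * q1" by (simp add: w1_def n_def q1_def)
      then show ?thesis
        unfolding ft_def fuu_def fu_def wt_def kt_def Y_def[symmetric] W_def[symmetric] using n
        by (simp add: field_simps power2_eq_square power4_eq_xxxx)
    qed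
    moreover have "2 * \<theta> * K1\<^sup>2 \<le> 2 * (\<theta> * Y - K * (w1 u0)\<^sup>2) / n\<^sup>2"
      using Y n by (simp add: field_simps)
    moreover have "0 \<le> fuu / n\<^sup>2" using fuu0 by simp
    \<comment> \<open>Since \<open>K * W\<^sup>2 = \<theta> * K1\<close>, this absorbs the other
      half of the reaction term. What remains is the good term with h: the reason for subtracting h
      from the support function.\<close>
    moreover have "2 * K * W * K1 * (W + h) = 2 * \<theta> * K1\<^sup>2 + 2 * K * W * K1 * h"
      using eqK by (simp add: power2_eq_square algebra_simps)
    moreover have "4 * K * W * (wedge (P (g1 u0 s0)) (P (V u0 s0)) / n) \<le> 4 * K * W * sqrt K1"
    proof -
      have "wedge (P (g1 u0 s0)) (P (V u0 s0)) \<le> cmod (P (g1 u0 s0)) * cmod (P (V u0 s0))"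
        using wedge_le[of "P (g1 u0 s0)" "P (V u0 s0)"] by linarith
      also have "\<dots> \<le> n * sqrt K1"
        unfolding n_def N_def K1_def k_def norm_eq_sqrt_inner[symmetric] by (intro mult_mono P) auto
      finally have "wedge (P (g1 u0 s0)) (P (V u0 s0)) / n \<le> sqrt K1" using n by (simp add: field_simps)
      then show ?thesis using Kpos W h by (intro mult_left_mono) auto
    qed
    ultimately have "2 * K * W * K1 * h \<le> 4 * K * W * sqrt K1 + K1" using ft0 fu0 by simp
    moreover have "K1 \<le> K * W * h * K1"
    proof -
      have "1 \<le> K * h\<^sup>2" using Kpos(2) h by (simp add: field_simps)
      also have "\<dots> \<le> K * W * h" using W h Kpos by (simp add: power2_eq_square)
      finally show ?thesis using K1 by simp
    qed
    ultimately have "(K * W) * (h * K1) \<le> (K * W) * (4 * sqrt K1)" by (simp add: algebra_simps)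
    then have "h * K1 \<le> 4 * sqrt K1" using Kpos W h by simp
    moreover have "sqrt K1 * sqrt K1 = K1" using K1 by simp
    ultimately have "h * sqrt K1 * sqrt K1 \<le> 4 * sqrt K1" by (simp only: mult.assoc)
    then have "h * sqrt K1 \<le> 4" by (rule mult_right_le_imp_le) (use K1 in simp)
    then have "(h * sqrt K1)\<^sup>2 \<le> 4\<^sup>2" using h K1 by (intro power_mono) auto
    then have hK: "h\<^sup>2 * K1 \<le> 16" using K1 by (simp add: power_mult_distrib)
    have "h\<^sup>2 \<le> W\<^sup>2" using W h by (intro power_mono) auto
    then have "K * h\<^sup>2 * h\<^sup>2 \<le> K * W\<^sup>2 * h\<^sup>2"
      using Kpos by (intro mult_right_mono mult_left_mono) auto
    then have "K * (h\<^sup>2 * h\<^sup>2) \<le> (K * W\<^sup>2) * h\<^sup>2" by (simp only: mult.assoc)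
    also have "\<dots> = \<theta> * (h\<^sup>2 * K1)" by (simp flip: eqK)
    also have "\<dots> \<le> (t2 - t1) * 16" using \<theta> hK K1 by (intro mult_mono) auto
    finally have "K \<le> 16 * (t2 - t1) / h ^ 4" using h by (simp add: field_simps power4_eq_xxxx power2_eq_square)
    with Kpos(3) show False by simp
  qed
  moreover have "q u t2 \<le> K" using max[of u t2] t by (simp add: K_def)
  ultimately have "q u t2 \<le> 1 / h\<^sup>2 + 16 * (t2 - t1) / h ^ 4" by simp
  then have 1: "(t2 - t1) * k u t2 \<le> (1 / h\<^sup>2 + 16 * (t2 - t1) / h ^ 4) * (w u t2)\<^sup>2"
    using w_nz[of t2 u] t by (simp add: q_def pos_divide_le_eq)
  have t2: "t2 \<in> {t1..t2}" "t2 \<in> {0..<T}" using t by auto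
  have "wedge (P (g1 u t2)) (m - P (g u t2)) \<le> norm (g1 u t2) * D"
  proof -
    have "wedge (P (g1 u t2)) (m - P (g u t2)) \<le> cmod (P (g1 u t2)) * cmod (m - P (g u t2))"
      using wedge_le[of "P (g1 u t2)" "m - P (g u t2)"] by linarith
    also have "\<dots> \<le> norm (g1 u t2) * D" by (intro mult_mono P up) auto
    finally show ?thesis .
  qed
  then have "wedge (P (g1 u t2)) (m - P (g u t2)) / norm (g1 u t2) \<le> D"
    using g1_nz[OF t2(2), of u] by (simp add: field_simps)
  then have "w u t2 \<le> D" using h by (simp add: w_def)
  then have "(w u t2)\<^sup>2 \<le> D\<^sup>2" using wh[OF t2(1), of u] h by (intro power_mono) auto
  then have "(1 / h\<^sup>2 + 16 * (t2 - t1) / h ^ 4) * (w u t2)\<^sup>2 \<le> (1 / h\<^sup>2 + 16 * (t2 - t1) / h ^ 4) * D\<^sup>2"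
    using t h by (intro mult_left_mono) auto
  with 1 show ?thesis by (simp add: k_def power2_norm_eq_inner mult.commute)
qed

end

section \<open>Preserved area forms\<close>

lemma type_I_from_plane_flow:
  fixes g g1 g2 V V1 V2 :: "real \<Rightarrow> real \<Rightarrow> 'a::euclidean_space" and P :: "'a \<Rightarrow> complex"
  assumes S: "space_flow g g1 g2 V V1 V2 T"
    and F: "plane_flow (\<lambda>u t. P (g u t)) (\<lambda>u t. P (g1 u t)) (\<lambda>u t. P (g2 u t)) a b t0 T \<delta>"
    and P: "bounded_linear P" "\<And>x. cmod (P x) \<le> norm x"
    and t0: "0 \<le> t0" and slope: "\<And>u t. t \<in> {t0..<T} \<Longrightarrow> \<delta> * norm (g1 u t) \<le> cmod (P (g1 u t))"
  obtains C where "\<And>u t. t \<in> {(t0 + T) / 2..<T} \<Longrightarrow> (norm (V u t))\<^sup>2 * (T - t) \<le> C"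
proof -
  interpret S: space_flow g g1 g2 V V1 V2 T by (rule S)
  interpret F: plane_flow "\<lambda>u t. P (g u t)" "\<lambda>u t. P (g1 u t)" "\<lambda>u t. P (g2 u t)" a b t0 T \<delta> by (rule F)
  obtain K \<kappa> where K: "0 < K" "0 < \<kappa>"
    and diam: "\<And>t u v. t \<in> {t0..<T} \<Longrightarrow> cmod (P (g u t) - P (g v t)) \<le> K * sqrt (T - t)"
    and ball: "\<And>t. t \<in> {t0..<T} \<Longrightarrow> \<exists>m. cball m (\<kappa> * sqrt (T - t)) \<subseteq> F.region t"
    using F.size_bounds by metis
  \<comment> \<open>The slope \<delta> passes from the projected to the full speed, and the 2
    matches the factor 2 * h in \<open>curvature_estimate\<close>.\<close>
  define k where "k = \<kappa> * \<delta> / 2"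
  have k: "0 < k" using K F.\<delta>_pos by (simp add: k_def)
  show thesis
  proof (rule that[of "(1 / k\<^sup>2 + 16 / k ^ 4) * K\<^sup>2"])
    fix u t assume t: "t \<in> {(t0 + T) / 2..<T}"
    define r where "r = sqrt (T - t)"
    have r: "0 < r" "r\<^sup>2 = T - t" using t by (auto simp: r_def)
    \<comment> \<open>Looking back by the remaining lifetime makes t - t1 and T - t equal. The disc
      found at time t lies in all regions since t1, because the regions decrease.\<close>
    define t1 where "t1 = t - (T - t)"
    have t1: "t0 \<le> t1" "t1 < t" using t by (auto simp: t1_def)
    have tt: "t \<in> {t0..<T}" using t t1 by auto
    obtain m where m: "cball m (\<kappa> * r) \<subseteq> F.region t" using ball[OF tt] by (auto simp: r_def)
    have h: "0 < k * r" using k r by simp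
    have est: "(norm (V u t))\<^sup>2 * (t - t1) \<le> (1 / (k * r)\<^sup>2 + 16 * (t - t1) / (k * r) ^ 4) * (K * r)\<^sup>2"
    proof (rule S.curvature_estimate[OF P _ t1(2) _ h])
      fix u s assume s: "s \<in> {t1..t}"
      have sT: "s \<in> {t0..<T}" using s t1 t by auto
      have reg: "F.region t \<subseteq> F.region s" using F.region_decreasing[of s t] sT s t by auto
      define c1 where "c1 = P (g1 u s)"
      have c1: "\<delta> * norm (g1 u s) \<le> cmod c1" using slope[OF sT] by (simp add: c1_def)
      moreover have "0 < \<delta> * norm (g1 u s)" using F.\<delta>_pos S.g1_nz[of s u] sT t0 by simp
      ultimately have c1p: "0 < cmod c1" by linarith
      \<comment> \<open>The point of the disc farthest to the right of the tangent direction. It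
        lies in the region, hence left of the tangent, so the centre keeps the distance \<kappa> * r
        from the tangent line.\<close>
      define z where "z = m - of_real (\<kappa> * r / cmod c1) * (\<i> * c1)"
      have "z \<in> cball m (\<kappa> * r)" using K r c1p by (simp add: z_def dist_norm norm_mult norm_divide)
      with m reg have z: "z \<in> F.region s" by blast
      have "0 \<le> wedge c1 (z - P (g u s))"
        using F.tangent_left_weak[OF sT z, of u] by (cases "z = P (g u s)") (auto simp: c1_def wedge_alt)
      also have "wedge c1 (z - P (g u s)) = wedge c1 (m - P (g u s)) - \<kappa> * r / cmod c1 * (cmod c1)\<^sup>2"
        unfolding cmod_power2 z_def
        by (simp add: wedge_alt times_complex.sel power2_eq_square algebra_simps)
      also have "\<kappa> * r / cmod c1 * (cmod c1)\<^sup>2 = \<kappa> * r * cmod c1" using c1p by (simp add: power2_eq_square)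
      finally have "\<kappa> * r * cmod c1 \<le> wedge c1 (m - P (g u s))" by simp
      moreover have "\<kappa> * r * (\<delta> * norm (g1 u s)) \<le> \<kappa> * r * cmod c1" using c1 K r by (intro mult_left_mono) auto
      ultimately show "2 * (k * r) * norm (g1 u s) \<le> wedge (P (g1 u s)) (m - P (g u s))"
        by (simp add: k_def c1_def mult_ac)
    next
      fix u
      have "F.region t \<subseteq> cball (P (g u t)) (K * r)" unfolding F.region_def
        by (rule hull_minimal) (use diam[OF tt] in \<open>auto simp: dist_norm r_def\<close>)
      moreover have "m \<in> F.region t" using m K r by auto
      ultimately show "cmod (m - P (g u t)) \<le> K * r" by (auto simp: dist_norm norm_minus_commute)
    qed (use t1 t0 t in auto)
    have "t - t1 = r\<^sup>2" using r by (simp add: t1_def)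
    moreover have "(1 / (k * r)\<^sup>2 + 16 * r\<^sup>2 / (k * r) ^ 4) * (K * r)\<^sup>2 = (1 / k\<^sup>2 + 16 / k ^ 4) * K\<^sup>2"
      using r(1) k by (simp add: field_simps power2_eq_square power4_eq_xxxx)
    ultimately show "(norm (V u t))\<^sup>2 * (T - t) \<le> (1 / k\<^sup>2 + 16 / k ^ 4) * K\<^sup>2"
      using est r(2) by (simp only:)
  qed
qed

section \<open>Three-point area forms along the flow\<close>

context space_flow
begin

text \<open>The value of \<beta> on two edges of the triangle (\<open>B_edge\<close>), written so
  that the form is affine in each of the three points; this makes it solve a linear equation in each
  parameter.\<close>

definition triangle_form :: "('a \<Rightarrow> 'a \<Rightarrow> real) \<Rightarrow> real \<Rightarrow> real \<Rightarrow> real \<Rightarrow> real \<Rightarrow> real"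
  where "triangle_form \<beta> u v w t = \<beta> (g u t) (g v t) + \<beta> (g v t) (g w t) + \<beta> (g w t) (g u t)"

abbreviation A2 :: "real \<Rightarrow> real \<Rightarrow> real"
  where "A2 u t \<equiv> inverse ((norm (g1 u t))\<^sup>2)"

abbreviation A1 :: "real \<Rightarrow> real \<Rightarrow> real"
  where "A1 u t \<equiv> - (inner (g1 u t) (g2 u t) / (norm (g1 u t)) ^ 4)"

lemma V_eq': "t \<in> {0..<T} \<Longrightarrow> V u t = A2 u t *\<^sub>R g2 u t + A1 u t *\<^sub>R g1 u t"
  by (simp add: V_eq)

lemma A2_pos: "t \<in> {0..<T} \<Longrightarrow> 0 < A2 u t"
  using g1_nz by simp

end

locale alternating_form =
  fixes \<beta> :: "'a::real_normed_vector \<Rightarrow> 'a \<Rightarrow> real"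
  assumes bilinear: "bounded_bilinear \<beta>"
    and alternating: "\<beta> x y = - \<beta> y x"
begin

lemmas add_left = bounded_bilinear.add_left[OF bilinear]
  and add_right = bounded_bilinear.add_right[OF bilinear]
  and diff_left = bounded_bilinear.diff_left[OF bilinear]
  and diff_right = bounded_bilinear.diff_right[OF bilinear]
  and scaleR_left = bounded_bilinear.scaleR_left[OF bilinear]
  and scaleR_right = bounded_bilinear.scaleR_right[OF bilinear]

lemma self [simp]: "\<beta> x x = 0"
  using alternating[of x x] by simp

lemma deriv:
  assumes "(f has_vector_derivative f') (at x within S)" "(h has_vector_derivative h') (at x within S)"
  shows "((\<lambda>x. \<beta> (f x) (h x)) has_real_derivative \<beta> (f x) h' + \<beta> f' (h x)) (at x within S)"
  using bounded_bilinear.has_vector_derivative[OF bilinear assms]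
  by (simp add: has_real_derivative_iff_has_vector_derivative)

end

locale space_form = space_flow g g1 g2 V V1 V2 T + alternating_form \<beta>
  for g g1 g2 V V1 V2 :: "real \<Rightarrow> real \<Rightarrow> 'a::euclidean_space" and T :: real and \<beta> :: "'a \<Rightarrow> 'a \<Rightarrow> real"
begin

abbreviation B :: "real \<Rightarrow> real \<Rightarrow> real \<Rightarrow> real \<Rightarrow> real"
  where "B \<equiv> triangle_form \<beta>"

lemma B_rotate: "t \<in> {0..<T} \<Longrightarrow> B v w (u + 2 * pi) t = B u v w t"
  by (simp add: triangle_form_def per)

lemma B_rotate': "B v w u t = B u v w t"
  by (simp add: triangle_form_def)

lemma B_edge: "B u v w t = \<beta> (g v t - g u t) (g w t - g u t)"
  using alternating[of "g u t" "g w t"] alternating[of "g u t" "g v t"]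
  by (simp add: triangle_form_def diff_left diff_right)

lemma B_degenerate: "B u u w t = 0" "B u v v t = 0" "t \<in> {0..<T} \<Longrightarrow> B u v (u + 2 * pi) t = 0"
proof -
  show "B u u w t = 0" using alternating[of "g u t" "g w t"] by (simp add: triangle_form_def)
  have uv: "\<beta> (g u t) (g v t) + \<beta> (g v t) (g u t) = 0" using alternating[of "g u t" "g v t"] by simp
  then show "B u v v t = 0" by (simp add: triangle_form_def)
  show "B u v (u + 2 * pi) t = 0" if "t \<in> {0..<T}" using uv that by (simp add: triangle_form_def per)
qed

lemma B_shift: "t \<in> {0..<T} \<Longrightarrow>
    B (u + 2 * pi * of_int k) (v + 2 * pi * of_int k) (w + 2 * pi * of_int k) t = B u v w t"
  using periodic_2pi_shift[of "\<lambda>u. g u t", OF per] by (simp add: triangle_form_def)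

lemma B_derivs:
  assumes t: "t \<in> {0..<T}"
  shows "((\<lambda>x. B x v w t) has_real_derivative \<beta> (g1 u t) (g v t - g w t)) (at u)"
    and "((\<lambda>x. \<beta> (g1 x t) z) has_real_derivative \<beta> (g2 u t) z) (at u)"
    and "((\<lambda>s. B u v w s) has_real_derivative
      A2 u t * \<beta> (g2 u t) (g v t - g w t) + A1 u t * \<beta> (g1 u t) (g v t - g w t)
      + (A2 v t * \<beta> (g2 v t) (g w t - g u t) + A1 v t * \<beta> (g1 v t) (g w t - g u t))
      + (A2 w t * \<beta> (g2 w t) (g u t - g v t) + A1 w t * \<beta> (g1 w t) (g u t - g v t))) (at t within {0..<T})"
proof -
  note c = has_vector_derivative_const
  show "((\<lambda>x. B x v w t) has_real_derivative \<beta> (g1 u t) (g v t - g w t)) (at u)"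
    unfolding triangle_form_def
    using DERIV_add[OF DERIV_add[OF deriv[OF g_u[OF t, of u] c[of "g v t"]] deriv[OF c[of "g v t"] c[of "g w t"]]]
        deriv[OF c[of "g w t"] g_u[OF t, of u]]] alternating[of "g w t" "g1 u t"]
    by (simp add: diff_right bounded_bilinear.zero_left[OF bilinear] bounded_bilinear.zero_right[OF bilinear])
  show "((\<lambda>x. \<beta> (g1 x t) z) has_real_derivative \<beta> (g2 u t) z) (at u)"
    using deriv[OF g1_u[OF t, of u] c[of z]] by (simp add: bounded_bilinear.zero_right[OF bilinear])
  have "((\<lambda>s. B u v w s) has_real_derivative
      \<beta> (V u t) (g v t - g w t) + \<beta> (V v t) (g w t - g u t) + \<beta> (V w t) (g u t - g v t)) (at t within {0..<T})"
    unfolding triangle_form_def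
    using DERIV_add[OF DERIV_add[OF deriv[OF g_t[OF t, of u] g_t[OF t, of v]] deriv[OF g_t[OF t, of v] g_t[OF t, of w]]]
        deriv[OF g_t[OF t, of w] g_t[OF t, of u]]]
      alternating[of "g w t" "V u t"] alternating[of "g u t" "V v t"] alternating[of "g v t" "V w t"]
    by (simp add: diff_right algebra_simps)
  then show "((\<lambda>s. B u v w s) has_real_derivative
      A2 u t * \<beta> (g2 u t) (g v t - g w t) + A1 u t * \<beta> (g1 u t) (g v t - g w t)
      + (A2 v t * \<beta> (g2 v t) (g w t - g u t) + A1 v t * \<beta> (g1 v t) (g w t - g u t))
      + (A2 w t * \<beta> (g2 w t) (g u t - g v t) + A1 w t * \<beta> (g1 w t) (g u t - g v t))) (at t within {0..<T})"
    unfolding V_eq'[OF t] add_left scaleR_left by simp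
qed

lemma B_derivs':
  assumes t: "t \<in> {0..<T}"
  shows "((\<lambda>x. B u x w t) has_real_derivative \<beta> (g1 v t) (g w t - g u t)) (at v)"
    and "((\<lambda>x. B u v x t) has_real_derivative \<beta> (g1 w t) (g u t - g v t)) (at w)"
  using B_derivs(1)[OF t, of w u v] B_derivs(1)[OF t, of u v w] B_rotate'
  by (simp_all add: triangle_form_def add_ac)

lemma cont_B: "K \<subseteq> UNIV \<times> UNIV \<times> UNIV \<times> {0..<T} \<Longrightarrow> continuous_on K (\<lambda>(u, v, w, t). B u v w t)"
proof -
  assume K: "K \<subseteq> UNIV \<times> UNIV \<times> UNIV \<times> {0..<T}"
  have c: "continuous_on K (\<lambda>x. g (f x) (snd (snd (snd x))))" if "continuous_on K f" for f
  proof -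
    have p: "continuous_on K (\<lambda>x. (f x, snd (snd (snd x))))" by (intro continuous_intros that)
    have i: "(\<lambda>x. (f x, snd (snd (snd x)))) ` K \<subseteq> UNIV \<times> {0..<T}" using K by auto
    show ?thesis using continuous_on_compose2[OF cont_g p i] by simp
  qed
  show ?thesis
    unfolding triangle_form_def case_prod_unfold
    by (intro continuous_intros bounded_bilinear.continuous_on[OF bilinear] c)
qed

text \<open>Nonnegativity is preserved because \<open>B\<close> solves the heat equation in three variables and vanishes
  on the boundary of the simplex of cyclically ordered triples.\<close>

lemma B_nonneg_preserved:
  assumes t: "0 \<le> t1" "t1 \<le> t2" "t2 < T"
    and init: "\<And>u v w. u \<le> v \<Longrightarrow> v \<le> w \<Longrightarrow> w \<le> u + 2 * pi \<Longrightarrow> 0 \<le> B u v w t1"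
    and uvw: "u \<le> v" "v \<le> w" "w \<le> u + 2 * pi"
  shows "0 \<le> B u v w t2"
proof (rule field_le_epsilon)
  fix e0 :: real assume e0: "e0 > 0"
  define \<epsilon> where "\<epsilon> = e0 / (t2 - t1 + 1)"
  have \<epsilon>: "\<epsilon> > 0" "\<epsilon> * (t2 - t1) \<le> e0" using e0 t by (auto simp: \<epsilon>_def field_simps)
  let ?S = "{x. fst x \<le> fst (snd x) \<and> fst (snd x) \<le> fst (snd (snd x)) \<and> fst (snd (snd x)) \<le> fst x + 2 * pi}"
  \<comment> \<open>Moving all three parameters by a common period puts u into one period, and then
    v and w are below 4 * pi; this makes the domain compact.\<close>
  let ?K = "({0..2 * pi} \<times> {0..4 * pi} \<times> {0..4 * pi} \<times> {t1..t2}) \<inter> ?S"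
  have "closed ?S" by (intro closed_Collect_conj closed_Collect_le continuous_intros)
  then have cK: "compact ?K" by (intro compact_Int_closed compact_Times compact_Icc)
  define F where "F = (\<lambda>u v w s. B u v w s + \<epsilon> * (s - t1))"
  have "continuous_on ?K (\<lambda>(u, v, w, t). B u v w t)" by (rule cont_B) (use t in auto)
  then have cF: "continuous_on ?K (\<lambda>(u, v, w, s). F u v w s)"
    unfolding F_def case_prod_unfold by (intro continuous_intros)
  have "(0, 0, 0, t1) \<in> ?K" using t by auto
  then have "?K \<noteq> {}" by blast
  from continuous_attains_inf[OF cK this cF] obtain y where y: "y \<in> ?K"
    "\<forall>x\<in>?K. (\<lambda>(u, v, w, s). F u v w s) y \<le> (\<lambda>(u, v, w, s). F u v w s) x" by blast
  obtain u0 v0 w0 s0 where "y = (u0, v0, w0, s0)" by (cases y)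
  with y have K0: "(u0, v0, w0, s0) \<in> ?K"
    and min: "\<forall>x\<in>?K. F u0 v0 w0 s0 \<le> (\<lambda>(u, v, w, s). F u v w s) x" by auto
  have min': "F u0 v0 w0 s0 \<le> F u v w s"
    if "u \<le> v" "v \<le> w" "w \<le> u + 2 * pi" "s \<in> {t1..t2}" for u v w s
  proof -
    obtain k where k: "u + 2 * pi * of_int k \<in> {0..<2 * pi}" by (rule shift_into_period)
    let ?d = "2 * pi * real_of_int k"
    have "(u + ?d, v + ?d, w + ?d, s) \<in> ?K" using that k by auto
    from bspec[OF min this] have "F u0 v0 w0 s0 \<le> F (u + ?d) (v + ?d) (w + ?d) s" by simp
    also have "\<dots> = F u v w s" using B_shift[of s u k v w] that t by (simp add: F_def)
    finally show ?thesis .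
  qed
  have "0 \<le> F u0 v0 w0 s0"
  proof (rule ccontr)
    assume neg: "\<not> 0 \<le> F u0 v0 w0 s0"
    have s0: "s0 \<in> {t1..t2}" "s0 \<in> {0..<T}" using K0 t by auto
    have nn: "0 \<le> \<epsilon> * (s0 - t1)" using \<epsilon> s0 by simp
    have Bneg: "B u0 v0 w0 s0 < 0" using neg nn by (simp add: F_def)
    have "u0 \<noteq> v0" "v0 \<noteq> w0" "w0 \<noteq> u0 + 2 * pi"
      using Bneg B_degenerate(1)[of u0 w0 s0] B_degenerate(2)[of u0 v0 s0] B_degenerate(3)[OF s0(2), of u0 v0] by auto
    then have o: "u0 < v0" "v0 < w0" "w0 < u0 + 2 * pi" using K0 by auto
    have "s0 \<noteq> t1" using Bneg init[of u0 v0 w0] o by auto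
    then have s1: "t1 < s0" using s0 by auto
    have Fd: "((\<lambda>x. F x v w s0) has_real_derivative \<beta> (g1 x s0) (g v s0 - g w s0)) (at x)"
      "((\<lambda>x. F u x w s0) has_real_derivative \<beta> (g1 x s0) (g w s0 - g u s0)) (at x)"
      "((\<lambda>x. F u v x s0) has_real_derivative \<beta> (g1 x s0) (g u s0 - g v s0)) (at x)" for u v w x
      unfolding F_def by (rule derivative_eq_intros B_derivs[OF s0(2)] B_derivs'[OF s0(2)] refl | simp)+
    have n: "\<forall>\<^sub>F x in nhds u0. x < v0 \<and> w0 < x + 2 * pi" "\<forall>\<^sub>F x in nhds v0. u0 < x \<and> x < w0"
      "\<forall>\<^sub>F x in nhds w0. v0 < x \<and> x < u0 + 2 * pi"
    proof -
      have "\<forall>\<^sub>F x in nhds u0. x \<in> {w0 - 2 * pi<..<v0}" using o by (intro eventually_nhds_in_open) auto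
      then show "\<forall>\<^sub>F x in nhds u0. x < v0 \<and> w0 < x + 2 * pi" by (rule eventually_mono) auto
      have "\<forall>\<^sub>F x in nhds v0. x \<in> {u0<..<w0}" using o by (intro eventually_nhds_in_open) auto
      then show "\<forall>\<^sub>F x in nhds v0. u0 < x \<and> x < w0" by (rule eventually_mono) auto
      have "\<forall>\<^sub>F x in nhds w0. x \<in> {v0<..<u0 + 2 * pi}" using o by (intro eventually_nhds_in_open) auto
      then show "\<forall>\<^sub>F x in nhds w0. v0 < x \<and> x < u0 + 2 * pi" by (rule eventually_mono) auto
    qed
    have e: "\<forall>\<^sub>F x in nhds u0. F u0 v0 w0 s0 \<le> F x v0 w0 s0"
      "\<forall>\<^sub>F x in nhds v0. F u0 v0 w0 s0 \<le> F u0 x w0 s0"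
      "\<forall>\<^sub>F x in nhds w0. F u0 v0 w0 s0 \<le> F u0 v0 x s0"
    proof -
      show "\<forall>\<^sub>F x in nhds u0. F u0 v0 w0 s0 \<le> F x v0 w0 s0"
        by (rule eventually_mono[OF n(1)], rule min') (use o s0 in auto)
      show "\<forall>\<^sub>F x in nhds v0. F u0 v0 w0 s0 \<le> F u0 x w0 s0"
        by (rule eventually_mono[OF n(2)], rule min') (use o s0 in auto)
      show "\<forall>\<^sub>F x in nhds w0. F u0 v0 w0 s0 \<le> F u0 v0 x s0"
        by (rule eventually_mono[OF n(3)], rule min') (use o s0 in auto)
    qed
    note m = local_min_second_derivative[OF always_eventually[rule_format, OF Fd(1)] B_derivs(2)[OF s0(2)] e(1)]
      local_min_second_derivative[OF always_eventually[rule_format, OF Fd(2)] B_derivs(2)[OF s0(2)] e(2)]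
      local_min_second_derivative[OF always_eventually[rule_format, OF Fd(3)] B_derivs(2)[OF s0(2)] e(3)]
    define D where "D = A2 u0 s0 * \<beta> (g2 u0 s0) (g v0 s0 - g w0 s0) + A1 u0 s0 * \<beta> (g1 u0 s0) (g v0 s0 - g w0 s0)
      + (A2 v0 s0 * \<beta> (g2 v0 s0) (g w0 s0 - g u0 s0) + A1 v0 s0 * \<beta> (g1 v0 s0) (g w0 s0 - g u0 s0))
      + (A2 w0 s0 * \<beta> (g2 w0 s0) (g u0 s0 - g v0 s0) + A1 w0 s0 * \<beta> (g1 w0 s0) (g u0 s0 - g v0 s0))"
    have "0 \<le> D" unfolding D_def using m A2_pos[OF s0(2)] by (simp add: less_imp_le)
    have Ft: "((\<lambda>s. F u0 v0 w0 s) has_real_derivative D + \<epsilon>) (at s0 within {0..<T})"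
      unfolding F_def D_def by (rule derivative_eq_intros B_derivs(3)[OF s0(2)] refl)+ simp
    have "\<forall>\<^sub>F s in at_left s0. F u0 v0 w0 s0 \<le> F u0 v0 w0 s"
      using eventually_at_left_interval[OF s1 order.refl]
      by eventually_elim (rule min', use o s0 in auto)
    then have "D + \<epsilon> \<le> 0" by (rule left_min_derivative[OF Ft, rotated 2]) (use s0 s1 t in auto)
    with \<open>0 \<le> D\<close> \<epsilon> show False by simp
  qed
  also have "F u0 v0 w0 s0 \<le> F u v w t2" using uvw t by (intro min') auto
  finally show "0 \<le> B u v w t2 + e0" using \<epsilon> by (simp add: F_def)
qed

end

section \<open>A strict maximum principle on the simplex\<close>

lemma x_cos_le_sin:
  assumes "0 \<le> x" "x \<le> pi"
  shows "x * cos x \<le> sin x"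
proof -
  have "\<exists>y. ((\<lambda>x. sin x - x * cos x) has_real_derivative y) (at z) \<and> 0 \<le> y" if "0 \<le> z" "z \<le> x" for z
    using that assms by (intro exI[of _ "z * sin z"] conjI mult_nonneg_nonneg sin_ge_zero)
      (auto intro!: derivative_eq_intros)
  from DERIV_nonneg_imp_nondecreasing[OF assms(1) this] show ?thesis by simp
qed

lemma pi_minus_x_cos_le_sin:
  assumes "0 \<le> x" "x \<le> pi"
  shows "- ((pi - x) * cos x) \<le> sin x"
  using x_cos_le_sin[of "pi - x"] assms by simp

text \<open>For x half a gap of the current triple and p the full gap of a reference triple.
  Depending on the sign of cos x, the inequality \<open>x * cos x \<le> sin x\<close> is used from
  one end of the interval or from the other.\<close>

lemma diff_cos_le_sin:
  assumes x: "0 \<le> x" "x \<le> pi" and p: "0 \<le> p" "p \<le> 2 * pi"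
  shows "(2 * x - p) * cos x \<le> 2 * sin x"
proof (cases "0 \<le> cos x")
  case True
  have "(2 * x - p) * cos x \<le> (2 * x) * cos x" using True p by (intro mult_right_mono) auto
  then show ?thesis using x_cos_le_sin[OF x] by simp
next
  case False
  have "(2 * x - p) * cos x \<le> (2 * x - 2 * pi) * cos x" using False p by (intro mult_right_mono_neg) auto
  then show ?thesis using pi_minus_x_cos_le_sin[OF x] by (simp add: algebra_simps)
qed

text \<open>The same comparison for a quantity d that is small relative to the gap and to its
  complement.\<close>

lemma small_cos_le_sin:
  assumes x: "0 \<le> x" "x \<le> pi" and d: "\<bar>d\<bar> \<le> c * (2 * x)" "\<bar>d\<bar> \<le> c * (2 * pi - 2 * x)" and c: "0 \<le> c"
  shows "d * cos x \<le> 2 * c * sin x"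
proof (cases "0 \<le> cos x")
  case True
  have "d * cos x \<le> (c * (2 * x)) * cos x" using True d by (intro mult_right_mono) auto
  also have "\<dots> = 2 * c * (x * cos x)" by simp
  also have "\<dots> \<le> 2 * c * sin x" using x_cos_le_sin[OF x] c by (intro mult_left_mono) auto
  finally show ?thesis .
next
  case False
  have "d * cos x \<le> (- (c * (2 * pi - 2 * x))) * cos x"
    using False d by (intro mult_right_mono_neg) (auto simp: abs_le_iff)
  also have "\<dots> = 2 * c * (- ((pi - x) * cos x))" by (simp add: algebra_simps)
  also have "\<dots> \<le> 2 * c * sin x" using pi_minus_x_cos_le_sin[OF x] c by (intro mult_left_mono) auto
  finally show ?thesis .
qed

text \<open>Twice the oriented area of the triangle with vertices \<open>cis x\<close>, \<open>cis y\<close>, \<open>cis z\<close>.\<close>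

definition cis_area :: "real \<Rightarrow> real \<Rightarrow> real \<Rightarrow> real"
  where "cis_area x y z = sin (y - x) + sin (z - y) + sin (x - z)"

lemma cis_area_product:
  assumes "y = x + 2 * A" "z = y + 2 * B"
  shows "cis_area x y z = 4 * sin A * sin B * sin (A + B)"
proof -
  \<comment> \<open>Sines and cosines are replaced by points of the unit circle, which leaves a
    polynomial identity.\<close>
  have key: "2 * a * b + 2 * c * d - (2 * a * b * (d\<^sup>2 - c\<^sup>2) + (b\<^sup>2 - a\<^sup>2) * (2 * c * d)) = 4 * a * c * (a * d + b * c)"
    if "a\<^sup>2 + b\<^sup>2 = 1" "c\<^sup>2 + d\<^sup>2 = 1" for a b c d :: real
    using that by algebra
  have "sin (y - x) = 2 * sin A * cos A" "sin (z - y) = 2 * sin B * cos B"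
    using assms by (simp_all add: sin_double)
  moreover have "sin (x - z) = - sin (2 * A + 2 * B)" using sin_minus[of "2 * A + 2 * B"] by (simp add: assms)
  then have "sin (x - z) = - (2 * sin A * cos A * ((cos B)\<^sup>2 - (sin B)\<^sup>2)
      + ((cos A)\<^sup>2 - (sin A)\<^sup>2) * (2 * sin B * cos B))"
    by (simp only: sin_add sin_double cos_double)
  ultimately show ?thesis
    using key[of "sin A" "cos A" "sin B" "cos B"] by (simp add: cis_area_def sin_add)
qed

text \<open>In half gaps each term of the directional derivative keeps two of the three sines of the
  product formula; the missing one must come from the difference of the direction's
  components.\<close>

lemma cis_area_gradient:
  assumes "y = x + 2 * A" "z = y + 2 * B" and C: "C = pi - (A + B)"
  shows "(cos (x - z) - cos (y - x)) * p + (cos (y - x) - cos (z - y)) * q + (cos (z - y) - cos (x - z)) * r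
    = 2 * ((q - p) * cos A * sin B * sin C + (r - q) * sin A * cos B * sin C + (p - r) * sin A * sin B * cos C)"
proof -
  have key: "((b\<^sup>2 - a\<^sup>2) * (d\<^sup>2 - c\<^sup>2) - 2 * a * b * (2 * c * d) - (b\<^sup>2 - a\<^sup>2)) * p
      + ((b\<^sup>2 - a\<^sup>2) - (d\<^sup>2 - c\<^sup>2)) * q
      + ((d\<^sup>2 - c\<^sup>2) - ((b\<^sup>2 - a\<^sup>2) * (d\<^sup>2 - c\<^sup>2) - 2 * a * b * (2 * c * d))) * r
    = 2 * ((q - p) * b * c * (a * d + b * c) + (r - q) * a * d * (a * d + b * c) + (p - r) * a * c * (- (b * d - a * c)))"
    if "a\<^sup>2 + b\<^sup>2 = 1" "c\<^sup>2 + d\<^sup>2 = 1" for a b c d :: real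
    using that by algebra
  have "cos (y - x) = (cos A)\<^sup>2 - (sin A)\<^sup>2" "cos (z - y) = (cos B)\<^sup>2 - (sin B)\<^sup>2"
    using assms by (simp_all add: cos_double)
  moreover have "cos (x - z) = cos (2 * A + 2 * B)" using cos_minus[of "2 * A + 2 * B"] by (simp add: assms)
  then have "cos (x - z) = ((cos A)\<^sup>2 - (sin A)\<^sup>2) * ((cos B)\<^sup>2 - (sin B)\<^sup>2) - 2 * sin A * cos A * (2 * sin B * cos B)"
    by (simp only: cos_add sin_double cos_double)
  moreover have "sin C = sin A * cos B + cos A * sin B" "cos C = - (cos A * cos B - sin A * sin B)"
    by (simp_all add: C sin_add cos_add)
  ultimately show ?thesis using key[of "sin A" "cos A" "sin B" "cos B"] by simp
qed

lemma cis_area_nonneg: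
  assumes "x \<le> y" "y \<le> z" "z \<le> x + 2 * pi"
  shows "0 \<le> cis_area x y z"
proof -
  have "cis_area x y z = 4 * sin ((y - x) / 2) * sin ((z - y) / 2) * sin ((y - x) / 2 + (z - y) / 2)"
    by (rule cis_area_product) (simp_all add: field_simps)
  moreover have "(y - x) / 2 + (z - y) / 2 = (z - x) / 2" by (simp add: field_simps)
  ultimately show ?thesis using assms by (auto intro!: mult_nonneg_nonneg sin_ge_zero)
qed

lemma cis_area_le: "cis_area x y z \<le> 3"
  unfolding cis_area_def using sin_le_one[of "y - x"] sin_le_one[of "z - y"] sin_le_one[of "x - z"] by linarith

text \<open>The gradient of \<open>cis_area\<close> need not vanish on the faces of the simplex, but
  its pairing with suitable directions is bounded by \<open>cis_area\<close> itself. The first bound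
  treats the displacement from an ordered triple, as it arises from the cutoff, the second a drift
  that is Lipschitz in the parameters.\<close>

lemma cis_area_gradient_bounds:
  assumes o: "x < y" "y < z" "z < x + 2 * pi"
  shows "p \<le> q \<Longrightarrow> q \<le> r \<Longrightarrow> r \<le> p + 2 * pi \<Longrightarrow>
      (cos (x - z) - cos (y - x)) * (x - p) + (cos (y - x) - cos (z - y)) * (y - q)
      + (cos (z - y) - cos (x - z)) * (z - r) \<le> 3 * cis_area x y z"
    and "0 \<le> c \<Longrightarrow> \<bar>q - p\<bar> \<le> c * (y - x) \<Longrightarrow> \<bar>q - p\<bar> \<le> c * (x + 2 * pi - y) \<Longrightarrow>
      \<bar>r - q\<bar> \<le> c * (z - y) \<Longrightarrow> \<bar>r - q\<bar> \<le> c * (y + 2 * pi - z) \<Longrightarrow>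
      \<bar>p - r\<bar> \<le> c * (z - x) \<Longrightarrow> \<bar>p - r\<bar> \<le> c * (x + 2 * pi - z) \<Longrightarrow>
      (cos (x - z) - cos (y - x)) * p + (cos (y - x) - cos (z - y)) * q + (cos (z - y) - cos (x - z)) * r
      \<le> 3 * c * cis_area x y z"
proof -
  define A B C where "A = (y - x) / 2" and "B = (z - y) / 2" and "C = pi - (A + B)"
  have AB: "y = x + 2 * A" "z = y + 2 * B" by (simp_all add: A_def B_def field_simps)
  have AC: "0 \<le> A" "A \<le> pi" "0 \<le> B" "B \<le> pi" "0 \<le> C" "C \<le> pi"
  proof -
    have "C = pi - (z - x) / 2" by (simp add: A_def B_def C_def field_simps)
    then show "0 \<le> A" "A \<le> pi" "0 \<le> B" "B \<le> pi" "0 \<le> C" "C \<le> pi" using o by (auto simp: A_def B_def)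
  qed
  have s: "0 \<le> sin A" "0 \<le> sin B" "0 \<le> sin C" using AC by (auto intro: sin_ge_zero)
  have "sin C = sin (A + B)" by (simp add: C_def)
  with cis_area_product[OF AB] have area: "cis_area x y z = 4 * sin A * sin B * sin C" by simp
  note grad = cis_area_gradient[OF AB C_def]
  have combine: "2 * (d1 * cos A * sin B * sin C + d2 * sin A * cos B * sin C + d3 * sin A * sin B * cos C)
      \<le> 3 * c * cis_area x y z"
    if d: "d1 * cos A \<le> 2 * c * sin A" "d2 * cos B \<le> 2 * c * sin B" "d3 * cos C \<le> 2 * c * sin C" for d1 d2 d3 c
  proof -
    have "d1 * cos A * (sin B * sin C) \<le> 2 * c * sin A * (sin B * sin C)"
      "d2 * cos B * (sin A * sin C) \<le> 2 * c * sin B * (sin A * sin C)"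
      "d3 * cos C * (sin A * sin B) \<le> 2 * c * sin C * (sin A * sin B)"
      using s d by (intro mult_right_mono mult_nonneg_nonneg; simp)+
    then show ?thesis unfolding area by (simp add: mult_ac)
  qed
  {
    assume pqr: "p \<le> q" "q \<le> r" "r \<le> p + 2 * pi"
    have e: "(y - q) - (x - p) = 2 * A - (q - p)" "(z - r) - (y - q) = 2 * B - (r - q)"
      "(x - p) - (z - r) = 2 * C - (p + 2 * pi - r)" by (simp_all add: A_def B_def C_def field_simps)
    have "2 * (((y - q) - (x - p)) * cos A * sin B * sin C + ((z - r) - (y - q)) * sin A * cos B * sin C
        + ((x - p) - (z - r)) * sin A * sin B * cos C) \<le> 3 * 1 * cis_area x y z"
      unfolding e using pqr AC by (intro combine) (use diff_cos_le_sin in simp_all)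
    then show "(cos (x - z) - cos (y - x)) * (x - p) + (cos (y - x) - cos (z - y)) * (y - q)
      + (cos (z - y) - cos (x - z)) * (z - r) \<le> 3 * cis_area x y z" unfolding grad by simp
  next
    assume c: "0 \<le> c" and d: "\<bar>q - p\<bar> \<le> c * (y - x)" "\<bar>q - p\<bar> \<le> c * (x + 2 * pi - y)"
      "\<bar>r - q\<bar> \<le> c * (z - y)" "\<bar>r - q\<bar> \<le> c * (y + 2 * pi - z)"
      "\<bar>p - r\<bar> \<le> c * (z - x)" "\<bar>p - r\<bar> \<le> c * (x + 2 * pi - z)"
    have e: "y - x = 2 * A" "x + 2 * pi - y = 2 * pi - 2 * A" "z - y = 2 * B" "y + 2 * pi - z = 2 * pi - 2 * B"
      "z - x = 2 * pi - 2 * C" "x + 2 * pi - z = 2 * C" by (simp_all add: A_def B_def C_def field_simps)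
    show "(cos (x - z) - cos (y - x)) * p + (cos (y - x) - cos (z - y)) * q + (cos (z - y) - cos (x - z)) * r
      \<le> 3 * c * cis_area x y z"
      unfolding grad
      by (intro combine small_cos_le_sin AC c d[unfolded e])
  }
qed

text \<open>The barrier in one of its three parameters; k contains the radius and the squares
  belonging to the other two.\<close>

lemma barrier_derivs:
  fixes p y z k :: real
  defines "\<phi> \<equiv> \<lambda>x. k - (x - p)\<^sup>2"
  shows "((\<lambda>x. cis_area x y z * (\<phi> x)\<^sup>2) has_real_derivative
      (cos (x - z) - cos (y - x)) * (\<phi> x)\<^sup>2 - 4 * cis_area x y z * \<phi> x * (x - p)) (at x)"
    and "((\<lambda>x. (cos (x - z) - cos (y - x)) * (\<phi> x)\<^sup>2 - 4 * cis_area x y z * \<phi> x * (x - p)) has_real_derivative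
      - (sin (y - x) + sin (x - z)) * (\<phi> x)\<^sup>2 - 8 * (cos (x - z) - cos (y - x)) * \<phi> x * (x - p)
      + cis_area x y z * (8 * (x - p)\<^sup>2 - 4 * \<phi> x)) (at x)"
proof -
  have V: "((\<lambda>x. cis_area x y z) has_real_derivative cos (x - z) - cos (y - x)) (at x)" for x
    unfolding cis_area_def by (rule derivative_eq_intros refl)+ simp
  have F: "(\<phi> has_real_derivative - 2 * (x - p)) (at x)" for x
    unfolding \<phi>_def by (rule derivative_eq_intros refl)+ simp
  show "((\<lambda>x. cis_area x y z * (\<phi> x)\<^sup>2) has_real_derivative
      (cos (x - z) - cos (y - x)) * (\<phi> x)\<^sup>2 - 4 * cis_area x y z * \<phi> x * (x - p)) (at x)"
    by (rule derivative_eq_intros V F refl)+ (simp add: algebra_simps)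
  show "((\<lambda>x. (cos (x - z) - cos (y - x)) * (\<phi> x)\<^sup>2 - 4 * cis_area x y z * \<phi> x * (x - p)) has_real_derivative
      - (sin (y - x) + sin (x - z)) * (\<phi> x)\<^sup>2 - 8 * (cos (x - z) - cos (y - x)) * \<phi> x * (x - p)
      + cis_area x y z * (8 * (x - p)\<^sup>2 - 4 * \<phi> x)) (at x)"
    by (rule derivative_eq_intros V F refl)+ (simp add: algebra_simps power2_eq_square)
qed

section \<open>Arc length parameters\<close>

context space_flow
begin

lemma cont_speed: "continuous_on (UNIV \<times> {0..<T}) (\<lambda>(u, t). norm (g1 u t))"
  using continuous_on_norm[OF cont_g1] by (simp add: case_prod_unfold)

text \<open>A length for u \<ge> 0 only, since the integral over an empty interval is 0. Therefore
  the barrier is later built over a window of large parameters.\<close>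

definition arc_length :: "real \<Rightarrow> real \<Rightarrow> real"
  where "arc_length u t = integral {0..u} (\<lambda>x. norm (g1 x t))"

definition arc_length_t :: "real \<Rightarrow> real \<Rightarrow> real"
  where "arc_length_t u t = integral {0..u} (\<lambda>x. - (norm (g1 x t) * (norm (V x t))\<^sup>2))"

text \<open>Arc length normalized to the period 2 * pi. In this parameter the spatial operator is a
  factor depending on time alone times the plain second derivative, so the barrier meets no first
  order coefficient in space; the price is the drift \<open>arc_param_t\<close>.\<close>

definition arc_param :: "real \<Rightarrow> real \<Rightarrow> real"
  where "arc_param u t = 2 * pi * arc_length u t / arc_length (2 * pi) t"

definition arc_param_t :: "real \<Rightarrow> real \<Rightarrow> real"
  where "arc_param_t u t = 2 * pi * (arc_length_t u t / arc_length (2 * pi) t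
    - arc_length u t * arc_length_t (2 * pi) t / (arc_length (2 * pi) t)\<^sup>2)"

lemma speed_integrable:
  assumes "t \<in> {0..<T}"
  shows "(\<lambda>x. norm (g1 x t)) integrable_on {u..v}"
    "(\<lambda>x. - (norm (g1 x t) * (norm (V x t))\<^sup>2)) integrable_on {u..v}"
proof -
  have "continuous_on {u..v} (\<lambda>x. g1 x t)" "continuous_on {u..v} (\<lambda>x. V x t)"
    using g1_u[OF assms] V_u[OF assms]
    by (meson continuous_at_imp_continuous_on has_vector_derivative_continuous)+
  then show "(\<lambda>x. norm (g1 x t)) integrable_on {u..v}"
    "(\<lambda>x. - (norm (g1 x t) * (norm (V x t))\<^sup>2)) integrable_on {u..v}"
    by (auto intro!: integrable_continuous_interval continuous_intros)
qed

lemma arc_length_diff: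
  assumes t: "t \<in> {0..<T}" and uv: "0 \<le> u" "u \<le> v"
  shows "arc_length v t = arc_length u t + integral {u..v} (\<lambda>x. norm (g1 x t))"
    "arc_length_t v t = arc_length_t u t + integral {u..v} (\<lambda>x. - (norm (g1 x t) * (norm (V x t))\<^sup>2))"
  unfolding arc_length_def arc_length_t_def
  using Henstock_Kurzweil_Integration.integral_combine[OF uv speed_integrable(1)[OF t]]
    Henstock_Kurzweil_Integration.integral_combine[OF uv speed_integrable(2)[OF t]] by simp_all

lemma arc_length_u:
  assumes t: "t \<in> {0..<T}" and u: "0 < u"
  shows "((\<lambda>v. arc_length v t) has_real_derivative norm (g1 u t)) (at u)"
proof -
  have "continuous_on {0..u + 1} (\<lambda>x. norm (g1 x t))"
    using g1_u[OF t]
    by (intro continuous_on_norm) (meson continuous_at_imp_continuous_on has_vector_derivative_continuous)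
  then have "((\<lambda>v. integral {0..v} (\<lambda>x. norm (g1 x t))) has_vector_derivative norm (g1 u t)) (at u within {0..u + 1})"
    by (rule integral_has_vector_derivative) (use u in auto)
  moreover have "at u within {0..u + 1} = at u"
    by (rule at_within_interior) (use u in auto)
  ultimately show ?thesis
    by (simp add: arc_length_def[abs_def] has_real_derivative_iff_has_vector_derivative)
qed

lemma arc_length_has_derivative_t:
  assumes t: "t \<in> {0..<T}" and u: "0 \<le> u"
  shows "((\<lambda>s. arc_length u s) has_real_derivative arc_length_t u t) (at t within {0..<T})"
proof -
  have "((\<lambda>s. integral (cbox 0 u) (\<lambda>x. norm (g1 x s))) has_real_derivative
      integral (cbox 0 u) (\<lambda>x. - (norm (g1 x t) * (norm (V x t))\<^sup>2))) (at t within {0..<T})"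
  proof (rule leibniz_rule_field_derivative)
    show "((\<lambda>s. norm (g1 x s)) has_real_derivative - (norm (g1 x s) * (norm (V x s))\<^sup>2)) (at s within {0..<T})"
      if "s \<in> {0..<T}" for s x by (rule speed_t[OF that])
    show "(\<lambda>x. norm (g1 x s)) integrable_on cbox 0 u" if "s \<in> {0..<T}" for s
      using speed_integrable[OF that] by simp
    have "continuous_on ({0..<T} \<times> cbox 0 u) (\<lambda>x. f (snd x) (fst x))"
      if "continuous_on (UNIV \<times> {0..<T}) (\<lambda>(u, t). f u t)" for f :: "real \<Rightarrow> real \<Rightarrow> 'a"
      using continuous_on_compose2[OF that, of "{0..<T} \<times> cbox 0 u" "\<lambda>x. (snd x, fst x)"]
      by (force intro: continuous_intros)
    from this[OF cont_g1] this[OF cont_V]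
    show "continuous_on ({0..<T} \<times> cbox 0 u) (\<lambda>(s, x). - (norm (g1 x s) * (norm (V x s))\<^sup>2))"
      by (auto simp: case_prod_unfold intro!: continuous_intros)
  qed (use t in \<open>auto simp: convex_real_interval\<close>)
  then show ?thesis by (simp add: arc_length_def[abs_def] arc_length_t_def)
qed

lemma speed_bounds:
  assumes t: "0 \<le> t2" "t2 < T"
  obtains n0 n1 M where "0 < n0" "\<And>u t. t \<in> {0..t2} \<Longrightarrow> n0 \<le> norm (g1 u t)"
    "\<And>u t. t \<in> {0..t2} \<Longrightarrow> norm (g1 u t) \<le> n1" "0 \<le> M"
    "\<And>u t. t \<in> {0..t2} \<Longrightarrow> norm (g1 u t) * (norm (V u t))\<^sup>2 \<le> M"
proof -
  let ?K = "{0..2 * pi} \<times> {0..t2}"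
  have cK: "compact ?K" "?K \<noteq> {}" using t by (auto intro!: compact_Times)
  have per': "\<exists>v\<in>{0..2 * pi}. g1 v t = g1 u t \<and> V v t = V u t" if s: "t \<in> {0..t2}" for u t
  proof -
    have s': "t \<in> {0..<T}" using s t by auto
    obtain k :: int where k: "u + 2 * pi * of_int k \<in> {0..<2 * pi}" by (rule shift_into_period)
    show ?thesis
      using periodic_2pi_shift[of "\<lambda>u. g1 u t" u k, OF periodic_g1[OF s']]
        periodic_2pi_shift[of "\<lambda>u. V u t" u k, OF periodic_V[OF s']] k
      by (intro bexI[of _ "u + 2 * pi * of_int k"]) auto
  qed
  have sub: "?K \<subseteq> UNIV \<times> {0..<T}" using t by auto
  have c1: "continuous_on ?K (\<lambda>x. norm (g1 (fst x) (snd x)))"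
    using continuous_on_subset[OF cont_speed sub] by (simp add: case_prod_unfold)
  have "continuous_on ?K (\<lambda>x. V (fst x) (snd x))"
    using continuous_on_subset[OF cont_V sub] by (simp add: case_prod_unfold)
  then have c2: "continuous_on ?K (\<lambda>x. norm (g1 (fst x) (snd x)) * (norm (V (fst x) (snd x)))\<^sup>2)"
    by (intro continuous_intros c1)
  obtain x0 where x0: "x0 \<in> ?K" "\<forall>y\<in>?K. norm (g1 (fst x0) (snd x0)) \<le> norm (g1 (fst y) (snd y))"
    using continuous_attains_inf[OF cK c1] by blast
  obtain x1 where x1: "\<forall>y\<in>?K. norm (g1 (fst y) (snd y)) \<le> norm (g1 (fst x1) (snd x1))"
    using continuous_attains_sup[OF cK c1] by blast
  obtain x2 where x2: "\<forall>y\<in>?K. norm (g1 (fst y) (snd y)) * (norm (V (fst y) (snd y)))\<^sup>2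
      \<le> norm (g1 (fst x2) (snd x2)) * (norm (V (fst x2) (snd x2)))\<^sup>2"
    using continuous_attains_sup[OF cK c2] by blast
  show thesis
  proof (rule that)
    show "0 < norm (g1 (fst x0) (snd x0))" using g1_nz[of "snd x0" "fst x0"] x0(1) t by auto
    fix u s assume s: "s \<in> {0..t2}"
    obtain v where v: "v \<in> {0..2 * pi}" "g1 v s = g1 u s" "V v s = V u s" using per'[OF s] by blast
    have "(v, s) \<in> ?K" using v s by auto
    from bspec[OF x0(2) this] bspec[OF x1 this] bspec[OF x2 this]
    show "norm (g1 (fst x0) (snd x0)) \<le> norm (g1 u s)" "norm (g1 u s) \<le> norm (g1 (fst x1) (snd x1))"
      "norm (g1 u s) * (norm (V u s))\<^sup>2 \<le> norm (g1 (fst x2) (snd x2)) * (norm (V (fst x2) (snd x2)))\<^sup>2"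
      by (simp_all add: v)
  qed auto
qed

end

lemma continuous_on_Lipschitz_fst:
  fixes f :: "real \<Rightarrow> real \<Rightarrow> real"
  assumes lip: "\<And>u v t. u \<in> A \<Longrightarrow> v \<in> A \<Longrightarrow> t \<in> B \<Longrightarrow> \<bar>f u t - f v t\<bar> \<le> K * \<bar>u - v\<bar>"
    and cont: "\<And>u. u \<in> A \<Longrightarrow> continuous_on B (\<lambda>t. f u t)"
  shows "continuous_on (A \<times> B) (\<lambda>(u, t). f u t)"
  unfolding continuous_on_iff
proof (intro ballI allI impI)
  fix x :: "real \<times> real" and e :: real
  assume x: "x \<in> A \<times> B" and e: "0 < e"
  obtain u t where ut: "x = (u, t)" "u \<in> A" "t \<in> B" using x by auto
  obtain d1 where d1: "d1 > 0" "\<And>s. s \<in> B \<Longrightarrow> dist s t < d1 \<Longrightarrow> dist (f u s) (f u t) < e / 2"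
    using cont[OF ut(2)] ut(3) e unfolding continuous_on_iff by (metis half_gt_zero)
  define k where "k = \<bar>K\<bar> + 1"
  have k: "0 < k" "K \<le> k" by (auto simp: k_def)
  have "dist (case y of (u, t) \<Rightarrow> f u t) (case x of (u, t) \<Rightarrow> f u t) < e"
    if y: "y \<in> A \<times> B" "dist y x < min d1 (e / (2 * k))" for y
  proof -
    obtain v s where vs: "y = (v, s)" "v \<in> A" "s \<in> B" using y by auto
    have "dist v u \<le> dist y x" "dist s t \<le> dist y x"
      using dist_fst_le[of y x] dist_snd_le[of y x] by (auto simp: vs ut)
    then have d: "\<bar>v - u\<bar> < e / (2 * k)" "dist s t < d1" using y by (auto simp: dist_real_def)
    have "\<bar>f v s - f u s\<bar> \<le> K * \<bar>v - u\<bar>" by (rule lip[OF vs(2) ut(2) vs(3)])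
    also have "\<dots> \<le> k * \<bar>v - u\<bar>" using k by (intro mult_right_mono) auto
    also have "\<dots> < k * (e / (2 * k))" using d k by (intro mult_strict_left_mono) auto
    also have "\<dots> = e / 2" using k by simp
    finally have "\<bar>f v s - f u s\<bar> < e / 2" .
    moreover have "\<bar>f u s - f u t\<bar> < e / 2" using d1(2)[OF vs(3) d(2)] by (simp add: dist_real_def)
    ultimately have "\<bar>f v s - f u t\<bar> < e" by linarith
    then show ?thesis by (simp add: vs ut dist_real_def)
  qed
  moreover have "min d1 (e / (2 * k)) > 0" using d1 e k by simp
  ultimately show "\<exists>d>0. \<forall>x'\<in>A \<times> B. dist x' x < d \<longrightarrow>
      dist (case x' of (u, t) \<Rightarrow> f u t) (case x of (u, t) \<Rightarrow> f u t) < e" by blast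
qed

context space_flow
begin

lemma arc_length_periodic:
  assumes t: "t \<in> {0..<T}" and u: "0 \<le> u"
  shows "arc_length (u + 2 * pi) t = arc_length u t + arc_length (2 * pi) t"
    "arc_length_t (u + 2 * pi) t = arc_length_t u t + arc_length_t (2 * pi) t"
proof -
  have sh: "(f :: real \<Rightarrow> real) \<circ> ((+) (2 * pi)) = f" if "\<And>x. f (x + 2 * pi) = f x" for f
    using that by (auto simp: fun_eq_iff add.commute)
  have "integral {2 * pi..u + 2 * pi} (\<lambda>x. norm (g1 x t)) = integral {0..u} (\<lambda>x. norm (g1 x t))"
    using integral_shift_Icc_real[of 0 u "\<lambda>x. norm (g1 x t)" "2 * pi"]
    by (subst (asm) sh) (simp_all add: periodic_g1[OF t])
  then show "arc_length (u + 2 * pi) t = arc_length u t + arc_length (2 * pi) t"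
    using arc_length_diff(1)[OF t, of "2 * pi" "u + 2 * pi"] u by (simp add: arc_length_def)
  have "integral {2 * pi..u + 2 * pi} (\<lambda>x. - (norm (g1 x t) * (norm (V x t))\<^sup>2))
      = integral {0..u} (\<lambda>x. - (norm (g1 x t) * (norm (V x t))\<^sup>2))"
    using integral_shift_Icc_real[of 0 u "\<lambda>x. - (norm (g1 x t) * (norm (V x t))\<^sup>2)" "2 * pi"]
    by (subst (asm) sh) (simp_all add: periodic_g1[OF t] periodic_V[OF t])
  then show "arc_length_t (u + 2 * pi) t = arc_length_t u t + arc_length_t (2 * pi) t"
    using arc_length_diff(2)[OF t, of "2 * pi" "u + 2 * pi"] u by (simp add: arc_length_t_def)
qed

lemma arc_length_pos: "t \<in> {0..<T} \<Longrightarrow> 0 < arc_length (2 * pi) t"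
proof -
  assume t: "t \<in> {0..<T}"
  obtain n0 where n0: "0 < n0" "\<And>u s. s \<in> {0..t} \<Longrightarrow> n0 \<le> norm (g1 u s)"
    using speed_bounds[of t] t by (metis atLeastLessThan_iff)
  have "integral {0..2 * pi} (\<lambda>x. n0) \<le> arc_length (2 * pi) t"
    unfolding arc_length_def using n0 t by (intro integral_le speed_integrable) auto
  moreover have "0 < integral {0..2 * pi} (\<lambda>x. n0)" using n0(1) by simp
  ultimately show ?thesis by (rule less_le_trans[rotated])
qed

lemma arc_param_0: "arc_param 0 t = 0" "arc_param_t 0 t = 0"
  by (simp_all add: arc_param_def arc_param_t_def arc_length_def arc_length_t_def)

lemma arc_param_periodic:
  assumes t: "t \<in> {0..<T}" and u: "0 \<le> u"
  shows "arc_param (u + 2 * pi) t = arc_param u t + 2 * pi" "arc_param_t (u + 2 * pi) t = arc_param_t u t"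
proof -
  note L = arc_length_pos[OF t]
  show "arc_param (u + 2 * pi) t = arc_param u t + 2 * pi"
    unfolding arc_param_def arc_length_periodic[OF t u] using L by (simp add: field_simps)
  show "arc_param_t (u + 2 * pi) t = arc_param_t u t"
    unfolding arc_param_t_def arc_length_periodic[OF t u] using L by (simp add: power2_eq_square field_simps)
qed

lemma arc_param_u:
  assumes t: "t \<in> {0..<T}" and u: "0 < u"
  shows "((\<lambda>v. arc_param v t) has_real_derivative 2 * pi / arc_length (2 * pi) t * norm (g1 u t)) (at u)"
  unfolding arc_param_def
  by (rule derivative_eq_intros arc_length_u[OF t u] refl)+ (use arc_length_pos[OF t] in \<open>auto simp: field_simps\<close>)

lemma arc_param_has_derivative_t:
  assumes t: "t \<in> {0..<T}" and u: "0 \<le> u"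
  shows "((\<lambda>s. arc_param u s) has_real_derivative arc_param_t u t) (at t within {0..<T})"
proof -
  have "0 \<le> 2 * pi" by simp
  note d = arc_length_has_derivative_t[OF t]
  show ?thesis
    unfolding arc_param_def arc_param_t_def
    by (rule derivative_eq_intros d[OF u] d[OF \<open>0 \<le> 2 * pi\<close>] refl)+
      (use arc_length_pos[OF t] in \<open>auto simp: field_simps power2_eq_square\<close>)
qed

text \<open>The drift is Lipschitz with respect to the arc length parameter itself, as the second
  bound of \<open>cis_area_gradient_bounds\<close> demands; m and M compare parameters and also
  enclose the factor of the operator.\<close>

lemma arc_param_bounds:
  assumes t2: "0 \<le> t2" "t2 < T"
  obtains m M c where "0 < m" "0 < M" "0 \<le> c"
    "\<And>u v t. t \<in> {0..t2} \<Longrightarrow> 0 \<le> u \<Longrightarrow> u \<le> v \<Longrightarrow> m * (v - u) \<le> arc_param v t - arc_param u t"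
    "\<And>u v t. t \<in> {0..t2} \<Longrightarrow> 0 \<le> u \<Longrightarrow> u \<le> v \<Longrightarrow> arc_param v t - arc_param u t \<le> M * (v - u)"
    "\<And>u v t. t \<in> {0..t2} \<Longrightarrow> 0 \<le> u \<Longrightarrow> u \<le> v \<Longrightarrow>
      \<bar>arc_param_t v t - arc_param_t u t\<bar> \<le> c * (arc_param v t - arc_param u t)"
    "\<And>t. t \<in> {0..t2} \<Longrightarrow> m \<le> 2 * pi / arc_length (2 * pi) t"
    "\<And>t. t \<in> {0..t2} \<Longrightarrow> 2 * pi / arc_length (2 * pi) t \<le> M"
proof -
  obtain n0 n1 B where n0: "0 < n0" "\<And>u t. t \<in> {0..t2} \<Longrightarrow> n0 \<le> norm (g1 u t)"
    and n1: "\<And>u t. t \<in> {0..t2} \<Longrightarrow> norm (g1 u t) \<le> n1" and B: "0 \<le> B"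
      "\<And>u t. t \<in> {0..t2} \<Longrightarrow> norm (g1 u t) * (norm (V u t))\<^sup>2 \<le> B"
    using speed_bounds[OF t2] by metis
  have n01: "n0 \<le> n1" using order_trans[OF n0(2) n1] t2 by auto
  have d: "n0 * (v - u) \<le> arc_length v t - arc_length u t" "arc_length v t - arc_length u t \<le> n1 * (v - u)"
    "\<bar>arc_length_t v t - arc_length_t u t\<bar> \<le> B * (v - u)"
    if t: "t \<in> {0..t2}" and uv: "0 \<le> u" "u \<le> v" for u v t
  proof -
    have tT: "t \<in> {0..<T}" using t t2 by auto
    have c: "integral {u..v} (\<lambda>x. k) = k * (v - u)" for k :: real using uv by simp
    have "integral {u..v} (\<lambda>x. n0) \<le> integral {u..v} (\<lambda>x. norm (g1 x t))"
      by (intro integral_le speed_integrable[OF tT] n0(2)[OF t]) auto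
    then show "n0 * (v - u) \<le> arc_length v t - arc_length u t"
      using arc_length_diff(1)[OF tT uv] by (simp only: c)
    have "integral {u..v} (\<lambda>x. norm (g1 x t)) \<le> integral {u..v} (\<lambda>x. n1)"
      by (intro integral_le speed_integrable[OF tT] n1[OF t]) auto
    then show "arc_length v t - arc_length u t \<le> n1 * (v - u)"
      using arc_length_diff(1)[OF tT uv] by (simp only: c)
    have "integral {u..v} (\<lambda>x. - B) \<le> integral {u..v} (\<lambda>x. - (norm (g1 x t) * (norm (V x t))\<^sup>2))"
      by (intro integral_le speed_integrable[OF tT]) (use B(2)[OF t] in auto)
    moreover have "integral {u..v} (\<lambda>x. - (norm (g1 x t) * (norm (V x t))\<^sup>2)) \<le> integral {u..v} (\<lambda>x. 0)"
      by (intro integral_le speed_integrable[OF tT]) auto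
    ultimately show "\<bar>arc_length_t v t - arc_length_t u t\<bar> \<le> B * (v - u)"
      using arc_length_diff(2)[OF tT uv] mult_nonneg_nonneg[OF B(1), of "v - u"] uv unfolding c by simp
  qed
  have L: "2 * pi * n0 \<le> arc_length (2 * pi) t" "arc_length (2 * pi) t \<le> 2 * pi * n1"
    "\<bar>arc_length_t (2 * pi) t\<bar> \<le> 2 * pi * B" if "t \<in> {0..t2}" for t
    using d[OF that, of 0 "2 * pi"] by (simp_all add: arc_length_def arc_length_t_def mult_ac)
  have Lp: "0 < arc_length (2 * pi) t" if "t \<in> {0..t2}" for t
    using arc_length_pos[of t] that t2 by auto
  have \<mu>: "1 / n1 \<le> 2 * pi / arc_length (2 * pi) t" "2 * pi / arc_length (2 * pi) t \<le> 1 / n0"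
    if "t \<in> {0..t2}" for t
    using L[OF that] Lp[OF that] n0(1) n01 by (simp_all add: field_simps)
  have pd: "arc_param v t - arc_param u t = 2 * pi / arc_length (2 * pi) t * (arc_length v t - arc_length u t)"
    for u v t by (simp add: arc_param_def diff_divide_distrib right_diff_distrib)
  \<comment> \<open>Each minimum and maximum joins the constant for parameter increments with the
    one for the scale factor \<open>2 * pi / arc_length (2 * pi) t\<close>.\<close>
  show thesis
  proof (rule that[of "min (n0 / n1) (1 / n1)" "max (n1 / n0) (1 / n0)" "2 * B / n0"])
    show "0 < min (n0 / n1) (1 / n1)" "0 < max (n1 / n0) (1 / n0)" "0 \<le> 2 * B / n0"
      using n0 n01 B by (auto simp: less_max_iff_disj)
    show "min (n0 / n1) (1 / n1) \<le> 2 * pi / arc_length (2 * pi) t"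
      "2 * pi / arc_length (2 * pi) t \<le> max (n1 / n0) (1 / n0)" if "t \<in> {0..t2}" for t
      using \<mu>[OF that] by auto
    fix u v t :: real assume t: "t \<in> {0..t2}" and uv: "0 \<le> u" "u \<le> v"
    note D = d[OF t uv]
    have "min (n0 / n1) (1 / n1) * (v - u) \<le> 1 / n1 * (n0 * (v - u))"
      using uv mult_right_mono[of "min (n0 / n1) (1 / n1)" "n0 / n1" "v - u"] by simp
    also have "\<dots> \<le> 2 * pi / arc_length (2 * pi) t * (arc_length v t - arc_length u t)"
      using D \<mu>[OF t] n0(1) n01 uv Lp[OF t] by (intro mult_mono) auto
    finally show "min (n0 / n1) (1 / n1) * (v - u) \<le> arc_param v t - arc_param u t" by (simp only: pd)
    have D0: "0 \<le> arc_length v t - arc_length u t"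
    proof -
      have "0 \<le> n0 * (v - u)" using n0(1) uv by simp
      with D(1) show ?thesis by linarith
    qed
    have "2 * pi / arc_length (2 * pi) t * (arc_length v t - arc_length u t) \<le> 1 / n0 * (n1 * (v - u))"
      using D \<mu>[OF t] n0(1) D0 by (intro mult_mono) auto
    also have "\<dots> \<le> max (n1 / n0) (1 / n0) * (v - u)"
      using uv mult_right_mono[of "n1 / n0" "max (n1 / n0) (1 / n0)" "v - u"] by simp
    finally show "arc_param v t - arc_param u t \<le> max (n1 / n0) (1 / n0) * (v - u)" by (simp only: pd)
    define p where "p = arc_param v t - arc_param u t"
    define A where "A = arc_length (2 * pi) t"
    have A: "0 < A" "2 * pi * n0 \<le> A" using Lp[OF t] L(1)[OF t] by (auto simp: A_def)
    have p: "p = 2 * pi / A * (arc_length v t - arc_length u t)" by (simp add: p_def pd A_def)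
    have p0: "0 \<le> p" unfolding p using A D0 by simp
    have "arc_param_t v t - arc_param_t u t = 2 * pi / A * (arc_length_t v t - arc_length_t u t)
        - p * (arc_length_t (2 * pi) t / A)"
      unfolding arc_param_t_def p A_def[symmetric] using A(1) by (simp add: field_simps power2_eq_square)
    then have "\<bar>arc_param_t v t - arc_param_t u t\<bar> \<le> \<bar>2 * pi / A * (arc_length_t v t - arc_length_t u t)\<bar>
        + \<bar>p * (arc_length_t (2 * pi) t / A)\<bar>" by linarith
    moreover have "\<bar>2 * pi / A * (arc_length_t v t - arc_length_t u t)\<bar> \<le> B / n0 * p"
    proof -
      have "\<bar>2 * pi / A * (arc_length_t v t - arc_length_t u t)\<bar>
          = 2 * pi / A * \<bar>arc_length_t v t - arc_length_t u t\<bar>" using A by (simp add: abs_mult)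
      also have "\<dots> \<le> 2 * pi / A * (B / n0 * (n0 * (v - u)))"
        using D(3) A n0(1) by (intro mult_left_mono) auto
      also have "\<dots> \<le> 2 * pi / A * (B / n0 * (arc_length v t - arc_length u t))"
        using D(1) A n0(1) B(1) by (intro mult_left_mono) auto
      also have "\<dots> = B / n0 * p" unfolding p by (simp add: mult_ac)
      finally show ?thesis .
    qed
    moreover have "\<bar>p * (arc_length_t (2 * pi) t / A)\<bar> \<le> B / n0 * p"
    proof -
      have "\<bar>arc_length_t (2 * pi) t\<bar> / A \<le> (2 * pi * B) / (2 * pi * n0)"
        using L(3)[OF t] A n0(1) B(1) by (intro frac_le) auto
      then have "\<bar>arc_length_t (2 * pi) t / A\<bar> \<le> B / n0" using A by simp
      then show ?thesis using p0 mult_right_mono[of "\<bar>arc_length_t (2 * pi) t / A\<bar>" "B / n0" p]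
        by (simp only: abs_mult abs_of_nonneg[OF p0] mult.commute)
    qed
    ultimately show "\<bar>arc_param_t v t - arc_param_t u t\<bar> \<le> 2 * B / n0 * (arc_param v t - arc_param u t)"
      unfolding p_def[symmetric] by simp
  qed
qed

lemma cont_arc_param:
  assumes t2: "0 \<le> t2" "t2 < T"
  shows "continuous_on ({0..} \<times> {0..t2}) (\<lambda>(u, t). arc_param u t)"
proof -
  obtain m M where mM: "0 < m"
    "\<And>u v t. t \<in> {0..t2} \<Longrightarrow> 0 \<le> u \<Longrightarrow> u \<le> v \<Longrightarrow> m * (v - u) \<le> arc_param v t - arc_param u t"
    "\<And>u v t. t \<in> {0..t2} \<Longrightarrow> 0 \<le> u \<Longrightarrow> u \<le> v \<Longrightarrow> arc_param v t - arc_param u t \<le> M * (v - u)"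
    using arc_param_bounds[OF t2] by metis
  show ?thesis
  proof (rule continuous_on_Lipschitz_fst)
    fix u v t :: real assume *: "u \<in> {0..}" "v \<in> {0..}" "t \<in> {0..t2}"
    have "\<bar>arc_param x t - arc_param y t\<bar> \<le> M * (x - y)" if "0 \<le> y" "y \<le> x" for x y
    proof -
      have "0 \<le> m * (x - y)" using mM(1) that by simp
      then show ?thesis using mM(2)[OF *(3) that] mM(3)[OF *(3) that] by linarith
    qed
    from this[of u v] this[of v u] show "\<bar>arc_param u t - arc_param v t\<bar> \<le> M * \<bar>u - v\<bar>"
      using * by (cases "u \<le> v") (auto simp: abs_minus_commute)
  next
    fix u :: real assume "u \<in> {0..}"
    then show "continuous_on {0..t2} (\<lambda>t. arc_param u t)"
      using arc_param_has_derivative_t[of _ u] t2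
      by (intro continuous_on_subset[OF DERIV_continuous_on, of "{0..<T}"]) auto
  qed
qed

end

section \<open>The growing barrier\<close>

context space_form
begin

text \<open>The second derivative test in one parameter with the other two fixed. Adding
  \<open>A1\<close> times the vanishing first derivative to \<open>A2\<close> times the second one
  turns the barrier's part into a pure second derivative in the arc length parameter.\<close>

lemma barrier_slot:
  fixes y z p k E :: real
  assumes s: "s \<in> {0..<T}" and u: "0 < u"
    and h: "\<And>x. (h has_real_derivative \<beta> (g1 x s) e) (at x)"
    and min: "\<forall>\<^sub>F x in nhds u. h u - E * (cis_area (arc_param u s) y z * (k - (arc_param u s - p)\<^sup>2)\<^sup>2)
      \<le> h x - E * (cis_area (arc_param x s) y z * (k - (arc_param x s - p)\<^sup>2)\<^sup>2)"
  shows "E * (2 * pi / arc_length (2 * pi) s)\<^sup>2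
      * (- (sin (y - arc_param u s) + sin (arc_param u s - z)) * (k - (arc_param u s - p)\<^sup>2)\<^sup>2
         - 8 * (cos (arc_param u s - z) - cos (y - arc_param u s)) * (k - (arc_param u s - p)\<^sup>2) * (arc_param u s - p)
         + cis_area (arc_param u s) y z * (8 * (arc_param u s - p)\<^sup>2 - 4 * (k - (arc_param u s - p)\<^sup>2)))
    \<le> A2 u s * \<beta> (g2 u s) e + A1 u s * \<beta> (g1 u s) e"
proof -
  define \<mu> where "\<mu> = 2 * pi / arc_length (2 * pi) s"
  define N where "N = (\<lambda>x. norm (g1 x s))"
  define H1 where "H1 = (\<lambda>x. (cos (x - z) - cos (y - x)) * (k - (x - p)\<^sup>2)\<^sup>2 - 4 * cis_area x y z * (k - (x - p)\<^sup>2) * (x - p))"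
  define H2 where "H2 = (\<lambda>x. - (sin (y - x) + sin (x - z)) * (k - (x - p)\<^sup>2)\<^sup>2
      - 8 * (cos (x - z) - cos (y - x)) * (k - (x - p)\<^sup>2) * (x - p)
      + cis_area x y z * (8 * (x - p)\<^sup>2 - 4 * (k - (x - p)\<^sup>2)))"
  have HH: "((\<lambda>x. cis_area x y z * (k - (x - p)\<^sup>2)\<^sup>2) has_real_derivative H1 x) (at x)"
    "(H1 has_real_derivative H2 x) (at x)" for x
    using barrier_derivs[where x = x and y = y and z = z and k = k and p = p] by (simp_all add: H1_def H2_def)
  have \<sigma>: "((\<lambda>v. arc_param v s) has_real_derivative \<mu> * N x) (at x)" if "0 < x" for x
    using arc_param_u[OF s that] by (simp add: \<mu>_def N_def)
  have N: "0 < N u" using g1_nz[OF s, of u] by (simp add: N_def)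
  define r where "r = inner (g1 u s) (g2 u s)"
  have Nu: "(N has_real_derivative r / N u) (at u)"
    unfolding N_def r_def by (rule has_real_derivative_norm[OF g1_u[OF s] g1_nz[OF s]])
  define fu where "fu = (\<lambda>x. \<beta> (g1 x s) e - E * (H1 (arc_param x s) * (\<mu> * N x)))"
  define fuu where "fuu = \<beta> (g2 u s) e - E * (H2 (arc_param u s) * (\<mu> * N u) * (\<mu> * N u)
      + H1 (arc_param u s) * (\<mu> * (r / N u)))"
  have pos: "\<forall>\<^sub>F x in nhds u. 0 < x"
    using eventually_nhds_in_open[of "{0<..}" u] u by simp
  have d: "\<forall>\<^sub>F x in nhds u. ((\<lambda>x. h x - E * (cis_area (arc_param x s) y z * (k - (arc_param x s - p)\<^sup>2)\<^sup>2))
      has_real_derivative fu x) (at x)"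
    using pos
  proof eventually_elim
    case (elim x)
    show ?case unfolding fu_def
      by (rule DERIV_diff[OF h DERIV_cmult[OF DERIV_chain2[OF HH(1) \<sigma>[OF elim]]]])
  qed
  have d2: "(fu has_real_derivative fuu) (at u)"
  proof -
    have "((\<lambda>x. H1 (arc_param x s) * (\<mu> * N x)) has_real_derivative
        H2 (arc_param u s) * (\<mu> * N u) * (\<mu> * N u) + \<mu> * (r / N u) * H1 (arc_param u s)) (at u)"
      by (rule DERIV_mult[OF DERIV_chain2[OF HH(2) \<sigma>[OF u]] DERIV_cmult[OF Nu]])
    from DERIV_diff[OF B_derivs(2)[OF s, of e u] DERIV_cmult[OF this, of E]]
    show ?thesis unfolding fu_def fuu_def by (simp add: mult.commute)
  qed
  note m = local_min_second_derivative[OF d d2 min]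
  have "A2 u s * fuu + A1 u s * fu u = A2 u s * \<beta> (g2 u s) e + A1 u s * \<beta> (g1 u s) e - E * \<mu>\<^sup>2 * H2 (arc_param u s)"
  proof -
    have n: "norm (g1 u s) = N u" by (simp add: N_def)
    show ?thesis
      unfolding fuu_def fu_def r_def[symmetric] n using N
      by (simp add: field_simps power2_eq_square power4_eq_xxxx)
  qed
  moreover have "0 \<le> A2 u s * fuu" using m(2) A2_pos[OF s, of u] by simp
  ultimately have "E * \<mu>\<^sup>2 * H2 (arc_param u s) \<le> A2 u s * \<beta> (g2 u s) e + A1 u s * \<beta> (g1 u s) e"
    using m(1) by simp
  then show ?thesis by (simp add: \<mu>_def H2_def)
qed

lemma arc_param_2pi: "t \<in> {0..<T} \<Longrightarrow> arc_param (2 * pi * real n) t = 2 * pi * real n"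
proof (induction n)
  case 0
  then show ?case by (simp add: arc_param_0)
next
  case (Suc n)
  have "arc_param (2 * pi * real (Suc n)) t = arc_param (2 * pi * real n + 2 * pi) t" by (simp add: algebra_simps)
  also have "\<dots> = arc_param (2 * pi * real n) t + 2 * pi" by (rule arc_param_periodic[OF Suc.prems]) simp
  finally show ?case using Suc by (simp add: algebra_simps)
qed

lemma positive_nearby:
  assumes pos: "0 < B u v w t" and t: "t \<in> {0..<T}"
  obtains d where "0 < d" "\<And>x y z. \<bar>x - u\<bar> < d \<Longrightarrow> \<bar>y - v\<bar> < d \<Longrightarrow> \<bar>z - w\<bar> < d \<Longrightarrow> B u v w t / 2 < B x y z t"
proof -
  have "continuous_on (UNIV \<times> UNIV \<times> UNIV \<times> {t}) (\<lambda>(u, v, w, t). B u v w t)" by (rule cont_B) (use t in auto)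
  moreover have "continuous_on UNIV (\<lambda>x :: real \<times> real \<times> real. (fst x, fst (snd x), snd (snd x), t))"
    by (intro continuous_intros)
  moreover have "range (\<lambda>x :: real \<times> real \<times> real. (fst x, fst (snd x), snd (snd x), t)) \<subseteq> UNIV \<times> UNIV \<times> UNIV \<times> {t}"
    by auto
  ultimately have "continuous_on UNIV (\<lambda>x. (\<lambda>(u, v, w, t). B u v w t) (fst x, fst (snd x), snd (snd x), t))"
    by (rule continuous_on_compose2)
  then have "continuous_on UNIV (\<lambda>x. B (fst x) (fst (snd x)) (snd (snd x)) t)" by simp
  then obtain d where d: "d > 0"
    "\<And>x. dist x (u, v, w) < d \<Longrightarrow> dist (B (fst x) (fst (snd x)) (snd (snd x)) t) (B u v w t) < B u v w t / 2"
    using pos unfolding continuous_on_iff by (metis UNIV_I fst_conv half_gt_zero snd_conv)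
  show thesis
  proof (rule that[of "d / 3"])
    fix x y z assume *: "\<bar>x - u\<bar> < d / 3" "\<bar>y - v\<bar> < d / 3" "\<bar>z - w\<bar> < d / 3"
    have "dist (x, y, z) (u, v, w) \<le> \<bar>x - u\<bar> + dist (y, z) (v, w)"
      using sqrt_sum_squares_le_sum_abs[of "dist x u" "dist (y, z) (v, w)"] by (simp add: dist_Pair_Pair dist_real_def)
    also have "dist (y, z) (v, w) \<le> \<bar>y - v\<bar> + \<bar>z - w\<bar>"
      using sqrt_sum_squares_le_sum_abs[of "dist y v" "dist z w"] by (simp add: dist_Pair_Pair dist_real_def)
    finally have "dist (x, y, z) (u, v, w) < d" using * by linarith
    from d(2)[OF this] have "\<bar>B x y z t - B u v w t\<bar> < B u v w t / 2" by (simp add: dist_real_def)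
    then show "B u v w t / 2 < B x y z t" by linarith
  qed (use d in simp)
qed

text \<open>The barrier is \<open>\<epsilon> e\<^bsup>- K s\<^esup> cis_area \<phi>\<^sup>2\<close> in the arc length parameters. It is supported where \<open>\<phi> \<ge> 0\<close>, a ball
  around the starting triple that grows until it contains the whole simplex.\<close>

lemma B_strict_arc:
  assumes t2: "0 < t2" "t2 < T"
    and nonneg: "\<And>u v w s. s \<in> {0..t2} \<Longrightarrow> u \<le> v \<Longrightarrow> v \<le> w \<Longrightarrow> w \<le> u + 2 * pi \<Longrightarrow> 0 \<le> B u v w s"
    and start: "u1 < v1" "v1 < w1" "w1 < u1 + 2 * pi" "0 < B u1 v1 w1 0" "8 * pi \<le> u1" "u1 < 10 * pi"
  obtains k where "0 < k" "\<And>u v w. 8 * pi \<le> u \<Longrightarrow> u \<le> 10 * pi \<Longrightarrow> u \<le> v \<Longrightarrow> v \<le> w \<Longrightarrow> w \<le> u + 2 * pi \<Longrightarrow>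
    k * cis_area (arc_param u t2) (arc_param v t2) (arc_param w t2) \<le> B u v w t2"
proof -
  let ?\<sigma> = arc_param
  have t2': "0 \<le> t2" using t2 by simp
  have sT: "s \<in> {0..<T}" if "s \<in> {0..t2}" for s using that t2 by auto
  obtain m M c where m: "0 < m" and M: "0 < M" and c: "0 \<le> c"
    and low: "\<And>u v t. t \<in> {0..t2} \<Longrightarrow> 0 \<le> u \<Longrightarrow> u \<le> v \<Longrightarrow> m * (v - u) \<le> ?\<sigma> v t - ?\<sigma> u t"
    and lip: "\<And>u v t. t \<in> {0..t2} \<Longrightarrow> 0 \<le> u \<Longrightarrow> u \<le> v \<Longrightarrow>
      \<bar>arc_param_t v t - arc_param_t u t\<bar> \<le> c * (?\<sigma> v t - ?\<sigma> u t)"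
    and mu: "\<And>t. t \<in> {0..t2} \<Longrightarrow> m \<le> 2 * pi / arc_length (2 * pi) t"
      "\<And>t. t \<in> {0..t2} \<Longrightarrow> 2 * pi / arc_length (2 * pi) t \<le> M"
    by (rule arc_param_bounds[OF t2' t2(2)], rule that)
  have mono: "?\<sigma> u s \<le> ?\<sigma> v s" if "s \<in> {0..t2}" "0 \<le> u" "u \<le> v" for u v s
  proof -
    have "0 \<le> m * (v - u)" using m that by simp
    with low[OF that] show ?thesis by linarith
  qed
  have smono: "?\<sigma> u s < ?\<sigma> v s" if "s \<in> {0..t2}" "0 \<le> u" "u < v" for u v s
  proof -
    have "0 < m * (v - u)" using m that by simp
    with low[of s u v] that show ?thesis by linarith
  qed
  have \<sigma>2: "?\<sigma> (8 * pi) s = 8 * pi" "?\<sigma> (10 * pi) s = 10 * pi" "?\<sigma> (12 * pi) s = 12 * pi" "?\<sigma> (20 * pi) s = 20 * pi"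
    if "s \<in> {0..t2}" for s
    using arc_param_2pi[OF sT[OF that], of 4] arc_param_2pi[OF sT[OF that], of 5]
      arc_param_2pi[OF sT[OF that], of 6] arc_param_2pi[OF sT[OF that], of 10] by (simp_all add: mult.commute)
  have z0: "0 \<in> {0..t2}" "t2 \<in> {0..t2}" using t2 by auto
  define p q r where "p = ?\<sigma> u1 0" and "q = ?\<sigma> v1 0" and "r = ?\<sigma> w1 0"
  have u1: "0 \<le> u1" using start pi_gt_zero by linarith
  have pqr: "p < q" "q < r" "r < p + 2 * pi" "8 * pi \<le> p" "p \<le> 10 * pi" "r \<le> 12 * pi"
  proof -
    show "p < q" "q < r" unfolding p_def q_def r_def using start u1 by (auto intro!: smono[OF z0(1)])
    have "r < ?\<sigma> (u1 + 2 * pi) 0" unfolding r_def using start u1 by (intro smono[OF z0(1)]) auto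
    then show "r < p + 2 * pi" unfolding p_def using arc_param_periodic(1)[OF sT[OF z0(1)] u1] by simp
    show "8 * pi \<le> p" "p \<le> 10 * pi" unfolding p_def
      using mono[OF z0(1), of "8 * pi" u1] mono[OF z0(1), of u1 "10 * pi"] start u1 \<sigma>2[OF z0(1)] by auto
    then show "r \<le> 12 * pi" using \<open>r < p + 2 * pi\<close> by simp
  qed
  obtain d where d: "0 < d"
    and near: "\<And>x y z. \<bar>x - u1\<bar> < d \<Longrightarrow> \<bar>y - v1\<bar> < d \<Longrightarrow> \<bar>z - w1\<bar> < d \<Longrightarrow> B u1 v1 w1 0 / 2 < B x y z 0"
    using positive_nearby[OF start(4) sT[OF z0(1)]] by metis
  \<comment> \<open>So small that a nonnegative \<phi> at time 0 forces each parameter to within d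
    of the starting triple, where the form keeps half of its value.\<close>
  define \<rho>0 where "\<rho>0 = min 1 ((m * d / 2)\<^sup>2)"
  have \<rho>0: "0 < \<rho>0" "\<rho>0 \<le> 1" "\<rho>0 \<le> (m * d / 2)\<^sup>2" using m d by (auto simp: \<rho>0_def)
  \<comment> \<open>Fitted to time t2: the parameters then range over 8 * pi to 12 * pi, the three
    squares sum to at most \<open>48 * pi\<^sup>2\<close>, and \<phi> is at least
    \<open>2 * pi\<^sup>2\<close> on the whole simplex.\<close>
  define \<rho>1 where "\<rho>1 = 50 * pi\<^sup>2 / t2"
  have \<rho>1: "0 < \<rho>1" using t2 by (simp add: \<rho>1_def)
  define \<phi> where "\<phi> = (\<lambda>u v w s. \<rho>0 + \<rho>1 * s - (?\<sigma> u s - p)\<^sup>2 - (?\<sigma> v s - q)\<^sup>2 - (?\<sigma> w s - r)\<^sup>2)"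
  define S0 where "S0 = 3 * (8 * pi * (c * (20 * pi)))"
  define E1 where "E1 = 44 * M\<^sup>2 + 2 * (\<rho>1 + 2 * S0)"
  define D where "D = m\<^sup>2 * \<rho>0"
  have D: "0 < D" using m \<rho>0 by (simp add: D_def)
  \<comment> \<open>The summands offset the drift of \<open>cis_area\<close>, its own Laplacian (-2
    times itself) and, by completing a square, all terms linear in \<phi>.\<close>
  define K where "K = 3 * c + 2 * M\<^sup>2 + E1\<^sup>2 / (16 * D)"
  \<comment> \<open>With \<open>cis_area \<le> 3\<close> and \<phi> \<le> \<rho>0 at time 0, the
    initial barrier is at most half of the starting value.\<close>
  define \<epsilon> where "\<epsilon> = B u1 v1 w1 0 / 2 / (3 * \<rho>0\<^sup>2)"
  have \<epsilon>: "0 < \<epsilon>" using start \<rho>0 by (simp add: \<epsilon>_def)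
  define E where "E = (\<lambda>s. \<epsilon> * exp (- K * s))"
  have E: "0 < E s" for s using \<epsilon> by (simp add: E_def)
  define F where "F = (\<lambda>u v w s. B u v w s - E s * (cis_area (?\<sigma> u s) (?\<sigma> v s) (?\<sigma> w s) * (\<phi> u v w s)\<^sup>2))"
  \<comment> \<open>Where \<phi> is nonnegative the parameters are less than 8 * pi away from p, q,
    r, which lie between 8 * pi and 12 * pi. So the ends of this window are never reached and the
    minimum is interior.\<close>
  let ?I = "{0..20 * pi}"
  let ?Q = "?I \<times> ?I \<times> ?I \<times> {0..t2}"
  have c\<sigma>: "continuous_on ?Q (\<lambda>x. ?\<sigma> (f x) (snd (snd (snd x))))"
    if "continuous_on ?Q f" "\<And>x. x \<in> ?Q \<Longrightarrow> 0 \<le> f x" for f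
  proof -
    have p: "continuous_on ?Q (\<lambda>x. (f x, snd (snd (snd x))))" by (intro continuous_intros that)
    have i: "(\<lambda>x. (f x, snd (snd (snd x)))) ` ?Q \<subseteq> {0..} \<times> {0..t2}" using that(2) by auto
    show ?thesis using continuous_on_compose2[OF cont_arc_param[OF t2' t2(2)] p i] by simp
  qed
  have c\<sigma>3: "continuous_on ?Q (\<lambda>x. ?\<sigma> (fst x) (snd (snd (snd x))))"
    "continuous_on ?Q (\<lambda>x. ?\<sigma> (fst (snd x)) (snd (snd (snd x))))"
    "continuous_on ?Q (\<lambda>x. ?\<sigma> (fst (snd (snd x))) (snd (snd (snd x))))"
    by (rule c\<sigma>; auto intro!: continuous_intros)+
  have c\<phi>: "continuous_on ?Q (\<lambda>x. \<phi> (fst x) (fst (snd x)) (fst (snd (snd x))) (snd (snd (snd x))))"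
    unfolding \<phi>_def by (intro continuous_intros c\<sigma>3)
  let ?G = "{x \<in> ?Q. 0 \<le> \<phi> (fst x) (fst (snd x)) (fst (snd (snd x))) (snd (snd (snd x)))}"
  let ?S = "{x. fst x \<le> fst (snd x) \<and> fst (snd x) \<le> fst (snd (snd x)) \<and> fst (snd (snd x)) \<le> fst x + 2 * pi}"
  let ?K = "?G \<inter> ?S"
  have "closed ?S" by (intro closed_Collect_conj closed_Collect_le continuous_intros)
  moreover have "compact ?G"
  proof -
    have cQ: "compact ?Q" by (intro compact_Times compact_Icc)
    have "?G = ?Q \<inter> (\<lambda>x. \<phi> (fst x) (fst (snd x)) (fst (snd (snd x))) (snd (snd (snd x)))) -` {0..}" by auto
    moreover have "closed (?Q \<inter> (\<lambda>x. \<phi> (fst x) (fst (snd x)) (fst (snd (snd x))) (snd (snd (snd x)))) -` {0..})"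
      by (intro continuous_closed_preimage c\<phi> compact_imp_closed cQ closed_atLeast)
    ultimately have "closed ?G" by simp
    with cQ have "compact (?Q \<inter> ?G)" by (rule compact_Int_closed)
    moreover have "?Q \<inter> ?G = ?G" by auto
    ultimately show ?thesis by simp
  qed
  ultimately have cK: "compact ?K" by (intro compact_Int_closed)
  have cF: "continuous_on ?K (\<lambda>(u, v, w, s). F u v w s)"
  proof -
    have sub: "?K \<subseteq> ?Q" by auto
    have "continuous_on ?K (\<lambda>(u, v, w, t). B u v w t)" by (rule cont_B) (use t2 in auto)
    then show ?thesis
      unfolding F_def E_def cis_area_def case_prod_unfold
      by (intro continuous_intros continuous_on_subset[OF c\<sigma>3(1) sub] continuous_on_subset[OF c\<sigma>3(2) sub]
          continuous_on_subset[OF c\<sigma>3(3) sub] continuous_on_subset[OF c\<phi> sub])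
  qed
  have large: "\<bar>?\<sigma> u s - p\<bar> < 8 * pi" "\<bar>?\<sigma> v s - q\<bar> < 8 * pi" "\<bar>?\<sigma> w s - r\<bar> < 8 * pi"
    if "0 \<le> \<phi> u v w s" "s \<in> {0..t2}" for u v w s
  proof -
    have "\<rho>1 * s \<le> 50 * pi\<^sup>2" using that t2 mult_left_mono[of s t2 "50 * pi\<^sup>2"] by (simp add: \<rho>1_def field_simps)
    moreover have "1 < pi\<^sup>2" using pi_gt3 by (simp add: one_less_power)
    moreover have "(8 * pi)\<^sup>2 = 64 * pi\<^sup>2" by (simp add: power_mult_distrib)
    moreover have "(?\<sigma> u s - p)\<^sup>2 + (?\<sigma> v s - q)\<^sup>2 + (?\<sigma> w s - r)\<^sup>2 \<le> \<rho>0 + \<rho>1 * s"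
      using that by (simp add: \<phi>_def)
    moreover have "0 \<le> (?\<sigma> u s - p)\<^sup>2" "0 \<le> (?\<sigma> v s - q)\<^sup>2" "0 \<le> (?\<sigma> w s - r)\<^sup>2" by simp_all
    ultimately have "(?\<sigma> u s - p)\<^sup>2 < (8 * pi)\<^sup>2" "(?\<sigma> v s - q)\<^sup>2 < (8 * pi)\<^sup>2" "(?\<sigma> w s - r)\<^sup>2 < (8 * pi)\<^sup>2"
      using \<rho>0 by linarith+
    then show "\<bar>?\<sigma> u s - p\<bar> < 8 * pi" "\<bar>?\<sigma> v s - q\<bar> < 8 * pi" "\<bar>?\<sigma> w s - r\<bar> < 8 * pi"
      using abs_le_square_iff[of "8 * pi"] by (auto simp: not_le[symmetric])
  qed
  have F_init: "0 \<le> F u v w 0" if uvw: "(u, v, w, 0) \<in> ?K" for u v w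
  proof -
    have ph: "0 \<le> \<phi> u v w 0" "0 \<le> u" "u \<le> v" "v \<le> w" "w \<le> u + 2 * pi" using uvw by auto
    have sq: "(?\<sigma> u 0 - p)\<^sup>2 + (?\<sigma> v 0 - q)\<^sup>2 + (?\<sigma> w 0 - r)\<^sup>2 \<le> (m * d / 2)\<^sup>2"
      using ph(1) \<rho>0(3) by (simp add: \<phi>_def)
    have "\<bar>x - y\<bar> < d" if xy: "0 \<le> x" "0 \<le> y" "(?\<sigma> x 0 - ?\<sigma> y 0)\<^sup>2 \<le> (m * d / 2)\<^sup>2" for x y
    proof -
      have "m * \<bar>x - y\<bar> \<le> \<bar>?\<sigma> x 0 - ?\<sigma> y 0\<bar>"
        using low[OF z0(1) xy(1), of y] low[OF z0(1) xy(2), of x] by (cases "x \<le> y") (auto simp: abs_if)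
      also have "\<dots> \<le> m * d / 2" using xy(3) m d by (metis abs_le_square_iff abs_of_pos half_gt_zero mult_pos_pos)
      finally have "m * \<bar>x - y\<bar> < m * d" using m d mult_pos_pos[OF m d] by linarith
      then show ?thesis using m by simp
    qed
    note cl = this
    have "\<bar>u - u1\<bar> < d" "\<bar>v - v1\<bar> < d" "\<bar>w - w1\<bar> < d"
      using sq ph start u1 unfolding p_def q_def r_def
      by (auto intro!: cl intro: order_trans[OF _ sq[unfolded p_def q_def r_def]])
    from near[OF this] have "B u1 v1 w1 0 / 2 < B u v w 0" .
    moreover have "E 0 * (cis_area (?\<sigma> u 0) (?\<sigma> v 0) (?\<sigma> w 0) * (\<phi> u v w 0)\<^sup>2) \<le> B u1 v1 w1 0 / 2"
    proof -
      have "0 \<le> (?\<sigma> u 0 - p)\<^sup>2" "0 \<le> (?\<sigma> v 0 - q)\<^sup>2" "0 \<le> (?\<sigma> w 0 - r)\<^sup>2" by simp_all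
      then have "\<phi> u v w 0 \<le> \<rho>0" unfolding \<phi>_def by linarith
      then have "(\<phi> u v w 0)\<^sup>2 \<le> \<rho>0\<^sup>2" using ph by (intro power_mono) auto
      then have "cis_area (?\<sigma> u 0) (?\<sigma> v 0) (?\<sigma> w 0) * (\<phi> u v w 0)\<^sup>2 \<le> 3 * \<rho>0\<^sup>2"
        using cis_area_le by (intro mult_mono) auto
      then have "E 0 * (cis_area (?\<sigma> u 0) (?\<sigma> v 0) (?\<sigma> w 0) * (\<phi> u v w 0)\<^sup>2) \<le> \<epsilon> * (3 * \<rho>0\<^sup>2)"
        using \<epsilon> by (simp add: E_def)
      also have "\<dots> = B u1 v1 w1 0 / 2" using \<rho>0 by (simp add: \<epsilon>_def)
      finally show ?thesis .
    qed
    ultimately show ?thesis by (simp add: F_def)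
  qed
  have nonneg_F: "0 \<le> F u v w s" if uvws: "(u, v, w, s) \<in> ?K" for u v w s
  proof (rule ccontr)
    assume neg: "\<not> 0 \<le> F u v w s"
    have "?K \<noteq> {}" using uvws by blast
    from continuous_attains_inf[OF cK this cF] obtain y where y: "y \<in> ?K"
      "\<forall>x\<in>?K. (\<lambda>(u, v, w, s). F u v w s) y \<le> (\<lambda>(u, v, w, s). F u v w s) x" by blast
    obtain u0 v0 w0 s0 where ydef: "y = (u0, v0, w0, s0)" by (cases y)
    have K0: "(u0, v0, w0, s0) \<in> ?K" using y(1) ydef by simp
    have min: "F u0 v0 w0 s0 \<le> F u v w s" if "(u, v, w, s) \<in> ?K" for u v w s
      using bspec[OF y(2) that] by (simp add: ydef)
    have Fneg: "F u0 v0 w0 s0 < 0" using min[OF uvws] neg by simp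
    have s0: "s0 \<in> {0..t2}" and o': "u0 \<le> v0" "v0 \<le> w0" "w0 \<le> u0 + 2 * pi" and nn: "0 \<le> u0" "0 \<le> v0" "0 \<le> w0"
      and le20: "u0 \<le> 20 * pi" "v0 \<le> 20 * pi" "w0 \<le> 20 * pi" and \<phi>0: "0 \<le> \<phi> u0 v0 w0 s0" using K0 by auto
    note s0T = sT[OF s0]
    define x y z where "x = ?\<sigma> u0 s0" and "y = ?\<sigma> v0 s0" and "z = ?\<sigma> w0 s0"
    define V where "V = cis_area x y z"
    define f where "f = \<phi> u0 v0 w0 s0"
    have s_ne: "s0 \<noteq> 0" using F_init[of u0 v0 w0] K0 Fneg by auto
    have s_pos: "0 < s0" using s_ne s0 by auto
    \<comment> \<open>On the faces of the simplex and on the edge of the ball the barrier vanishes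
      and F is nonnegative, so a negative minimum is off both.\<close>
    have "V * f\<^sup>2 \<noteq> 0"
    proof
      assume "V * f\<^sup>2 = 0"
      then have "F u0 v0 w0 s0 = B u0 v0 w0 s0" by (simp add: F_def V_def f_def x_def y_def z_def)
      with Fneg nonneg[OF s0 o'] show False by simp
    qed
    then have Vn: "V \<noteq> 0" and fpos: "0 < f" using \<phi>0 by (auto simp: f_def less_le)
    have zp: "z \<le> x + 2 * pi"
      using mono[OF s0 nn(3) o'(3)] arc_param_periodic(1)[OF s0T nn(1)] by (simp add: x_def z_def)
    have xyz': "x \<le> y" "y \<le> z" using mono[OF s0 nn(1) o'(1)] mono[OF s0 nn(2) o'(2)] by (simp_all add: x_def y_def z_def)
    have Vpos: "0 < V" using cis_area_nonneg[OF xyz' zp] Vn by (simp add: V_def less_le)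
    have "sin (x + 2 * pi - y) = sin (x - y)" using sin_periodic[of "x - y"] by (simp add: algebra_simps)
    then have "x \<noteq> y" "y \<noteq> z" "z \<noteq> x + 2 * pi"
      using Vn sin_minus[of "x - z"] sin_minus[of "x - y"] by (auto simp: V_def cis_area_def)
    then have xyz: "x < y" "y < z" "z < x + 2 * pi" using xyz' zp by auto
    have "u0 \<noteq> v0" "v0 \<noteq> w0" using xyz by (auto simp: x_def y_def z_def)
    moreover have "w0 \<noteq> u0 + 2 * pi" using xyz arc_param_periodic(1)[OF s0T nn(1)] by (auto simp: x_def z_def)
    ultimately have o: "u0 < v0" "v0 < w0" "w0 < u0 + 2 * pi" using o' by auto
    note lg = large[OF \<phi>0 s0, folded x_def y_def z_def]
    have xb: "0 < x" "x < 20 * pi" "0 < y" "y < 20 * pi" "0 < z" "z < 20 * pi"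
      using lg pqr xyz by (auto simp: abs_less_iff)
    have upos: "0 < u0" "0 < v0" "0 < w0"
      using xb nn arc_param_0(1)[of s0] by (auto simp: x_def y_def z_def less_le)
    have ult: "u0 < 20 * pi" "v0 < 20 * pi" "w0 < 20 * pi"
      using xb le20 \<sigma>2(4)[OF s0] by (auto simp: x_def y_def z_def less_le)
    have tend: "((\<lambda>v. ?\<sigma> v s0) \<longlongrightarrow> ?\<sigma> u s0) (nhds u)" if "0 < u" for u
      by (rule DERIV_tendsto_nhds[OF arc_param_u[OF s0T that]])
    have ev\<phi>: "\<forall>\<^sub>F u in nhds u0. 0 < \<phi> u v0 w0 s0" "\<forall>\<^sub>F v in nhds v0. 0 < \<phi> u0 v w0 s0"
      "\<forall>\<^sub>F w in nhds w0. 0 < \<phi> u0 v0 w s0"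
    proof -
      have "((\<lambda>u. \<phi> u v0 w0 s0) \<longlongrightarrow> f) (nhds u0)" "((\<lambda>v. \<phi> u0 v w0 s0) \<longlongrightarrow> f) (nhds v0)"
        "((\<lambda>w. \<phi> u0 v0 w s0) \<longlongrightarrow> f) (nhds w0)"
        unfolding \<phi>_def f_def using upos by (auto intro!: tendsto_intros tend)
      from this[THEN order_tendstoD(1), OF fpos]
      show "\<forall>\<^sub>F u in nhds u0. 0 < \<phi> u v0 w0 s0" "\<forall>\<^sub>F v in nhds v0. 0 < \<phi> u0 v w0 s0"
        "\<forall>\<^sub>F w in nhds w0. 0 < \<phi> u0 v0 w s0" .
    qed
    have ev: "\<forall>\<^sub>F u in nhds u0. (u, v0, w0, s0) \<in> ?K" "\<forall>\<^sub>F v in nhds v0. (u0, v, w0, s0) \<in> ?K"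
      "\<forall>\<^sub>F w in nhds w0. (u0, v0, w, s0) \<in> ?K"
    proof -
      have "\<forall>\<^sub>F u in nhds u0. u \<in> {max 0 (w0 - 2 * pi)<..<v0}" using o upos by (intro eventually_nhds_in_open) auto
      then show "\<forall>\<^sub>F u in nhds u0. (u, v0, w0, s0) \<in> ?K" using ev\<phi>(1)
        by eventually_elim (use s0 o' nn le20 in auto)
      have "\<forall>\<^sub>F v in nhds v0. v \<in> {u0<..<w0}" using o by (intro eventually_nhds_in_open) auto
      then show "\<forall>\<^sub>F v in nhds v0. (u0, v, w0, s0) \<in> ?K" using ev\<phi>(2)
        by eventually_elim (use s0 o' nn le20 in auto)
      have "\<forall>\<^sub>F w in nhds w0. w \<in> {v0<..<min (20 * pi) (u0 + 2 * pi)}"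
        using o ult by (intro eventually_nhds_in_open) auto
      then show "\<forall>\<^sub>F w in nhds w0. (u0, v0, w, s0) \<in> ?K" using ev\<phi>(3)
        by eventually_elim (use s0 o' nn le20 in auto)
    qed
    define \<rho> where "\<rho> = \<rho>0 + \<rho>1 * s0"
    define \<mu> where "\<mu> = 2 * pi / arc_length (2 * pi) s0"
    have fx: "f = \<rho> - (x - p)\<^sup>2 - (y - q)\<^sup>2 - (z - r)\<^sup>2" by (simp add: f_def \<phi>_def \<rho>_def x_def y_def z_def)
    define X Y Z where "X = cos (x - z) - cos (y - x)" and "Y = cos (y - x) - cos (z - y)" and "Z = cos (z - y) - cos (x - z)"
    define Du where "Du = A2 u0 s0 * \<beta> (g2 u0 s0) (g v0 s0 - g w0 s0) + A1 u0 s0 * \<beta> (g1 u0 s0) (g v0 s0 - g w0 s0)"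
    define Dv where "Dv = A2 v0 s0 * \<beta> (g2 v0 s0) (g w0 s0 - g u0 s0) + A1 v0 s0 * \<beta> (g1 v0 s0) (g w0 s0 - g u0 s0)"
    define Dw where "Dw = A2 w0 s0 * \<beta> (g2 w0 s0) (g u0 s0 - g v0 s0) + A1 w0 s0 * \<beta> (g1 w0 s0) (g u0 s0 - g v0 s0)"
    have kx: "f = (\<rho> - (y - q)\<^sup>2 - (z - r)\<^sup>2) - (x - p)\<^sup>2" "f = (\<rho> - (x - p)\<^sup>2 - (z - r)\<^sup>2) - (y - q)\<^sup>2"
      "f = (\<rho> - (x - p)\<^sup>2 - (y - q)\<^sup>2) - (z - r)\<^sup>2" by (simp_all add: fx)
    have Vrot: "cis_area y z x = V" "cis_area z x y = V" by (simp_all add: V_def cis_area_def)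
    have sl1: "E s0 * \<mu>\<^sup>2 * (- (sin (y - x) + sin (x - z)) * f\<^sup>2 - 8 * X * f * (x - p) + V * (8 * (x - p)\<^sup>2 - 4 * f)) \<le> Du"
    proof -
      have "\<forall>\<^sub>F u in nhds u0. B u0 v0 w0 s0 - E s0 * (cis_area (?\<sigma> u0 s0) y z * (\<rho> - (y - q)\<^sup>2 - (z - r)\<^sup>2 - (?\<sigma> u0 s0 - p)\<^sup>2)\<^sup>2)
        \<le> B u v0 w0 s0 - E s0 * (cis_area (?\<sigma> u s0) y z * (\<rho> - (y - q)\<^sup>2 - (z - r)\<^sup>2 - (?\<sigma> u s0 - p)\<^sup>2)\<^sup>2)"
        using ev(1) by eventually_elim
          (drule min, simp add: F_def \<phi>_def \<rho>_def y_def z_def algebra_simps)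
      from barrier_slot[OF s0T upos(1) B_derivs(1)[OF s0T] this, folded x_def \<mu>_def]
      show ?thesis unfolding Du_def kx(1) X_def V_def .
    qed
    have sl2: "E s0 * \<mu>\<^sup>2 * (- (sin (z - y) + sin (y - x)) * f\<^sup>2 - 8 * Y * f * (y - q) + V * (8 * (y - q)\<^sup>2 - 4 * f)) \<le> Dv"
    proof -
      have "\<forall>\<^sub>F u in nhds v0. B u0 v0 w0 s0 - E s0 * (cis_area (?\<sigma> v0 s0) z x * (\<rho> - (x - p)\<^sup>2 - (z - r)\<^sup>2 - (?\<sigma> v0 s0 - q)\<^sup>2)\<^sup>2)
        \<le> B u0 u w0 s0 - E s0 * (cis_area (?\<sigma> u s0) z x * (\<rho> - (x - p)\<^sup>2 - (z - r)\<^sup>2 - (?\<sigma> u s0 - q)\<^sup>2)\<^sup>2)"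
        using ev(2) by eventually_elim
          (drule min, simp add: F_def \<phi>_def \<rho>_def x_def z_def cis_area_def algebra_simps)
      from barrier_slot[OF s0T upos(2) B_derivs'(1)[OF s0T] this, folded y_def \<mu>_def]
      show ?thesis unfolding Dv_def kx(2) Y_def Vrot[symmetric] by (simp only: Vrot)
    qed
    have sl3: "E s0 * \<mu>\<^sup>2 * (- (sin (x - z) + sin (z - y)) * f\<^sup>2 - 8 * Z * f * (z - r) + V * (8 * (z - r)\<^sup>2 - 4 * f)) \<le> Dw"
    proof -
      have "\<forall>\<^sub>F u in nhds w0. B u0 v0 w0 s0 - E s0 * (cis_area (?\<sigma> w0 s0) x y * (\<rho> - (x - p)\<^sup>2 - (y - q)\<^sup>2 - (?\<sigma> w0 s0 - r)\<^sup>2)\<^sup>2)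
        \<le> B u0 v0 u s0 - E s0 * (cis_area (?\<sigma> u s0) x y * (\<rho> - (x - p)\<^sup>2 - (y - q)\<^sup>2 - (?\<sigma> u s0 - r)\<^sup>2)\<^sup>2)"
        using ev(3) by eventually_elim
          (drule min, simp add: F_def \<phi>_def \<rho>_def x_def y_def cis_area_def algebra_simps)
      from barrier_slot[OF s0T upos(3) B_derivs'(2)[OF s0T] this, folded z_def \<mu>_def]
      show ?thesis unfolding Dw_def kx(3) Z_def Vrot[symmetric] by (simp only: Vrot)
    qed
    define a1 a2 a3 where "a1 = arc_param_t u0 s0" and "a2 = arc_param_t v0 s0" and "a3 = arc_param_t w0 s0"
    define Qs where "Qs = (x - p) * a1 + (y - q) * a2 + (z - r) * a3"
    define J where "J = X * a1 + Y * a2 + Z * a3"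
    define Ft where "Ft = Du + Dv + Dw - E s0 * (- K * V * f\<^sup>2 + J * f\<^sup>2 + 2 * V * f * (\<rho>1 - 2 * Qs))"
    note \<sigma>t = arc_param_has_derivative_t[OF s0T nn(1)] arc_param_has_derivative_t[OF s0T nn(2)]
      arc_param_has_derivative_t[OF s0T nn(3)]
    have F_t: "((\<lambda>s. F u0 v0 w0 s) has_real_derivative Ft) (at s0 within {0..<T})"
    proof -
      let ?d = "\<lambda>f f'. (f has_real_derivative f') (at s0 within {0..<T})"
      have 1: "?d (\<lambda>s. cis_area (?\<sigma> u0 s) (?\<sigma> v0 s) (?\<sigma> w0 s)) J"
        unfolding cis_area_def J_def X_def Y_def Z_def a1_def a2_def a3_def x_def y_def z_def
        by (rule derivative_eq_intros \<sigma>t refl)+ (simp add: algebra_simps)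
      have 2: "?d (\<lambda>s. \<phi> u0 v0 w0 s) (\<rho>1 - 2 * Qs)"
        unfolding \<phi>_def Qs_def a1_def a2_def a3_def x_def y_def z_def
        by (rule derivative_eq_intros \<sigma>t refl)+ (simp add: algebra_simps)
      have 3: "?d E (- K * E s0)" unfolding E_def by (rule derivative_eq_intros refl)+ simp
      have "?d (\<lambda>s. E s * (cis_area (?\<sigma> u0 s) (?\<sigma> v0 s) (?\<sigma> w0 s) * (\<phi> u0 v0 w0 s)\<^sup>2))
          (E s0 * (- K * V * f\<^sup>2 + J * f\<^sup>2 + 2 * V * f * (\<rho>1 - 2 * Qs)))"
        by (rule derivative_eq_intros 1 2 3 refl)+
          (simp add: V_def f_def x_def y_def z_def algebra_simps power2_eq_square)
      from DERIV_diff[OF B_derivs(3)[OF s0T] this] show ?thesis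
        unfolding F_def Ft_def Du_def Dv_def Dw_def .
    qed
    have left: "\<forall>\<^sub>F s in at_left s0. F u0 v0 w0 s0 \<le> F u0 v0 w0 s"
    proof -
      have 2: "((\<lambda>s. \<phi> u0 v0 w0 s) has_real_derivative (\<rho>1 - 2 * Qs)) (at s0 within {0..s0})"
        by (rule DERIV_subset[of _ _ _ "{0..<T}"])
          (unfold \<phi>_def Qs_def a1_def a2_def a3_def x_def y_def z_def,
            (rule derivative_eq_intros \<sigma>t refl)+, simp add: algebra_simps, use s0T in auto)
      have "((\<lambda>s. \<phi> u0 v0 w0 s) \<longlongrightarrow> f) (at_left s0)"
        using DERIV_continuous[OF 2] at_within_Icc_at_left[OF s_pos] by (simp add: continuous_within f_def)
      from order_tendstoD(1)[OF this fpos] eventually_at_left_interval[OF s_pos order.refl]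
      show ?thesis by eventually_elim (rule min, use s0 o' nn le20 in auto)
    qed
    have "Ft \<le> 0" by (rule left_min_derivative[OF F_t s_pos _ left]) (use s0T in auto)
    have Ab: "\<bar>a1\<bar> \<le> c * (20 * pi)" "\<bar>a2\<bar> \<le> c * (20 * pi)" "\<bar>a3\<bar> \<le> c * (20 * pi)"
    proof -
      have "\<bar>arc_param_t u s0\<bar> \<le> c * ?\<sigma> u s0" if "0 \<le> u" for u
        using lip[OF s0 order.refl that] by (simp add: arc_param_0)
      from this[OF nn(1)] this[OF nn(2)] this[OF nn(3)] xb c
      show "\<bar>a1\<bar> \<le> c * (20 * pi)" "\<bar>a2\<bar> \<le> c * (20 * pi)" "\<bar>a3\<bar> \<le> c * (20 * pi)"
        unfolding a1_def a2_def a3_def x_def y_def z_def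
        by (meson less_imp_le mult_left_mono order_trans)+
    qed
    have Qb: "\<bar>Qs\<bar> \<le> S0"
    proof -
      have "\<bar>(x - p) * a1\<bar> \<le> 8 * pi * (c * (20 * pi))" "\<bar>(y - q) * a2\<bar> \<le> 8 * pi * (c * (20 * pi))"
        "\<bar>(z - r) * a3\<bar> \<le> 8 * pi * (c * (20 * pi))"
        unfolding abs_mult using lg Ab by (intro mult_mono; simp)+
      then show ?thesis unfolding Qs_def S0_def by linarith
    qed
    \<comment> \<open>Cross term between the gradients of \<open>cis_area\<close> and \<phi>; the
      ordering of p, q, r makes it comparable to V.\<close>
    have G: "X * (x - p) + Y * (y - q) + Z * (z - r) \<le> 3 * V"
      unfolding X_def Y_def Z_def V_def using pqr by (intro cis_area_gradient_bounds(1)[OF xyz]) auto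
    \<comment> \<open>The change of \<open>cis_area\<close> caused by the drift of the arc length
      parameters.\<close>
    have Jb: "J \<le> 3 * c * V"
      unfolding J_def X_def Y_def Z_def V_def
    proof (rule cis_area_gradient_bounds(2)[OF xyz c])
      note per = arc_param_periodic[OF s0T nn(1)] arc_param_periodic[OF s0T nn(2)]
      have up: "u0 + 2 * pi \<ge> v0" "v0 + 2 * pi \<ge> w0" using o by auto
      show "\<bar>a2 - a1\<bar> \<le> c * (y - x)" "\<bar>a3 - a2\<bar> \<le> c * (z - y)"
        using lip[OF s0 nn(1) o'(1)] lip[OF s0 nn(2) o'(2)] by (simp_all add: a1_def a2_def a3_def x_def y_def z_def)
      show "\<bar>a2 - a1\<bar> \<le> c * (x + 2 * pi - y)" "\<bar>a3 - a2\<bar> \<le> c * (y + 2 * pi - z)"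
        using lip[OF s0 nn(2) up(1)] lip[OF s0 nn(3) up(2)] per
        by (simp_all add: a1_def a2_def a3_def x_def y_def z_def abs_minus_commute)
      show "\<bar>a1 - a3\<bar> \<le> c * (z - x)" "\<bar>a1 - a3\<bar> \<le> c * (x + 2 * pi - z)"
        using lip[OF s0 nn(1) order_trans[OF o'(1,2)]] lip[OF s0 nn(3) o'(3)] per
        by (simp_all add: a1_def a2_def a3_def x_def y_def z_def abs_minus_commute)
    qed
    have mu0: "m\<^sup>2 \<le> \<mu>\<^sup>2" "\<mu>\<^sup>2 \<le> M\<^sup>2"
      using mu[OF s0] m unfolding \<mu>_def[symmetric] by (auto intro!: power_mono)
    have "E s0 * (\<mu>\<^sup>2 * (- 2 * V * f\<^sup>2 - 8 * f * (X * (x - p) + Y * (y - q) + Z * (z - r)) + V * (8 * (\<rho> - f) - 12 * f)))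
      \<le> Du + Dv + Dw"
    proof -
      have "E s0 * (\<mu>\<^sup>2 * (- 2 * V * f\<^sup>2 - 8 * f * (X * (x - p) + Y * (y - q) + Z * (z - r)) + V * (8 * (\<rho> - f) - 12 * f)))
        = E s0 * \<mu>\<^sup>2 * (- (sin (y - x) + sin (x - z)) * f\<^sup>2 - 8 * X * f * (x - p) + V * (8 * (x - p)\<^sup>2 - 4 * f))
        + E s0 * \<mu>\<^sup>2 * (- (sin (z - y) + sin (y - x)) * f\<^sup>2 - 8 * Y * f * (y - q) + V * (8 * (y - q)\<^sup>2 - 4 * f))
        + E s0 * \<mu>\<^sup>2 * (- (sin (x - z) + sin (z - y)) * f\<^sup>2 - 8 * Z * f * (z - r) + V * (8 * (z - r)\<^sup>2 - 4 * f))"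
      proof -
        have rf: "\<rho> - f = (x - p)\<^sup>2 + (y - q)\<^sup>2 + (z - r)\<^sup>2" by (simp add: fx)
        have VV: "V = sin (y - x) + sin (z - y) + sin (x - z)" by (simp add: V_def cis_area_def)
        define b1 b2 b3 where "b1 = sin (y - x)" and "b2 = sin (z - y)" and "b3 = sin (x - z)"
        have V3: "V = b1 + b2 + b3" by (simp add: VV b1_def b2_def b3_def)
        define h1 h2 h3 where "h1 = (x - p)" and "h2 = (y - q)" and "h3 = (z - r)"
        show ?thesis
          unfolding rf b1_def[symmetric] b2_def[symmetric] b3_def[symmetric]
            h1_def[symmetric] h2_def[symmetric] h3_def[symmetric] V3
          by algebra
      qed
      with sl1 sl2 sl3 show ?thesis by linarith
    qed
    with \<open>Ft \<le> 0\<close> have "E s0 * (\<mu>\<^sup>2 * (- 2 * V * f\<^sup>2 - 8 * f * (X * (x - p) + Y * (y - q) + Z * (z - r)) + V * (8 * (\<rho> - f) - 12 * f)))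
      \<le> E s0 * (- K * V * f\<^sup>2 + J * f\<^sup>2 + 2 * V * f * (\<rho>1 - 2 * Qs))" by (simp add: Ft_def)
    then have main: "\<mu>\<^sup>2 * (- 2 * V * f\<^sup>2 - 8 * f * (X * (x - p) + Y * (y - q) + Z * (z - r)) + V * (8 * (\<rho> - f) - 12 * f))
      \<le> - K * V * f\<^sup>2 + J * f\<^sup>2 + 2 * V * f * (\<rho>1 - 2 * Qs)" using E[of s0] by simp
    have l1: "\<mu>\<^sup>2 * (V * (8 * \<rho> - 2 * f\<^sup>2 - 44 * f))
      \<le> \<mu>\<^sup>2 * (- 2 * V * f\<^sup>2 - 8 * f * (X * (x - p) + Y * (y - q) + Z * (z - r)) + V * (8 * (\<rho> - f) - 12 * f))"
    proof (rule mult_left_mono)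
      have "8 * f * (X * (x - p) + Y * (y - q) + Z * (z - r)) \<le> 8 * f * (3 * V)"
        using G fpos by (intro mult_left_mono) auto
      then show "V * (8 * \<rho> - 2 * f\<^sup>2 - 44 * f)
        \<le> - 2 * V * f\<^sup>2 - 8 * f * (X * (x - p) + Y * (y - q) + Z * (z - r)) + V * (8 * (\<rho> - f) - 12 * f)"
        by (simp add: algebra_simps)
    qed simp
    have l2: "J * f\<^sup>2 \<le> V * (3 * c * f\<^sup>2)"
      using mult_right_mono[OF Jb, of "f\<^sup>2"] by (simp add: mult_ac)
    have l3: "2 * V * f * (\<rho>1 - 2 * Qs) \<le> V * (2 * f * (\<rho>1 + 2 * S0))"
    proof -
      have "2 * V * f * (\<rho>1 - 2 * Qs) \<le> 2 * V * f * (\<rho>1 + 2 * S0)"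
        using Qb Vpos fpos by (intro mult_left_mono) auto
      then show ?thesis by (simp add: mult_ac)
    qed
    have "V * (\<mu>\<^sup>2 * (8 * \<rho> - 2 * f\<^sup>2 - 44 * f)) \<le> V * (- K * f\<^sup>2 + 3 * c * f\<^sup>2 + 2 * f * (\<rho>1 + 2 * S0))"
      using main l1 l2 l3 by (simp add: algebra_simps)
    then have "\<mu>\<^sup>2 * (8 * \<rho> - 2 * f\<^sup>2 - 44 * f) \<le> - K * f\<^sup>2 + 3 * c * f\<^sup>2 + 2 * f * (\<rho>1 + 2 * S0)"
      using Vpos by simp
    then have "8 * (\<mu>\<^sup>2 * \<rho>) \<le> - K * f\<^sup>2 + 3 * c * f\<^sup>2 + 2 * f * (\<rho>1 + 2 * S0) + 2 * (\<mu>\<^sup>2 * f\<^sup>2) + 44 * (\<mu>\<^sup>2 * f)"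
      by (simp add: algebra_simps)
    moreover have "\<mu>\<^sup>2 * f\<^sup>2 \<le> M\<^sup>2 * f\<^sup>2" "\<mu>\<^sup>2 * f \<le> M\<^sup>2 * f" using mu0 fpos by (auto intro!: mult_right_mono)
    moreover have "D \<le> \<mu>\<^sup>2 * \<rho>" unfolding D_def \<rho>_def
      using mu0 \<rho>0 \<rho>1 s_pos by (intro mult_mono) auto
    \<comment> \<open>Squaring \<phi> supplies \<open>8 * \<rho>\<close>, which does not vanish with
      f, from the squared gradient of \<phi>. It wins near the edge of the ball, and the term with K
      wins elsewhere; K was chosen so that the right side stays below 4 * D.\<close>
    ultimately have "8 * D \<le> - (E1\<^sup>2 / (16 * D)) * f\<^sup>2 + E1 * f"
      unfolding K_def E1_def by (simp add: algebra_simps)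
    moreover have "- (E1\<^sup>2 / (16 * D)) * f\<^sup>2 + E1 * f \<le> 4 * D"
    proof -
      have "0 \<le> (E1 * f - 8 * D)\<^sup>2 / (16 * D)" using D by simp
      also have "\<dots> = E1\<^sup>2 / (16 * D) * f\<^sup>2 - E1 * f + 4 * D"
        using D by (simp add: field_simps power2_eq_square)
      finally show ?thesis by simp
    qed
    ultimately show False using D by linarith
  qed
  define k where "k = E t2 * (2 * pi\<^sup>2)\<^sup>2"
  show thesis
  proof (rule that[of k])
    show "0 < k" using E[of t2] by (simp add: k_def)
    fix u v w assume uvw: "8 * pi \<le> u" "u \<le> 10 * pi" "u \<le> v" "v \<le> w" "w \<le> u + 2 * pi"
    have nn: "0 \<le> u" "0 \<le> v" "0 \<le> w" using uvw pi_gt_zero by linarith+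
    have \<sigma>b: "8 * pi \<le> ?\<sigma> u t2" "?\<sigma> u t2 \<le> 12 * pi" "8 * pi \<le> ?\<sigma> v t2" "?\<sigma> v t2 \<le> 12 * pi" "8 * pi \<le> ?\<sigma> w t2" "?\<sigma> w t2 \<le> 12 * pi"
      using mono[OF z0(2), of "8 * pi" u] mono[OF z0(2), of u "12 * pi"] mono[OF z0(2), of "8 * pi" v]
        mono[OF z0(2), of v "12 * pi"] mono[OF z0(2), of "8 * pi" w] mono[OF z0(2), of w "12 * pi"]
        \<sigma>2[OF z0(2)] uvw nn by auto
    have sq: "(x - y)\<^sup>2 \<le> 16 * pi\<^sup>2" if "8 * pi \<le> x" "x \<le> 12 * pi" "8 * pi \<le> y" "y \<le> 12 * pi" for x y
    proof -
      have "\<bar>x - y\<bar> \<le> 4 * pi" using that by (simp add: abs_le_iff)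
      then have "\<bar>x - y\<bar>\<^sup>2 \<le> (4 * pi)\<^sup>2" by (intro power_mono) auto
      then show ?thesis by (simp add: power_mult_distrib)
    qed
    have "\<rho>1 * t2 = 50 * pi\<^sup>2" using t2 by (simp add: \<rho>1_def)
    moreover have "(?\<sigma> u t2 - p)\<^sup>2 \<le> 16 * pi\<^sup>2" "(?\<sigma> v t2 - q)\<^sup>2 \<le> 16 * pi\<^sup>2" "(?\<sigma> w t2 - r)\<^sup>2 \<le> 16 * pi\<^sup>2"
      using \<sigma>b pqr by (auto intro!: sq)
    ultimately have \<phi>: "2 * pi\<^sup>2 \<le> \<phi> u v w t2" unfolding \<phi>_def using \<rho>0 by linarith
    have "(u, v, w, t2) \<in> ?K"
      using uvw nn \<phi> z0(2) order_trans[OF _ \<phi>, of 0] pi_gt_zero by auto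
    from nonneg_F[OF this]
    have "E t2 * (cis_area (?\<sigma> u t2) (?\<sigma> v t2) (?\<sigma> w t2) * (\<phi> u v w t2)\<^sup>2) \<le> B u v w t2" by (simp add: F_def)
    moreover have "k * cis_area (?\<sigma> u t2) (?\<sigma> v t2) (?\<sigma> w t2)
      \<le> E t2 * (cis_area (?\<sigma> u t2) (?\<sigma> v t2) (?\<sigma> w t2) * (\<phi> u v w t2)\<^sup>2)"
    proof -
      have "0 \<le> cis_area (?\<sigma> u t2) (?\<sigma> v t2) (?\<sigma> w t2)"
        using mono[OF z0(2) nn(1) uvw(3)] mono[OF z0(2) nn(2) uvw(4)] mono[OF z0(2) nn(3) uvw(5)]
          arc_param_periodic(1)[OF sT[OF z0(2)] nn(1)] by (intro cis_area_nonneg) auto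
      moreover have "(2 * pi\<^sup>2)\<^sup>2 \<le> (\<phi> u v w t2)\<^sup>2" using \<phi> by (intro power_mono) auto
      ultimately show ?thesis unfolding k_def mult.assoc
        using E[of t2] by (subst mult.commute[of "(2 * pi\<^sup>2)\<^sup>2"]) (intro mult_left_mono, auto)
    qed
    ultimately show "k * cis_area (?\<sigma> u t2) (?\<sigma> v t2) (?\<sigma> w t2) \<le> B u v w t2" by linarith
  qed
qed

end

section \<open>Area forms as products of gaps\<close>

lemma half_le_sin:
  assumes "0 \<le> x" "x \<le> pi / 2"
  shows "x / 2 \<le> sin x"
proof -
  have "0 \<le> cos x" using assms by (intro cos_ge_zero) auto
  then have "1 / 2 \<le> (cos (x / 2))\<^sup>2" using cos_double_cos[of "x / 2"] by simp
  then have "x * (1 / 2) \<le> x * (cos (x / 2))\<^sup>2" by (intro mult_left_mono assms)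
  also have "\<dots> = 2 * (x / 2 * cos (x / 2)) * cos (x / 2)" by (simp add: power2_eq_square)
  also have "\<dots> \<le> 2 * sin (x / 2) * cos (x / 2)"
    using assms by (intro mult_right_mono mult_left_mono x_cos_le_sin cos_ge_zero) auto
  also have "\<dots> = sin x" using sin_double[of "x / 2"] by simp
  finally show ?thesis by simp
qed

lemma sin_half_ge:
  assumes "0 \<le> x" "x \<le> 2 * pi" "a \<le> x" "a \<le> 2 * pi - x"
  shows "a / 4 \<le> sin (x / 2)"
proof (cases "x \<le> pi")
  case True
  then show ?thesis using half_le_sin[of "x / 2"] assms by auto
next
  case False
  have "sin (x / 2) = sin (pi - x / 2)" by simp
  then show ?thesis using half_le_sin[of "pi - x / 2"] False assms by auto
qed

lemma sin_half_le:
  assumes "0 \<le> x" "x \<le> 2 * pi"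
  shows "0 \<le> sin (x / 2)" "sin (x / 2) \<le> x / 2" "sin (x / 2) \<le> (2 * pi - x) / 2"
proof -
  show "0 \<le> sin (x / 2)" using assms by (intro sin_ge_zero) auto
  show "sin (x / 2) \<le> x / 2" using assms by (intro sin_x_le_x) auto
  have "sin (x / 2) = sin ((2 * pi - x) / 2)" by (simp add: diff_divide_distrib)
  also have "\<dots> \<le> (2 * pi - x) / 2" using assms by (intro sin_x_le_x) auto
  finally show "sin (x / 2) \<le> (2 * pi - x) / 2" .
qed

text \<open>Transfers the sine of half a gap from the arc length parameter to the original one. The
  complementary gap must be compared as well, because the sine vanishes at both ends of the
  period.\<close>

lemma sin_half_compare:
  assumes "0 \<le> x" "x \<le> 2 * pi" "0 \<le> m" "m * x \<le> X" "m * (2 * pi - x) \<le> 2 * pi - X"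
  shows "m / 2 * sin (x / 2) \<le> sin (X / 2)"
proof -
  have "0 \<le> m * x" "0 \<le> m * (2 * pi - x)" using assms by auto
  then have X: "0 \<le> X" "X \<le> 2 * pi" using assms(4,5) by linarith+
  have "m * (2 * sin (x / 2)) \<le> m * x" "m * (2 * sin (x / 2)) \<le> m * (2 * pi - x)"
    using sin_half_le[OF assms(1,2)] by (intro mult_left_mono assms(3), simp)+
  then have "m * (2 * sin (x / 2)) / 4 \<le> sin (X / 2)"
    using assms(4,5) X by (intro sin_half_ge) linarith+
  then show ?thesis by simp
qed

text \<open>A quarter of \<^const>\<open>cis_area\<close>, written as a product (\<open>cis_area_product\<close>) to exhibit its order of vanishing
  at coinciding points of the circle.\<close>

definition gap_product :: "real \<Rightarrow> real \<Rightarrow> real \<Rightarrow> real"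
  where "gap_product u v w = sin ((v - u) / 2) * sin ((w - v) / 2) * sin ((w - u) / 2)"

lemma gap_product_rotate: "gap_product v w (u + 2 * pi) = gap_product u v w"
proof -
  have "(u + 2 * pi - w) / 2 = pi - (w - u) / 2" "(u + 2 * pi - v) / 2 = pi - (v - u) / 2" by (simp_all add: field_simps)
  then have "sin ((u + 2 * pi - w) / 2) = sin ((w - u) / 2)" "sin ((u + 2 * pi - v) / 2) = sin ((v - u) / 2)"
    by (simp_all only: sin_pi_minus)
  then show ?thesis unfolding gap_product_def by (simp only: mult_ac)
qed

lemma gap_product_shift:
  "gap_product (u + a) (v + a) (w + a) = gap_product u v w"
  by (simp add: gap_product_def)

lemma gap_product_pos:
  assumes "u < v" "v < w" "w < u + 2 * pi"
  shows "0 < gap_product u v w"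
  unfolding gap_product_def
  using assms by (intro mult_pos_pos sin_gt_zero) auto

context space_form
begin

lemma B_lower:
  assumes t2: "0 < t2" "t2 < T"
    and init: "\<And>u v w. u \<le> v \<Longrightarrow> v \<le> w \<Longrightarrow> w \<le> u + 2 * pi \<Longrightarrow> 0 \<le> B u v w 0"
    and start: "u1 < v1" "v1 < w1" "w1 < u1 + 2 * pi" "0 < B u1 v1 w1 0"
  obtains k where "0 < k" "\<And>u v w. u \<le> v \<Longrightarrow> v \<le> w \<Longrightarrow> w \<le> u + 2 * pi \<Longrightarrow> k * gap_product u v w \<le> B u v w t2"
proof -
  let ?\<sigma> = "\<lambda>u. arc_param u t2"
  have t2': "t2 \<in> {0..<T}" "0 \<le> t2" using t2 by auto
  have T0: "0 \<in> {0..<T}" using T_pos by simp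
  have nonneg: "0 \<le> B u v w s" if "s \<in> {0..t2}" "u \<le> v" "v \<le> w" "w \<le> u + 2 * pi" for u v w s
    by (rule B_nonneg_preserved[of 0 s, OF _ _ _ init]) (use that t2 in auto)
  obtain j :: int where j: "u1 + 2 * pi * of_int j \<in> {0..<2 * pi}" by (rule shift_into_period)
  \<comment> \<open>Four additional periods move the triple into the window used by
    \<open>B_strict_arc\<close>.\<close>
  define d where "d = 2 * pi * of_int (j + 4)"
  have d: "8 * pi \<le> u1 + d" "u1 + d < 10 * pi" using j by (auto simp: d_def algebra_simps)
  have "0 < B (u1 + d) (v1 + d) (w1 + d) 0" using start(4) B_shift[OF T0, of u1 "j + 4" v1 w1] by (simp add: d_def)
  then obtain k where k: "0 < k" "\<And>u v w. 8 * pi \<le> u \<Longrightarrow> u \<le> 10 * pi \<Longrightarrow> u \<le> v \<Longrightarrow> v \<le> w \<Longrightarrow> w \<le> u + 2 * pi \<Longrightarrow>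
    k * cis_area (?\<sigma> u) (?\<sigma> v) (?\<sigma> w) \<le> B u v w t2"
    using B_strict_arc[OF t2 nonneg, of "u1 + d" "v1 + d" "w1 + d"] start(1-3) d by auto
  obtain m M c where m: "0 < m" and
    low: "\<And>u v t. t \<in> {0..t2} \<Longrightarrow> 0 \<le> u \<Longrightarrow> u \<le> v \<Longrightarrow> m * (v - u) \<le> arc_param v t - arc_param u t"
    by (rule arc_param_bounds[OF t2'(2) t2(2)]) (rule that)
  have low2: "m * (v - u) \<le> ?\<sigma> v - ?\<sigma> u" if "0 \<le> u" "u \<le> v" for u v using low[of t2 u v] that t2 by simp
  have sin_low: "m / 2 * sin ((v - u) / 2) \<le> sin ((?\<sigma> v - ?\<sigma> u) / 2)"
    if "0 \<le> u" "u \<le> v" "v \<le> u + 2 * pi" for u v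
    using low2[of v "u + 2 * pi"] low2[of u v] arc_param_periodic(1)[OF t2'(1) that(1)] that m
    by (intro sin_half_compare) (auto simp: algebra_simps)
  show thesis
  proof (rule that[of "k * (4 * (m / 2) ^ 3)"])
    show "0 < k * (4 * (m / 2) ^ 3)" using k m by simp
    have base: "k * (4 * (m / 2) ^ 3) * gap_product u v w \<le> B u v w t2"
      if u: "8 * pi \<le> u" "u \<le> 10 * pi" and o: "u \<le> v" "v \<le> w" "w \<le> u + 2 * pi" for u v w
    proof -
      have u0: "0 \<le> u" using u(1) pi_ge_zero by linarith
      define A B' where "A = (?\<sigma> v - ?\<sigma> u) / 2" and "B' = (?\<sigma> w - ?\<sigma> v) / 2"
      have AB: "A + B' = (?\<sigma> w - ?\<sigma> u) / 2" by (simp add: A_def B'_def field_simps)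
      have s: "m / 2 * sin ((v - u) / 2) \<le> sin A" "m / 2 * sin ((w - v) / 2) \<le> sin B'"
        "m / 2 * sin ((w - u) / 2) \<le> sin (A + B')"
        unfolding AB using sin_low[of u v] sin_low[of v w] sin_low[of u w] o u0 by (auto simp: A_def B'_def)
      have p: "0 \<le> sin ((v - u) / 2)" "0 \<le> sin ((w - v) / 2)" "0 \<le> sin ((w - u) / 2)"
        using sin_half_le(1)[of "v - u"] sin_half_le(1)[of "w - v"] sin_half_le(1)[of "w - u"] o by auto
      have q: "0 \<le> m / 2 * sin ((v - u) / 2)" "0 \<le> m / 2 * sin ((w - v) / 2)" "0 \<le> m / 2 * sin ((w - u) / 2)"
        using p m by auto
      have "(m / 2) ^ 3 * gap_product u v w
          = (m / 2 * sin ((v - u) / 2)) * (m / 2 * sin ((w - v) / 2)) * (m / 2 * sin ((w - u) / 2))"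
        by (simp add: gap_product_def power3_eq_cube)
      also have "\<dots> \<le> sin A * sin B' * sin (A + B')"
        by (rule mult_mono[OF mult_mono[OF s(1,2) _ q(2)] s(3) mult_nonneg_nonneg q(3)])
          (use s q in linarith)+
      finally have "(m / 2) ^ 3 * gap_product u v w \<le> sin A * sin B' * sin (A + B')" .
      moreover have "cis_area (?\<sigma> u) (?\<sigma> v) (?\<sigma> w) = 4 * sin A * sin B' * sin (A + B')"
        by (rule cis_area_product) (simp_all add: A_def B'_def field_simps)
      ultimately have "4 * ((m / 2) ^ 3 * gap_product u v w) \<le> cis_area (?\<sigma> u) (?\<sigma> v) (?\<sigma> w)"
        by simp
      then have "k * (4 * ((m / 2) ^ 3 * gap_product u v w)) \<le> k * cis_area (?\<sigma> u) (?\<sigma> v) (?\<sigma> w)"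
        using k(1) by (intro mult_left_mono) auto
      also have "\<dots> \<le> B u v w t2" by (rule k(2)[OF u o])
      finally show ?thesis by (simp only: mult.assoc)
    qed
    fix u v w :: real assume o: "u \<le> v" "v \<le> w" "w \<le> u + 2 * pi"
    obtain i :: int where i: "u + 2 * pi * of_int i \<in> {0..<2 * pi}" by (rule shift_into_period)
    define d where "d = 2 * pi * of_int (i + 4)"
    have d: "8 * pi \<le> u + d" "u + d \<le> 10 * pi" using i by (auto simp: d_def algebra_simps)
    have "k * (4 * (m / 2) ^ 3) * gap_product (u + d) (v + d) (w + d) \<le> B (u + d) (v + d) (w + d) t2"
      by (rule base[OF d]) (use o in auto)
    then show "k * (4 * (m / 2) ^ 3) * gap_product u v w \<le> B u v w t2"
      unfolding gap_product_shift using B_shift[OF t2'(1), of u "i + 4" v w] by (simp add: d_def)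
  qed
qed

text \<open>Expanding both edges at the middle point v, the product of the linear parts cancels
  because the form is alternating. What remains is of order \<open>x * y * (x + y)\<close> in the
  gaps x and y, the order of \<open>gap_product\<close>.\<close>

lemma B_upper:
  assumes t: "t \<in> {0..<T}"
  obtains C where "0 \<le> C"
    "\<And>u v w. u \<le> v \<Longrightarrow> v \<le> w \<Longrightarrow> w \<le> u + 2 * pi \<Longrightarrow> \<bar>B u v w t\<bar> \<le> C * gap_product u v w"
proof -
  have bdd: "\<exists>b\<ge>0. \<forall>u. norm (f u) \<le> b"
    if f: "continuous_on UNIV f" "\<And>u. f (u + 2 * pi) = f u" for f :: "real \<Rightarrow> 'a"
  proof -
    have "bounded (f ` {0..2 * pi})"
      by (intro compact_imp_bounded compact_continuous_image continuous_on_subset[OF f(1)]) auto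
    then obtain b where b: "\<And>x. x \<in> {0..2 * pi} \<Longrightarrow> norm (f x) \<le> b" unfolding bounded_iff by blast
    have "norm (f u) \<le> b" for u
    proof -
      obtain k :: int where k: "u + 2 * pi * of_int k \<in> {0..<2 * pi}" by (rule shift_into_period)
      then show ?thesis using b[of "u + 2 * pi * of_int k"] periodic_2pi_shift[of f u k, OF f(2)] by auto
    qed
    moreover have "0 \<le> b" using order_trans[OF norm_ge_zero b[of 0]] by simp
    ultimately show ?thesis by blast
  qed
  have c1: "continuous_on UNIV (\<lambda>u. g1 u t)" and c2: "continuous_on UNIV (\<lambda>u. g2 u t)"
    using continuous_on_compose2[OF cont_g1, of UNIV "\<lambda>u. (u, t)"]
      continuous_on_compose2[OF cont_g2, of UNIV "\<lambda>u. (u, t)"] t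
      continuous_on_Pair[OF continuous_on_id continuous_on_const, of UNIV t] by (auto simp: image_subset_iff)
  obtain L where L: "0 \<le> L" "\<And>u. norm (g1 u t) \<le> L" using bdd[OF c1 periodic_g1[OF t]] by blast
  obtain M where M: "0 \<le> M" "\<And>u. norm (g2 u t) \<le> M" using bdd[OF c2 periodic_g2[OF t]] by blast
  obtain K where K: "0 \<le> K" "\<And>p q. \<bar>\<beta> p q\<bar> \<le> norm p * norm q * K"
    using bounded_bilinear.nonneg_bounded[OF bilinear] by auto
  have onb: "onorm (\<lambda>h. h *\<^sub>R p) \<le> b" if "norm p \<le> b" for p :: 'a and b
    by (rule onorm_le) (use that in \<open>simp add: mult.commute[of b] mult_left_mono\<close>)
  have lip: "norm (g v t - g u t) \<le> L * \<bar>v - u\<bar>" for u v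
    using differentiable_bound[of UNIV "\<lambda>v. g v t" "\<lambda>x h. h *\<^sub>R g1 x t" L v u] g_u[OF t] onb[OF L(2)]
    by (auto simp: has_vector_derivative_def)
  have lip1: "norm (g1 v t - g1 u t) \<le> M * \<bar>v - u\<bar>" for u v
    using differentiable_bound[of UNIV "\<lambda>v. g1 v t" "\<lambda>x h. h *\<^sub>R g2 x t" M v u] g1_u[OF t] onb[OF M(2)]
    by (auto simp: has_vector_derivative_def)
  have rem: "norm (g b t - g a t - (b - a) *\<^sub>R g1 v t) \<le> M * (b - a)\<^sup>2" if "a \<le> b" "v \<in> {a..b}" for a b v
  proof -
    have "norm (g b t - g a t - (b - a) *\<^sub>R g1 v t) \<le> norm (b - a) * (M * (b - a))"
    proof (rule vector_differentiable_bound_linearization[where S = "{a..b}" and f' = "\<lambda>x. g1 x t"])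
      fix x assume x: "x \<in> {a..b}"
      show "((\<lambda>x. g x t) has_vector_derivative g1 x t) (at x within {a..b})"
        by (rule has_vector_derivative_at_within[OF g_u[OF t]])
      have "M * \<bar>x - v\<bar> \<le> M * (b - a)" using x that M by (intro mult_left_mono) auto
      with lip1[of x v] show "norm (g1 x t - g1 v t) \<le> M * (b - a)" by linarith
    qed (use that in \<open>auto simp: closed_segment_eq_real_ivl\<close>)
    also have "\<dots> = M * (b - a)\<^sup>2" using that by (simp add: power2_eq_square)
    finally show ?thesis .
  qed
  define C where "C = 512 * (K * L * M)"
  have C: "0 \<le> C" using K L M by (simp add: C_def)
  \<comment> \<open>One of the three cyclic gaps is at least a third of the period, and rotating the
    triple makes it the outer one. Up to the length 4 * pi / 3 a gap z is at most
    \<open>8 * sin (z / 2)\<close>, whence the factor 512.\<close>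
  have short: "\<bar>B u v w t\<bar> \<le> C * gap_product u v w" if o: "u \<le> v" "v \<le> w" "w \<le> u + 4 * pi / 3" for u v w
  proof -
    define x y where "x = v - u" and "y = w - v"
    have xy: "0 \<le> x" "0 \<le> y" "x + y \<le> 4 * pi / 3" using o by (auto simp: x_def y_def)
    define r s where "r = g v t - g u t - x *\<^sub>R g1 v t" and "s = g w t - g v t - y *\<^sub>R g1 v t"
    have r: "norm r \<le> M * x\<^sup>2" and s: "norm s \<le> M * y\<^sup>2"
      using rem[of u v v] rem[of v w v] o by (auto simp: r_def s_def x_def y_def)
    have "B u v w t = \<beta> (g v t - g u t) ((g w t - g v t) + (g v t - g u t))" by (simp add: B_edge)
    also have "\<dots> = \<beta> (g v t - g u t) (g w t - g v t)" by (simp only: add_right self)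
    also have "\<dots> = \<beta> (x *\<^sub>R g1 v t + r) (g w t - g v t)" by (simp add: r_def)
    also have "\<dots> = x * \<beta> (g1 v t) (y *\<^sub>R g1 v t + s) + \<beta> r (g w t - g v t)"
      by (simp add: add_left scaleR_left s_def)
    also have "\<dots> = x * \<beta> (g1 v t) s + \<beta> r (g w t - g v t)" by (simp add: add_right scaleR_right)
    finally have e: "B u v w t = x * \<beta> (g1 v t) s + \<beta> r (g w t - g v t)" .
    have "\<bar>\<beta> (g1 v t) s\<bar> \<le> L * (M * y\<^sup>2) * K"
      by (rule order_trans[OF K(2)]) (use L M K s in \<open>intro mult_right_mono mult_mono; auto\<close>)
    then have 1: "\<bar>x * \<beta> (g1 v t) s\<bar> \<le> x * (L * (M * y\<^sup>2) * K)"
      using xy by (simp add: abs_mult mult_left_mono)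
    have "norm (g w t - g v t) \<le> L * y" using lip[of w v] o by (simp add: y_def)
    then have 2: "\<bar>\<beta> r (g w t - g v t)\<bar> \<le> (M * x\<^sup>2) * (L * y) * K"
      by (intro order_trans[OF K(2)]) (use L M K r xy in \<open>intro mult_right_mono mult_mono; auto\<close>)
    have "\<bar>B u v w t\<bar> \<le> x * (L * (M * y\<^sup>2) * K) + (M * x\<^sup>2) * (L * y) * K" using 1 2 unfolding e by linarith
    also have "\<dots> = K * L * M * (x * y * (x + y))" by (simp add: power2_eq_square algebra_simps)
    also have "\<dots> \<le> K * L * M * ((8 * sin (x / 2)) * (8 * sin (y / 2)) * (8 * sin ((x + y) / 2)))"
    proof -
      have h: "z \<le> 8 * sin (z / 2)" if "0 \<le> z" "z \<le> 4 * pi / 3" for z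
        using sin_half_ge[of z "z / 2"] that by auto
      show ?thesis using h[of x] h[of y] h[of "x + y"] xy K L M
        by (intro mult_left_mono mult_mono mult_nonneg_nonneg) auto
    qed
    also have "\<dots> = C * gap_product u v w" by (simp add: gap_product_def C_def x_def y_def)
    finally show ?thesis .
  qed
  show thesis
  proof (rule that[OF C])
    fix u v w :: real assume o: "u \<le> v" "v \<le> w" "w \<le> u + 2 * pi"
    consider "w \<le> u + 4 * pi / 3" | "u + 2 * pi \<le> v + 4 * pi / 3" | "v + 2 * pi \<le> w + 4 * pi / 3" by linarith
    then show "\<bar>B u v w t\<bar> \<le> C * gap_product u v w"
    proof cases
      case 2
      then show ?thesis using short[of v w "u + 2 * pi"] o by (simp add: gap_product_rotate B_rotate[OF t])
    next
      case 3
      then show ?thesis using short[of w "u + 2 * pi" "v + 2 * pi"] o by (simp add: gap_product_rotate B_rotate[OF t])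
    qed (use short o in auto)
  qed
qed

end

section \<open>Slope of the projection\<close>

lemma bounded_bilinear_combine:
  fixes \<alpha> \<beta> :: "'a::real_normed_vector \<Rightarrow> 'b::real_normed_vector \<Rightarrow> real"
  assumes "bounded_bilinear \<alpha>" "bounded_bilinear \<beta>"
  shows "bounded_bilinear (\<lambda>p q. k * \<alpha> p q + l * \<beta> p q)"
proof -
  interpret a: bounded_bilinear \<alpha> by fact
  interpret b: bounded_bilinear \<beta> by fact
  obtain K where K: "\<And>p q. norm (\<alpha> p q) \<le> norm p * norm q * K" using a.bounded by blast
  obtain L where L: "\<And>p q. norm (\<beta> p q) \<le> norm p * norm q * L" using b.bounded by blast
  show ?thesis
  proof
    have "norm (k * \<alpha> p q + l * \<beta> p q) \<le> norm p * norm q * (\<bar>k\<bar> * K + \<bar>l\<bar> * L)" for p q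
    proof -
      have "norm (k * \<alpha> p q + l * \<beta> p q) \<le> \<bar>k\<bar> * norm (\<alpha> p q) + \<bar>l\<bar> * norm (\<beta> p q)"
        using norm_triangle_ineq[of "k * \<alpha> p q" "l * \<beta> p q"] by (simp add: abs_mult)
      also have "\<dots> \<le> \<bar>k\<bar> * (norm p * norm q * K) + \<bar>l\<bar> * (norm p * norm q * L)"
        by (intro add_mono mult_left_mono K L) auto
      finally show ?thesis by (simp add: algebra_simps)
    qed
    then show "\<exists>K. \<forall>p q. norm (k * \<alpha> p q + l * \<beta> p q) \<le> norm p * norm q * K" by blast
  qed (simp_all add: a.add_left a.add_right b.add_left b.add_right a.scaleR_left a.scaleR_right
      b.scaleR_left b.scaleR_right algebra_simps)
qed

lemma alternating_form_combine:
  assumes "alternating_form \<alpha>" "alternating_form \<beta>"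
  shows "alternating_form (\<lambda>p q. k * \<alpha> p q + l * \<beta> p q)"
proof (rule alternating_form.intro)
  show "bounded_bilinear (\<lambda>p q. k * \<alpha> p q + l * \<beta> p q)"
    using assms by (intro bounded_bilinear_combine alternating_form.bilinear)
  show "k * \<alpha> x y + l * \<beta> x y = - (k * \<alpha> y x + l * \<beta> y x)" for x y
    using alternating_form.alternating[OF assms(1), of x y] alternating_form.alternating[OF assms(2), of x y]
    by simp
qed

text \<open>The two by two minors of the pair p, q, that is, its Pluecker coordinates.\<close>

definition coord_form :: "'a::euclidean_space \<Rightarrow> 'a \<Rightarrow> 'a \<Rightarrow> 'a \<Rightarrow> real"
  where "coord_form b c p q = inner p b * inner q c - inner p c * inner q b"

lemma alternating_coord_form: "alternating_form (coord_form b c)"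
proof (rule alternating_form.intro)
  have h: "bounded_bilinear (\<lambda>p q. inner p b * inner q c)" for b c :: 'a
    by (rule bounded_bilinear.comp[OF bounded_bilinear_mult bounded_linear_inner_left bounded_linear_inner_left])
  from bounded_bilinear_combine[OF h[of b c] h[of c b], of 1 "- 1"]
  show "bounded_bilinear (coord_form b c)" by (simp add: coord_form_def[abs_def])
qed (simp add: coord_form_def)

lemma lagrange_identity:
  fixes p q :: "'a::euclidean_space"
  shows "(\<Sum>b\<in>Basis. \<Sum>c\<in>Basis. (coord_form b c p q)\<^sup>2) = 2 * ((norm p)\<^sup>2 * (norm q)\<^sup>2 - (inner p q)\<^sup>2)"
proof -
  have n: "(norm x)\<^sup>2 = (\<Sum>b\<in>Basis. (inner x b)\<^sup>2)" for x :: 'a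
    unfolding power2_norm_eq_inner euclidean_inner[of x x] by (simp add: power2_eq_square)
  have pq: "(norm p)\<^sup>2 * (norm q)\<^sup>2 = (\<Sum>b\<in>Basis. \<Sum>c\<in>Basis. (inner p b)\<^sup>2 * (inner q c)\<^sup>2)"
    "(norm q)\<^sup>2 * (norm p)\<^sup>2 = (\<Sum>b\<in>Basis. \<Sum>c\<in>Basis. (inner q b)\<^sup>2 * (inner p c)\<^sup>2)"
    unfolding n by (simp_all add: sum_product)
  have i: "(inner p q)\<^sup>2 = (\<Sum>b\<in>Basis. \<Sum>c\<in>Basis. (inner p b * inner q b) * (inner p c * inner q c))"
    unfolding euclidean_inner[of p q] power2_eq_square by (simp add: sum_product)
  have "(\<Sum>b\<in>Basis. \<Sum>c\<in>Basis. (coord_form b c p q)\<^sup>2)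
    = (\<Sum>b\<in>Basis. \<Sum>c\<in>Basis. (inner p b)\<^sup>2 * (inner q c)\<^sup>2 + (inner q b)\<^sup>2 * (inner p c)\<^sup>2
        - 2 * ((inner p b * inner q b) * (inner p c * inner q c)))"
    by (intro sum.cong refl) (simp add: coord_form_def power2_eq_square algebra_simps)
  also have "\<dots> = (norm p)\<^sup>2 * (norm q)\<^sup>2 + (norm q)\<^sup>2 * (norm p)\<^sup>2 - 2 * (inner p q)\<^sup>2"
    unfolding pq i by (simp add: sum.distrib sum_subtractf sum_distrib_left)
  finally show ?thesis by (simp add: algebra_simps)
qed

lemma right_min_derivative:
  assumes "(f has_real_derivative l) (at x)" "x < y" "\<And>z. x \<le> z \<Longrightarrow> z \<le> y \<Longrightarrow> f x \<le> f z"
  shows "0 \<le> l"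
proof (rule ccontr)
  assume "\<not> 0 \<le> l"
  then obtain d where d: "0 < d" "\<forall>h>0. h < d \<longrightarrow> f (x + h) < f x" using DERIV_neg_dec_right[OF assms(1)] by auto
  define h where "h = min (d / 2) (y - x)"
  have "0 < h" "h < d" "x + h \<le> y" using d assms(2) by (auto simp: h_def)
  with d(2) assms(3)[of "x + h"] show False by fastforce
qed

context space_form
begin

text \<open>The form vanishes at v = u, so its derivative in v there inherits the sign.\<close>

lemma B_tangent_nonneg:
  assumes t: "t \<in> {0..<T}" and nonneg: "\<And>u v w. u \<le> v \<Longrightarrow> v \<le> w \<Longrightarrow> w \<le> u + 2 * pi \<Longrightarrow> 0 \<le> B u v w t"
    and uw: "u < w" "w \<le> u + 2 * pi"
  shows "0 \<le> \<beta> (g1 u t) (g w t - g u t)"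
  by (rule right_min_derivative[OF B_derivs'(1)[OF t, of u w u] uw(1)])
    (use nonneg[of u _ w] uw in \<open>auto simp: B_degenerate\<close>)

text \<open>Here the multiple of \<open>gap_product\<close> below the form also vanishes at v = u,
  but with positive slope.\<close>

lemma B_tangent_pos:
  assumes t: "t \<in> {0..<T}" and k: "0 < k"
    and low: "\<And>u v w. u \<le> v \<Longrightarrow> v \<le> w \<Longrightarrow> w \<le> u + 2 * pi \<Longrightarrow> k * gap_product u v w \<le> B u v w t"
    and uw: "u < w" "w < u + 2 * pi"
  shows "0 < \<beta> (g1 u t) (g w t - g u t)"
proof -
  let ?l = "1 / 2 * sin ((w - u) / 2) * sin ((w - u) / 2)"
  have "((\<lambda>v. gap_product u v w) has_real_derivative ?l) (at u)"
    unfolding gap_product_def by (auto intro!: derivative_eq_intros)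
  from DERIV_diff[OF B_derivs'(1)[OF t, of u w u] DERIV_cmult[OF this, of k]]
  have "0 \<le> \<beta> (g1 u t) (g w t - g u t) - k * ?l"
    by (rule right_min_derivative[OF _ uw(1)])
      (use low[of u _ w] uw in \<open>auto simp: B_degenerate gap_product_def\<close>)
  moreover have "0 < sin ((w - u) / 2)" using uw by (intro sin_gt_zero) auto
  then have "0 < k * ?l" using k by simp
  ultimately show ?thesis by linarith
qed

end

section \<open>Domination of all area forms by the projected one\<close>

context space_flow
begin

lemma triangle_form_combine:
  "triangle_form (\<lambda>p q. k * \<alpha> p q + l * \<beta> p q) u v w t = k * triangle_form \<alpha> u v w t + l * triangle_form \<beta> u v w t"
  by (simp add: triangle_form_def algebra_simps)

text \<open>At time t0 the gap product separates the two forms, so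
  \<open>(D / k) * \<alpha> + \<beta>\<close> and \<open>(D / k) * \<alpha> - \<beta>\<close> are
  nonnegative. Both combinations are alternating forms, hence remain so; letting two of the points
  merge gives the statement about tangents.\<close>

lemma form_dominated:
  assumes \<alpha>: "alternating_form \<alpha>" and \<beta>: "alternating_form \<beta>" and t0: "0 < t0" "t0 < T"
    and init: "\<And>u v w. u \<le> v \<Longrightarrow> v \<le> w \<Longrightarrow> w \<le> u + 2 * pi \<Longrightarrow> 0 \<le> triangle_form \<alpha> u v w 0"
    and start: "u1 < v1" "v1 < w1" "w1 < u1 + 2 * pi" "0 < triangle_form \<alpha> u1 v1 w1 0"
  obtains C where "0 \<le> C"
    "\<And>u w t. t \<in> {t0..<T} \<Longrightarrow> u < w \<Longrightarrow> w \<le> u + 2 * pi \<Longrightarrow>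
      \<bar>\<beta> (g1 u t) (g w t - g u t)\<bar> \<le> C * \<alpha> (g1 u t) (g w t - g u t)"
proof -
  interpret A: space_form g g1 g2 V V1 V2 T \<alpha> by (rule space_form.intro[OF space_flow_axioms \<alpha>])
  interpret B: space_form g g1 g2 V V1 V2 T \<beta> by (rule space_form.intro[OF space_flow_axioms \<beta>])
  obtain k where k: "0 < k" "\<And>u v w. u \<le> v \<Longrightarrow> v \<le> w \<Longrightarrow> w \<le> u + 2 * pi \<Longrightarrow> k * gap_product u v w \<le> triangle_form \<alpha> u v w t0"
    using A.B_lower[OF t0 init start] by blast
  obtain D where D: "0 \<le> D" "\<And>u v w. u \<le> v \<Longrightarrow> v \<le> w \<Longrightarrow> w \<le> u + 2 * pi \<Longrightarrow>
      \<bar>triangle_form \<beta> u v w t0\<bar> \<le> D * gap_product u v w"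
    using B.B_upper[of t0] t0 by auto
  show thesis
  proof (rule that[of "D / k"])
    show "0 \<le> D / k" using D k by simp
    have nonneg: "0 \<le> (D / k) * \<alpha> (g1 u t) (g w t - g u t) + s * \<beta> (g1 u t) (g w t - g u t)"
      if s: "s = 1 \<or> s = - 1" and t: "t \<in> {t0..<T}" and uw: "u < w" "w \<le> u + 2 * pi" for s u w t
    proof -
      let ?f = "\<lambda>p q. (D / k) * \<alpha> p q + s * \<beta> p q"
      interpret F: space_form g g1 g2 V V1 V2 T ?f
        by (rule space_form.intro[OF space_flow_axioms alternating_form_combine[OF \<alpha> \<beta>]])
      have i: "0 \<le> triangle_form ?f u v w t0" if o: "u \<le> v" "v \<le> w" "w \<le> u + 2 * pi" for u v w
      proof -
        have "D * gap_product u v w = (D / k) * (k * gap_product u v w)" using k by simp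
        also have "\<dots> \<le> (D / k) * triangle_form \<alpha> u v w t0" using D k o by (intro mult_left_mono) auto
        finally show ?thesis unfolding triangle_form_combine using D(2)[OF o] s by auto
      qed
      show ?thesis
      proof (rule F.B_tangent_nonneg[OF _ _ uw])
        show "0 \<le> triangle_form ?f u v w t" if "u \<le> v" "v \<le> w" "w \<le> u + 2 * pi" for u v w
          by (rule F.B_nonneg_preserved[of t0 t, OF _ _ _ i that]) (use t t0 in auto)
      qed (use t t0 in auto)
    qed
    show "\<bar>\<beta> (g1 u t) (g w t - g u t)\<bar> \<le> D / k * \<alpha> (g1 u t) (g w t - g u t)"
      if "t \<in> {t0..<T}" "u < w" "w \<le> u + 2 * pi" for u w t
      using nonneg[of 1, OF _ that] nonneg[of "- 1", OF _ that] by auto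
  qed
qed

text \<open>The component of the chord along the tangent is positive just after u and negative just
  before u + 2 * pi, so it vanishes in between.\<close>

lemma perpendicular_chord:
  assumes t: "t \<in> {0..<T}"
  obtains w where "u < w" "w < u + 2 * pi" "inner (g1 u t) (g w t - g u t) = 0"
proof -
  define f where "f = (\<lambda>w. inner (g1 u t) (g w t - g u t))"
  have d: "(f has_real_derivative inner (g1 u t) (g1 w t)) (at w)" for w
    unfolding f_def has_real_derivative_iff_has_vector_derivative
    using bounded_linear.has_vector_derivative[OF bounded_linear_inner_right
        has_vector_derivative_diff[OF g_u[OF t, of w] has_vector_derivative_const[of "g u t"]], of "g1 u t"]
    by simp
  have pos: "0 < inner (g1 u t) (g1 u t)" using g1_nz[OF t] by simp
  obtain d1 where d1: "0 < d1" "\<forall>h>0. h < d1 \<longrightarrow> f u < f (u + h)"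
    using DERIV_pos_inc_right[OF d pos] by auto
  have "(f has_real_derivative inner (g1 u t) (g1 u t)) (at (u + 2 * pi))"
    using d[of "u + 2 * pi"] by (simp add: periodic_g1[OF t])
  from DERIV_pos_inc_left[OF this pos]
  obtain d2 where d2: "0 < d2" "\<forall>h>0. h < d2 \<longrightarrow> f (u + 2 * pi - h) < f (u + 2 * pi)" by auto
  define h where "h = min (min (d1 / 2) (d2 / 2)) (pi / 2)"
  have h: "0 < h" "h < d1" "h < d2" "h \<le> pi / 2" using d1(1) d2(1) pi_gt_zero by (auto simp: h_def)
  have "f u = 0" "f (u + 2 * pi) = 0" by (simp_all add: f_def per[OF t])
  then have s: "0 < f (u + h)" "f (u + 2 * pi - h) < 0" using d1(2) d2(2) h by auto
  have "\<exists>w\<ge>u + h. w \<le> u + 2 * pi - h \<and> f w = 0"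
    by (rule IVT2') (use s h pi_gt_zero in \<open>auto intro!: DERIV_continuous_on[of _ f] DERIV_subset[OF d]\<close>)
  then obtain w where w: "u + h \<le> w" "w \<le> u + 2 * pi - h" "f w = 0" by blast
  show thesis by (rule that[of w]) (use w h in \<open>simp_all add: f_def\<close>)
qed

text \<open>For a chord perpendicular to the tangent \<open>g1\<close>, the coordinate forms of tangent and chord add up to the full
  product of their lengths, while the projected form is at most the product of the projected lengths.\<close>

lemma slope_bound:
  fixes P :: "'a \<Rightarrow> complex"
  assumes t: "t \<in> {0..<T}" and P: "\<And>x. cmod (P x) \<le> norm x" and C: "0 \<le> C"
    and pos: "\<And>w. u < w \<Longrightarrow> w < u + 2 * pi \<Longrightarrow> 0 < wedge (P (g1 u t)) (P (g w t - g u t))"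
    and dom: "\<And>b c w. b \<in> Basis \<Longrightarrow> c \<in> Basis \<Longrightarrow> u < w \<Longrightarrow> w \<le> u + 2 * pi \<Longrightarrow>
      \<bar>coord_form b c (g1 u t) (g w t - g u t)\<bar> \<le> C * wedge (P (g1 u t)) (P (g w t - g u t))"
  shows "norm (g1 u t) \<le> real DIM('a) * C * cmod (P (g1 u t))"
proof -
  obtain w where w: "u < w" "w < u + 2 * pi" "inner (g1 u t) (g w t - g u t) = 0"
    using perpendicular_chord[OF t] by blast
  define p q where "p = g1 u t" and "q = g w t - g u t"
  let ?n = "real DIM('a)"
  have wpos: "0 < wedge (P p) (P q)" using pos[OF w(1,2)] by (simp add: p_def q_def)
  have "0 < cmod (P p) * cmod (P q)" using wpos wedge_le[of "P p" "P q"] by linarith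
  then have "0 < cmod (P q)" by (simp add: zero_less_mult_iff)
  then have q: "0 < norm q" using P[of q] by linarith
  have "wedge (P p) (P q) \<le> cmod (P p) * cmod (P q)" using wedge_le[of "P p" "P q"] by linarith
  also have "\<dots> \<le> cmod (P p) * norm q" by (intro mult_left_mono P) simp
  finally have W: "wedge (P p) (P q) \<le> cmod (P p) * norm q" .
  define D where "D = C * (cmod (P p) * norm q)"
  have D: "0 \<le> D" using C by (simp add: D_def)
  have cf: "(coord_form b c p q)\<^sup>2 \<le> D\<^sup>2" if "b \<in> Basis" "c \<in> Basis" for b c
  proof -
    have "\<bar>coord_form b c p q\<bar> \<le> C * wedge (P p) (P q)" using dom[OF that w(1)] w(2) by (simp add: p_def q_def)
    also have "\<dots> \<le> D" unfolding D_def by (intro mult_left_mono W C)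
    finally show ?thesis using D by (simp add: abs_le_square_iff[symmetric])
  qed
  have "2 * ((norm p)\<^sup>2 * (norm q)\<^sup>2) = (\<Sum>b\<in>Basis. \<Sum>c\<in>Basis. (coord_form b c p q)\<^sup>2)"
    using w(3) by (simp add: lagrange_identity p_def q_def)
  also have "\<dots> \<le> (\<Sum>b\<in>(Basis :: 'a set). \<Sum>c\<in>(Basis :: 'a set). D\<^sup>2)" by (intro sum_mono cf)
  also have "\<dots> = (?n * D)\<^sup>2" by (simp add: power2_eq_square)
  finally have "2 * (norm p * norm q)\<^sup>2 \<le> (?n * D)\<^sup>2" by (simp add: power_mult_distrib)
  moreover have "0 \<le> (norm p * norm q)\<^sup>2" by simp
  ultimately have "(norm p * norm q)\<^sup>2 \<le> (?n * D)\<^sup>2" by linarith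
  then have "norm p * norm q \<le> ?n * D" by (rule power2_le_imp_le) (use D in simp)
  then have "norm p * norm q \<le> (?n * C * cmod (P p)) * norm q" by (simp add: D_def mult_ac)
  then show ?thesis using q by (simp add: p_def)
qed

end

section \<open>The singularity is of type I\<close>

definition plane_coords :: "'n \<Rightarrow> 'n \<Rightarrow> real ^ 'n::finite \<Rightarrow> complex"
  where "plane_coords i j z = Complex (z $ i) (z $ j)"

lemma bounded_linear_plane_coords: "bounded_linear (plane_coords i j)"
  unfolding linear_conv_bounded_linear[symmetric]
  by (rule linearI) (simp_all add: plane_coords_def complex_eq_iff)

lemma norm_plane_coords_le:
  assumes "i \<noteq> j"
  shows "cmod (plane_coords i j z) \<le> norm z"
proof -
  have "(\<Sum>k\<in>{i, j}. (z $ k)\<^sup>2) \<le> (\<Sum>k\<in>UNIV. (z $ k)\<^sup>2)" by (rule sum_mono2) auto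
  then have "(z $ i)\<^sup>2 + (z $ j)\<^sup>2 \<le> (\<Sum>k\<in>UNIV. (z $ k)\<^sup>2)" using assms by simp
  then have "(cmod (plane_coords i j z))\<^sup>2 \<le> (norm z)\<^sup>2"
    by (simp add: cmod_power2 plane_coords_def norm_vec_def L2_set_def sum_nonneg)
  then show ?thesis by (rule power2_le_imp_le) simp
qed

lemma wedge_swap: "wedge (plane_coords j i p) (plane_coords j i q) = - wedge (plane_coords i j p) (plane_coords i j q)"
  by (simp add: wedge_alt plane_coords_def)

text \<open>A negatively oriented projection becomes positively oriented when its two coordinates
  are exchanged, which is why the indices are chosen here.\<close>

lemma orientation:
  fixes c :: "real \<Rightarrow> real ^ 'n::finite"
  assumes proj: "one_to_one_convex_projection x y c" and xy: "x \<noteq> y"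
    and c: "continuous_on UNIV c" "\<And>u. c (u + 2 * pi) = c u"
  obtains i j where "i \<noteq> j"
    "\<And>u v w. u \<le> v \<Longrightarrow> v \<le> w \<Longrightarrow> w \<le> u + 2 * pi \<Longrightarrow>
      0 \<le> wedge (plane_coords i j (c v - c u)) (plane_coords i j (c w - c u))"
    "\<exists>u v w. u < v \<and> v < w \<and> w < u + 2 * pi \<and>
      0 < wedge (plane_coords i j (c v - c u)) (plane_coords i j (c w - c u))"
proof -
  \<comment> \<open>The convex set lives in \<open>real ^ 2\<close>; this linear bijection carries
    it and its frontier to the complex plane.\<close>
  define Q :: "real ^ 2 \<Rightarrow> complex" where "Q = plane_coords 1 2"
  let ?P = "plane_coords x y"
  have Q: "linear Q" unfolding Q_def using bounded_linear_plane_coords by (rule bounded_linear.linear)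
  have "inj Q" unfolding Q_def
    by (rule injI) (auto simp: plane_coords_def vec_eq_iff forall_2)
  moreover have "surj Q" unfolding Q_def
    by (rule surjI[of _ "\<lambda>z. vector [Re z, Im z]"]) (simp add: plane_coords_def)
  ultimately have bij: "bij Q" by (rule bijI)
  have PQ: "?P p = Q (xy_proj x y p)" for p by (simp add: Q_def plane_coords_def xy_proj_def)
  obtain K where K: "compact K" "convex K" "interior K \<noteq> {}" and r: "range (\<lambda>u. xy_proj x y (c u)) = frontier K"
    using proj by (auto simp: one_to_one_convex_projection_def convex_curve_def)
  have QK: "compact (Q ` K)"
    by (rule compact_continuous_image[OF linear_continuous_on K(1)]) (simp add: Q_def bounded_linear_plane_coords)
  have cl: "closed K" "closed (Q ` K)" using K(1) QK by (simp_all add: compact_imp_closed)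
  have int: "interior (Q ` K) = Q ` interior K" by (rule interior_bijective_linear_image[OF Q bij])
  have "range (\<lambda>u. ?P (c u)) = Q ` frontier K" unfolding r[symmetric] PQ by auto
  also have "\<dots> = frontier (Q ` K)"
    unfolding frontier_def closure_closed[OF cl(1)] closure_closed[OF cl(2)] int
    by (rule image_set_diff[OF \<open>inj Q\<close>])
  finally have r': "range (\<lambda>u. ?P (c u)) = frontier (Q ` K)" .
  obtain o' where o': "o' \<in> interior (Q ` K)" using K(3) unfolding int by auto
  interpret convex_loop "\<lambda>u. ?P (c u)" "Q ` K" o'
  proof
    show "continuous_on UNIV (\<lambda>u. ?P (c u))"
      by (rule linear_continuous_on_compose[OF c(1)]) (rule bounded_linear.linear[OF bounded_linear_plane_coords])
    show "inj_on (\<lambda>u. ?P (c u)) {0..<2 * pi}"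
    proof (rule inj_onI)
      fix u v assume uv: "u \<in> {0..<2 * pi}" "v \<in> {0..<2 * pi}" "?P (c u) = ?P (c v)"
      then have "xy_proj x y (c u) = xy_proj x y (c v)" unfolding PQ by (simp add: inj_eq[OF \<open>inj Q\<close>])
      then show "u = v"
        using proj uv by (auto simp: one_to_one_convex_projection_def inj_on_def)
    qed
    show "compact (Q ` K)" by (rule QK)
    show "convex (Q ` K)" using convex_linear_image[OF Q K(2)] .
  qed (use c(2) o' r' in auto)
  obtain \<rho> where \<rho>: "\<rho> = 1 \<or> \<rho> = -1"
    and n: "\<And>u v w. u \<le> v \<Longrightarrow> v \<le> w \<Longrightarrow> w \<le> u + 2 * pi \<Longrightarrow>
      0 \<le> \<rho> * wedge (?P (c v) - ?P (c u)) (?P (c w) - ?P (c u))"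
    and s: "\<exists>u v w. u < v \<and> v < w \<and> w < u + 2 * pi \<and>
      0 < \<rho> * wedge (?P (c v) - ?P (c u)) (?P (c w) - ?P (c u))"
    by (rule oriented) (rule that)
  have d: "?P (p - q) = ?P p - ?P q" for p q
    by (rule linear_diff[OF bounded_linear.linear[OF bounded_linear_plane_coords]])
  show thesis
  proof (cases "\<rho> = 1")
    case True
    show thesis by (rule that[of x y]) (use True xy n s d in auto)
  next
    case False
    then have "\<rho> = - 1" using \<rho> by simp
    show thesis
      by (rule that[of y x]) (use \<open>\<rho> = - 1\<close> xy n s in \<open>auto simp: wedge_swap[of y x] d\<close>)
  qed
qed

lemma (in space_flow) plane_flow_of_orientation:
  fixes P :: "'a \<Rightarrow> complex"
  assumes P: "bounded_linear P" "\<And>x. cmod (P x) \<le> norm x"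
    and init: "\<And>u v w. u \<le> v \<Longrightarrow> v \<le> w \<Longrightarrow> w \<le> u + 2 * pi \<Longrightarrow>
      0 \<le> wedge (P (g v 0 - g u 0)) (P (g w 0 - g u 0))"
    and start: "u1 < v1" "v1 < w1" "w1 < u1 + 2 * pi" "0 < wedge (P (g v1 0 - g u1 0)) (P (g w1 0 - g u1 0))"
    and shrinks: "uniform_limit UNIV (\<lambda>t u. g u t) (\<lambda>_. 0) (at_left T)"
    and t0: "0 < t0" "t0 < T"
  obtains \<delta> where "plane_flow (\<lambda>u t. P (g u t)) (\<lambda>u t. P (g1 u t)) (\<lambda>u t. P (g2 u t)) A2 A1 t0 T \<delta>"
    "\<And>u t. t \<in> {t0..<T} \<Longrightarrow> \<delta> * norm (g1 u t) \<le> cmod (P (g1 u t))"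
proof -
  let ?\<alpha> = "\<lambda>p q. wedge (P p) (P q)"
  interpret P: bounded_linear P by (rule P(1))
  have \<alpha>: "alternating_form ?\<alpha>"
    by (rule alternating_form.intro[OF bounded_bilinear.comp[OF bilinear_wedge P(1) P(1)]]) (simp add: wedge_alt)
  interpret A: space_form g g1 g2 V V1 V2 T ?\<alpha> by (rule space_form.intro[OF space_flow_axioms \<alpha>])
  have init': "0 \<le> triangle_form ?\<alpha> u v w 0" if "u \<le> v" "v \<le> w" "w \<le> u + 2 * pi" for u v w
    unfolding A.B_edge by (rule init[OF that])
  have start': "0 < triangle_form ?\<alpha> u1 v1 w1 0" unfolding A.B_edge by (rule start(4))
  have pos: "0 < wedge (P (g1 u t)) (P (g w t - g u t))"
    "u < v \<Longrightarrow> v < w \<Longrightarrow> 0 < wedge (P (g v t - g u t)) (P (g w t - g u t))"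
    if t: "t \<in> {t0..<T}" and uw: "u < w" "w < u + 2 * pi" for u v w t
  proof -
    have tT: "0 < t" "t < T" "t \<in> {0..<T}" using t t0 by auto
    \<comment> \<open>Strict convexity at time t comes from the barrier run from 0 to t, with k
      depending on t; uniformity in time enters only through \<open>form_dominated\<close>.\<close>
    obtain k where k: "0 < k" "\<And>u v w. u \<le> v \<Longrightarrow> v \<le> w \<Longrightarrow> w \<le> u + 2 * pi \<Longrightarrow>
        k * gap_product u v w \<le> triangle_form ?\<alpha> u v w t"
      using A.B_lower[OF tT(1,2) init' start(1-3) start'] by blast
    show "0 < wedge (P (g1 u t)) (P (g w t - g u t))" by (rule A.B_tangent_pos[OF tT(3) k uw])
    assume o: "u < v" "v < w"
    have "0 < k * gap_product u v w" using k(1) gap_product_pos[OF o uw(2)] by simp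
    also have "\<dots> \<le> triangle_form ?\<alpha> u v w t" by (rule k(2)) (use o uw in auto)
    finally show "0 < wedge (P (g v t - g u t)) (P (g w t - g u t))" unfolding A.B_edge .
  qed
  have "\<exists>C\<ge>0. \<forall>u w t. t \<in> {t0..<T} \<longrightarrow> u < w \<longrightarrow> w \<le> u + 2 * pi \<longrightarrow>
      \<bar>coord_form b c (g1 u t) (g w t - g u t)\<bar> \<le> C * ?\<alpha> (g1 u t) (g w t - g u t)" for b c :: 'a
    using form_dominated[OF \<alpha> alternating_coord_form t0 init' start(1-3) start', of b c] by metis
  then obtain D where D: "\<And>b c. 0 \<le> D b c" "\<And>b c u w t. t \<in> {t0..<T} \<Longrightarrow> u < w \<Longrightarrow> w \<le> u + 2 * pi \<Longrightarrow>
      \<bar>coord_form b c (g1 u t) (g w t - g u t)\<bar> \<le> D b c * ?\<alpha> (g1 u t) (g w t - g u t)"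
    by metis
  define C where "C = (\<Sum>b\<in>Basis. \<Sum>c\<in>Basis. D b c)"
  have C: "0 \<le> C" unfolding C_def by (intro sum_nonneg D)
  have DC: "D b c \<le> C" if "b \<in> Basis" "c \<in> Basis" for b c
  proof -
    have "D b c \<le> (\<Sum>c\<in>Basis. D b c)" by (rule member_le_sum[OF that(2)]) (auto intro: D)
    also have "\<dots> \<le> C" unfolding C_def by (rule member_le_sum[OF that(1)]) (auto intro!: sum_nonneg D)
    finally show ?thesis .
  qed
  \<comment> \<open>The summand 1 keeps N positive, so that \<delta> = 1 / N is defined and
    positive.\<close>
  define N where "N = real DIM('a) * C + 1"
  have N: "1 \<le> N" using C by (simp add: N_def)
  have slope: "norm (g1 u t) \<le> N * cmod (P (g1 u t))" if t: "t \<in> {t0..<T}" for u t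
  proof -
    have tT: "t \<in> {0..<T}" using t t0 by auto
    have "norm (g1 u t) \<le> real DIM('a) * C * cmod (P (g1 u t))"
    proof (rule slope_bound[OF tT P(2) C])
      fix b c :: 'a and w assume bc: "b \<in> Basis" "c \<in> Basis" and w: "u < w" "w \<le> u + 2 * pi"
      have "0 \<le> wedge (P (g1 u t)) (P (g w t - g u t))"
      proof (cases "w = u + 2 * pi")
        case True
        then show ?thesis by (simp add: per[OF tT] wedge_alt P.zero)
      next
        case False
        then show ?thesis using pos(1)[OF t, of u w] w by simp
      qed
      then have "D b c * wedge (P (g1 u t)) (P (g w t - g u t)) \<le> C * wedge (P (g1 u t)) (P (g w t - g u t))"
        by (rule mult_right_mono[OF DC[OF bc]])
      then show "\<bar>coord_form b c (g1 u t) (g w t - g u t)\<bar> \<le> C * wedge (P (g1 u t)) (P (g w t - g u t))"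
        using D(2)[OF t w, of b c] by linarith
    qed (use pos(1)[OF t] in auto)
    then show ?thesis unfolding N_def distrib_right using norm_ge_zero[of "P (g1 u t)"] by linarith
  qed
  show thesis
  proof (rule that[of "inverse N"])
    show sl: "inverse N * norm (g1 u t) \<le> cmod (P (g1 u t))" if "t \<in> {t0..<T}" for u t
      using slope[OF that, of u] N by (simp add: field_simps)
    have sub: "t \<in> {0..<T}" if "t \<in> {t0..<T}" for t using that t0 by auto
    show "plane_flow (\<lambda>u t. P (g u t)) (\<lambda>u t. P (g1 u t)) (\<lambda>u t. P (g2 u t)) A2 A1 t0 T (inverse N)"
    proof
      show "continuous_on (UNIV \<times> {t0..<T}) (\<lambda>(u, t). P (g u t))"
        unfolding case_prod_unfold
        by (intro P.continuous_on continuous_on_subset[OF cont_g[unfolded case_prod_unfold]]) (use t0 in auto)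
      fix u t :: real assume t: "t \<in> {t0..<T}"
      note tT = sub[OF t]
      show "((\<lambda>v. P (g v t)) has_vector_derivative P (g1 u t)) (at u)"
        by (rule P.has_vector_derivative[OF g_u[OF tT]])
      show "((\<lambda>v. P (g1 v t)) has_vector_derivative P (g2 u t)) (at u)"
        by (rule P.has_vector_derivative[OF g1_u[OF tT]])
      have "((\<lambda>s. P (g u s)) has_vector_derivative P (V u t)) (at t within {t0..<T})"
        by (rule P.has_vector_derivative[OF has_vector_derivative_within_subset[OF g_t[OF tT]]]) (use t0 in auto)
      then show "((\<lambda>s. P (g u s)) has_vector_derivative A2 u t *\<^sub>R P (g2 u t) + A1 u t *\<^sub>R P (g1 u t))
          (at t within {t0..<T})"
        unfolding V_eq'[OF tT] by (simp only: P.add P.scaleR)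
      have n: "0 < norm (g1 u t)" using g1_nz[OF tT] by simp
      have "(inverse N)\<^sup>2 * (norm (g1 u t))\<^sup>2 \<le> (cmod (P (g1 u t)))\<^sup>2"
        unfolding power_mult_distrib[symmetric] using sl[OF t] N by (intro power_mono) auto
      then show "(inverse N)\<^sup>2 \<le> A2 u t * (cmod (P (g1 u t)))\<^sup>2"
        using n by (simp add: field_simps)
      have "(cmod (P (g1 u t)))\<^sup>2 \<le> (norm (g1 u t))\<^sup>2" by (intro power_mono P) simp
      then show "A2 u t * (cmod (P (g1 u t)))\<^sup>2 \<le> 1" using n by (simp add: field_simps)
      show "0 < A2 u t" by (rule A2_pos[OF tT])
      show "P (g (u + 2 * pi) t) = P (g u t)" by (simp add: per[OF tT])
      show "0 < wedge (P (g1 u t)) (P (g v t) - P (g u t))" if "u < v" "v < u + 2 * pi" for v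
        using pos(1)[OF t that] by (simp add: P.diff)
      show "0 < wedge (P (g v t) - P (g u t)) (P (g w t) - P (g u t))"
        if "u < v" "v < w" "w < u + 2 * pi" for v w
        using pos(2)[OF t, of u w v] that by (simp add: P.diff)
    next
      show "uniform_limit UNIV (\<lambda>t u. P (g u t)) (\<lambda>_. 0) (at_left T)"
        using P.uniform_limit[OF shrinks] by (simp add: P.zero)
    qed (use t0 N in auto)
  qed
qed

lemma convex_projection_type_I:
  fixes \<gamma> :: "real \<Rightarrow> real \<Rightarrow> real ^ 'n::finite"
  assumes xy: "x \<noteq> y" and csf: "CSF T \<gamma>"
    and proj: "one_to_one_convex_projection x y (\<lambda>u. \<gamma> u 0)" and shrinks: "shrinks_to T \<gamma> 0"
  shows "type_I_singularity T \<gamma>"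
proof -
  obtain g1 g2 V V1 V2 where S: "space_flow \<gamma> g1 g2 V V1 V2 T"
    and curv: "\<And>u t. t \<in> {0..<T} \<Longrightarrow> curvature (\<lambda>v. \<gamma> v t) u = norm (V u t)"
    using CSF_space_flow[OF csf] by metis
  interpret space_flow \<gamma> g1 g2 V V1 V2 T by (rule S)
  have T0: "0 \<in> {0..<T}" using T_pos by simp
  have c0: "continuous_on UNIV (\<lambda>u. \<gamma> u 0)"
    by (intro continuous_at_imp_continuous_on ballI has_vector_derivative_continuous[OF g_u[OF T0]])
  obtain i j where ij: "i \<noteq> j"
    and init: "\<And>u v w. u \<le> v \<Longrightarrow> v \<le> w \<Longrightarrow> w \<le> u + 2 * pi \<Longrightarrow>
      0 \<le> wedge (plane_coords i j (\<gamma> v 0 - \<gamma> u 0)) (plane_coords i j (\<gamma> w 0 - \<gamma> u 0))"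
    and ex: "\<exists>u v w. u < v \<and> v < w \<and> w < u + 2 * pi \<and>
      0 < wedge (plane_coords i j (\<gamma> v 0 - \<gamma> u 0)) (plane_coords i j (\<gamma> w 0 - \<gamma> u 0))"
    by (rule orientation[OF proj xy c0 per[OF T0]]) (rule that)
  obtain u1 v1 w1 where start: "u1 < v1" "v1 < w1" "w1 < u1 + 2 * pi"
    "0 < wedge (plane_coords i j (\<gamma> v1 0 - \<gamma> u1 0)) (plane_coords i j (\<gamma> w1 0 - \<gamma> u1 0))"
    using ex by blast
  let ?P = "plane_coords i j"
  note P = bounded_linear_plane_coords[of i j] norm_plane_coords_le[OF ij]
  \<comment> \<open>Any time strictly between 0 and T would do, since the type of the singularity is
    decided near T.\<close>
  define t0 where "t0 = T / 2"
  have t0: "0 < t0" "t0 < T" using T_pos by (auto simp: t0_def)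
  obtain \<delta> where F: "plane_flow (\<lambda>u t. ?P (\<gamma> u t)) (\<lambda>u t. ?P (g1 u t)) (\<lambda>u t. ?P (g2 u t)) A2 A1 t0 T \<delta>"
    and slope: "\<And>u t. t \<in> {t0..<T} \<Longrightarrow> \<delta> * norm (g1 u t) \<le> cmod (?P (g1 u t))"
    using plane_flow_of_orientation[OF P init start shrinks[unfolded shrinks_to_def] t0] by blast
  obtain C where C: "\<And>u t. t \<in> {(t0 + T) / 2..<T} \<Longrightarrow> (norm (V u t))\<^sup>2 * (T - t) \<le> C"
    using type_I_from_plane_flow[OF S F P less_imp_le[OF t0(1)] slope] by blast
  have ev: "\<forall>\<^sub>F t in at_left T. t \<in> {(t0 + T) / 2..<T}"
    using eventually_at_left_real[of "(t0 + T) / 2" T] t0 by (auto elim: eventually_mono)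
  have "Limsup (at_left T) (\<lambda>t. SUP u. ereal ((curvature (\<lambda>v. \<gamma> v t) u)\<^sup>2 * (T - t))) \<le> ereal C"
  proof (rule Limsup_bounded, use ev in eventually_elim)
    case (elim t)
    then have "t \<in> {0..<T}" using t0 by auto
    with C[OF elim] show ?case by (auto simp: curv intro!: SUP_least)
  qed
  then show ?thesis unfolding type_I_singularity_def by (rule le_less_trans) simp
qed

theorem theorem1p14:
  fixes \<gamma> :: "real \<Rightarrow> real \<Rightarrow> real ^ 'n::finite"
    and x y :: 'n
    and T :: real
    and \<tau> :: "nat \<Rightarrow> real"
  assumes "x \<noteq> y"
    and "maximal_CSF T \<gamma>"
    and "one_to_one_convex_projection x y (\<lambda>u. \<gamma> u 0)"
    and "shrinks_to T \<gamma> 0"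
    and "type_II_singularity T \<gamma>"
    and "filterlim \<tau> at_top sequentially"
  shows "\<exists>(r :: nat \<Rightarrow> nat) (L :: (real ^ 'n) set) (v :: real ^ 'n).
    strict_mono r \<and> norm v = 1 \<and> L = span {v} \<and>
    locally_smoothly_converges (rescaled_CSF_seq T \<gamma> (\<tau> \<circ> r)) (stationary_double_line v) \<and>
    \<not> perpendicular L (xy_plane x y)"
proof -
  have "type_I_singularity T \<gamma>"
    using assms(1-4) unfolding maximal_CSF_def by (intro convex_projection_type_I) auto
  with assms(5) show ?thesis by (simp add: type_II_singularity_def)
qed

end
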